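(* For $i=1,\dots,n$ let $g^i(\cdot,c)$ be the inverse of $u^i_x(\cdot,c)$ and $h^i(\psi,c):=u^i_c(g^i(\psi,c),c)$ for $\psi,c>0$. Let Assumption U and Assumption P (stated in the context) hold and suppose that the Inada conditions $\lim_{c\downarrow0}h^i(\psi,c)=+\infty$ and $\lim_{c\uparrow\infty}h^i(\psi,c)=0$ are satisfied. Then for any given set of weights $\{\gamma^i\}_{i=1,\dots,n}$ and for any given $\lambda>0$ there exists a unique (up to indistinguishability) optional, upper right-continuous process $l^*$ solving the stochastic backward equation $$E\Big[\int_\tau^Te^{-\int_0^tr(s)ds}\sum_{i=1}^n\gamma^ih^i\Big(\frac{\lambda}{\gamma^i}e^{\int_0^tr(u)du}\psi_x(t),\ \sup_{\tau\le u\le t}l(u)\Big)dt\,\Big|\,\mathcal{F}_\tau\Big]=\lambda\psi_c(\tau)\mathbf{1}_{\{\tau<T\}}$$ for any stopping time $\tau\in[0,T]$, subject to $l^*_T=0$, $P$-a.s.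
   Context: Setting. Fix $0<T\le\infty$, a number $n\ge1$ of agents, and a filtered probability space $(\Omega,\mathcal{F},\{\mathcal{F}_t\}_{t\in[0,T]},P)$ satisfying the usual conditions, with expectation $E$. Let $w^i>0$ be initial wealths, $\psi_x,\psi_c$ strictly positive price processes, $r$ a discount rate process. For nonnegative processes set $$\Psi(x^i,C^i):=E\Big[\int_0^T\psi_x(t)x^i(t)\,dt+\int_0^T\psi_c(t)\,dC^i(t)\Big].$$ For a nondecreasing right-continuous $C$, $\int_0^T(\cdot)\,dC(t)$ denotes the Lebesgue–Stieltjes integral over $[0,T]$, including a possible point mass $C(0)$ at $t=0$ (convention $C(0-)=0$). The budget sets are $$\mathcal{B}_{w^i}:=\{(x^i,C^i):\Omega\times[0,T]\to\mathbb{R}_+^2\text{ optional}:\ C^i\text{ right-continuous, nondecreasing},\ C^i(0-)=0\ P\text{-a.s.},\ \Psi(x^i,C^i)\le w^i\}.$$ Utility functions $u^i:\mathbb{R}_+^2\to\mathbb{R}_+$, subscripts denoting partial derivatives. Weights satisfy $\gamma^i>0$, $\sum_i\gamma^i=1$. Since $h^i(\psi,c)$ is defined for $c>0$ only, a solution $l$ is understood to have positive running suprema $\sup_{\tau\le u\le t}l(u)$ wherever they enter the integral. A process $l$ is upper right-continuous if a.s. $l(t)=\limsup_{s\downarrow t}l(s):=\lim_{s\downarrow t}\sup_{v\in[t,s)}l(v)$ for all $t\in[0,T)$. Assumption U. (i) Each $u^i$ is increasing and strictly concave on $\mathbb{R}_+^2$ and twice continuously differentiable on $\mathbb{R}_{++}^2$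 with negative definite Hessian; moreover $\lim_{x\downarrow0}u^i_x(x,c)=+\infty$ and $\lim_{x\uparrow\infty}u^i_x(x,c)=0$ for any $c>0$. (ii) For each $i$ the family $e^{-\int_0^t r(\omega,s)ds}u^i(x^i(\omega,t),C(\omega,t))$, indexed by $((x^j,C^j))_{j}\in\prod_{j=1}^n\mathcal{B}_{w^j}$ with $C=\sum_jC^j$, is $P\otimes dt$-uniformly integrable. Assumption P. (i) $\psi_c=\{\psi_c(t),t\in[0,T]\}$ is adapted, right-continuous, $\psi_c(t)=e^{-\int_0^t r_c(s)ds}\mathcal{E}_c(t)$ a.s. for every $t\in[0,T]$, with $r_c$ a uniformly bounded, strictly positive process and $\mathcal{E}_c=\{\mathcal{E}_c(t),t\in[0,T]\}$ an exponential martingale (strictly positive, mean one); if $T=\infty$ then $\psi_c(T)=0$ a.s. (ii) $\psi_x$ is adapted, right-continuous, $\psi_x(t)=e^{-\int_0^t r_x(s)ds}\mathcal{E}_x(t)$ a.s. for every $t\in[0,T]$, with $r_x$ uniformly bounded and strictly positive and $\mathcal{E}_x$ an exponential martingale. (iii) $r$ is optional, strictly positive and uniformly bounded. *)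

theory Defs
  imports "HOL-Probability.Probability"
begin

text \<open>
  Time runs through the interval \<open>[0, T]\<close> with \<open>0 < T \<le> \<infinity>\<close>, represented as the set \<open>{..T}\<close> of
  extended nonnegative reals, so that the end point \<open>T = \<infinity>\<close> is an ordinary point of time.
  A process is a function \<open>X t \<omega>\<close>; only its values for \<open>t \<le> T\<close> and \<open>\<omega> \<in> space M\<close> matter.
\<close>

type_synonym 'a process = "ennreal \<Rightarrow> 'a \<Rightarrow> real"

section \<open>Filtered probability space and processes\<close>

text \<open>
  The library filtration is indexed by a whole type; we extend a filtration on \<open>[0, T]\<close>
  by \<open>F t = F T\<close> for \<open>t > T\<close>.  For \<open>\<tau> \<le> T\<close> the library's \<open>stopping_time\<close> and \<open>pre_sigma\<close> are then
  exactly the notions relative to \<open>[0, T]\<close>.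
\<close>

locale filtered_prob_space = prob_space M + complete_measure M + filtration "space M" F
  for M :: "'a measure" and F :: "ennreal \<Rightarrow> 'a measure" +
  fixes T :: ennreal
  assumes T_pos: "0 < T"
    and sets_F_le: "\<And>t. sets (F t) \<subseteq> sets M"
    and sets_F_after_T: "\<And>t. T \<le> t \<Longrightarrow> sets (F t) = sets (F T)"
    and null_sets_F: "null_sets M \<subseteq> sets (F 0)"
    and right_continuous_F: "\<And>t. t < T \<Longrightarrow> sets (F t) = (\<Inter>s\<in>{t<..T}. sets (F s))"

definition adapted :: "(ennreal \<Rightarrow> 'a measure) \<Rightarrow> ennreal \<Rightarrow> 'a process \<Rightarrow> bool" where
  "adapted F T X \<longleftrightarrow> (\<forall>t\<le>T. X t \<in> borel_measurable (F t))"

definition measurable_process :: "'a measure \<Rightarrow> ennreal \<Rightarrow> 'a process \<Rightarrow> bool" where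
  "measurable_process M T X \<longleftrightarrow>
     (\<lambda>(\<omega>, t). X t \<omega>) \<in> borel_measurable (M \<Otimes>\<^sub>M restrict_space borel {..T})"

definition right_continuous_path :: "ennreal \<Rightarrow> (ennreal \<Rightarrow> real) \<Rightarrow> bool" where
  "right_continuous_path T f \<longleftrightarrow> (\<forall>t<T. continuous (at_right t) f)"

definition cadlag_path :: "ennreal \<Rightarrow> (ennreal \<Rightarrow> real) \<Rightarrow> bool" where
  "cadlag_path T f \<longleftrightarrow>
     right_continuous_path T f \<and> (\<forall>t. 0 < t \<and> t \<le> T \<longrightarrow> (\<exists>a. (f \<longlongrightarrow> a) (at_left t)))"

definition optional_sigma ::
    "'a measure \<Rightarrow> (ennreal \<Rightarrow> 'a measure) \<Rightarrow> ennreal \<Rightarrow> ('a \<times> ennreal) measure" where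
  "optional_sigma M F T = sigma (space M \<times> {..T})
     {{(\<omega>, t) \<in> space M \<times> {..T}. X t \<omega> \<in> B} | X B.
        adapted F T X \<and> (\<forall>\<omega>\<in>space M. cadlag_path T (\<lambda>t. X t \<omega>)) \<and> B \<in> sets borel}"

definition optional_process ::
    "'a measure \<Rightarrow> (ennreal \<Rightarrow> 'a measure) \<Rightarrow> ennreal \<Rightarrow> 'a process \<Rightarrow> bool" where
  "optional_process M F T X \<longleftrightarrow> (\<lambda>(\<omega>, t). X t \<omega>) \<in> borel_measurable (optional_sigma M F T)"

definition martingale_on ::
    "'a measure \<Rightarrow> (ennreal \<Rightarrow> 'a measure) \<Rightarrow> ennreal \<Rightarrow> 'a process \<Rightarrow> bool" where
  "martingale_on M F T X \<longleftrightarrow> adapted F T X \<and> (\<forall>t\<le>T. integrable M (X t)) \<and>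
     (\<forall>s t. s \<le> t \<and> t \<le> T \<longrightarrow> (AE \<omega> in M. real_cond_exp M (F s) (X t) \<omega> = X s \<omega>))"

definition exponential_martingale ::
    "'a measure \<Rightarrow> (ennreal \<Rightarrow> 'a measure) \<Rightarrow> ennreal \<Rightarrow> 'a process \<Rightarrow> bool" where
  "exponential_martingale M F T X \<longleftrightarrow> martingale_on M F T X \<and>
     (\<forall>t\<le>T. \<forall>\<omega>\<in>space M. 0 < X t \<omega>) \<and> (\<forall>t\<le>T. (\<integral>\<omega>. X t \<omega> \<partial>M) = 1)"

definition upper_right_continuous :: "ennreal \<Rightarrow> (ennreal \<Rightarrow> real) \<Rightarrow> bool" where
  "upper_right_continuous T f \<longleftrightarrow>
     (\<forall>t<T. ((\<lambda>s. SUP v\<in>{t..<s}. ereal (f v)) \<longlongrightarrow> ereal (f t)) (at_right t))"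

section \<open>Integration in time\<close>

text \<open>Lebesgue measure on \<open>[0, T]\<close>; it does not charge the point \<open>\<infinity>\<close>.\<close>

definition leb_time :: "ennreal \<Rightarrow> ennreal measure" where
  "leb_time T = distr (restrict_space lborel {s. 0 \<le> s \<and> ennreal s \<le> T})
     (restrict_space borel {..T}) ennreal"

text \<open>
  Lebesgue--Stieltjes measure of a nondecreasing right-continuous nonnegative \<open>C\<close> on \<open>[0, T]\<close>: the
  measure giving \<open>[0, t]\<close> the mass \<open>C t\<close>, hence with a point mass \<open>C 0\<close> at \<open>0\<close>
  (convention \<open>C(0-) = 0\<close>); see \<open>emeasure_stieltjes\<close> below.
\<close>

definition stieltjes :: "ennreal \<Rightarrow> (ennreal \<Rightarrow> real) \<Rightarrow> ennreal measure" where
  "stieltjes T C = extend_measure {..T} {..T} (\<lambda>t. {..t}) (\<lambda>t. ennreal (C t))"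

lemma emeasure_stieltjes:
  fixes C :: "ennreal \<Rightarrow> real"
  assumes rc: "right_continuous_path T C" and mono: "mono_on {..T} C"
    and nonneg: "\<And>t. t \<le> T \<Longrightarrow> 0 \<le> C t" and "t \<le> T"
  shows "emeasure (stieltjes T C) {..t} = ennreal (C t)"
proof -
  define I where "I y = Inf {s. s \<le> T \<and> y \<le> C s}" for y
  define L where "L = restrict_space lborel {0<..C T}"
  define S where "S = sigma {..T} ((\<lambda>t. {..t}) ` {..T})"
  have sets_S: "sets S = sigma_sets {..T} ((\<lambda>t. {..t}) ` {..T})" and space_S: "space S = {..T}"
    unfolding S_def by (auto intro!: sets_measure_of space_measure_of)
  have space_L: "space L = {0<..C T}"
    by (simp add: L_def space_restrict_space)
  have I_iff: "I y \<le> s \<longleftrightarrow> y \<le> C s" if y: "y \<in> {0<..C T}" and s: "s \<le> T" for y s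
  proof
    assume "y \<le> C s"
    then show "I y \<le> s" using s unfolding I_def by (intro Inf_lower) auto
  next
    assume le: "I y \<le> s"
    show "y \<le> C s"
    proof (rule ccontr)
      assume neg: "\<not> y \<le> C s"
      then have "s < T" using s y by (cases "s = T") auto
      have "(C \<longlongrightarrow> C s) (at_right s)"
        using rc \<open>s < T\<close> by (auto simp: right_continuous_path_def continuous_within)
      then have "eventually (\<lambda>v. C v < y) (at_right s)"
        using neg by (intro order_tendstoD(2)) auto
      then obtain b where b: "s < b" "\<And>v. s < v \<Longrightarrow> v < b \<Longrightarrow> C v < y"
        using \<open>s < T\<close> by (auto simp: eventually_at_right[OF \<open>s < T\<close>])
      have "b \<le> v" if "v \<le> T" "y \<le> C v" for v
      proof (rule ccontr)
        assume "\<not> b \<le> v"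
        moreover have "s < v"
          using mono_onD[OF mono, of v s] that neg s by (cases "s < v") (auto simp: not_less)
        ultimately show False using b(2)[of v] that by (auto simp: not_le not_less dest: leD)
      qed
      then have "b \<le> I y" unfolding I_def by (intro Inf_greatest) auto
      then show False using le b by auto
    qed
  qed
  have vimage: "I -` {..s} \<inter> space L = {0<..C s}" if s: "s \<le> T" for s
    using I_iff[OF _ s] mono_onD[OF mono, of s T] s by (auto simp: space_L)
  have meas: "I \<in> measurable L S"
    unfolding S_def
  proof (rule measurable_measure_of)
    show "I \<in> space L \<rightarrow> {..T}" using I_iff[of _ T] by (auto simp: space_L)
    fix A assume "A \<in> (\<lambda>t. {..t}) ` {..T}"
    then obtain s where s: "A = {..s}" "s \<le> T" by auto
    have "C s \<le> C T" using mono_onD[OF mono, of s T] s by auto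
    then show "I -` A \<inter> space L \<in> sets L"
      unfolding s(1) vimage[OF s(2)] by (auto simp: L_def sets_restrict_space_iff)
  qed auto
  have S_atMost: "{..s} \<in> sets S" if "s \<le> T" for s
    using that by (auto simp: sets_S)
  have eq: "emeasure (distr L S I) {..s} = ennreal (C s)" if s: "s \<le> T" for s
  proof -
    have "C s \<le> C T" using mono_onD[OF mono, of s T] s by auto
    then have "emeasure L {0<..C s} = ennreal (C s)"
      using nonneg[OF s] by (subst L_def, subst emeasure_restrict_space) auto
    then show ?thesis
      by (simp add: emeasure_distr[OF meas S_atMost[OF s]] vimage[OF s])
  qed
  have sub: "(\<lambda>t. {..t}) ` {..T} \<subseteq> Pow {..T}" by auto
  have sets_eq: "sets (stieltjes T C) = sets (distr L S I)"
    using sub by (simp add: stieltjes_def sets_extend_measure sets_S)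
  have "positive (sets (stieltjes T C)) (emeasure (distr L S I))"
    and "countably_additive (sets (stieltjes T C)) (emeasure (distr L S I))"
    unfolding sets_eq by (rule emeasure_positive, rule emeasure_countably_additive)
  then show ?thesis
    using emeasure_extend_measure[OF stieltjes_def, of T "emeasure (distr L S I)" C t] eq sub \<open>t \<le> T\<close>
    by simp
qed

text \<open>\<open>\<integral>\<^sub>0\<^sup>t r ds\<close> may be infinite when \<open>t = \<infinity>\<close>, in which case \<open>exp (-\<infinity>) = 0\<close>.\<close>

definition cumulative :: "'a process \<Rightarrow> ennreal \<Rightarrow> 'a \<Rightarrow> ennreal" where
  "cumulative r t \<omega> = (\<integral>\<^sup>+ s. ennreal (r s \<omega>) \<partial>leb_time t)"

definition discount :: "'a process \<Rightarrow> 'a process" where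
  "discount r t \<omega> =
     (if cumulative r t \<omega> = \<infinity> then 0 else exp (- enn2real (cumulative r t \<omega>)))"

definition bounded_positive_rate :: "'a measure \<Rightarrow> ennreal \<Rightarrow> 'a process \<Rightarrow> bool" where
  "bounded_positive_rate M T r \<longleftrightarrow> measurable_process M T r \<and>
     (\<exists>K. \<forall>t\<le>T. \<forall>\<omega>\<in>space M. 0 < r t \<omega> \<and> r t \<omega> \<le> K)"

text \<open>
  Uniform integrability with respect to a measure that may be infinite (\<open>P \<otimes> dt\<close> for
  \<open>T = \<infinity>\<close>): the truncation levels are integrable functions.  On a finite measure space this
  is the usual definition with constant truncation levels.
\<close>

definition uniformly_integrable :: "'b measure \<Rightarrow> ('b \<Rightarrow> real) set \<Rightarrow> bool" where
  "uniformly_integrable N K \<longleftrightarrow> K \<subseteq> borel_measurable N \<and>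
     (\<forall>\<epsilon>>0. \<exists>g. integrable N g \<and> (\<forall>z\<in>space N. 0 \<le> g z) \<and>
        (\<forall>f\<in>K. (\<integral>\<^sup>+ z\<in>{z. g z < \<bar>f z\<bar>}. ennreal \<bar>f z\<bar> \<partial>N) \<le> ennreal \<epsilon>))"

section \<open>Budget sets\<close>

definition total_price ::
    "'a measure \<Rightarrow> ennreal \<Rightarrow> 'a process \<Rightarrow> 'a process \<Rightarrow> 'a process \<Rightarrow> 'a process \<Rightarrow> ennreal" where
  "total_price M T \<psi>x \<psi>c x C =
     (\<integral>\<^sup>+ \<omega>. (\<integral>\<^sup>+ t. ennreal (\<psi>x t \<omega> * x t \<omega>) \<partial>leb_time T)
           + (\<integral>\<^sup>+ t. ennreal (\<psi>c t \<omega>) \<partial>stieltjes T (\<lambda>t. C t \<omega>)) \<partial>M)"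

definition budget_set ::
    "'a measure \<Rightarrow> (ennreal \<Rightarrow> 'a measure) \<Rightarrow> ennreal \<Rightarrow> 'a process \<Rightarrow> 'a process \<Rightarrow> real
      \<Rightarrow> ('a process \<times> 'a process) set" where
  "budget_set M F T \<psi>x \<psi>c w = {(x, C).
     optional_process M F T x \<and> optional_process M F T C \<and>
     (\<forall>t\<le>T. \<forall>\<omega>\<in>space M. 0 \<le> x t \<omega> \<and> 0 \<le> C t \<omega>) \<and>
     (AE \<omega> in M. right_continuous_path T (\<lambda>t. C t \<omega>) \<and> mono_on {..T} (\<lambda>t. C t \<omega>)) \<and>
     total_price M T \<psi>x \<psi>c x C \<le> ennreal w}"

section \<open>Utility functions\<close>

definition partial_x :: "(real \<Rightarrow> real \<Rightarrow> real) \<Rightarrow> real \<Rightarrow> real \<Rightarrow> real" where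
  "partial_x f x c = deriv (\<lambda>y. f y c) x"

definition partial_c :: "(real \<Rightarrow> real \<Rightarrow> real) \<Rightarrow> real \<Rightarrow> real \<Rightarrow> real" where
  "partial_c f x c = deriv (\<lambda>d. f x d) c"

definition C1_pos :: "(real \<Rightarrow> real \<Rightarrow> real) \<Rightarrow> bool" where
  "C1_pos f \<longleftrightarrow>
     (\<forall>x>0. \<forall>c>0. (\<lambda>y. f y c) differentiable (at x) \<and> (\<lambda>d. f x d) differentiable (at c)) \<and>
     continuous_on ({0<..} \<times> {0<..}) (\<lambda>(x, c). partial_x f x c) \<and>
     continuous_on ({0<..} \<times> {0<..}) (\<lambda>(x, c). partial_c f x c)"

definition C2_pos :: "(real \<Rightarrow> real \<Rightarrow> real) \<Rightarrow> bool" where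
  "C2_pos f \<longleftrightarrow> C1_pos f \<and> C1_pos (partial_x f) \<and> C1_pos (partial_c f)"

definition negative_definite_hessian_pos :: "(real \<Rightarrow> real \<Rightarrow> real) \<Rightarrow> bool" where
  "negative_definite_hessian_pos f \<longleftrightarrow> (\<forall>x>0. \<forall>c>0. \<forall>a b. (a, b) \<noteq> (0, 0) \<longrightarrow>
     a * partial_x (partial_x f) x c * a + a * partial_c (partial_x f) x c * b
     + b * partial_x (partial_c f) x c * a + b * partial_c (partial_c f) x c * b < 0)"

definition increasing_nonneg :: "(real \<Rightarrow> real \<Rightarrow> real) \<Rightarrow> bool" where
  "increasing_nonneg f \<longleftrightarrow>
     (\<forall>x x' c c'. 0 \<le> x \<and> x \<le> x' \<and> 0 \<le> c \<and> c \<le> c' \<longrightarrow> f x c \<le> f x' c')"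

definition strictly_concave_nonneg :: "(real \<Rightarrow> real \<Rightarrow> real) \<Rightarrow> bool" where
  "strictly_concave_nonneg f \<longleftrightarrow>
     (\<forall>x c x' c' s. 0 \<le> x \<and> 0 \<le> c \<and> 0 \<le> x' \<and> 0 \<le> c' \<and> (x, c) \<noteq> (x', c') \<and> 0 < s \<and> s < 1 \<longrightarrow>
        (1 - s) * f x c + s * f x' c' < f ((1 - s) * x + s * x') ((1 - s) * c + s * c'))"

definition g_inv :: "(real \<Rightarrow> real \<Rightarrow> real) \<Rightarrow> real \<Rightarrow> real \<Rightarrow> real" where
  "g_inv u \<psi> c = the_inv_into {0<..} (\<lambda>x. partial_x u x c) \<psi>"

definition h_fun :: "(real \<Rightarrow> real \<Rightarrow> real) \<Rightarrow> real \<Rightarrow> real \<Rightarrow> real" where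
  "h_fun u \<psi> c = partial_c u (g_inv u \<psi> c) c"

section \<open>Standing assumptions\<close>

definition assumption_U ::
    "'a measure \<Rightarrow> (ennreal \<Rightarrow> 'a measure) \<Rightarrow> ennreal \<Rightarrow> nat \<Rightarrow> (nat \<Rightarrow> real \<Rightarrow> real \<Rightarrow> real)
      \<Rightarrow> (nat \<Rightarrow> real) \<Rightarrow> 'a process \<Rightarrow> 'a process \<Rightarrow> 'a process \<Rightarrow> bool" where
  "assumption_U M F T n u w r \<psi>x \<psi>c \<longleftrightarrow>
     (\<forall>i\<in>{1..n}.
        increasing_nonneg (u i) \<and> strictly_concave_nonneg (u i) \<and>
        C2_pos (u i) \<and> negative_definite_hessian_pos (u i) \<and>
        (\<forall>c>0. filterlim (\<lambda>x. partial_x (u i) x c) at_top (at_right 0) \<and>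
               ((\<lambda>x. partial_x (u i) x c) \<longlongrightarrow> 0) at_top)) \<and>
     (\<forall>i\<in>{1..n}. uniformly_integrable (M \<Otimes>\<^sub>M leb_time T)
        {(\<lambda>(\<omega>, t). discount r t \<omega> * u i (x i t \<omega>) (\<Sum>j=1..n. C j t \<omega>)) | x C.
           \<forall>j\<in>{1..n}. (x j, C j) \<in> budget_set M F T \<psi>x \<psi>c (w j)})"

text \<open>
  Strict positivity of a price process is required at finite times only: at \<open>T = \<infinity>\<close> the
  price \<open>\<psi>\<^sub>c\<close> is zero by assumption.
\<close>

definition price_process ::
    "'a measure \<Rightarrow> (ennreal \<Rightarrow> 'a measure) \<Rightarrow> ennreal \<Rightarrow> 'a process \<Rightarrow> bool" where
  "price_process M F T \<psi> \<longleftrightarrow>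
     adapted F T \<psi> \<and> (\<forall>\<omega>\<in>space M. right_continuous_path T (\<lambda>t. \<psi> t \<omega>)) \<and>
     (\<forall>t\<le>T. t < \<infinity> \<longrightarrow> (\<forall>\<omega>\<in>space M. 0 < \<psi> t \<omega>)) \<and>
     (\<exists>\<rho> E. bounded_positive_rate M T \<rho> \<and> exponential_martingale M F T E \<and>
        (\<forall>t\<le>T. AE \<omega> in M. \<psi> t \<omega> = discount \<rho> t \<omega> * E t \<omega>))"

definition assumption_P ::
    "'a measure \<Rightarrow> (ennreal \<Rightarrow> 'a measure) \<Rightarrow> ennreal
      \<Rightarrow> 'a process \<Rightarrow> 'a process \<Rightarrow> 'a process \<Rightarrow> bool" where
  "assumption_P M F T r \<psi>x \<psi>c \<longleftrightarrow>
     price_process M F T \<psi>c \<and> (T = \<infinity> \<longrightarrow> (AE \<omega> in M. \<psi>c T \<omega> = 0)) \<and>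
     price_process M F T \<psi>x \<and>
     optional_process M F T r \<and> bounded_positive_rate M T r"

section \<open>The stochastic backward equation\<close>

text \<open>
  The first clause makes the running supremum a positive real number for \<open>\<tau> < t < T\<close>, i.e. for almost
  every \<open>t\<close> in the range of integration, where it is inserted into \<open>h\<close>.  As the integrand is
  nonnegative, the conditional expectation is the one for \<open>[0, \<infinity>]\<close>-valued random variables; the
  equation thus entails that it is finite almost surely.
\<close>

definition solves_backward_equation ::
    "'a measure \<Rightarrow> (ennreal \<Rightarrow> 'a measure) \<Rightarrow> ennreal \<Rightarrow> nat \<Rightarrow> (nat \<Rightarrow> real \<Rightarrow> real \<Rightarrow> real)
      \<Rightarrow> (nat \<Rightarrow> real) \<Rightarrow> real \<Rightarrow> 'a process \<Rightarrow> 'a process \<Rightarrow> 'a process \<Rightarrow> 'a process \<Rightarrow> bool" where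
  "solves_backward_equation M F T n u \<gamma> lam r \<psi>x \<psi>c l \<longleftrightarrow>
     (\<forall>\<tau>. stopping_time F \<tau> \<and> (\<forall>\<omega>\<in>space M. \<tau> \<omega> \<le> T) \<longrightarrow>
        (AE \<omega> in M. \<forall>t. \<tau> \<omega> < t \<and> t < T \<longrightarrow>
           bdd_above ((\<lambda>v. l v \<omega>) ` {\<tau> \<omega>..t}) \<and> 0 < (SUP v\<in>{\<tau> \<omega>..t}. l v \<omega>)) \<and>
        (AE \<omega> in M.
           nn_cond_exp M (filtration.pre_sigma (space M) F \<tau>)
             (\<lambda>\<omega>. \<integral>\<^sup>+ t\<in>{\<tau> \<omega>..T}. ennreal (discount r t \<omega> *
                (\<Sum>i=1..n. \<gamma> i * h_fun (u i)
                    (lam / \<gamma> i * exp (enn2real (cumulative r t \<omega>)) * \<psi>x t \<omega>)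
                    (SUP v\<in>{\<tau> \<omega>..t}. l v \<omega>))) \<partial>leb_time T) \<omega>
           = ennreal (lam * \<psi>c (\<tau> \<omega>) \<omega> * indicator {\<omega>. \<tau> \<omega> < T} \<omega>)))"

end

theory Submission
 imports Defs
begin

text \<open>After Bank and El Karoui. For each level \<open>l > 0\<close> consider the problem of stopping at the time \<open>\<tau>\<close> that
 minimises the expected price \<open>\<psi>\<^sub>c(\<tau>)\<close> plus the marginal value at level \<open>l\<close> accrued up to \<open>\<tau>\<close>; Snell envelopes
 solve it. The earliest optimal time after a given one increases with \<open>l\<close>, and \<open>l\<^sup>*(t)\<close> is the supremum of the
 levels at which stopping at \<open>t\<close> is optimal. The running supremum of \<open>l\<^sup>*\<close> then exceeds \<open>l\<close> exactly
 after such optimal times, and summing the differences of the envelopes over a fine partition of levels yields the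
 equation. Conversely any solution makes stopping at \<open>\<sigma>\<close> optimal exactly at the levels below its value at
 \<open>\<sigma>\<close>, so two solutions agree at all stopping times, and the optional section theorem gives
 indistinguishability.\<close>

section \<open>Paths along a countable dense set of times\<close>

text \<open>Null sets shape the argument: times and levels are both uncountable. Times are reduced
  to the countable set \<open>grid_times\<close>, levels to \<open>pos_rats\<close>;
  right-continuity and monotonicity then reach the rest. Conditional inequalities are kept as
  integrals over events with values in [0, \<infinity>], so that versions rarely have to be chosen
  and finiteness enters mainly where terms are cancelled.

  The price \<open>\<psi>c\<close> may lack left limits. Optimal times still exist because only the
  mean reward must not drop along increasing stopping times: the price term is a supermartingale and
  the accrued marginal value is continuous in time. That this value is integrable at every level is
  extracted from uniform integrability, tested with plans that keep \<open>C\<close> constant.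

  For uniqueness, optimality yields one implication: a level not exceeding the value of a solution
  is a contact level, so any solution is at most \<open>opt_level\<close>. Equality follows because
  both running suprema produce the same finite expectation while the marginal value decreases
  strictly, and upper right-continuity recovers the value from the running supremum.\<close>

definition grid :: "ennreal => nat => ennreal set" where
 "grid T m = {0, T} \<union> ((\<lambda>k. ennreal (real_of_rat (nat_to_rat_surj k))) ` {..<m} \<inter> {..T})"

definition grid_times :: "ennreal => ennreal set" where
 "grid_times T = (\<Union>m. grid T m)"

text \<open>Strictness keeps the rounded time to the right of \<open>s\<close> before
  \<open>T\<close>, as right limits require, and makes the event
  \<open>round_up T m s \<le> t\<close> a finite union of events \<open>s < x\<close>. Rounding thus
  turns stopping times into stopping times with finitely many values.\<close>

definition round_up :: "ennreal => nat => ennreal => ennreal" where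
 "round_up T m s = Min {x \<in> grid T m. s < x \<or> x = T}"

lemma finite_grid [simp]: "finite (grid T m)" by (auto simp: grid_def)

lemma grid_mono: "m \<le> m' ==> grid T m \<subseteq> grid T m'" by (auto simp: grid_def)

lemma grid_le: "x \<in> grid T m ==> x \<le> T" by (auto simp: grid_def)

lemma zero_in_grid [simp]: "0 \<in> grid T m" and end_in_grid [simp]: "T \<in> grid T m" by (auto simp: grid_def)

lemma grid_subset_times: "grid T m \<subseteq> grid_times T" by (auto simp: grid_times_def)

lemma zero_in_grid_times [simp]: "0 \<in> grid_times T" and end_in_grid_times [simp]: "T \<in> grid_times T"
 by (auto simp: grid_times_def)

lemma grid_times_le: "x \<in> grid_times T ==> x \<le> T" by (auto simp: grid_times_def grid_le)

lemma countable_grid_times [simp]: "countable (grid_times T)"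
 unfolding grid_times_def by (intro countable_UN) (auto intro: countable_finite)

lemma grid_dense: assumes "s < v" "v \<le> T" shows "\<exists>q\<in>grid_times T. s < q \<and> q < v"
proof -
 obtain r :: rat where r: "s < ennreal (real_of_rat r)" "ennreal (real_of_rat r) < v"
  using ennreal_rat_dense[OF \<open>s < v\<close>] by auto
 obtain k where "r = nat_to_rat_surj k" using surj_nat_to_rat_surj by (metis surjD)
 then have "ennreal (real_of_rat r) \<in> grid T (Suc k)" using r \<open>v \<le> T\<close> unfolding grid_def by auto
 then show ?thesis using r by (auto simp: grid_times_def)
qed

lemma round_up_cases:
 "{x \<in> grid T m. s < x \<or> x = T} \<noteq> {}" "finite {x \<in> grid T m. s < x \<or> x = T}"
 by (auto simp: grid_def)

lemma round_up_in_grid: "round_up T m s \<in> grid T m"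
 using Min_in[OF round_up_cases(2,1)] by (auto simp: round_up_def)

lemma round_up_in_times: "round_up T m s \<in> grid_times T" using round_up_in_grid grid_subset_times by blast

lemma round_up_le_end: "round_up T m s \<le> T" using round_up_in_grid grid_le by blast

lemma round_up_greater: "s < T ==> s < round_up T m s"
 using Min_in[OF round_up_cases(2,1), of T m s] by (auto simp: round_up_def)

lemma round_up_ge: "s \<le> T ==> s \<le> round_up T m s"
 using round_up_greater[of s T m] Min_in[OF round_up_cases(2,1), of T m s]
 by (cases "s = T") (auto simp: round_up_def less_imp_le)

lemma round_up_end [simp]: "round_up T m T = T" using round_up_ge[of T T m] round_up_le_end[of T m T] by auto

lemma round_up_le: "x \<in> grid T m ==> s < x ==> round_up T m s \<le> x" unfolding round_up_def by (intro Min_le) auto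

lemma round_up_le_iff:
 "t < T ==> round_up T m s \<le> t \<longleftrightarrow> (\<exists>x\<in>grid T m. x \<le> t \<and> s < x)"
 unfolding round_up_def by (subst Min_le_iff) (use round_up_cases[of T m s] in auto)

lemma eventually_round_up_less:
 assumes "s < v" "v \<le> T" shows "eventually (\<lambda>m. round_up T m s < v) sequentially"
proof -
 obtain q m where q: "q \<in> grid T m" "s < q" "q < v" using grid_dense[OF assms] by (auto simp: grid_times_def)
 have "round_up T m' s < v" if "m \<le> m'" for m' using round_up_le[of q T m' s] grid_mono[OF that, of T] q by auto
 then show ?thesis by (auto simp: eventually_sequentially)
qed

lemma round_up_tendsto: assumes "s \<le> T" shows "(\<lambda>m. round_up T m s) \<longlonglongrightarrow> s"
proof (rule order_tendstoI)
 show "eventually (\<lambda>m. a < round_up T m s) sequentially" if "a < s" for a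
  using round_up_ge[OF assms] that by (intro always_eventually) (auto intro: less_le_trans)
 show "eventually (\<lambda>m. round_up T m s < a) sequentially" if "s < a" for a
 proof (cases "s = T")
  case False
  then have "s < min a T" using that assms by auto
  from eventually_round_up_less[OF this, of T] show ?thesis by (auto elim: eventually_mono)
 qed (use that in auto)
qed

section \<open>One-sided limits along the grid times\<close>

definition right_grid :: "ennreal => ennreal => ennreal filter" where
 "right_grid T t = inf (at_right t) (principal (grid_times T))"

definition left_grid :: "ennreal => ennreal => ennreal filter" where
 "left_grid T t = inf (at_left t) (principal (grid_times T))"

lemma eventually_right_grid:
 "t < T ==> eventually P (right_grid T t) \<longleftrightarrow>
  (\<exists>v>t. v \<le> T \<and> (\<forall>q\<in>grid_times T. t < q \<and> q < v \<longrightarrow> P q))"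
 unfolding right_grid_def eventually_inf_principal
proof safe
 assume "t < T" "eventually (\<lambda>x. x \<in> grid_times T \<longrightarrow> P x) (at_right t)"
 then obtain b where "b > t" "\<forall>y>t. y < b \<longrightarrow> y \<in> grid_times T \<longrightarrow> P y"
  by (auto simp: eventually_at_right[OF \<open>t < T\<close>])
 then show "\<exists>v>t. v \<le> T \<and> (\<forall>q\<in>grid_times T. t < q \<and> q < v \<longrightarrow> P q)"
  using \<open>t < T\<close> by (intro exI[of _ "min b T"]) auto
next
 fix v assume "t < T" "t < v" "v \<le> T" "\<forall>q\<in>grid_times T. t < q \<and> q < v \<longrightarrow> P q"
 then show "eventually (\<lambda>x. x \<in> grid_times T \<longrightarrow> P x) (at_right t)"
  by (auto simp: eventually_at_right[OF \<open>t < T\<close>] intro!: exI[of _ v])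
qed

lemma eventually_left_grid:
 "0 < t ==> eventually P (left_grid T t) \<longleftrightarrow> (\<exists>v<t. \<forall>q\<in>grid_times T. v < q \<and> q < t \<longrightarrow> P q)"
 unfolding left_grid_def eventually_inf_principal by (auto simp: eventually_at_left[of 0 t])

lemma right_grid_nontrivial: "t < T ==> right_grid T t \<noteq> bot"
 unfolding trivial_limit_def eventually_right_grid using grid_dense by auto

lemma left_grid_nontrivial: "0 < t ==> t \<le> T ==> left_grid T t \<noteq> bot"
 unfolding trivial_limit_def eventually_left_grid using grid_dense by auto

lemma round_up_filterlim: "t < T ==> filterlim (\<lambda>m. round_up T m t) (right_grid T t) sequentially"
 unfolding filterlim_iff
proof safe
 fix P assume "t < T" "eventually P (right_grid T t)"
 then obtain v where v: "t < v" "v \<le> T" "\<forall>q\<in>grid_times T. t < q \<and> q < v \<longrightarrow> P q"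
  by (auto simp: eventually_right_grid)
 show "eventually (\<lambda>m. P (round_up T m t)) sequentially" using eventually_round_up_less[OF v(1,2)]
  by eventually_elim (use v(3) round_up_in_times round_up_greater[OF \<open>t < T\<close>] in auto)
qed

lemma right_continuous_round_up: assumes "right_continuous_path T f" "t \<le> T"
 shows "(\<lambda>m. f (round_up T m t)) \<longlonglongrightarrow> f t"
proof (cases "t = T")
 case False
 then have t: "t < T" using assms by auto
 then have "(f \<longlongrightarrow> f t) (at_right t)"
  using assms by (auto simp: right_continuous_path_def continuous_within)
 moreover have "filterlim (\<lambda>m. round_up T m t) (at_right t) sequentially"
  using round_up_filterlim[OF t] by (auto simp: right_grid_def filterlim_inf)
 ultimately show ?thesis by (rule filterlim_compose)
qed simp

text \<open>A lower limit strictly below the upper limit leaves room for two rationals. The bounds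
  make both limits real, and \<open>0 \<le> x q\<close> makes the smaller rational positive, as the
  factor \<open>a / b\<close> of the upcrossing bound requires.\<close>

lemma limit_exists_no_crossing:
 fixes x :: "'b => real"
 assumes G: "G \<noteq> bot" and bounded: "eventually (\<lambda>q. 0 \<le> x q \<and> x q \<le> K) G"
  and no: "\<And>a b :: rat. 0 < a ==> a < b ==>
   \<not> (frequently (\<lambda>q. x q < of_rat a) G \<and> frequently (\<lambda>q. of_rat b < x q) G)"
 shows "\<exists>L. (x \<longlongrightarrow> L) G"
proof -
 let ?l = "Liminf G (\<lambda>q. ereal (x q))" and ?u = "Limsup G (\<lambda>q. ereal (x q))"
 have l0: "0 \<le> ?l" using bounded by (intro Liminf_bounded) (auto elim: eventually_mono)
 have uK: "?u \<le> ereal K" using bounded by (intro Limsup_bounded) (auto elim: eventually_mono)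
 have lu: "?l \<le> ?u" by (rule Liminf_le_Limsup[OF G])
 have "?l = ?u"
 proof (rule ccontr)
  assume "?l \<noteq> ?u"
  with lu have "?l < ?u" by auto
  then obtain a :: rat where a: "?l < ereal (of_rat a)" "ereal (of_rat a) < ?u" using ereal_dense3 by blast
  then obtain b :: rat where b: "ereal (of_rat a) < ereal (of_rat b)" "ereal (of_rat b) < ?u"
   using ereal_dense3 by blast
  have "0 < ereal (of_rat a)" using l0 a by order
  then have ab: "0 < a" "a < b" using b by (auto simp: of_rat_less)
  have "frequently (\<lambda>q. x q < of_rat a) G" unfolding frequently_def
  proof
   assume "eventually (\<lambda>q. \<not> x q < of_rat a) G"
   then have "ereal (of_rat a) \<le> ?l" by (intro Liminf_bounded) (auto elim: eventually_mono)
   with a show False by order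
  qed
  moreover have "frequently (\<lambda>q. of_rat b < x q) G" unfolding frequently_def
  proof
   assume "eventually (\<lambda>q. \<not> of_rat b < x q) G"
   then have "?u \<le> ereal (of_rat b)" by (intro Limsup_bounded) (auto elim: eventually_mono)
   with b show False by order
  qed
  ultimately show False using no[OF ab] by auto
 qed
 moreover obtain L where "?l = ereal L" using l0 uK lu by (cases ?l) auto
 ultimately have "((\<lambda>q. ereal (x q)) \<longlongrightarrow> ereal L) G"
  using tendsto_iff_Liminf_eq_Limsup[OF G] by auto
 then show ?thesis by (auto simp: lim_ereal)
qed

text \<open>The recursion carries the starting time as an argument, so that after one passage from
  below \<open>a\<close> to above \<open>b\<close> the count can continue from a stopping
  time.\<close>

primrec upcrossings :: "ennreal set => (ennreal => real) => real => real => nat => ennreal => bool" where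
 "upcrossings G x a b 0 s \<longleftrightarrow> True"
| "upcrossings G x a b (Suc k) s \<longleftrightarrow>
  (\<exists>p\<in>G. s \<le> p \<and> x p < a \<and> (\<exists>q\<in>G. p \<le> q \<and> b < x q \<and> upcrossings G x a b k q))"

lemma upcrossings_antimono: "upcrossings G x a b k s ==> s' \<le> s ==> upcrossings G x a b k s'"
 by (cases k) (auto intro: order_trans)

lemma upcrossings_mono: "G \<subseteq> G' ==> upcrossings G x a b k s ==> upcrossings G' x a b k s"
proof (induction k arbitrary: s)
 case (Suc k)
 then show ?case by (simp, meson subsetD)
qed auto

lemma upcrossings_finite:
 "upcrossings (grid_times T) x a b k s ==> \<exists>m. upcrossings (grid T m) x a b k s"
proof (induction k arbitrary: s)
 case (Suc k)
 then obtain p q where pq: "p \<in> grid_times T" "s \<le> p" "x p < a" "q \<in> grid_times T" "p \<le> q" "b < x q"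
  "upcrossings (grid_times T) x a b k q" by auto
 from Suc.IH[OF pq(7)] obtain m where m: "upcrossings (grid T m) x a b k q" by auto
 from pq obtain m1 m2 where "p \<in> grid T m1" "q \<in> grid T m2" by (auto simp: grid_times_def)
 moreover define m' where "m' = m + m1 + m2"
 ultimately have "p \<in> grid T m'" "q \<in> grid T m'" "grid T m \<subseteq> grid T m'"
  using grid_mono[of m1 m' T] grid_mono[of m2 m' T] grid_mono[of m m' T] by auto
 moreover have "upcrossings (grid T m') x a b k q"
  using m \<open>grid T m \<subseteq> grid T m'\<close> by (auto intro: upcrossings_mono)
 ultimately show ?case using pq by (intro exI[of _ m']) auto
qed auto

text \<open>The last passages are placed first: every further one fits between \<open>t\<close> and
  the earliest one found so far. In \<open>left_crossing\<close> they are placed in order of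
  time.\<close>

lemma right_crossing:
 assumes "t < T" "frequently (\<lambda>q. x q < a) (right_grid T t)" "frequently (\<lambda>q. b < x q) (right_grid T t)"
 shows "\<forall>k. upcrossings (grid_times T) x a b k 0"
proof -
 have ex: "\<exists>q\<in>grid_times T. t < q \<and> q < s \<and> P q"
  if "frequently P (right_grid T t)" "t < s" for P s
  using that \<open>t < T\<close> unfolding frequently_def eventually_right_grid[OF \<open>t < T\<close>]
  by (auto dest!: spec[of _ "min s T"])
 have "\<exists>s>t. upcrossings (grid_times T) x a b k s" for k
 proof (induction k)
  case (Suc k)
  then obtain s where s: "t < s" "upcrossings (grid_times T) x a b k s" by auto
  obtain q where q: "q \<in> grid_times T" "t < q" "q < s" "b < x q" using ex[OF assms(3) s(1)] by auto
  obtain p where p: "p \<in> grid_times T" "t < p" "p < q" "x p < a" using ex[OF assms(2) q(2)] by auto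
  have "upcrossings (grid_times T) x a b k q" using upcrossings_antimono[OF s(2)] q by auto
  moreover have "p \<le> q" using p by auto
  ultimately show ?case using p q(1,4) by (intro exI[of _ p]) auto
 qed (use \<open>t < T\<close> in auto)
 then show ?thesis by (meson upcrossings_antimono zero_le)
qed

lemma left_crossing:
 assumes "0 < t" "frequently (\<lambda>q. x q < a) (left_grid T t)" "frequently (\<lambda>q. b < x q) (left_grid T t)"
 shows "\<forall>k. upcrossings (grid_times T) x a b k 0"
proof -
 have ex: "\<exists>q\<in>grid_times T. s < q \<and> q < t \<and> P q" if "frequently P (left_grid T t)" "s < t" for P s
  using that unfolding frequently_def eventually_left_grid[OF \<open>0 < t\<close>] by auto
 have "s < t ==> upcrossings (grid_times T) x a b k s" for s k
 proof (induction k arbitrary: s)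
  case (Suc k)
  obtain p where p: "p \<in> grid_times T" "s < p" "p < t" "x p < a" using ex[OF assms(2) Suc.prems] by auto
  obtain q where q: "q \<in> grid_times T" "p < q" "q < t" "b < x q" using ex[OF assms(3) p(3)] by auto
  have "s \<le> p" "p \<le> q" using p q by auto
  then show ?case using p(1,4) q(1,4) Suc.IH[OF q(3)] by auto
 qed auto
 then show ?thesis using \<open>0 < t\<close> by auto
qed

definition right_limit_path :: "ennreal => (ennreal => real) => ennreal => real" where
 "right_limit_path T x t = (if t < T then Lim (right_grid T t) x else x T)"

definition regular_path :: "ennreal => (ennreal => real) => bool" where
 "regular_path T x \<longleftrightarrow> (\<forall>t<T. \<exists>L. (x \<longlongrightarrow> L) (right_grid T t)) \<and>
  (\<forall>t. 0 < t \<and> t \<le> T \<longrightarrow> (\<exists>L. (x \<longlongrightarrow> L) (left_grid T t)))"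

lemma regular_pathI: assumes "\<And>q. q \<in> grid_times T ==> 0 \<le> x q \<and> x q \<le> K"
  and "\<And>a b :: rat. 0 < a ==> a < b ==> \<exists>k. \<not> upcrossings (grid_times T) x (of_rat a) (of_rat b) k 0"
 shows "regular_path T x" unfolding regular_path_def
proof (intro conjI allI impI)
 fix t assume t: "t < T"
 show "\<exists>L. (x \<longlongrightarrow> L) (right_grid T t)"
 proof (rule limit_exists_no_crossing[where K = K])
  show "eventually (\<lambda>q. 0 \<le> x q \<and> x q \<le> K) (right_grid T t)"
   using assms(1) by (auto simp: right_grid_def eventually_inf_principal)
 qed (use right_grid_nontrivial[OF t] right_crossing[OF t] assms(2) in blast)+
next
 fix t assume t: "0 < t \<and> t \<le> T"
 show "\<exists>L. (x \<longlongrightarrow> L) (left_grid T t)"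
 proof (rule limit_exists_no_crossing[where K = K])
  show "eventually (\<lambda>q. 0 \<le> x q \<and> x q \<le> K) (left_grid T t)"
   using assms(1) by (auto simp: left_grid_def eventually_inf_principal)
 qed (use left_grid_nontrivial[of t T] left_crossing[of t] assms(2) t in blast)+
qed

lemma right_limit_path: assumes "regular_path T x" "t < T"
 shows "(x \<longlongrightarrow> right_limit_path T x t) (right_grid T t)"
proof -
 obtain L where L: "(x \<longlongrightarrow> L) (right_grid T t)" using assms by (auto simp: regular_path_def)
 then have "Lim (right_grid T t) x = L" by (intro tendsto_Lim right_grid_nontrivial assms)
 with L assms show ?thesis by (simp add: right_limit_path_def)
qed

text \<open>The right limit at \<open>t\<close> only sees grid points between \<open>s\<close> and
  \<open>v\<close>. This one estimate yields both right-continuity and left limits of the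
  regularised path.\<close>

lemma dist_right_limit_path_le: assumes "regular_path T x" "t < v" "v \<le> T" "s < t"
  and "\<And>q. q \<in> grid_times T ==> s < q ==> q < v ==> dist (x q) L < e"
 shows "dist (right_limit_path T x t) L \<le> e"
proof -
 have t: "t < T" using assms by auto
 have "eventually (\<lambda>q. dist (x q) L \<le> e) (right_grid T t)"
  using assms by (auto simp: eventually_right_grid[OF t] intro!: exI[of _ v] less_imp_le)
 with tendsto_dist[OF right_limit_path[OF assms(1) t] tendsto_const[of L]]
 show ?thesis using right_grid_nontrivial[OF t] by (intro tendsto_upperbound)
qed

lemma cadlag_right_limit_path: assumes reg: "regular_path T x" shows "cadlag_path T (right_limit_path T x)"
 unfolding cadlag_path_def right_continuous_path_def continuous_within
proof (intro conjI allI impI)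
 fix t assume t: "t < T"
 show "(right_limit_path T x \<longlongrightarrow> right_limit_path T x t) (at_right t)"
 proof (rule tendstoI)
  fix e :: real assume "0 < e"
  then have "eventually (\<lambda>q. dist (x q) (right_limit_path T x t) < e / 2) (right_grid T t)"
   using right_limit_path[OF reg t] by (intro tendstoD) auto
  then obtain v where v: "t < v" "v \<le> T"
   "\<And>q. q \<in> grid_times T ==> t < q ==> q < v ==> dist (x q) (right_limit_path T x t) < e / 2"
   by (auto simp: eventually_right_grid[OF t])
  have "dist (right_limit_path T x s) (right_limit_path T x t) < e" if "t < s" "s < v" for s
   using dist_right_limit_path_le[OF reg that(2) v(2) that(1) v(3)] \<open>0 < e\<close> by auto
  then show "eventually (\<lambda>s. dist (right_limit_path T x s) (right_limit_path T x t) < e) (at_right t)"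
   using v(1) by (auto simp: eventually_at_right[OF t])
 qed
next
 fix t assume t: "0 < t \<and> t \<le> T"
 then obtain L where L: "(x \<longlongrightarrow> L) (left_grid T t)" using reg by (auto simp: regular_path_def)
 have "(right_limit_path T x \<longlongrightarrow> L) (at_left t)"
 proof (rule tendstoI)
  fix e :: real assume "0 < e"
  then have "eventually (\<lambda>q. dist (x q) L < e / 2) (left_grid T t)" using L by (intro tendstoD) auto
  then obtain v where v: "v < t"
   "\<And>q. q \<in> grid_times T ==> v < q ==> q < t ==> dist (x q) L < e / 2"
   using t by (auto simp: eventually_left_grid)
  have "dist (right_limit_path T x s) L < e" if "v < s" "s < t" for s
   using dist_right_limit_path_le[OF reg that(2) _ that(1) v(2)] t \<open>0 < e\<close> by auto
  then show "eventually (\<lambda>s. dist (right_limit_path T x s) L < e) (at_left t)"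
   using v(1) t by (auto simp: eventually_at_left[of 0 t])
 qed
 then show "\<exists>a. (right_limit_path T x \<longlongrightarrow> a) (at_left t)" by auto
qed

lemma right_continuous_right_grid:
 assumes "right_continuous_path T f" "t < T" shows "(f \<longlongrightarrow> f t) (right_grid T t)"
proof -
 have "(f \<longlongrightarrow> f t) (at_right t)"
  using assms by (auto simp: right_continuous_path_def continuous_within)
 then show ?thesis unfolding right_grid_def by (rule tendsto_mono[rotated]) auto
qed

lemma right_continuous_le: assumes "right_continuous_path T f" "right_continuous_path T g"
  and "\<And>q. q \<in> grid_times T ==> f q \<le> g q" "t \<le> T" shows "f t \<le> g t"
 using right_continuous_round_up[OF assms(1,4)] right_continuous_round_up[OF assms(2,4)]
 by (rule LIMSEQ_le) (use assms(3) round_up_in_times in auto)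

lemma right_continuous_add:
 "right_continuous_path T f ==> right_continuous_path T g ==> right_continuous_path T (\<lambda>t. f t + g t)"
 and right_continuous_diff:
 "right_continuous_path T f ==> right_continuous_path T g ==> right_continuous_path T (\<lambda>t. f t - g t)"
 and right_continuous_mult:
 "right_continuous_path T f ==> right_continuous_path T g ==> right_continuous_path T (\<lambda>t. f t * g t)"
 and right_continuous_const: "right_continuous_path T (\<lambda>t. c)"
 by (auto simp: right_continuous_path_def intro: continuous_intros)

section \<open>Stopping times\<close>

text \<open>Fatou's lemma, shaped for approximations that all obey the same upper bound.\<close>

lemma nn_integral_le_of_tendsto:
 fixes f :: "nat => 'a => ennreal" assumes [measurable]: "\<And>n. f n \<in> borel_measurable M"
  and lim: "AE x in M. (\<lambda>n. f n x) \<longlonglongrightarrow> g x"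
  and le: "eventually (\<lambda>n. (\<integral>\<^sup>+ x. f n x \<partial>M) \<le> c) sequentially"
 shows "(\<integral>\<^sup>+ x. g x \<partial>M) \<le> c"
proof -
 have "(\<integral>\<^sup>+ x. g x \<partial>M) = (\<integral>\<^sup>+ x. liminf (\<lambda>n. f n x) \<partial>M)"
  using lim by (intro nn_integral_cong_AE) (auto elim!: eventually_mono dest!: lim_imp_Liminf[rotated])
 also have "\<dots> \<le> liminf (\<lambda>n. \<integral>\<^sup>+ x. f n x \<partial>M)"
  by (rule nn_integral_liminf) simp
 also have "\<dots> \<le> limsup (\<lambda>n. \<integral>\<^sup>+ x. f n x \<partial>M)" by (rule Liminf_le_Limsup) simp
 also have "\<dots> \<le> c" using le by (rule Limsup_bounded)
 finally show ?thesis .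
qed

lemma nn_integral_split_values: assumes "finite G" "\<And>x. x \<in> A ==> S x \<in> G"
  and "\<And>s. s \<in> G ==> {x \<in> A. S x = s} \<in> sets M" and [measurable]: "f \<in> borel_measurable M"
 shows "(\<integral>\<^sup>+ x\<in>A. f x \<partial>M) = (\<Sum>s\<in>G. \<integral>\<^sup>+ x\<in>{x \<in> A. S x = s}. f x \<partial>M)"
proof -
 have "f x * indicator A x = (\<Sum>s\<in>G. f x * indicator {x \<in> A. S x = s} x)" for x
 proof (cases "x \<in> A")
  case True
  then have "(\<Sum>s\<in>G. f x * indicator {x \<in> A. S x = s} x) = (\<Sum>s\<in>G. if s = S x then f x else 0)"
   by (intro sum.cong) (auto simp: indicator_def)
  then show ?thesis using True assms by simp
 qed auto
 then show ?thesis using assms(3) by (simp add: nn_integral_sum)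
qed

lemma borel_measurable_round_up [measurable]: "round_up T m \<in> borel_measurable borel"
proof (rule borel_measurableI_le)
 fix a
 show "{s \<in> space borel. round_up T m s \<le> a} \<in> sets borel"
 proof (cases "a < T")
  case True
  then have "{s \<in> space borel. round_up T m s \<le> a} = (\<Union>x\<in>{x\<in>grid T m. x \<le> a}. {..<x})"
   by (auto simp: round_up_le_iff)
  then show ?thesis by auto
 next
  case False
  then have "{s \<in> space borel. round_up T m s \<le> a} = UNIV"
   by (auto simp: not_less intro: order_trans[OF round_up_le_end])
  then show ?thesis by auto
 qed
qed

context filtered_prob_space
begin

text \<open>Integrals over an event stand in for conditional expectations: an inequality for all
  events of a sigma-algebra is the conditional inequality, with no integrability condition
  attached.\<close>

abbreviation ei :: "'a set => ('a => real) => ennreal" where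
 "ei A X \<equiv> \<integral>\<^sup>+ x\<in>A. ennreal (X x) \<partial>M"

abbreviation ev :: "'a set => ('a => ennreal) => 'a process => ennreal" where
 "ev A \<tau> X \<equiv> \<integral>\<^sup>+ x\<in>A. ennreal (X (\<tau> x) x) \<partial>M"

lemma sub_F: "subalgebra M (F t)" by (auto simp: subalgebra_def space_F sets_F_le)

lemma F_le_M: "A \<in> sets (F t) ==> A \<in> sets M" using sets_F_le by blast

lemma F_mono: "A \<in> sets (F s) ==> s \<le> t ==> A \<in> sets (F t)" using sets_F_mono by blast

lemma F_measurable_mono: "X \<in> borel_measurable (F s) ==> s \<le> t ==> X \<in> borel_measurable (F t)"
 using sets_F_mono by (auto simp: measurable_def space_F)

lemma F_measurable_M: "X \<in> borel_measurable (F s) ==> X \<in> borel_measurable M"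
 by (rule measurable_from_subalg[OF sub_F])

lemma null_in_F: "A \<subseteq> N ==> N \<in> null_sets M ==> A \<in> sets (F t)"
proof -
 assume "A \<subseteq> N" "N \<in> null_sets M"
 then have "A \<in> null_sets M" using complete2 by blast
 then show ?thesis using null_sets_F F_mono[of A 0 t] by auto
qed

lemma sigma_finite_sub_F: "sigma_finite_subalgebra M (F t)"
 by (intro finite_measure_subalgebra_is_sigma_finite finite_measure_subalgebra.intro
   finite_measure_subalgebra_axioms.intro sub_F finite_measure_axioms)

text \<open>By completeness the exceptional set and all its subsets already lie in
  \<open>F t\<close>.\<close>

lemma F_measurable_AE:
 fixes X Y :: "'a => 'b::topological_space" assumes X: "X \<in> borel_measurable (F t)" and eq: "AE x in M. X x = Y x"
 shows "Y \<in> borel_measurable (F t)"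
proof (rule measurableI)
 obtain N where N: "{x \<in> space M. X x \<noteq> Y x} \<subseteq> N" "N \<in> null_sets M"
  using eq by (auto elim!: AE_E)
 fix B :: "'b set" assume "B \<in> sets borel"
 then have "X -` B \<inter> space (F t) \<in> sets (F t)" using X by (rule measurable_sets[rotated])
 moreover have "Y -` B \<inter> space (F t) = (X -` B \<inter> space (F t) - (N \<inter> space M)) \<union> (Y -` B \<inter> (N \<inter> space M))"
  using N(1) by (auto simp: space_F)
 moreover have "N \<inter> space M \<in> sets (F t)" "Y -` B \<inter> (N \<inter> space M) \<in> sets (F t)"
  using N(2) by (auto intro!: null_in_F[of _ N])
 ultimately show "Y -` B \<inter> space (F t) \<in> sets (F t)" by simp
qed simp

lemma F_right_continuous_measurable: assumes "t < T" "\<And>s. t < s ==> s \<le> T ==> X \<in> borel_measurable (F s)"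
 shows "X \<in> borel_measurable (F t)" using assms(2)[OF assms(1)] assms(2) right_continuous_F[OF assms(1)]
 by (auto simp: measurable_def space_F)

section \<open>Stopping times bounded by T\<close>

definition stopping :: "('a => ennreal) => bool" where
 "stopping S \<longleftrightarrow> stopping_time F S \<and> (\<forall>x\<in>space M. S x \<le> T)"

lemma stoppingD: "stopping S ==> stopping_time F S"
 "stopping S ==> x \<in> space M ==> S x \<le> T" by (auto simp: stopping_def)

lemma stopping_le_sets: "stopping S ==> {x \<in> space M. S x \<le> t} \<in> sets (F t)"
 using stopping_timeD[of F S t] by (auto simp: stopping_def pred_def space_F)

lemma stopping_less_sets: "stopping S ==> {x \<in> space M. S x < t} \<in> sets (F t)"
 using stopping_time_less_const[of S t] by (auto simp: stopping_def pred_def space_F)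

lemma stopping_eq_sets: "stopping S ==> {x \<in> space M. S x = t} \<in> sets (F t)"
 using stopping_time_eq_const[of S t] by (auto simp: stopping_def pred_def space_F)

lemma stoppingI: assumes le: "\<And>x. x \<in> space M ==> S x \<le> T"
  and sets: "\<And>t. t < T ==> {x \<in> space M. S x \<le> t} \<in> sets (F t)" shows "stopping S"
 unfolding stopping_def stopping_time_def pred_def
proof (intro conjI allI ballI le)
 fix t show "{x \<in> space (F t). S x \<le> t} \<in> sets (F t)"
 proof (cases "t < T")
  case False
  then have "{x \<in> space (F t). S x \<le> t} = space (F t)"
   by (auto simp: space_F not_less intro: order_trans[OF le])
  then show ?thesis by simp
 qed (use sets in \<open>auto simp: space_F\<close>)
qed

text \<open>For each \<open>s > t\<close> the event \<open>S \<le> t\<close> is the intersection of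
  the events \<open>S < q\<close> over rounded times \<open>q\<close> in \<open>(t, s]\<close>
  tending to \<open>t\<close>; hence it lies in every such \<open>F s\<close>, and right-continuity
  of the filtration puts it into \<open>F t\<close>.\<close>

lemma stoppingI_less: assumes le: "\<And>x. x \<in> space M ==> S x \<le> T"
  and less: "\<And>t. t \<le> T ==> {x \<in> space M. S x < t} \<in> sets (F t)" shows "stopping S"
proof (rule stoppingI[OF le])
 fix t assume t: "t < T"
 have "{x \<in> space M. S x \<le> t} \<in> sets (F s)" if s: "t < s" "s \<le> T" for s
 proof -
  have "S x \<le> t \<longleftrightarrow> (\<forall>m. S x < round_up s m t)" for x
  proof
   show "\<forall>m. S x < round_up s m t" if "S x \<le> t"
    using that round_up_greater[OF s(1)] by (auto intro: le_less_trans)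
   show "S x \<le> t" if "\<forall>m. S x < round_up s m t" using round_up_tendsto[of t s] s that
    by (intro LIMSEQ_le_const[of "\<lambda>m. round_up s m t" t]) (auto intro: less_imp_le)
  qed
  then have "{x \<in> space M. S x \<le> t} = (\<Inter>m. {x \<in> space M. S x < round_up s m t})" by auto
  also have "\<dots> \<in> sets (F s)"
  proof (rule sets.countable_INT, safe)
   fix m
   have "round_up s m t \<le> s" by (rule round_up_le_end)
   then show "{x \<in> space M. S x < round_up s m t} \<in> sets (F s)" using F_mono[OF less] s(2) order_trans by blast
  qed
  finally show ?thesis .
 qed
 then show "{x \<in> space M. S x \<le> t} \<in> sets (F t)" using right_continuous_F[OF t] by auto
qed auto

lemma stopping_const: "t \<le> T ==> stopping (\<lambda>x. t)" by (auto simp: stopping_def stopping_time_const)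

lemma stopping_SUP:
 fixes S :: "nat => 'a => ennreal" assumes "\<And>n. stopping (S n)" shows "stopping (\<lambda>x. SUP n. S n x)"
proof (rule stoppingI)
 show "(SUP n. S n x) \<le> T" if "x \<in> space M" for x using assms that by (auto simp: SUP_le_iff stopping_def)
 fix t
 have "{x \<in> space M. (SUP n. S n x) \<le> t} = (\<Inter>n. {x \<in> space M. S n x \<le> t})"
  by (auto simp: SUP_le_iff)
 then show "{x \<in> space M. (SUP n. S n x) \<le> t} \<in> sets (F t)" using stopping_le_sets[OF assms] by auto
qed

lemma stopping_INF:
 fixes S :: "nat => 'a => ennreal" assumes "\<And>n. stopping (S n)" shows "stopping (\<lambda>x. INF n. S n x)"
proof (rule stoppingI_less)
 show "(INF n. S n x) \<le> T" if "x \<in> space M" for x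
  using INF_lower2[of 0 UNIV "\<lambda>n. S n x" T] stoppingD(2)[OF assms that] by simp
 fix t
 have "{x \<in> space M. (INF n. S n x) < t} = (\<Union>n. {x \<in> space M. S n x < t})" by (auto simp: INF_less_iff)
 then show "{x \<in> space M. (INF n. S n x) < t} \<in> sets (F t)" using stopping_less_sets[OF assms] by auto
qed

lemma stopping_round_up: assumes "stopping S" shows "stopping (\<lambda>y. round_up T m (S y))"
proof (rule stoppingI)
 fix t assume "t < T"
 then have "{y \<in> space M. round_up T m (S y) \<le> t} = (\<Union>x\<in>{x\<in>grid T m. x \<le> t}. {y \<in> space M. S y < x})"
  by (auto simp: round_up_le_iff)
 also have "\<dots> \<in> sets (F t)" by (intro sets.finite_UN) (auto intro: F_mono[OF stopping_less_sets[OF assms]])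
 finally show "{y \<in> space M. round_up T m (S y) \<le> t} \<in> sets (F t)" .
qed (simp add: round_up_le_end)

lemma stopping_measurable [measurable_dest]: "stopping S ==> S \<in> borel_measurable M"
 by (rule measurable_stopping_time[where F = F]) (simp_all add: stopping_def sets_F_le space_F)

lemma sub_pre_sigma: assumes "stopping S" shows "subalgebra M (pre_sigma S)" unfolding subalgebra_def
proof (intro conjI subsetI)
 fix A assume "A \<in> sets (pre_sigma S)"
 then have "{x \<in> A. S x \<le> T} \<in> sets (F T)" and "A \<subseteq> space M"
  using sets_pre_sigmaD stoppingD[OF assms] sets.sets_into_space[of A "pre_sigma S"] by (auto simp: space_pre_sigma)
 moreover have "{x \<in> A. S x \<le> T} = A" using stoppingD[OF assms] \<open>A \<subseteq> space M\<close> by auto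
 ultimately show "A \<in> sets M" using F_le_M by auto
qed (simp add: space_pre_sigma)

lemma pre_sigma_le_M: "stopping S ==> A \<in> sets (pre_sigma S) ==> A \<in> sets M"
 using sub_pre_sigma by (auto simp: subalgebra_def)

lemma pre_sigma_measurable_M:
 "stopping S ==> X \<in> borel_measurable (pre_sigma S) ==> X \<in> borel_measurable M"
 by (rule measurable_from_subalg[OF sub_pre_sigma])

lemma sigma_finite_pre_sigma: "stopping S ==> sigma_finite_subalgebra M (pre_sigma S)"
 by (intro finite_measure_subalgebra_is_sigma_finite finite_measure_subalgebra.intro
   finite_measure_subalgebra_axioms.intro sub_pre_sigma finite_measure_axioms)

lemma pre_sigma_mono:
 "stopping S ==> stopping \<tau> ==> (\<And>x. x \<in> space M ==> S x \<le> \<tau> x) ==>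
  A \<in> sets (pre_sigma S) ==> A \<in> sets (pre_sigma \<tau>)"
 using mono_pre_sigma[OF stoppingD(1) stoppingD(1), of S \<tau>] by (meson subsetD)

lemma pre_sigma_le_sets:
 "stopping S ==> A \<in> sets (pre_sigma S) ==> {x \<in> A. S x \<le> t} \<in> sets (F t)"
 using sets_pre_sigmaD by (auto simp: stopping_def)

lemma pre_sigma_eq_sets: assumes "stopping S" "A \<in> sets (pre_sigma S)" shows "{x \<in> A. S x = t} \<in> sets (F t)"
proof -
 have "A \<subseteq> space M" using sets.sets_into_space[OF assms(2)] by (simp add: space_pre_sigma)
 then have "{x \<in> A. S x = t} = {x \<in> A. S x \<le> t} \<inter> {x \<in> space M. S x = t}" by auto
 then show ?thesis using pre_sigma_le_sets[OF assms] stopping_eq_sets[OF assms(1)] by simp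
qed

lemma pre_sigmaI:
 assumes "stopping S" "A \<subseteq> space M" "\<And>t. t \<le> T ==> {x \<in> A. S x \<le> t} \<in> sets (F t)"
 shows "A \<in> sets (pre_sigma S)"
proof (rule sets_pre_sigmaI[OF stoppingD(1)[OF assms(1)]])
 fix t show "{x \<in> A. S x \<le> t} \<in> sets (F t)"
 proof (cases "t \<le> T")
  case False
  moreover have "S x \<le> T" if "x \<in> A" for x using assms(2) stoppingD(2)[OF assms(1)] that by blast
  ultimately have "{x \<in> A. S x \<le> t} = {x \<in> A. S x \<le> T}" by (auto intro: order_trans less_imp_le)
  moreover have "T \<le> t" using False by simp
  ultimately show ?thesis using F_mono[OF assms(3)[of T], of t] by simp
 qed (rule assms(3))
qed

lemma pre_sigma_const: "t \<le> T ==> A \<in> sets (F t) ==> A \<in> sets (pre_sigma (\<lambda>x. t))"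
proof (rule pre_sigmaI[OF stopping_const])
 assume A: "A \<in> sets (F t)"
 then show "A \<subseteq> space M" using sets.sets_into_space[OF A] by (simp add: space_F)
 show "{x \<in> A. t \<le> s} \<in> sets (F s)" for s using A F_mono[of A t s] by (cases "t \<le> s") auto
qed

section \<open>Progressive measurability\<close>

definition progressive :: "'a process => bool" where
 "progressive X \<longleftrightarrow> (\<forall>t\<le>T. measurable_process (F t) t X)"

text \<open>On the event \<open>S \<le> t\<close> the variable equals \<open>X\<close> at
  \<open>min (S x) t\<close>, a composition that uses the process only up to
  \<open>t\<close>.\<close>

lemma progressive_pre_sigma: assumes X: "progressive X" and S: "stopping S"
 shows "(\<lambda>x. X (S x) x) \<in> borel_measurable (pre_sigma S)"
proof (rule measurableI)
 fix B :: "real set" assume B: "B \<in> sets borel"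
 show "(\<lambda>x. X (S x) x) -` B \<inter> space (pre_sigma S) \<in> sets (pre_sigma S)"
 proof (rule pre_sigmaI[OF S])
  fix t assume t: "t \<le> T"
  have [measurable]: "(\<lambda>(x, s). X s x) \<in> borel_measurable (F t \<Otimes>\<^sub>M restrict_space borel {..t})"
   using X t by (auto simp: progressive_def measurable_process_def)
  have "(\<lambda>x. min (S x) t) \<in> borel_measurable (F t)"
  proof (rule borel_measurableI_le)
   fix a
   have "{x \<in> space (F t). min (S x) t \<le> a} = (if t \<le> a then space (F t) else {x \<in> space M. S x \<le> a})"
    by (auto simp: space_F min_le_iff_disj)
   then show "{x \<in> space (F t). min (S x) t \<le> a} \<in> sets (F t)"
    using F_mono[OF stopping_le_sets[OF S], of a t] by (cases "t \<le> a") simp_all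
  qed
  then have [measurable]: "(\<lambda>x. min (S x) t) \<in> F t \<rightarrow>\<^sub>M restrict_space borel {..t}"
   by (rule measurable_restrict_space2[rotated]) auto
  have "(\<lambda>x. (\<lambda>(x, s). X s x) (x, min (S x) t)) \<in> borel_measurable (F t)" by measurable
  then have "(\<lambda>x. X (min (S x) t) x) \<in> borel_measurable (F t)" by simp
  then have "(\<lambda>x. X (min (S x) t) x) -` B \<inter> space (F t) \<in> sets (F t)"
   by (rule measurable_sets) (rule B)
  then have "((\<lambda>x. X (min (S x) t) x) -` B \<inter> space (F t)) \<inter> {x \<in> space M. S x \<le> t} \<in> sets (F t)"
   using stopping_le_sets[OF S] by (rule sets.Int)
  also have "((\<lambda>x. X (min (S x) t) x) -` B \<inter> space (F t)) \<inter> {x \<in> space M. S x \<le> t} =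
   {x \<in> (\<lambda>x. X (S x) x) -` B \<inter> space (pre_sigma S). S x \<le> t}" unfolding space_F space_pre_sigma
  proof (rule set_eqI)
   fix x show "x \<in> ((\<lambda>x. X (min (S x) t) x) -` B \<inter> space M) \<inter> {x \<in> space M. S x \<le> t} \<longleftrightarrow>
    x \<in> {x \<in> (\<lambda>x. X (S x) x) -` B \<inter> space M. S x \<le> t}"
    by (cases "S x \<le> t") (auto simp: min_absorb1)
  qed
  finally show "{x \<in> (\<lambda>x. X (S x) x) -` B \<inter> space (pre_sigma S). S x \<le> t} \<in> sets (F t)" .
 qed (auto simp: space_pre_sigma)
qed (auto)

lemma progressive_stopped_measurable:
 "progressive X ==> stopping S ==> (\<lambda>x. X (S x) x) \<in> borel_measurable M"
 by (rule pre_sigma_measurable_M[OF _ progressive_pre_sigma])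

text \<open>Rounding up within the grid of \<open>[0, t]\<close>, not of \<open>[0, T]\<close>,
  keeps all approximations \<open>F t\<close>-measurable.\<close>

lemma right_continuous_progressive:
 assumes ad: "adapted F T X" and rc: "\<And>x. x \<in> space M ==> right_continuous_path T (\<lambda>t. X t x)"
 shows "progressive X" unfolding progressive_def measurable_process_def
proof (intro allI impI)
 fix t assume t: "t \<le> T"
 let ?N = "F t \<Otimes>\<^sub>M restrict_space borel {..t}"
 have "(\<lambda>z. X (round_up t m (snd z)) (fst z)) \<in> borel_measurable ?N" for m
 proof (rule measurable_compose_countable'[where I = "grid t m"])
  show "(\<lambda>z. X i (fst z)) \<in> borel_measurable ?N" if "i \<in> grid t m" for i
  proof -
   have "i \<le> t" using that grid_le by auto
   then have [measurable]: "X i \<in> borel_measurable (F t)"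
    using ad t F_measurable_mono[of "X i" i t] by (auto simp: adapted_def)
   show ?thesis by measurable
  qed
  have [measurable]: "(\<lambda>s. s) \<in> borel_measurable (restrict_space borel {..t})"
   by (rule measurable_restrict_space1) simp
  have "(\<lambda>z. round_up t m (snd z)) \<in> borel_measurable ?N" by measurable
  then show "(\<lambda>z. round_up t m (snd z)) \<in> ?N \<rightarrow>\<^sub>M count_space (grid t m)"
   by (subst measurable_count_space_eq2) (auto simp: round_up_in_grid)
 qed (simp add: countable_finite)
 moreover have "(\<lambda>m. X (round_up t m (snd z)) (fst z)) \<longlonglongrightarrow> (\<lambda>(x, s). X s x) z" if z_in: "z \<in> space ?N" for z
 proof -
  obtain x s where z: "z = (x, s)" "x \<in> space M" "s \<le> t"
   using z_in by (cases z) (auto simp: space_pair_measure space_F space_restrict_space)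
  have "right_continuous_path t (\<lambda>t. X t x)" using rc[OF z(2)] t by (auto simp: right_continuous_path_def)
  from right_continuous_round_up[OF this z(3)] show ?thesis using z by simp
 qed
 ultimately show "(\<lambda>(x, s). X s x) \<in> borel_measurable ?N" by (rule borel_measurable_LIMSEQ_metric)
qed

end

section \<open>Nonnegative supermartingales\<close>

lemma nn_integral_set_split:
 assumes [measurable]: "f \<in> borel_measurable M" "A \<in> sets M" and P: "{x \<in> A. P x} \<in> sets M"
 shows "(\<integral>\<^sup>+ x\<in>A. f x \<partial>M) = (\<integral>\<^sup>+ x\<in>{x \<in> A. P x}. f x \<partial>M) + (\<integral>\<^sup>+ x\<in>{x \<in> A. \<not> P x}. f x \<partial>M)"
proof -
 have "{x \<in> A. \<not> P x} = A - {x \<in> A. P x}" by auto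
 then have [measurable]: "{x \<in> A. \<not> P x} \<in> sets M" "{x \<in> A. P x} \<in> sets M" using P by auto
 have "(\<integral>\<^sup>+ x\<in>A. f x \<partial>M) =
  (\<integral>\<^sup>+ x. f x * indicator {x \<in> A. P x} x + f x * indicator {x \<in> A. \<not> P x} x \<partial>M)"
  by (intro nn_integral_cong) (auto simp: indicator_def)
 also have "\<dots> = (\<integral>\<^sup>+ x\<in>{x \<in> A. P x}. f x \<partial>M) + (\<integral>\<^sup>+ x\<in>{x \<in> A. \<not> P x}. f x \<partial>M)"
  by (rule nn_integral_add) measurable
 finally show ?thesis .
qed

lemma nn_integral_truncate_le: assumes [measurable]: "X \<in> borel_measurable M" "A \<in> sets M"
  and le: "\<And>K::nat. (\<integral>\<^sup>+ x\<in>A. ennreal (min (X x) K) \<partial>M) \<le> c"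
 shows "(\<integral>\<^sup>+ x\<in>A. ennreal (X x) \<partial>M) \<le> c"
proof (rule nn_integral_le_of_tendsto)
 show "AE x in M. (\<lambda>K. ennreal (min (X x) (real K)) * indicator A x) \<longlonglongrightarrow> ennreal (X x) * indicator A x"
 proof (intro AE_I2)
  fix x
  obtain k :: nat where "X x \<le> k" using real_arch_simple by blast
  then have "eventually (\<lambda>K. min (X x) (real K) = X x) sequentially"
   by (auto simp: eventually_sequentially intro!: exI[of _ k])
  then show "(\<lambda>K. ennreal (min (X x) (real K)) * indicator A x) \<longlonglongrightarrow> ennreal (X x) * indicator A x"
   by (intro tendsto_eventually) (auto elim: eventually_mono)
 qed
qed (use le in auto)

context filtered_prob_space
begin

text \<open>The time set \<open>D\<close> is \<open>grid_times T\<close> before regularisation and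
  \<open>{..T}\<close> after it.\<close>

definition supermart :: "ennreal set => 'a process => bool" where
 "supermart D X \<longleftrightarrow>
  (\<forall>t\<in>D. X t \<in> borel_measurable (F t) \<and> (\<forall>x\<in>space M. 0 \<le> X t x) \<and> integrable M (X t)) \<and>
  (\<forall>s\<in>D. \<forall>t\<in>D. s \<le> t \<longrightarrow> (\<forall>A\<in>sets (F s).
    ei A (X t) \<le> ei A (X s)))"

lemma supermartD: assumes "supermart D X" "t \<in> D"
 shows "X t \<in> borel_measurable (F t)" "X t \<in> borel_measurable M"
  "\<And>x. x \<in> space M ==> 0 \<le> X t x" "integrable M (X t)"
 using assms F_measurable_M by (auto simp: supermart_def)

lemma supermart_le:
 "supermart D X ==> s \<in> D ==> t \<in> D ==> s \<le> t ==> A \<in> sets (F s) ==>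
  ei A (X t) \<le> ei A (X s)" by (auto simp: supermart_def)

lemma supermart_subset: "supermart D X ==> D' \<subseteq> D ==> supermart D' X"
 unfolding supermart_def by (simp add: subset_eq)

lemma supermart_const: "0 \<le> K ==> supermart D (\<lambda>t x. K)" by (auto simp: supermart_def)

text \<open>The event is split at the earlier time \<open>s\<close> according to which of the two
  processes is smaller there; each part uses the inequality of that process.\<close>

lemma supermart_min: assumes X: "supermart D X" and Y: "supermart D Y"
 shows "supermart D (\<lambda>t x. min (X t x) (Y t x))" unfolding supermart_def
proof (intro conjI ballI impI)
 fix t assume t: "t \<in> D"
 show "(\<lambda>x. min (X t x) (Y t x)) \<in> borel_measurable (F t)"
  using supermartD(1)[OF X t] supermartD(1)[OF Y t] by measurable
 show "integrable M (\<lambda>x. min (X t x) (Y t x))"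
  using supermartD(4)[OF X t] supermartD(4)[OF Y t] by (rule integrable_min)
 show "0 \<le> min (X t x) (Y t x)" if "x \<in> space M" for x
  using supermartD(3)[OF X t that] supermartD(3)[OF Y t that] by simp
next
 fix s t A assume st: "s \<in> D" "t \<in> D" "s \<le> t" and A: "A \<in> sets (F s)"
 note m [measurable] = supermartD(1)[OF X st(1)] supermartD(1)[OF Y st(1)]
  supermartD(2)[OF X st(1)] supermartD(2)[OF Y st(1)]
  supermartD(2)[OF X st(2)] supermartD(2)[OF Y st(2)]
 note AM [measurable] = F_le_M[OF A]
 have AF [measurable]: "A \<in> sets (F s)" by (rule A)
 let ?A = "{x \<in> A. X s x \<le> Y s x}" and ?B = "{x \<in> A. \<not> X s x \<le> Y s x}"
 have "?A = A \<inter> {x \<in> space (F s). X s x \<le> Y s x}" "?B = A \<inter> {x \<in> space (F s). \<not> X s x \<le> Y s x}"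
  using sets.sets_into_space[OF A] by auto
 then have AB: "?A \<in> sets (F s)" "?B \<in> sets (F s)" by simp_all
 note split = nn_integral_set_split[OF _ AM F_le_M[OF AB(1)]]
 have "ei A (\<lambda>x. min (X t x) (Y t x)) =
   ei ?A (\<lambda>x. min (X t x) (Y t x)) + ei ?B (\<lambda>x. min (X t x) (Y t x))" by (rule split) measurable
 also have "\<dots> \<le> ei ?A (X t) + ei ?B (Y t)"
  by (intro add_mono nn_integral_mono mult_right_mono ennreal_leI) auto
 also have "\<dots> \<le> ei ?A (X s) + ei ?B (Y s)"
  by (intro add_mono supermart_le[OF X st AB(1)] supermart_le[OF Y st AB(2)])
 also have "\<dots> = ei ?A (\<lambda>x. min (X s x) (Y s x)) + ei ?B (\<lambda>x. min (X s x) (Y s x))"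
  by (intro arg_cong2[where f = "(+)"] nn_integral_cong) (auto simp: indicator_def min_def)
 also have "\<dots> = ei A (\<lambda>x. min (X s x) (Y s x))" by (rule split[symmetric]) measurable
 finally show "ei A (\<lambda>x. min (X t x) (Y t x)) \<le> ei A (\<lambda>x. min (X s x) (Y s x))" .
qed

lemma finite_stopped_measurable:
 fixes X :: "'a process" assumes S: "stopping S" "finite G" "\<And>x. x \<in> space M ==> S x \<in> G"
  and X: "\<And>t. t \<in> G ==> X t \<in> borel_measurable (F t)"
 shows "(\<lambda>x. X (S x) x) \<in> borel_measurable (pre_sigma S)"
proof (rule measurableI)
 fix B :: "real set" assume B: "B \<in> sets borel"
 show "(\<lambda>x. X (S x) x) -` B \<inter> space (pre_sigma S) \<in> sets (pre_sigma S)"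
 proof (rule pre_sigmaI[OF S(1)])
  fix t
  have "{x \<in> (\<lambda>x. X (S x) x) -` B \<inter> space (pre_sigma S). S x \<le> t} =
   (\<Union>s\<in>{s\<in>G. s \<le> t}. (X s -` B \<inter> space (F s)) \<inter> {x \<in> space M. S x = s})"
   using S(3) by (auto simp: space_pre_sigma space_F)
  also have "\<dots> \<in> sets (F t)"
  proof (rule sets.finite_UN)
   fix s assume "s \<in> {s \<in> G. s \<le> t}"
   then show "(X s -` B \<inter> space (F s)) \<inter> {x \<in> space M. S x = s} \<in> sets (F t)"
    using F_mono[OF sets.Int[OF measurable_sets[OF X B] stopping_eq_sets[OF S(1)]], of s t] by simp
  qed (use S(2) in simp)
  finally show "{x \<in> (\<lambda>x. X (S x) x) -` B \<inter> space (pre_sigma S). S x \<le> t} \<in> sets (F t)" .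
 qed (auto simp: space_pre_sigma)
qed auto

text \<open>Induction on the number of points of \<open>G\<close> after \<open>s\<close>: where
  \<tau> equals \<open>s\<close> both sides agree, elsewhere \<tau> is at least the next point, from
  which the claim is known.\<close>

lemma supermart_sampling_from: assumes X: "supermart D X" and \<tau>: "stopping \<tau>"
  and G: "finite G" "G \<subseteq> D" "\<And>y. y \<in> space M ==> \<tau> y \<in> G"
 shows "s \<in> G ==> A \<in> sets (F s) ==> (\<And>y. y \<in> A ==> s \<le> \<tau> y) ==>
  ev A \<tau> X \<le> ei A (X s)"
proof (induction "card {x \<in> G. s < x}" arbitrary: s A rule: less_induct)
 case less
 have A_sub: "A \<subseteq> space M" using sets.sets_into_space[OF less.prems(2)] by (simp add: space_F)
 have s: "s \<in> D" using less.prems G by auto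
 have [measurable]: "X s \<in> borel_measurable M" "A \<in> sets M" using supermartD[OF X s] F_le_M less.prems by auto
 have [measurable]: "(\<lambda>y. X (\<tau> y) y) \<in> borel_measurable M"
  using G by (intro pre_sigma_measurable_M[OF \<tau> finite_stopped_measurable[OF \<tau> G(1)]]) (auto intro: supermartD(1)[OF X])
 let ?A = "{y \<in> A. \<tau> y \<le> s}" and ?B = "{y \<in> A. \<not> \<tau> y \<le> s}"
 have "?A = A \<inter> {y \<in> space M. \<tau> y \<le> s}" "?B = A - ?A" using A_sub by auto
 then have AB: "?A \<in> sets (F s)" "?B \<in> sets (F s)"
  using less.prems(2) stopping_le_sets[OF \<tau>, of s] by simp_all
 have B_le: "ev ?B \<tau> X \<le> ei ?B (X s)"
 proof (cases "{x \<in> G. s < x} = {}")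
  case True
  then have "?B = {}" using G(3) A_sub by (force simp: not_le)
  then show ?thesis by simp
 next
  case False
  define s' where "s' = Min {x \<in> G. s < x}"
  have fin: "finite {x \<in> G. s < x}" using G by auto
  have s': "s' \<in> G" "s < s'" using Min_in[OF fin False] by (auto simp: s'_def)
  have "{x \<in> G. s' < x} \<subset> {x \<in> G. s < x}" using s' by auto
  then have card: "card {x \<in> G. s' < x} < card {x \<in> G. s < x}" by (rule psubset_card_mono[OF fin])
  have "s' \<le> \<tau> y" if "y \<in> ?B" for y using that A_sub G(3) by (auto simp: s'_def intro!: Min_le fin)
  then have "ev ?B \<tau> X \<le> ei ?B (X s')" using s' by (intro less.hyps[OF card] F_mono[OF AB(2)]) auto
  also have "\<dots> \<le> ei ?B (X s)" using s' G by (intro supermart_le[OF X s _ _ AB(2)]) auto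
  finally show ?thesis .
 qed
 have "ev A \<tau> X =
  ev ?A \<tau> X + ev ?B \<tau> X" by (rule nn_integral_set_split[OF _ _ F_le_M[OF AB(1)]]) measurable
 also have "ev ?A \<tau> X = ei ?A (X s)"
 proof (intro nn_integral_cong)
  fix y
  have "\<tau> y = s" if "y \<in> ?A" using that less.prems(3)[of y] by auto
  then show "ennreal (X (\<tau> y) y) * indicator ?A y = ennreal (X s y) * indicator ?A y"
   by (cases "y \<in> ?A") simp_all
 qed
 also have "ei ?A (X s) + ev ?B \<tau> X \<le>
  ei ?A (X s) + ei ?B (X s)" using B_le by (rule add_left_mono)
 also have "\<dots> = ei A (X s)" by (rule nn_integral_set_split[OF _ _ F_le_M[OF AB(1)], symmetric]) measurable
 finally show ?case .
qed

lemma supermart_finite_sampling: assumes X: "supermart D X" and S: "stopping S" and \<tau>: "stopping \<tau>"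
  and le: "\<And>x. x \<in> space M ==> S x \<le> \<tau> x"
  and G: "finite G" "G \<subseteq> D" "\<And>x. x \<in> space M ==> S x \<in> G" "\<And>x. x \<in> space M ==> \<tau> x \<in> G"
  and A: "A \<in> sets (pre_sigma S)" shows "ev A \<tau> X \<le> ev A S X"
proof -
 have A_sub: "A \<subseteq> space M" using sets.sets_into_space[OF A] by (simp add: space_pre_sigma)
 have m: "(\<lambda>x. X (\<rho> x) x) \<in> borel_measurable M"
  if "stopping \<rho>" "\<And>x. x \<in> space M ==> \<rho> x \<in> G" for \<rho>
  using G that by (intro pre_sigma_measurable_M[OF that(1) finite_stopped_measurable[OF that(1) G(1)]])
   (auto intro: supermartD(1)[OF X])
 have [measurable]: "(\<lambda>x. X (\<tau> x) x) \<in> borel_measurable M" "(\<lambda>x. X (S x) x) \<in> borel_measurable M"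
  using m S \<tau> G by auto
 have eq: "{x \<in> A. S x = s} \<in> sets (F s)" for s by (rule pre_sigma_eq_sets[OF S A])
 have "ev A \<tau> X = (\<Sum>s\<in>G. \<integral>\<^sup>+ x\<in>{x \<in> A. S x = s}. ennreal (X (\<tau> x) x) \<partial>M)"
  using G A_sub by (intro nn_integral_split_values F_le_M[OF eq]) auto
 also have "\<dots> \<le> (\<Sum>s\<in>G. \<integral>\<^sup>+ x\<in>{x \<in> A. S x = s}. ennreal (X s x) \<partial>M)"
  using le A_sub G by (intro sum_mono supermart_sampling_from[OF X \<tau> G(1,2)] eq) auto
 also have "\<dots> = (\<Sum>s\<in>G. \<integral>\<^sup>+ x\<in>{x \<in> A. S x = s}. ennreal (X (S x) x) \<partial>M)"
  by (intro sum.cong nn_integral_cong) (auto simp: indicator_def)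
 also have "\<dots> = ev A S X" using G A_sub by (intro nn_integral_split_values[symmetric] F_le_M[OF eq]) auto
 finally show ?thesis .
qed

text \<open>\<open>T\<close> is always a grid point and serves as default, so the minimum exists;
  \<open>P\<close> can fail at the result only when the result is \<open>T\<close>.\<close>

definition first_hit :: "nat => ('a => ennreal) => (ennreal => 'a => bool) => 'a => ennreal" where
 "first_hit m \<rho> P x = Min {q \<in> grid T m. \<rho> x \<le> q \<and> P q x \<or> q = T}"

lemma first_hit_set: "finite {q \<in> grid T m. \<rho> x \<le> q \<and> P q x \<or> q = T}" "{q \<in> grid T m. \<rho> x \<le> q \<and> P q x \<or> q = T} \<noteq> {}"
proof -
 have "T \<in> {q \<in> grid T m. \<rho> x \<le> q \<and> P q x \<or> q = T}" by simp
 then show "{q \<in> grid T m. \<rho> x \<le> q \<and> P q x \<or> q = T} \<noteq> {}" by blast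
qed simp

lemma first_hit_Min: "first_hit m \<rho> P x \<in> {q \<in> grid T m. \<rho> x \<le> q \<and> P q x \<or> q = T}"
 unfolding first_hit_def by (rule Min_in[OF first_hit_set])

lemma first_hit_in_grid: "first_hit m \<rho> P x \<in> grid T m" using first_hit_Min[of m \<rho> P x] by simp

lemma first_hit_ge: "\<rho> x \<le> T ==> \<rho> x \<le> first_hit m \<rho> P x"
 using first_hit_Min[of m \<rho> P x] by auto

lemma first_hit_holds: assumes "q \<in> grid T m" "\<rho> x \<le> q" "P q x"
 shows "P (first_hit m \<rho> P x) x" "first_hit m \<rho> P x \<le> q"
proof -
 show le: "first_hit m \<rho> P x \<le> q" using assms unfolding first_hit_def by (intro Min_le) auto
 show "P (first_hit m \<rho> P x) x"
 proof (cases "first_hit m \<rho> P x = T")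
  case True
  then have "q = T" using le grid_le[OF assms(1)] by auto
  then show ?thesis using True assms by simp
 next
  case False
  then show ?thesis using first_hit_Min[of m \<rho> P x] by auto
 qed
qed

lemma space_in_pre_sigma [simp]: "space M \<in> sets (pre_sigma S)" by (metis sets.top space_pre_sigma)

lemma stopping_first_hit:
 assumes \<rho>: "stopping \<rho>" and P: "\<And>q. q \<in> grid T m ==> {x \<in> space M. P q x} \<in> sets (F q)"
 shows "stopping (first_hit m \<rho> P)"
proof (rule stoppingI)
 show "first_hit m \<rho> P x \<le> T" for x by (rule grid_le[OF first_hit_in_grid])
 fix t assume "t < T"
 have "first_hit m \<rho> P x \<le> t \<longleftrightarrow> (\<exists>q\<in>{q \<in> grid T m. \<rho> x \<le> q \<and> P q x \<or> q = T}. q \<le> t)" for x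
  unfolding first_hit_def by (rule Min_le_iff[OF first_hit_set])
 with \<open>t < T\<close> have "first_hit m \<rho> P x \<le> t \<longleftrightarrow> (\<exists>q\<in>grid T m. q \<le> t \<and> \<rho> x \<le> q \<and> P q x)" for x
  by auto
 then have "{x \<in> space M. first_hit m \<rho> P x \<le> t} =
  (\<Union>q\<in>{q\<in>grid T m. q \<le> t}. {x \<in> space M. \<rho> x \<le> q} \<inter> {x \<in> space M. P q x})"
  by auto
 also have "\<dots> \<in> sets (F t)"
 proof (rule sets.finite_UN)
  fix q assume "q \<in> {q \<in> grid T m. q \<le> t}"
  then show "{x \<in> space M. \<rho> x \<le> q} \<inter> {x \<in> space M. P q x} \<in> sets (F t)"
   using F_mono[OF sets.Int[OF stopping_le_sets[OF \<rho>] P], of q t] by simp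
 qed simp
 finally show "{x \<in> space M. first_hit m \<rho> P x \<le> t} \<in> sets (F t)" .
qed

lemma supermart_hit_sets: assumes X: "supermart (grid_times T) X" "q \<in> grid T m"
 shows "{x \<in> space M. X q x < a} \<in> sets (F q)" "{x \<in> space M. b < X q x} \<in> sets (F q)"
proof -
 have [measurable]: "X q \<in> borel_measurable (F q)"
  using X(2) by (intro supermartD(1)[OF X(1)] subsetD[OF grid_subset_times])
 have "{x \<in> space (F q). X q x < a} \<in> sets (F q)" "{x \<in> space (F q). b < X q x} \<in> sets (F q)"
  by measurable
 then show "{x \<in> space M. X q x < a} \<in> sets (F q)" "{x \<in> space M. b < X q x} \<in> sets (F q)"
  by (simp_all add: space_F)
qed

lemma upcrossings_measurable: assumes X: "supermart (grid_times T) X"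
 shows "{x \<in> space M. upcrossings (grid T m) (\<lambda>t. X t x) a b k s} \<in> sets M"
proof (induction k arbitrary: s)
 case (Suc k)
 have "{x \<in> space M. upcrossings (grid T m) (\<lambda>t. X t x) a b (Suc k) s} =
  (\<Union>p\<in>{p\<in>grid T m. s \<le> p}. {x \<in> space M. X p x < a} \<inter> (\<Union>q\<in>{q\<in>grid T m. p \<le> q}.
   {x \<in> space M. b < X q x} \<inter> {x \<in> space M. upcrossings (grid T m) (\<lambda>t. X t x) a b k q}))"
  by auto
 also have "\<dots> \<in> sets M"
  by (intro sets.finite_UN sets.Int Suc.IH) (auto intro!: F_le_M[OF supermart_hit_sets(1)[OF X]] F_le_M[OF supermart_hit_sets(2)[OF X]])
 finally show ?case .
qed auto

text \<open>Dubins' form of the upcrossing inequality: each further upcrossing costs a factor \<open>a / b\<close>.\<close>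

lemma upcrossings_prob_le: assumes X: "supermart (grid_times T) X" and ab: "0 < a" "a < b"
 shows "stopping \<rho> ==> (\<And>x. x \<in> space M ==> \<rho> x \<in> grid T m) ==> A \<in> sets (pre_sigma \<rho>) ==>
  emeasure M {x \<in> A. upcrossings (grid T m) (\<lambda>t. X t x) a b k (\<rho> x)} \<le> ennreal ((a / b) ^ k) * emeasure M A"
proof (induction k arbitrary: \<rho> A)
 case (Suc k)
 note \<rho> = Suc.prems(1,2) and A = Suc.prems(3)
 have A_sub: "A \<subseteq> space M" using sets.sets_into_space[OF A] by (simp add: space_pre_sigma)
 define S where "S = first_hit m \<rho> (\<lambda>q x. X q x < a)"
 have S: "stopping S" "\<And>x. S x \<in> grid T m"
  unfolding S_def by (intro stopping_first_hit \<rho> supermart_hit_sets[OF X]) (auto simp: first_hit_in_grid)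
 define \<tau> where "\<tau> = first_hit m S (\<lambda>q x. b < X q x)"
 have \<tau>: "stopping \<tau>" "\<And>x. \<tau> x \<in> grid T m"
  unfolding \<tau>_def by (intro stopping_first_hit S supermart_hit_sets[OF X]) (auto simp: first_hit_in_grid)
 have \<rho>S: "\<rho> x \<le> S x" if "x \<in> space M" for x
  unfolding S_def using stoppingD(2)[OF \<rho>(1) that] by (rule first_hit_ge)
 have S\<tau>: "S x \<le> \<tau> x" if "x \<in> space M" for x
  unfolding \<tau>_def using stoppingD(2)[OF S(1) that] by (rule first_hit_ge)
 have ad: "X t \<in> borel_measurable (F t)" if "t \<in> grid T m" for t
  using that by (intro supermartD(1)[OF X] subsetD[OF grid_subset_times])
 have XS [measurable]: "(\<lambda>x. X (S x) x) \<in> borel_measurable (pre_sigma S)"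
  by (rule finite_stopped_measurable[OF S(1) finite_grid S(2) ad])
 have X\<tau> [measurable]: "(\<lambda>x. X (\<tau> x) x) \<in> borel_measurable (pre_sigma \<tau>)"
  by (rule finite_stopped_measurable[OF \<tau>(1) finite_grid \<tau>(2) ad])
 have [measurable]: "(\<lambda>x. X (\<tau> x) x) \<in> borel_measurable M" "(\<lambda>x. X (S x) x) \<in> borel_measurable M"
  using pre_sigma_measurable_M[OF \<tau>(1) X\<tau>] pre_sigma_measurable_M[OF S(1) XS] by auto
 define A' where "A' = {x \<in> A. X (S x) x < a}"
 have "A' = A \<inter> {x \<in> space (pre_sigma S). X (S x) x < a}" using A_sub by (auto simp: A'_def space_pre_sigma)
 moreover have "A \<in> sets (pre_sigma S)" by (rule pre_sigma_mono[OF \<rho>(1) S(1) \<rho>S A])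
 ultimately have A': "A' \<in> sets (pre_sigma S)" by simp
 define B where "B = {x \<in> A'. b < X (\<tau> x) x}"
 have "B = A' \<inter> {x \<in> space (pre_sigma \<tau>). b < X (\<tau> x) x}"
  using A_sub by (auto simp: A'_def B_def space_pre_sigma)
 moreover have "A' \<in> sets (pre_sigma \<tau>)" by (rule pre_sigma_mono[OF S(1) \<tau>(1) S\<tau> A'])
 ultimately have B: "B \<in> sets (pre_sigma \<tau>)" by simp
 have [measurable]: "A \<in> sets M" "A' \<in> sets M" "B \<in> sets M"
  using pre_sigma_le_M[OF \<rho>(1) A] pre_sigma_le_M[OF S(1) A'] pre_sigma_le_M[OF \<tau>(1) B] by auto
 \<comment> \<open>The first hits come no later than the times of a given passage, so the remaining
   \<open>k\<close> upcrossings are still ahead of \<tau>.\<close>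
 have "{x \<in> A. upcrossings (grid T m) (\<lambda>t. X t x) a b (Suc k) (\<rho> x)} \<subseteq>
  {x \<in> B. upcrossings (grid T m) (\<lambda>t. X t x) a b k (\<tau> x)}"
 proof safe
  fix x assume x: "x \<in> A" "upcrossings (grid T m) (\<lambda>t. X t x) a b (Suc k) (\<rho> x)"
  then obtain p q where p: "p \<in> grid T m" "\<rho> x \<le> p" "X p x < a"
   and q: "q \<in> grid T m" "p \<le> q" "b < X q x" and up: "upcrossings (grid T m) (\<lambda>t. X t x) a b k q"
   by auto
  note 1 = first_hit_holds[where P = "\<lambda>q x. X q x < a" and \<rho> = \<rho>, OF p, folded S_def]
  have "S x \<le> q" using 1 q by auto
  note 2 = first_hit_holds[where P = "\<lambda>q x. b < X q x" and \<rho> = S, OF q(1) this q(3), folded \<tau>_def]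
  show "x \<in> B" using x 1 2 by (auto simp: B_def A'_def)
  show "upcrossings (grid T m) (\<lambda>t. X t x) a b k (\<tau> x)" using up 2(2) by (rule upcrossings_antimono)
 qed
 moreover have "{x \<in> B. upcrossings (grid T m) (\<lambda>t. X t x) a b k (\<tau> x)} \<in> sets M"
 proof -
  have "{x \<in> B. upcrossings (grid T m) (\<lambda>t. X t x) a b k (\<tau> x)} =
   (\<Union>s\<in>grid T m. (B \<inter> {x \<in> space M. \<tau> x = s}) \<inter> {x \<in> space M. upcrossings (grid T m) (\<lambda>t. X t x) a b k s})"
   using \<tau>(2) A_sub by (auto simp: B_def A'_def)
  also have "\<dots> \<in> sets M"
   by (intro sets.finite_UN sets.Int upcrossings_measurable[OF X] F_le_M[OF stopping_eq_sets[OF \<tau>(1)]]) auto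
  finally show ?thesis .
 qed
 ultimately have "emeasure M {x \<in> A. upcrossings (grid T m) (\<lambda>t. X t x) a b (Suc k) (\<rho> x)} \<le>
  emeasure M {x \<in> B. upcrossings (grid T m) (\<lambda>t. X t x) a b k (\<tau> x)}" by (rule emeasure_mono)
 also have "\<dots> \<le> ennreal ((a / b) ^ k) * emeasure M B" by (rule Suc.IH[OF \<tau>(1) \<tau>(2) B])
 \<comment> \<open>b P(B) \<le> E[X at \<tau>; A'] \<le> E[X at S; A'] \<le> a P(A), the middle
   inequality being sampling on the finite grid.\<close>
 also have "emeasure M B \<le> ennreal (a / b) * emeasure M A"
 proof -
  have "ennreal b * emeasure M B = (\<integral>\<^sup>+ x\<in>B. ennreal b \<partial>M)"
   by (simp add: nn_integral_cmult_indicator)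
  also have "\<dots> \<le> ev A' \<tau> X"
   by (intro nn_integral_mono) (auto simp: B_def indicator_def intro!: ennreal_leI)
  also have "\<dots> \<le> ev A' S X"
   by (rule supermart_finite_sampling[OF X S(1) \<tau>(1) S\<tau> finite_grid grid_subset_times S(2) \<tau>(2) A'])
  also have "\<dots> \<le> (\<integral>\<^sup>+ x\<in>A. ennreal a \<partial>M)"
   by (intro nn_integral_mono) (auto simp: A'_def indicator_def intro!: ennreal_leI)
  also have "\<dots> = ennreal a * emeasure M A" by (simp add: nn_integral_cmult_indicator)
  finally have "ennreal (1 / b) * (ennreal b * emeasure M B) \<le> ennreal (1 / b) * (ennreal a * emeasure M A)"
   by (rule mult_left_mono) simp
  then show ?thesis using ab by (simp flip: mult.assoc ennreal_mult)
 qed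
 finally have "emeasure M {x \<in> A. upcrossings (grid T m) (\<lambda>t. X t x) a b (Suc k) (\<rho> x)} \<le>
  ennreal ((a / b) ^ k) * (ennreal (a / b) * emeasure M A)" by (simp add: mult_left_mono)
 moreover have "ennreal ((a / b) ^ Suc k) = ennreal ((a / b) ^ k) * ennreal (a / b)"
  using ennreal_mult[of "(a / b) ^ k" "a / b"] ab by (simp add: mult.commute)
 ultimately show ?case by (simp only: mult.assoc)
qed auto

text \<open>A chain of upcrossings uses finitely many times, so it lives on some finite grid; the
  bound does not depend on the grid and survives the increasing union.\<close>

lemma upcrossings_grid_times: assumes X: "supermart (grid_times T) X" and ab: "0 < a" "a < b"
 defines "E \<equiv> \<lambda>k. {x \<in> space M. upcrossings (grid_times T) (\<lambda>t. X t x) a b k 0}"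
 shows "E k \<in> sets M" "emeasure M (E k) \<le> ennreal ((a / b) ^ k)"
proof -
 let ?E = "\<lambda>m. {x \<in> space M. upcrossings (grid T m) (\<lambda>t. X t x) a b k 0}"
 have E: "E k = (\<Union>m. ?E m)"
  by (auto simp: E_def dest: upcrossings_finite intro: upcrossings_mono[OF grid_subset_times])
 show "E k \<in> sets M" unfolding E by (intro sets.countable_UN) (auto simp: upcrossings_measurable[OF X])
 have "emeasure M (?E m) \<le> ennreal ((a / b) ^ k)" for m
  using upcrossings_prob_le[OF X ab stopping_const[of 0], of m "space M" k] by (simp add: emeasure_space_1)
 moreover have "emeasure M (E k) = (SUP m. emeasure M (?E m))" unfolding E by (intro SUP_emeasure_incseq[symmetric])
   (auto simp: upcrossings_measurable[OF X] incseq_def intro: upcrossings_mono[OF grid_mono])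
 ultimately show "emeasure M (E k) \<le> ennreal ((a / b) ^ k)" by (simp add: SUP_le_iff)
qed

lemma AE_avoids_small_sets:
 assumes E: "\<And>k. E k \<in> sets M" "\<And>k. emeasure M (E k) \<le> ennreal (c k)" and c: "c \<longlonglongrightarrow> 0"
 shows "AE x in M. \<exists>k. x \<notin> E k"
proof -
 have "emeasure M (\<Inter>k. E k) \<le> 0"
 proof (rule LIMSEQ_le_const)
  show "(\<lambda>k. ennreal (c k)) \<longlonglongrightarrow> 0" using tendsto_ennrealI[OF c] by simp
  show "\<exists>N. \<forall>n\<ge>N. emeasure M (\<Inter>k. E k) \<le> ennreal (c n)"
   using E(1) by (intro exI[of _ 0] allI impI order_trans[OF emeasure_mono E(2)]) auto
 qed
 then have "(\<Inter>k. E k) \<in> null_sets M" using E(1) by (auto intro!: null_setsI)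
 from AE_not_in[OF this] show ?thesis by simp
qed

lemma AE_finitely_many_upcrossings: assumes X: "supermart (grid_times T) X" and ab: "0 < a" "a < b"
 shows "AE x in M. \<exists>k. \<not> upcrossings (grid_times T) (\<lambda>t. X t x) a b k 0"
proof -
 have "(\<lambda>k. (a / b) ^ k) \<longlonglongrightarrow> 0" using ab by (intro LIMSEQ_power_zero) auto
 from AE_avoids_small_sets[OF upcrossings_grid_times[OF X ab] this] AE_space show ?thesis by eventually_elim auto
qed

text \<open>Exceeding a high level after starting below \<open>Suc i\<close> is a single upcrossing,
  so the case \<open>k = 1\<close> acts as a maximal inequality: \<open>i\<close> is chosen above
  \<open>X 0 x\<close>, and \<open>n\<close> exists because the bound tends to 0.\<close>

lemma AE_bounded_on_grid: assumes X: "supermart (grid_times T) X"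
 shows "AE x in M. \<exists>K. \<forall>q\<in>grid_times T. X q x \<le> K"
proof -
 define E where "E i n = {x \<in> space M. upcrossings (grid_times T) (\<lambda>t. X t x) (real (Suc i)) (real (Suc i) + real (Suc n)) 1 0}" for i n
 have "AE x in M. \<exists>n. x \<notin> E i n" for i
 proof (rule AE_avoids_small_sets)
  show "(\<lambda>n. (real (Suc i) / (real (Suc i) + real (Suc n))) ^ 1) \<longlonglongrightarrow> 0"
   unfolding power_one_right by (rule real_tendsto_divide_at_top[OF tendsto_const])
    (intro filterlim_tendsto_add_at_top[OF tendsto_const] filterlim_compose[OF filterlim_real_sequentially filterlim_Suc])
  show "E i n \<in> sets M" "emeasure M (E i n) \<le> ennreal ((real (Suc i) / (real (Suc i) + real (Suc n))) ^ 1)" for n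
   unfolding E_def by (rule upcrossings_grid_times[OF X]; simp)+
 qed
 then have "AE x in M. \<forall>i. \<exists>n. x \<notin> E i n" unfolding AE_all_countable by blast
 with AE_space show ?thesis
 proof eventually_elim
  case (elim x)
  obtain i where i: "X 0 x < real (Suc i)"
   using reals_Archimedean2[of "X 0 x"] by (meson less_trans lessI of_nat_less_iff)
  obtain n where n: "x \<notin> E i n" using elim(2) by blast
  have "X q x \<le> real (Suc i) + real (Suc n)" if q: "q \<in> grid_times T" for q
  proof (rule ccontr)
   assume "\<not> ?thesis"
   then have "upcrossings (grid_times T) (\<lambda>t. X t x) (real (Suc i)) (real (Suc i) + real (Suc n)) 1 0"
    unfolding One_nat_def upcrossings.simps using i q
    by (intro bexI[of _ 0] bexI[of _ q] conjI) (simp_all only: not_le zero_le zero_in_grid_times)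
   then show False using n elim(1) by (simp add: E_def)
  qed
  then show ?case by blast
 qed
qed

lemma AE_regular_path: assumes X: "supermart (grid_times T) X" shows "AE x in M. regular_path T (\<lambda>t. X t x)"
proof -
 have "AE x in M. \<forall>a b :: rat. 0 < a \<longrightarrow> a < b \<longrightarrow>
  (\<exists>k. \<not> upcrossings (grid_times T) (\<lambda>t. X t x) (of_rat a) (of_rat b) k 0)"
  unfolding AE_all_countable using AE_finitely_many_upcrossings[OF X] by (auto simp: of_rat_less)
 with AE_bounded_on_grid[OF X] AE_space show ?thesis
 proof eventually_elim
  case (elim x)
  then obtain K where "\<forall>q\<in>grid_times T. X q x \<le> K" by auto
  with elim supermartD(3)[OF X] show ?case by (intro regular_pathI[where K = K]) auto
 qed
qed

end

section \<open>Regularisation and optional sampling\<close>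

lemma (in complete_measure) measurable_AE_transfer:
 fixes X Y :: "'a => 'b::topological_space"
 assumes G: "space G = space M" "\<And>A N. N \<in> null_sets M ==> A \<subseteq> N ==> A \<in> sets G"
  and X: "X \<in> borel_measurable G" and eq: "AE x in M. X x = Y x" shows "Y \<in> borel_measurable G"
proof (rule measurableI)
 obtain N where N: "{x \<in> space M. X x \<noteq> Y x} \<subseteq> N" "N \<in> null_sets M"
  using eq by (auto elim!: AE_E)
 fix B :: "'b set" assume "B \<in> sets borel"
 then have "X -` B \<inter> space G \<in> sets G" using X by (rule measurable_sets[rotated])
 moreover have "Y -` B \<inter> space G = (X -` B \<inter> space G - (N \<inter> space M)) \<union> (Y -` B \<inter> (N \<inter> space M))"
  using N(1) by (auto simp: G)
 moreover have "N \<inter> space M \<in> sets G" "Y -` B \<inter> (N \<inter> space M) \<in> sets G"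
  using N(2) by (auto intro!: G(2)[of N])
 ultimately show "Y -` B \<inter> space G \<in> sets G" by simp
qed simp

text \<open>Tested on the event \<open>g < f\<close>; finiteness of the integral of \<open>f\<close>
  permits the subtraction.\<close>

lemma AE_le_of_set_integrals:
 fixes f g :: "'a => ennreal"
 assumes sub: "subalgebra M G" and m: "f \<in> borel_measurable G" "g \<in> borel_measurable G"
  and fin: "(\<integral>\<^sup>+ x. f x \<partial>M) < \<infinity>"
  and le: "\<And>A. A \<in> sets G ==> (\<integral>\<^sup>+ x\<in>A. f x \<partial>M) \<le> (\<integral>\<^sup>+ x\<in>A. g x \<partial>M)"
 shows "AE x in M. f x \<le> g x"
proof -
 define A where "A = {x \<in> space G. g x < f x}"
 have AG: "A \<in> sets G" unfolding A_def using m by measurable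
 then have [measurable]: "A \<in> sets M" using sub by (auto simp: subalgebra_def)
 have [measurable]: "f \<in> borel_measurable M" "g \<in> borel_measurable M"
  using measurable_from_subalg[OF sub] m by auto
 have le_f: "(\<integral>\<^sup>+ x\<in>A. g x \<partial>M) \<le> (\<integral>\<^sup>+ x\<in>A. f x \<partial>M)"
  by (intro nn_integral_mono) (auto simp: A_def indicator_def)
 have "(\<integral>\<^sup>+ x\<in>A. f x \<partial>M) \<le> (\<integral>\<^sup>+ x. f x \<partial>M)"
  by (intro nn_integral_mono) (auto simp: indicator_def)
 then have fin_f: "(\<integral>\<^sup>+ x\<in>A. f x \<partial>M) \<noteq> \<infinity>" using fin by (auto simp: top_unique)
 then have fin_g: "(\<integral>\<^sup>+ x\<in>A. g x \<partial>M) \<noteq> \<infinity>" using le_f by (auto simp: top_unique)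
 have "(\<integral>\<^sup>+ x. f x * indicator A x - g x * indicator A x \<partial>M) =
  (\<integral>\<^sup>+ x\<in>A. f x \<partial>M) - (\<integral>\<^sup>+ x\<in>A. g x \<partial>M)"
 proof (rule nn_integral_diff)
  show "AE x in M. g x * indicator A x \<le> f x * indicator A x" by (intro AE_I2) (auto simp: A_def indicator_def)
 qed (use fin_g in simp_all)
 also have "\<dots> = 0" using fin_f by (intro diff_eq_0_ennreal le[OF AG]) (simp add: top.not_eq_extremum)
 finally have "AE x in M. f x * indicator A x - g x * indicator A x = 0" by (subst (asm) nn_integral_0_iff_AE) auto
 with AE_space show ?thesis
 proof eventually_elim
  case (elim x)
  show ?case
  proof (rule ccontr)
   assume "\<not> f x \<le> g x"
   then have "x \<in> A" "g x < f x" using elim sub by (auto simp: A_def subalgebra_def)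
   then show False using elim(2) by (simp add: diff_gr0_ennreal[THEN less_imp_neq, symmetric])
  qed
 qed
qed

lemma cadlag_right_continuous: "cadlag_path T f ==> right_continuous_path T f" by (simp add: cadlag_path_def)

context filtered_prob_space
begin

lemma null_in_M: "N \<in> null_sets M ==> A \<subseteq> N ==> A \<in> sets M" using complete2 by blast

lemma M_measurable_AE:
 fixes X Y :: "'a => 'b::topological_space"
 shows "X \<in> borel_measurable M ==> AE x in M. X x = Y x ==> Y \<in> borel_measurable M"
 using null_in_M by (intro measurable_AE_transfer[of M X Y]) auto

lemma AE_le_of_F_integrals:
 fixes X Y :: "'a => real" assumes "X \<in> borel_measurable (F t)" "Y \<in> borel_measurable (F t)" "integrable M X"
  and "\<And>x. x \<in> space M ==> 0 \<le> Y x" and "\<And>A. A \<in> sets (F t) ==> ei A X \<le> ei A Y"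
 shows "AE x in M. X x \<le> Y x"
proof -
 have "AE x in M. ennreal (X x) \<le> ennreal (Y x)"
 proof (rule AE_le_of_set_integrals[OF sub_F[of t] _ _ _ assms(5)])
  show "(\<integral>\<^sup>+ x. ennreal (X x) \<partial>M) < \<infinity>"
   using assms(3) by (auto simp: real_integrable_def top.not_eq_extremum)
 qed (use assms(1,2) in auto)
 with AE_space show ?thesis by eventually_elim (simp add: ennreal_le_iff[OF assms(4)])
qed

text \<open>Covers both a right-continuous \<open>X\<close> with \<open>Y = X\<close> and a general
  supermartingale with its regularisation, so that sampling has to be proved only once.\<close>

definition right_closure :: "'a process => 'a process => bool" where
 "right_closure X Y \<longleftrightarrow> (AE x in M. \<forall>t\<le>T. (\<lambda>m. X (round_up T m t) x) \<longlonglongrightarrow> Y t x)"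

lemma right_closure_self:
 "(\<And>x. x \<in> space M ==> right_continuous_path T (\<lambda>t. X t x)) ==> right_closure X X"
 unfolding right_closure_def by (intro AE_I2) (auto intro: right_continuous_round_up)

lemma supermart_round_up_measurable: assumes X: "supermart (grid_times T) X" and S: "stopping S"
 shows "(\<lambda>x. X (round_up T m (S x)) x) \<in> borel_measurable M"
 by (rule pre_sigma_measurable_M[OF stopping_round_up[OF S]
    finite_stopped_measurable[OF stopping_round_up[OF S] finite_grid round_up_in_grid]])
  (intro supermartD(1)[OF X] subsetD[OF grid_subset_times])

lemma right_closure_measurable: assumes X: "supermart (grid_times T) X" and XY: "right_closure X Y" and S: "stopping S"
 shows "(\<lambda>x. Y (S x) x) \<in> borel_measurable M"
proof (rule M_measurable_AE)
 note [measurable] = supermart_round_up_measurable[OF X S]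
 show "(\<lambda>x. lim (\<lambda>m. X (round_up T m (S x)) x)) \<in> borel_measurable M" by measurable
 show "AE x in M. lim (\<lambda>m. X (round_up T m (S x)) x) = Y (S x) x" using XY[unfolded right_closure_def] AE_space
  by eventually_elim (auto intro!: limI stoppingD(2)[OF S])
qed

text \<open>Fatou's lemma points the wrong way here. Truncating at \<open>K\<close> preserves the
  supermartingale property and lets dominated convergence pass from the rounded times to
  \<open>S\<close>; afterwards \<open>K\<close> is released.\<close>

lemma grid_le_right_closure: assumes X: "supermart (grid_times T) X" and XY: "right_closure X Y"
  and S: "stopping S" and \<tau>: "stopping \<tau>" "\<And>x. x \<in> space M ==> \<tau> x \<in> grid T k"
  and le: "\<And>x. x \<in> space M ==> S x < \<tau> x \<or> \<tau> x = T" and A: "A \<in> sets (pre_sigma S)"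
 shows "ev A \<tau> X \<le> ev A S Y"
proof (rule nn_integral_truncate_le)
 show "(\<lambda>x. X (\<tau> x) x) \<in> borel_measurable M"
  by (rule pre_sigma_measurable_M[OF \<tau>(1) finite_stopped_measurable[OF \<tau>(1) finite_grid \<tau>(2)]])
   (auto intro: supermartD(1)[OF X] subsetD[OF grid_subset_times])
 show AM [measurable]: "A \<in> sets M" by (rule pre_sigma_le_M[OF S A])
 fix K :: nat
 define X' where "X' t x = min (X t x) (real K)" for t x
 have X': "supermart (grid_times T) X'" unfolding X'_def by (intro supermart_min X supermart_const) simp
 note [measurable] = supermart_round_up_measurable[OF X S] right_closure_measurable[OF X XY S]
 have lim: "(\<lambda>m. \<integral>\<^sup>+ x\<in>A. ennreal (X' (round_up T m (S x)) x) \<partial>M) \<longlonglongrightarrow>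
   ei A (\<lambda>x. min (Y (S x) x) (real K))" unfolding X'_def
 proof (rule nn_integral_dominated_convergence[where w = "\<lambda>_. ennreal K"])
  show "AE x in M. (\<lambda>m. ennreal (min (X (round_up T m (S x)) x) (real K)) * indicator A x) \<longlonglongrightarrow>
    ennreal (min (Y (S x) x) (real K)) * indicator A x" using XY[unfolded right_closure_def] AE_space
  proof eventually_elim
   case (elim x)
   then have "(\<lambda>m. X (round_up T m (S x)) x) \<longlonglongrightarrow> Y (S x) x"
    using stoppingD(2)[OF S] by auto
   then show ?case by (cases "x \<in> A") (auto intro!: tendsto_ennrealI tendsto_min)
  qed
  show "(\<integral>\<^sup>+ x. ennreal K \<partial>M) < \<infinity>"
   using emeasure_space_1 by (simp add: ennreal_of_nat_eq_real_of_nat[symmetric] of_nat_less_top)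
 qed (auto simp: indicator_def intro!: AE_I2 ennreal_leI)
 have "ev A \<tau> X' \<le> ei A (\<lambda>x. X' (round_up T m (S x)) x)" if "k \<le> m" for m
 proof (rule supermart_finite_sampling[OF X' stopping_round_up[OF S] \<tau>(1) _ finite_grid[of T m] grid_subset_times round_up_in_grid])
  show "\<tau> x \<in> grid T m" if "x \<in> space M" for x
   using \<tau>(2)[OF that] grid_mono[OF \<open>k \<le> m\<close>] by auto
  then show "round_up T m (S x) \<le> \<tau> x" if "x \<in> space M" for x
   using le[OF that] round_up_le[of "\<tau> x" T m "S x"] round_up_le_end[of T m "S x"] that by auto
  show "A \<in> sets (pre_sigma (\<lambda>x. round_up T m (S x)))" using round_up_ge stoppingD(2)[OF S]
   by (intro pre_sigma_mono[OF S stopping_round_up[OF S] _ A]) auto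
 qed
 then have "ev A \<tau> X' \<le> ei A (\<lambda>x. min (Y (S x) x) (real K))" by (intro LIMSEQ_le_const[OF lim]) auto
 also have "\<dots> \<le> ev A S Y" by (intro nn_integral_mono mult_right_mono ennreal_leI) auto
 finally show "ei A (\<lambda>x. min (X (\<tau> x) x) (real K)) \<le> ev A S Y" by (simp add: X'_def)
qed

text \<open>The rounded \<tau> lies strictly after \<open>S\<close> unless it is \<open>T\<close>,
  so \<open>grid_le_right_closure\<close> applies to it; Fatou's lemma then removes the rounding of
  \<tau>.\<close>

theorem optional_sampling: assumes X: "supermart (grid_times T) X" and XY: "right_closure X Y"
  and S: "stopping S" and \<tau>: "stopping \<tau>"
  and le: "\<And>x. x \<in> space M ==> S x \<le> \<tau> x" and A: "A \<in> sets (pre_sigma S)"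
 shows "ev A \<tau> Y \<le> ev A S Y"
proof (rule nn_integral_le_of_tendsto)
 have [measurable]: "A \<in> sets M" by (rule pre_sigma_le_M[OF S A])
 note [measurable] = supermart_round_up_measurable[OF X \<tau>]
 show "(\<lambda>x. ennreal (X (round_up T m (\<tau> x)) x) * indicator A x) \<in> borel_measurable M" for m
  by measurable
 show "AE x in M. (\<lambda>m. ennreal (X (round_up T m (\<tau> x)) x) * indicator A x) \<longlonglongrightarrow> ennreal (Y (\<tau> x) x) * indicator A x"
  using XY[unfolded right_closure_def] AE_space
 proof eventually_elim
  case (elim x)
  then have "(\<lambda>m. X (round_up T m (\<tau> x)) x) \<longlonglongrightarrow> Y (\<tau> x) x"
   using stoppingD(2)[OF \<tau>] by auto
  then show ?case by (cases "x \<in> A") (auto intro!: tendsto_ennrealI)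
 qed
 have "ei A (\<lambda>x. X (round_up T m (\<tau> x)) x) \<le> ev A S Y" for m
 proof (rule grid_le_right_closure[OF X XY S stopping_round_up[OF \<tau>] round_up_in_grid _ A])
  fix x assume "x \<in> space M"
  then show "S x < round_up T m (\<tau> x) \<or> round_up T m (\<tau> x) = T"
   using le[of x] stoppingD(2)[OF \<tau>, of x] round_up_greater[of "\<tau> x" T m]
   by (cases "\<tau> x = T") (auto intro: le_less_trans)
 qed
 then show "\<forall>\<^sub>F m in sequentially. ei A (\<lambda>x. X (round_up T m (\<tau> x)) x) \<le> ev A S Y"
  by simp
qed

lemma right_closure_le: assumes X: "supermart (grid_times T) X" and XY: "right_closure X Y"
  and S: "stopping S" and A: "A \<in> sets M" and le: "\<And>m. ei A (\<lambda>x. X (round_up T m (S x)) x) \<le> c"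
 shows "ev A S Y \<le> c"
proof (rule nn_integral_le_of_tendsto)
 note [measurable] = supermart_round_up_measurable[OF X S] A
 show "(\<lambda>x. ennreal (X (round_up T m (S x)) x) * indicator A x) \<in> borel_measurable M" for m by measurable
 show "AE x in M. (\<lambda>m. ennreal (X (round_up T m (S x)) x) * indicator A x) \<longlonglongrightarrow> ennreal (Y (S x) x) * indicator A x"
  using XY[unfolded right_closure_def] AE_space
 proof eventually_elim
  case (elim x)
  then have "(\<lambda>m. X (round_up T m (S x)) x) \<longlonglongrightarrow> Y (S x) x"
   using stoppingD(2)[OF S] by auto
  then show ?case by (cases "x \<in> A") (auto intro!: tendsto_ennrealI)
 qed
qed (simp add: le)

text \<open>The value 0 on irregular paths, a null event for supermartingales, makes every path
  cadlag without exception.\<close>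

definition regularised :: "'a process => 'a process" where
 "regularised X t x =
  (if regular_path T (\<lambda>q. X q x) then right_limit_path T (\<lambda>q. X q x) t else 0)"

lemma cadlag_regularised: "cadlag_path T (\<lambda>t. regularised X t x)"
proof (cases "regular_path T (\<lambda>q. X q x)")
 case True
 then show ?thesis using cadlag_right_limit_path[OF True] by (simp add: regularised_def)
qed (auto simp: regularised_def cadlag_path_def right_continuous_path_def)

lemma right_continuous_regularised: "right_continuous_path T (\<lambda>t. regularised X t x)"
 by (rule cadlag_right_continuous[OF cadlag_regularised])

lemma right_closure_regularised: assumes X: "supermart (grid_times T) X" shows "right_closure X (regularised X)"
 unfolding right_closure_def using AE_regular_path[OF X]
proof eventually_elim
 case (elim x)
 show ?case
 proof (intro allI impI)
  fix t assume "t \<le> T"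
  show "(\<lambda>m. X (round_up T m t) x) \<longlonglongrightarrow> regularised X t x"
  proof (cases "t = T")
   case True
   then show ?thesis using elim by (simp add: regularised_def right_limit_path_def)
  next
   case False
   then have "t < T" using \<open>t \<le> T\<close> by auto
   from filterlim_compose[OF right_limit_path[OF elim this] round_up_filterlim[OF this]]
   show ?thesis using elim by (simp add: regularised_def)
  qed
 qed
qed

text \<open>For each \<open>s > t\<close> the rounded times eventually stay below \<open>s\<close>,
  so the limit is \<open>F s\<close>-measurable; right-continuity of the filtration does the
  rest.\<close>

lemma right_closure_adapted: assumes X: "supermart (grid_times T) X" and XY: "right_closure X Y" and t: "t \<le> T"
 shows "Y t \<in> borel_measurable (F t)"
proof -
 have *: "Y t \<in> borel_measurable (F s)" if s: "t < s \<or> t = T \<and> s = T" "s \<le> T" for s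
 proof -
  have "eventually (\<lambda>m. round_up T m t \<le> s) sequentially"
  proof (cases "t = T")
   case False
   then have "t < s" using s by auto
   from eventually_round_up_less[OF this s(2)] show ?thesis by eventually_elim auto
  qed (use s t in auto)
  then obtain m0 where m0: "\<And>m. m0 \<le> m ==> round_up T m t \<le> s" by (auto simp: eventually_sequentially)
  have "X (round_up T (m + m0) t) \<in> borel_measurable (F s)" for m
   by (rule F_measurable_mono[OF supermartD(1)[OF X round_up_in_times] m0]) simp
  then have m: "(\<lambda>x. lim (\<lambda>m. X (round_up T (m + m0) t) x)) \<in> borel_measurable (F s)"
   by (rule borel_measurable_lim_metric)
  have "AE x in M. lim (\<lambda>m. X (round_up T (m + m0) t) x) = Y t x" using XY[unfolded right_closure_def]
  proof eventually_elim
   case (elim x)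
   then have "(\<lambda>m. X (round_up T m t) x) \<longlonglongrightarrow> Y t x" using t by auto
   from LIMSEQ_ignore_initial_segment[OF this, of m0] show ?case by (rule limI)
  qed
  with m show ?thesis by (rule F_measurable_AE)
 qed
 show ?thesis
 proof (cases "t = T")
  case False
  then have "t < T" using t by auto
  then show ?thesis by (rule F_right_continuous_measurable) (rule *, simp)
 qed (use *[of T] in simp)
qed

lemma right_closure_supermart: assumes X: "supermart (grid_times T) X" and XY: "right_closure X Y"
  and nonneg: "\<And>t x. t \<le> T ==> x \<in> space M ==> 0 \<le> Y t x" shows "supermart {..T} Y"
 unfolding supermart_def
proof (intro conjI ballI impI)
 fix t assume t: "t \<in> {..T}"
 show Yt: "Y t \<in> borel_measurable (F t)" using right_closure_adapted[OF X XY] t by auto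
 show "0 \<le> Y t x" if "x \<in> space M" for x using nonneg t that by auto
 show "integrable M (Y t)"
 proof (rule integrableI_nonneg)
  show "Y t \<in> borel_measurable M" by (rule F_measurable_M[OF Yt])
  show "AE x in M. 0 \<le> Y t x" using nonneg t by (intro AE_I2) auto
  have "(\<integral>\<^sup>+ x. ennreal (Y t x) \<partial>M) = ei (space M) (Y t)" by (intro nn_integral_cong) auto
  also have "\<dots> \<le> ei (space M) (X 0)"
  proof (rule right_closure_le[OF X XY stopping_const[of t]])
   fix m show "ei (space M) (X (round_up T m t)) \<le> ei (space M) (X 0)"
    by (rule supermart_le[OF X zero_in_grid_times round_up_in_times]) (auto simp flip: space_F[of 0])
  qed (use t in auto)
  also have "\<dots> = (\<integral>\<^sup>+ x. ennreal (X 0 x) \<partial>M)" by (intro nn_integral_cong) auto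
  also have "\<dots> < \<infinity>"
   using supermartD(4)[OF X zero_in_grid_times] by (auto simp: real_integrable_def top.not_eq_extremum)
  finally show "(\<integral>\<^sup>+ x. ennreal (Y t x) \<partial>M) < \<infinity>" .
 qed
next
 fix s t A assume st: "s \<in> {..T}" "t \<in> {..T}" "s \<le> t" and A: "A \<in> sets (F s)"
 then show "ei A (Y t) \<le> ei A (Y s)" using pre_sigma_const[OF _ A]
  by (intro optional_sampling[OF X XY stopping_const stopping_const]) auto
qed

lemma regularised_nonneg: assumes X: "supermart (grid_times T) X" and "t \<le> T" "x \<in> space M"
 shows "0 \<le> regularised X t x"
proof (cases "regular_path T (\<lambda>q. X q x)")
 case reg: True
 show ?thesis
 proof (cases "t = T")
  case True
  then show ?thesis using supermartD(3)[OF X end_in_grid_times] reg assms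
   by (simp add: regularised_def right_limit_path_def)
 next
  case False
  then have "t < T" using assms by auto
  from filterlim_compose[OF right_limit_path[OF reg this] round_up_filterlim[OF this]]
  have "(\<lambda>m. X (round_up T m t) x) \<longlonglongrightarrow> regularised X t x"
   using reg by (simp add: regularised_def)
  then show ?thesis
   using supermartD(3)[OF X round_up_in_times \<open>x \<in> space M\<close>] by (intro LIMSEQ_le_const) auto
 qed
qed (auto simp: regularised_def)

lemma supermart_regularised: assumes X: "supermart (grid_times T) X" shows "supermart {..T} (regularised X)"
 by (rule right_closure_supermart[OF X right_closure_regularised[OF X] regularised_nonneg[OF X]])

text \<open>The mean of \<open>X\<close> may drop immediately after \<open>q\<close>, so only an
  inequality survives the right limit.\<close>

lemma regularised_le: assumes X: "supermart (grid_times T) X" and q: "q \<in> grid_times T"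
 shows "AE x in M. regularised X q x \<le> X q x"
proof (rule AE_le_of_F_integrals[where t = q])
 have "q \<in> {..T}" using grid_times_le[OF q] by auto
 note R = supermartD[OF supermart_regularised[OF X] this]
 show "regularised X q \<in> borel_measurable (F q)" "integrable M (regularised X q)" by (rule R)+
 show "X q \<in> borel_measurable (F q)" "\<And>x. x \<in> space M ==> 0 \<le> X q x" using supermartD[OF X q] by auto
 fix A assume A: "A \<in> sets (F q)"
 show "ei A (regularised X q) \<le> ei A (X q)" using grid_times_le[OF q] round_up_ge[of q T]
  by (intro right_closure_le[OF X right_closure_regularised[OF X] stopping_const]
    supermart_le[OF X q round_up_in_times] A F_le_M[OF A]) auto
qed

text \<open>Supplies left limits to a right-continuous supermartingale up to indistinguishability;
  in this way prices become optional later on.\<close>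

lemma AE_regularised_eq: assumes X: "supermart (grid_times T) X"
  and rc: "\<And>x. x \<in> space M ==> right_continuous_path T (\<lambda>t. X t x)"
 shows "AE x in M. \<forall>t\<le>T. regularised X t x = X t x"
proof -
 have "right_closure X X" by (rule right_closure_self) (rule rc)
 then show ?thesis using right_closure_regularised[OF X] unfolding right_closure_def
  by eventually_elim (meson LIMSEQ_unique)
qed

text \<open>Conversion by \<open>ennreal\<close> replaces \<open>Z\<close> by its positive part, so
  every version is nonnegative.\<close>

definition closed_martingale :: "('a => real) => 'a process" where
 "closed_martingale Z t x = enn2real (nn_cond_exp M (F t) (\<lambda>x. ennreal (Z x)) x)"

lemma closed_martingale_set_integral: assumes Z: "integrable M Z" and A: "A \<in> sets (F t)"
 shows "ei A (closed_martingale Z t) = ei A Z"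
proof -
 interpret sigma_finite_subalgebra M "F t" by (rule sigma_finite_sub_F)
 have [measurable]: "(\<lambda>x. ennreal (Z x)) \<in> borel_measurable M" using Z by measurable
 have "(\<integral>\<^sup>+ x. nn_cond_exp M (F t) (\<lambda>x. ennreal (Z x)) x \<partial>M) = (\<integral>\<^sup>+ x. ennreal (Z x) \<partial>M)"
  using nn_cond_exp_intg[of "\<lambda>_. 1" "\<lambda>x. ennreal (Z x)"] by simp
 also have "\<dots> \<noteq> \<infinity>" using Z by (auto simp: real_integrable_def)
 finally have "AE x in M. nn_cond_exp M (F t) (\<lambda>x. ennreal (Z x)) x \<noteq> \<infinity>"
  by (intro nn_integral_PInf_AE) auto
 then have "ei A (closed_martingale Z t) =
   (\<integral>\<^sup>+ x. indicator A x * nn_cond_exp M (F t) (\<lambda>x. ennreal (Z x)) x \<partial>M)"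
  by (intro nn_integral_cong_AE) (auto simp: closed_martingale_def top.not_eq_extremum mult.commute)
 also have "\<dots> = (\<integral>\<^sup>+ x. indicator A x * ennreal (Z x) \<partial>M)"
  using A by (intro nn_cond_exp_intg) auto
 finally show ?thesis by (simp add: mult.commute)
qed

lemma closed_martingale_measurable: "closed_martingale Z t \<in> borel_measurable (F t)"
 unfolding closed_martingale_def by measurable

lemma supermart_closed_martingale: assumes Z: "integrable M Z" shows "supermart D (closed_martingale Z)"
 unfolding supermart_def
proof (intro conjI ballI impI)
 fix t
 show m: "closed_martingale Z t \<in> borel_measurable (F t)" by (rule closed_martingale_measurable)
 show "0 \<le> closed_martingale Z t x" for x by (simp add: closed_martingale_def)
 have "(\<integral>\<^sup>+ x. ennreal (closed_martingale Z t x) \<partial>M) = (\<integral>\<^sup>+ x. ennreal (Z x) \<partial>M)"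
  using closed_martingale_set_integral[OF Z sets.top[of "F t"]] by (simp add: space_F cong: nn_integral_cong)
 also have "\<dots> < \<infinity>" using Z by (auto simp: real_integrable_def top.not_eq_extremum)
 finally show "integrable M (closed_martingale Z t)"
  using F_measurable_M[OF m] by (intro integrableI_nonneg) (auto simp: closed_martingale_def)
next
 fix s t A assume "s \<le> t" "A \<in> sets (F s)"
 then show "ei A (closed_martingale Z t) \<le> ei A (closed_martingale Z s)"
  using F_mono[of A s t] by (simp add: closed_martingale_set_integral[OF Z])
qed

lemma closed_martingale_finite_sampling:
 assumes Z: "integrable M Z" and S: "stopping S" "\<And>x. x \<in> space M ==> S x \<in> grid T m"
  and A: "A \<in> sets (pre_sigma S)" shows "ev A S (closed_martingale Z) = ei A Z"
proof -
 have A_sub: "A \<subseteq> space M" using sets.sets_into_space[OF A] by (simp add: space_pre_sigma)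
 have [measurable]: "(\<lambda>x. closed_martingale Z (S x) x) \<in> borel_measurable M"
  by (rule pre_sigma_measurable_M[OF S(1) finite_stopped_measurable[OF S(1) finite_grid S(2) closed_martingale_measurable]])
 have [measurable]: "Z \<in> borel_measurable M" using Z by measurable
 have eq: "{x \<in> A. S x = s} \<in> sets (F s)" for s by (rule pre_sigma_eq_sets[OF S(1) A])
 have "ev A S (closed_martingale Z) =
   (\<Sum>s\<in>grid T m. \<integral>\<^sup>+ x\<in>{x \<in> A. S x = s}. ennreal (closed_martingale Z (S x) x) \<partial>M)"
  using S(2) A_sub by (intro nn_integral_split_values F_le_M[OF eq]) auto
 also have "\<dots> = (\<Sum>s\<in>grid T m. \<integral>\<^sup>+ x\<in>{x \<in> A. S x = s}. ennreal (closed_martingale Z s x) \<partial>M)"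
  by (intro sum.cong nn_integral_cong) (auto simp: indicator_def)
 also have "\<dots> = (\<Sum>s\<in>grid T m. \<integral>\<^sup>+ x\<in>{x \<in> A. S x = s}. ennreal (Z x) \<partial>M)"
  by (intro sum.cong closed_martingale_set_integral[OF Z] eq) auto
 also have "\<dots> = ei A Z" using S(2) A_sub by (intro nn_integral_split_values[symmetric] F_le_M[OF eq]) auto
 finally show ?thesis .
qed

text \<open>One inequality is Fatou's. For the other, rounding up on the coarsest grid already
  reproduces the integral of \<open>Z\<close>, and \<open>grid_le_right_closure\<close> bounds it by
  the value at \<open>S\<close>.\<close>

theorem regularised_martingale_sampling:
 assumes Z: "integrable M Z" and S: "stopping S" and A: "A \<in> sets (pre_sigma S)"
 shows "ei A (\<lambda>x. regularised (closed_martingale Z) (S x) x) = ei A Z"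
proof (rule antisym)
 note X = supermart_closed_martingale[OF Z, of "grid_times T"]
 note Sm = stopping_round_up[OF S]
 have A': "A \<in> sets (pre_sigma (\<lambda>x. round_up T m (S x)))" for m
  using round_up_ge stoppingD(2)[OF S] by (intro pre_sigma_mono[OF S Sm _ A]) auto
 note eq = closed_martingale_finite_sampling[OF Z Sm round_up_in_grid A']
 show "ei A (\<lambda>x. regularised (closed_martingale Z) (S x) x) \<le> ei A Z"
  by (intro right_closure_le[OF X right_closure_regularised[OF X] S pre_sigma_le_M[OF S A]]) (simp add: eq)
 have "ei A (\<lambda>x. closed_martingale Z (round_up T 0 (S x)) x) \<le>
   ei A (\<lambda>x. regularised (closed_martingale Z) (S x) x)"
 proof (rule grid_le_right_closure[OF X right_closure_regularised[OF X] S Sm round_up_in_grid _ A])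
  fix x assume "x \<in> space M"
  then show "S x < round_up T 0 (S x) \<or> round_up T 0 (S x) = T"
   using stoppingD(2)[OF S, of x] round_up_greater[of "S x" T 0] by (cases "S x = T") auto
 qed
 then show "ei A Z \<le> ei A (\<lambda>x. regularised (closed_martingale Z) (S x) x)" by (simp add: eq)
qed

end

section \<open>Snell envelopes and optimal stopping\<close>

context filtered_prob_space
begin

text \<open>Strict positivity of a right-continuous path persists for a moment, so grid times decide
  whether the entry occurs before \<open>t\<close>; the price is that at the entry time itself only
  \<open>0 \<le> Z\<close> is known.\<close>

definition hitting :: "('a => ennreal) => 'a process => 'a => ennreal" where
 "hitting \<rho> Z x = Inf (insert T {s. \<rho> x \<le> s \<and> s \<le> T \<and> 0 < Z s x})"

lemma hitting_le: "hitting \<rho> Z x \<le> T" unfolding hitting_def by (rule Inf_lower) simp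

lemma hitting_ge: "\<rho> x \<le> T ==> \<rho> x \<le> hitting \<rho> Z x"
 unfolding hitting_def by (rule Inf_greatest) auto

lemma hitting_le_hit: "\<rho> x \<le> s ==> s \<le> T ==> 0 < Z s x ==> hitting \<rho> Z x \<le> s"
 unfolding hitting_def by (rule Inf_lower) simp

lemma before_hitting: "\<rho> x \<le> s ==> s < hitting \<rho> Z x ==> Z s x \<le> 0"
 using hitting_le_hit[of \<rho> x s Z] hitting_le[of \<rho> Z x] by (meson less_imp_le less_le_trans not_le)

lemma hitting_mono: assumes "\<rho> x \<le> \<rho>' x" "\<And>s. Z' s x \<le> Z s x \<or> Z' s x \<le> 0"
 shows "hitting \<rho> Z x \<le> hitting \<rho>' Z' x" unfolding hitting_def
proof (rule Inf_superset_mono, safe)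
 fix s assume s: "\<rho>' x \<le> s" "s \<le> T" "0 < Z' s x"
 then show "\<rho> x \<le> s" "0 < Z s x" using assms(1) assms(2)[of s] by auto
qed

lemma hitting_less_iff: assumes rc: "right_continuous_path T (\<lambda>t. Z t x)" and t: "t \<le> T"
 shows "hitting \<rho> Z x < t \<longleftrightarrow> (\<exists>q\<in>grid_times T. q < t \<and> \<rho> x \<le> q \<and> 0 < Z q x)"
proof
 assume "hitting \<rho> Z x < t"
 then have "\<exists>s\<in>insert T {s. \<rho> x \<le> s \<and> s \<le> T \<and> 0 < Z s x}. s < t"
  unfolding hitting_def Inf_less_iff .
 then obtain s where s: "\<rho> x \<le> s" "s < t" "0 < Z s x" using t by auto
 then have sT: "s < T" using t by auto
 have "((\<lambda>t. Z t x) \<longlongrightarrow> Z s x) (right_grid T s)" by (rule right_continuous_right_grid[OF rc sT])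
 then have "eventually (\<lambda>q. 0 < Z q x) (right_grid T s)" using s(3) by (rule order_tendstoD)
 then obtain v where v: "s < v" "v \<le> T" "\<And>q. q \<in> grid_times T ==> s < q ==> q < v ==> 0 < Z q x"
  by (auto simp: eventually_right_grid[OF sT])
 have "s < min v t" "min v t \<le> T" using v s by (auto intro: min.coboundedI1)
 from grid_dense[OF this] obtain q where "q \<in> grid_times T" "s < q" "q < v" "q < t" by auto
 then show "\<exists>q\<in>grid_times T. q < t \<and> \<rho> x \<le> q \<and> 0 < Z q x"
  using v(3) s(1) by (intro bexI[of _ q]) auto
next
 assume "\<exists>q\<in>grid_times T. q < t \<and> \<rho> x \<le> q \<and> 0 < Z q x"
 then obtain q where q: "q < t" "\<rho> x \<le> q" "0 < Z q x" by auto
 have "hitting \<rho> Z x \<le> q" using q t by (intro hitting_le_hit) auto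
 then show "hitting \<rho> Z x < t" using q(1) by (rule le_less_trans)
qed

lemma hitting_value:
 assumes rc: "right_continuous_path T (\<lambda>t. Z t x)" and less: "hitting \<rho> Z x < T" and "\<rho> x \<le> T"
 shows "0 \<le> Z (hitting \<rho> Z x) x"
proof (rule ccontr)
 let ?h = "hitting \<rho> Z x"
 assume "\<not> 0 \<le> Z ?h x"
 then have neg: "Z ?h x < 0" by simp
 have "((\<lambda>t. Z t x) \<longlongrightarrow> Z ?h x) (at_right ?h)"
  using rc less by (auto simp: right_continuous_path_def continuous_within)
 then have "eventually (\<lambda>t. Z t x < 0) (at_right ?h)" using neg by (rule order_tendstoD)
 then obtain v where v: "?h < v" "\<And>s. ?h < s ==> s < v ==> Z s x < 0" by (auto simp: eventually_at_right[OF less])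
 then have "?h < min v T" using less by auto
 then obtain s where s: "s < min v T" "\<rho> x \<le> s" "0 < Z s x" unfolding hitting_def Inf_less_iff by auto
 then have "?h \<le> s" by (intro hitting_le_hit) auto
 then have "?h < s" using s(3) neg by (cases "?h = s") auto
 then show False using s v(2)[of s] by auto
qed

lemma stopping_hitting: assumes \<rho>: "stopping \<rho>" and Z: "adapted F T Z"
  and rc: "\<And>x. x \<in> space M ==> right_continuous_path T (\<lambda>t. Z t x)" shows "stopping (hitting \<rho> Z)"
proof (rule stoppingI_less[OF hitting_le])
 fix t assume t: "t \<le> T"
 have "{x \<in> space M. hitting \<rho> Z x < t} =
  (\<Union>q\<in>{q\<in>grid_times T. q < t}. {x \<in> space M. \<rho> x \<le> q} \<inter> {x \<in> space M. 0 < Z q x})"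
  using hitting_less_iff[OF rc t] by auto
 also have "\<dots> \<in> sets (F t)"
 proof (rule sets.countable_UN')
  show "countable {q\<in>grid_times T. q < t}" by (rule countable_subset[OF _ countable_grid_times[of T]]) auto
  show "(\<lambda>q. {x \<in> space M. \<rho> x \<le> q} \<inter> {x \<in> space M. 0 < Z q x}) ` {q\<in>grid_times T. q < t} \<subseteq> sets (F t)"
  proof safe
   fix q assume q: "q \<in> grid_times T" "q < t"
   then have [measurable]: "Z q \<in> borel_measurable (F q)" using Z grid_times_le by (auto simp: adapted_def)
   have "{x \<in> space (F q). 0 < Z q x} \<in> sets (F q)" by measurable
   then have "{x \<in> space M. \<rho> x \<le> q} \<inter> {x \<in> space M. 0 < Z q x} \<in> sets (F q)"
    using stopping_le_sets[OF \<rho>, of q] by (simp add: space_F)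
   then show "{x \<in> space M. \<rho> x \<le> q} \<inter> {x \<in> space M. 0 < Z q x} \<in> sets (F t)"
    by (rule F_mono) (use q in simp)
  qed
 qed
 finally show "{x \<in> space M. hitting \<rho> Z x < t} \<in> sets (F t)" .
qed

lemma supermart_add_scaled: assumes X: "supermart D X" and Y: "supermart D Y" and ab: "0 \<le> a" "0 \<le> b"
 shows "supermart D (\<lambda>t x. a * X t x + b * Y t x)" unfolding supermart_def
proof (intro conjI ballI impI)
 fix t assume t: "t \<in> D"
 note [measurable] = supermartD(1)[OF X t] supermartD(1)[OF Y t]
 show "(\<lambda>x. a * X t x + b * Y t x) \<in> borel_measurable (F t)" by measurable
 show "0 \<le> a * X t x + b * Y t x" if "x \<in> space M" for x
  using supermartD(3)[OF X t that] supermartD(3)[OF Y t that] ab by auto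
 show "integrable M (\<lambda>x. a * X t x + b * Y t x)" using supermartD(4)[OF X t] supermartD(4)[OF Y t] by auto
next
 fix s t A assume st: "s \<in> D" "t \<in> D" "s \<le> t" and A: "A \<in> sets (F s)"
 have eq: "ei A (\<lambda>x. a * X r x + b * Y r x) =
  ennreal a * ei A (X r) + ennreal b * ei A (Y r)" if r: "r \<in> D" for r
 proof -
  note [measurable] = supermartD(2)[OF X r] supermartD(2)[OF Y r] F_le_M[OF A]
  have "ei A (\<lambda>x. a * X r x + b * Y r x) =
   (\<integral>\<^sup>+ x. ennreal a * (ennreal (X r x) * indicator A x) + ennreal b * (ennreal (Y r x) * indicator A x) \<partial>M)"
  proof (rule nn_integral_cong)
   fix x assume "x \<in> space M"
   then show "ennreal (a * X r x + b * Y r x) * indicator A x =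
    ennreal a * (ennreal (X r x) * indicator A x) + ennreal b * (ennreal (Y r x) * indicator A x)"
    using ab supermartD(3)[OF X r] supermartD(3)[OF Y r] by (cases "x \<in> A") (simp_all add: ennreal_mult)
  qed
  also have "\<dots> = ennreal a * ei A (X r) + ennreal b * ei A (Y r)"
   by (subst nn_integral_add, measurable) (simp add: nn_integral_cmult)
  finally show ?thesis .
 qed
 show "ei A (\<lambda>x. a * X t x + b * Y t x) \<le> ei A (\<lambda>x. a * X s x + b * Y s x)"
  unfolding eq[OF st(1)] eq[OF st(2)]
  by (intro add_mono mult_left_mono supermart_le[OF X st A] supermart_le[OF Y st A]) auto
qed

section \<open>Minimal dominating supermartingales and the Snell envelope\<close>

definition dominates :: "'a process => 'a process => bool" where
 "dominates X H \<longleftrightarrow> supermart (grid_times T) X \<and> (\<forall>q\<in>grid_times T. AE x in M. H q x \<le> X q x)"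

text \<open>The mean is minimised at all grid times simultaneously: nearly optimal candidates for
  each time and each \<open>n\<close> are countably many, and their successive minima attain every
  infimum \<open>c q\<close> in the limit. A dominating \<open>Z\<close> lies above the limit
  \<open>J\<close>, for the minimum of both still dominates and cannot have a smaller mean.\<close>

lemma minimal_dominating_supermart: assumes N: "dominates N H"
 shows "\<exists>J. dominates J H \<and> (\<forall>X. dominates X H \<longrightarrow> (\<forall>q\<in>grid_times T. AE x in M. J q x \<le> X q x))"
proof -
 define c where "c q = (INF X\<in>{X. dominates X H}. \<integral>\<^sup>+ x. ennreal (X q x) \<partial>M)" for q
 have c_less: "c q \<noteq> \<infinity>" if q: "q \<in> grid_times T" for q
 proof -
  have "c q \<le> (\<integral>\<^sup>+ x. ennreal (N q x) \<partial>M)" unfolding c_def using N by (intro INF_lower) auto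
  also have "\<dots> < \<infinity>"
   using N q by (auto simp: dominates_def real_integrable_def top.not_eq_extremum dest: supermartD(4))
  finally show ?thesis by auto
 qed
 define d where "d = from_nat_into (grid_times T)"
 have d: "d i \<in> grid_times T" for i unfolding d_def by (rule from_nat_into) (use end_in_grid_times in blast)
 have "\<exists>X. dominates X H \<and> (\<integral>\<^sup>+ x. ennreal (X (d i) x) \<partial>M) \<le> c (d i) + ennreal (1 / real (Suc n))" for i n
 proof -
  have "\<exists>X\<in>{X. dominates X H}. (\<integral>\<^sup>+ x. ennreal (X (d i) x) \<partial>M) < c (d i) + ennreal (1 / real (Suc n))"
  proof (rule INF_approx_ennreal)
   show "c (d i) \<noteq> \<infinity>" by (rule c_less[OF d])
  qed (simp_all add: c_def)
  then show ?thesis by (auto intro: less_imp_le)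
 qed
 then have "\<exists>X. \<forall>i n. dominates (X i n) H \<and>
   (\<integral>\<^sup>+ x. ennreal (X i n (d i) x) \<partial>M) \<le> c (d i) + ennreal (1 / real (Suc n))"
  by (intro choice allI)
 then obtain X where X: "\<And>i n. dominates (X i n) H"
  "\<And>i n. (\<integral>\<^sup>+ x. ennreal (X i n (d i) x) \<partial>M) \<le> c (d i) + ennreal (1 / real (Suc n))"
  by blast
 define X' where "X' k = X (fst (prod_decode k)) (snd (prod_decode k))" for k
 define Y where "Y = rec_nat N (\<lambda>k y t x. min (y t x) (X' k t x))"
 have Y_Suc: "Y (Suc k) = (\<lambda>t x. min (Y k t x) (X' k t x))" and Y_0: "Y 0 = N" for k by (auto simp: Y_def)
 have dom_min: "dominates (\<lambda>t x. min (A t x) (B t x)) H" if "dominates A H" "dominates B H" for A B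
  using that by (auto simp: dominates_def intro: supermart_min)
 have Y: "dominates (Y k) H" for k by (induction k) (use N X(1) dom_min in \<open>auto simp: Y_0 Y_Suc X'_def\<close>)
 then have Y_super: "supermart (grid_times T) (Y k)" for k by (auto simp: dominates_def)
 have Y_dec: "decseq (\<lambda>k. Y k t x)" for t x by (rule decseq_SucI) (simp add: Y_Suc)
 define J where "J t x = (INF k. Y k t x)" for t x
 have lim: "(\<lambda>k. Y k q x) \<longlonglongrightarrow> J q x" if "q \<in> grid_times T" "x \<in> space M" for q x
  unfolding J_def using Y_dec supermartD(3)[OF Y_super that] by (intro LIMSEQ_decseq_INF bdd_belowI2[where m = 0]) auto
 have J_le: "J q x \<le> Y k q x" if "q \<in> grid_times T" "x \<in> space M" for k q x
  by (rule decseq_ge[OF Y_dec lim[OF that]])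
 have J_nonneg: "0 \<le> J q x" if "q \<in> grid_times T" "x \<in> space M" for q x
  using lim[OF that] supermartD(3)[OF Y_super that] by (intro LIMSEQ_le_const) auto
 have J_meas: "J q \<in> borel_measurable (F q)" if q: "q \<in> grid_times T" for q
  by (rule borel_measurable_LIMSEQ_metric[where f = "\<lambda>k. Y k q"])
   (use q lim supermartD(1)[OF Y_super] in \<open>auto simp: space_F\<close>)
 have J_int: "integrable M (J q)" if q: "q \<in> grid_times T" for q
 proof (rule Bochner_Integration.integrable_bound[OF supermartD(4)[OF Y_super[of 0] q]])
  show "J q \<in> borel_measurable M" by (rule F_measurable_M[OF J_meas[OF q]])
  show "AE x in M. norm (J q x) \<le> norm (Y 0 q x)" using AE_space
  proof eventually_elim
   case (elim x)
   then show ?case using J_le[OF q elim, of 0] J_nonneg[OF q elim] by simp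
  qed
 qed
 have J_super: "supermart (grid_times T) J" unfolding supermart_def
 proof (intro conjI ballI impI J_meas J_int J_nonneg)
  fix s t A assume s: "s \<in> grid_times T" and t: "t \<in> grid_times T" and "s \<le> t" and A: "A \<in> sets (F s)"
  have "(\<lambda>k. \<integral>\<^sup>+ x\<in>A. ennreal (Y k s x) \<partial>M) \<longlonglongrightarrow> ei A (J s)"
  proof (rule nn_integral_dominated_convergence[where w = "\<lambda>x. ennreal (Y 0 s x)"])
   note [measurable] = supermartD(2)[OF Y_super s] F_le_M[OF A] F_measurable_M[OF J_meas[OF s]]
   show "(\<lambda>x. ennreal (Y k s x) * indicator A x) \<in> borel_measurable M" for k by measurable
   show "(\<lambda>x. ennreal (J s x) * indicator A x) \<in> borel_measurable M" by measurable
   show "(\<lambda>x. ennreal (Y 0 s x)) \<in> borel_measurable M" by measurable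
   show "AE x in M. ennreal (Y k s x) * indicator A x \<le> ennreal (Y 0 s x)" for k
    using decseqD[OF Y_dec, of 0 k s] by (intro AE_I2) (auto simp: indicator_def intro!: ennreal_leI)
   show "(\<integral>\<^sup>+ x. ennreal (Y 0 s x) \<partial>M) < \<infinity>"
    using supermartD(4)[OF Y_super s] by (auto simp: real_integrable_def top.not_eq_extremum)
   show "AE x in M. (\<lambda>k. ennreal (Y k s x) * indicator A x) \<longlonglongrightarrow> ennreal (J s x) * indicator A x"
    using AE_space
   proof eventually_elim
    case (elim x)
    then show ?case by (cases "x \<in> A") (auto intro!: tendsto_ennrealI lim s)
   qed
  qed
  moreover have "ei A (J t) \<le> ei A (Y k s)" for k
  proof -
   have "ei A (J t) \<le> ei A (Y k t)" by (intro nn_integral_mono mult_right_mono ennreal_leI J_le t) auto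
   also have "\<dots> \<le> ei A (Y k s)" by (rule supermart_le[OF Y_super s t \<open>s \<le> t\<close> A])
   finally show ?thesis .
  qed
  ultimately show "ei A (J t) \<le> ei A (J s)" by (intro LIMSEQ_le_const) auto
 qed
 have J_dom: "dominates J H" unfolding dominates_def
 proof (intro conjI ballI J_super)
  fix q assume q: "q \<in> grid_times T"
  have "AE x in M. \<forall>k. H q x \<le> Y k q x" unfolding AE_all_countable using Y q by (auto simp: dominates_def)
  with AE_space show "AE x in M. H q x \<le> J q x" by eventually_elim (intro LIMSEQ_le_const[OF lim[OF q]], auto)
 qed
 have "AE x in M. J q x \<le> Z q x" if Z: "dominates Z H" and q: "q \<in> grid_times T" for Z q
 proof -
  obtain i where i: "q = d i" using from_nat_into_surj[OF countable_grid_times q] by (auto simp: d_def)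
  have "(\<integral>\<^sup>+ x. ennreal (J q x) \<partial>M) \<le> c q + ennreal (1 / real (Suc n))" for n
  proof -
   \<comment> \<open>Candidate number \<open>k\<close> first enters the minimum
     \<open>Y (Suc k)\<close>, hence the successor of the code of \<open>(i, n)\<close>.\<close>
   have "(\<integral>\<^sup>+ x. ennreal (J q x) \<partial>M) \<le> (\<integral>\<^sup>+ x. ennreal (X i n q x) \<partial>M)"
    using J_le[OF q, of _ "Suc (prod_encode (i, n))"] by (intro nn_integral_mono ennreal_leI) (auto simp: Y_Suc X'_def)
   also have "\<dots> \<le> c q + ennreal (1 / real (Suc n))" using X(2)[of i n] by (simp add: i)
   finally show ?thesis .
  qed
  moreover have "(\<lambda>n. c q + ennreal (1 / real (Suc n))) \<longlonglongrightarrow> c q + ennreal 0"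
   using LIMSEQ_Suc[OF lim_const_over_n[of 1]] by (intro tendsto_add tendsto_const tendsto_ennrealI) simp
  ultimately have "(\<integral>\<^sup>+ x. ennreal (J q x) \<partial>M) \<le> c q"
   by (intro LIMSEQ_le_const[of "\<lambda>n. c q + ennreal (1 / real (Suc n))"]) auto
  also have "\<dots> \<le> (\<integral>\<^sup>+ x. ennreal (min (J q x) (Z q x)) \<partial>M)"
   unfolding c_def using dom_min[OF J_dom Z] by (intro INF_lower2[of "\<lambda>t x. min (J t x) (Z t x)"]) auto
  finally have le: "(\<integral>\<^sup>+ x. ennreal (J q x) \<partial>M) \<le> (\<integral>\<^sup>+ x. ennreal (min (J q x) (Z q x)) \<partial>M)" .
  have Zs: "supermart (grid_times T) Z" using Z by (simp add: dominates_def)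
  note min_super = supermart_min[OF J_super Zs]
  have I: "integrable M (\<lambda>x. min (J q x) (Z q x))" and nn: "\<And>x. x \<in> space M ==> 0 \<le> min (J q x) (Z q x)"
   using supermartD(4,3)[OF min_super q] by auto
  have "ennreal (\<integral>x. J q x \<partial>M) \<le> ennreal (\<integral>x. min (J q x) (Z q x) \<partial>M)"
   using le J_nonneg[OF q] nn
   by (subst (asm) nn_integral_eq_integral[OF J_int[OF q]], simp, subst (asm) nn_integral_eq_integral[OF I]) auto
  then have "(\<integral>x. J q x \<partial>M) \<le> (\<integral>x. min (J q x) (Z q x) \<partial>M)"
   using nn by (subst (asm) ennreal_le_iff) (auto intro!: integral_nonneg_AE AE_I2)
  moreover have "(\<integral>x. min (J q x) (Z q x) \<partial>M) \<le> (\<integral>x. J q x \<partial>M)"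
   using I J_int[OF q] by (rule integral_mono) auto
  ultimately have "(\<integral>x. J q x - min (J q x) (Z q x) \<partial>M) = 0" using I J_int[OF q] by simp
  then have "AE x in M. J q x - min (J q x) (Z q x) = 0"
   using I J_int[OF q] by (subst (asm) integral_nonneg_eq_0_iff_AE) auto
  then show ?thesis by eventually_elim auto
 qed
 with J_dom show ?thesis by blast
qed

definition snell_envelope :: "'a process => 'a process => bool" where
 "snell_envelope H J \<longleftrightarrow> supermart {..T} J \<and>
  (\<forall>x\<in>space M. cadlag_path T (\<lambda>t. J t x)) \<and> (AE x in M. \<forall>t\<le>T. H t x \<le> J t x) \<and>
  (\<forall>X. dominates X H \<longrightarrow> (\<forall>q\<in>grid_times T. AE x in M. J q x \<le> X q x))"

text \<open>Regularising keeps domination because \<open>H\<close> is right-continuous, and keeps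
  minimality because it only lowers the process.\<close>

theorem snell_envelope_exists: assumes N: "dominates N H"
  and rc: "\<And>x. x \<in> space M ==> right_continuous_path T (\<lambda>t. H t x)"
 shows "\<exists>J. snell_envelope H J"
proof -
 obtain J where J: "dominates J H"
  and min: "\<And>X q. dominates X H ==> q \<in> grid_times T ==> AE x in M. J q x \<le> X q x"
  using minimal_dominating_supermart[OF N] by blast
 then have Js: "supermart (grid_times T) J" by (simp add: dominates_def)
 have "AE x in M. \<forall>q\<in>grid_times T. H q x \<le> J q x"
  using J by (auto simp: dominates_def intro!: AE_ball_countable')
 then have le: "AE x in M. \<forall>t\<le>T. H t x \<le> regularised J t x"
  using right_closure_regularised[OF Js, unfolded right_closure_def] AE_space
 proof eventually_elim
  case (elim x)
  show ?case
  proof (intro allI impI)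
   fix t assume t: "t \<le> T"
   show "H t x \<le> regularised J t x" using elim(1) round_up_in_times
    by (intro LIMSEQ_le[OF right_continuous_round_up[OF rc[OF elim(3)] t] elim(2)[rule_format, OF t]] exI[of _ 0]) auto
  qed
 qed
 have "AE x in M. regularised J q x \<le> X q x" if "dominates X H" "q \<in> grid_times T" for X q
  using regularised_le[OF Js that(2)] min[OF that] by eventually_elim auto
 with le supermart_regularised[OF Js] cadlag_regularised[of J]
 have "snell_envelope H (regularised J)" unfolding snell_envelope_def by auto
 then show ?thesis by auto
qed

lemma snell_envelopeD: assumes "snell_envelope H J" shows "supermart {..T} J" "supermart (grid_times T) J"
  "\<And>x. x \<in> space M ==> right_continuous_path T (\<lambda>t. J t x)"
  "\<And>x. x \<in> space M ==> cadlag_path T (\<lambda>t. J t x)"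
  "AE x in M. \<forall>t\<le>T. H t x \<le> J t x"
  "right_closure J J"
  "\<And>t x. t \<le> T ==> x \<in> space M ==> 0 \<le> J t x"
  "adapted F T J"
proof -
 show 1: "supermart {..T} J" "\<And>x. x \<in> space M ==> cadlag_path T (\<lambda>t. J t x)"
  "AE x in M. \<forall>t\<le>T. H t x \<le> J t x" using assms by (auto simp: snell_envelope_def)
 show "supermart (grid_times T) J" by (rule supermart_subset[OF 1(1)]) (auto dest: grid_times_le)
 show 2: "right_continuous_path T (\<lambda>t. J t x)" if "x \<in> space M" for x
  by (rule cadlag_right_continuous[OF 1(2)[OF that]])
 show "right_closure J J" by (rule right_closure_self) (rule 2)
 show "0 \<le> J t x" if "t \<le> T" "x \<in> space M" for t x using supermartD(3)[OF 1(1)] that by auto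
 show "adapted F T J" using supermartD(1)[OF 1(1)] by (auto simp: adapted_def)
qed

lemma snell_envelope_minimal:
 "snell_envelope H J ==> dominates X H ==> q \<in> grid_times T ==> AE x in M. J q x \<le> X q x"
 by (auto simp: snell_envelope_def)

end

context filtered_prob_space
begin

lemma nn_conditional_version:
 assumes X: "X \<in> borel_measurable M" and fin: "(\<integral>\<^sup>+ x. ennreal (X x) \<partial>M) < \<infinity>" "A \<in> sets (F t)"
 shows "ei A (\<lambda>x. closed_martingale (\<lambda>x. max 0 (X x)) t x) = ei A X"
proof -
 have "integrable M (\<lambda>x. max 0 (X x))" using X fin by (intro integrableI_nonneg) (auto simp: ennreal_max_0)
 from closed_martingale_set_integral[OF this fin(2)] show ?thesis by (simp add: ennreal_max_0)
qed

context
 fixes H J :: "'a process" assumes snell: "snell_envelope H J" and H_adapted: "adapted F T H"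
  and H_rc: "\<And>x. x \<in> space M ==> right_continuous_path T (\<lambda>t. H t x)"
  and H_nonneg: "\<And>t x. t \<le> T ==> x \<in> space M ==> 0 \<le> H t x"
begin

lemmas J_facts = snell_envelopeD[OF snell]

lemma snell_sampling:
 "stopping S ==> stopping \<tau> ==> (\<And>x. x \<in> space M ==> S x \<le> \<tau> x) ==> A \<in> sets (pre_sigma S) ==>
 ev A \<tau> J \<le> ev A S J" by (rule optional_sampling[OF J_facts(2,6)])

lemma snell_stopped_measurable: assumes "stopping S"
 shows "(\<lambda>x. J (S x) x) \<in> borel_measurable (pre_sigma S)" "(\<lambda>x. J (S x) x) \<in> borel_measurable M"
  "(\<lambda>x. H (S x) x) \<in> borel_measurable (pre_sigma S)" "(\<lambda>x. H (S x) x) \<in> borel_measurable M"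
proof -
 have J: "progressive J" by (rule right_continuous_progressive[OF J_facts(8) J_facts(3)])
 have H: "progressive H" by (rule right_continuous_progressive[OF H_adapted H_rc])
 show "(\<lambda>x. J (S x) x) \<in> borel_measurable (pre_sigma S)" "(\<lambda>x. J (S x) x) \<in> borel_measurable M"
  by (rule progressive_pre_sigma[OF J assms], rule progressive_stopped_measurable[OF J assms])
 show "(\<lambda>x. H (S x) x) \<in> borel_measurable (pre_sigma S)" "(\<lambda>x. H (S x) x) \<in> borel_measurable M"
  by (rule progressive_pre_sigma[OF H assms], rule progressive_stopped_measurable[OF H assms])
qed

lemma snell_finite: assumes "stopping S" shows "(\<integral>\<^sup>+ x. ennreal (J (S x) x) \<partial>M) < \<infinity>"
proof -
 have "(\<integral>\<^sup>+ x. ennreal (J (S x) x) \<partial>M) = ev (space M) S J" by (intro nn_integral_cong) auto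
 also have "\<dots> \<le> ei (space M) (J 0)" by (rule snell_sampling[OF stopping_const assms]) auto
 also have "\<dots> = (\<integral>\<^sup>+ x. ennreal (J 0 x) \<partial>M)" by (intro nn_integral_cong) auto
 also have "\<dots> < \<infinity>"
  using supermartD(4)[OF J_facts(2) zero_in_grid_times] by (auto simp: real_integrable_def top.not_eq_extremum)
 finally show ?thesis .
qed

text \<open>Lowering \<open>J\<close> to \<open>H\<close> at the single time \<open>T\<close> leaves
  a dominating supermartingale, so minimality forces equality.\<close>

lemma snell_end: "AE x in M. J T x = H T x"
proof -
 define X where "X t x = (if t < T then J t x else H T x)" for t x
 have HT: "H T \<in> borel_measurable (F T)" using H_adapted by (auto simp: adapted_def)
 have le: "AE x in M. H T x \<le> J T x" using J_facts(5) by eventually_elim auto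
 have HT_int: "integrable M (H T)"
 proof (rule Bochner_Integration.integrable_bound[OF supermartD(4)[OF J_facts(2) end_in_grid_times]])
  show "AE x in M. norm (H T x) \<le> norm (J T x)" using le AE_space by eventually_elim (use H_nonneg[of T] in auto)
 qed (rule F_measurable_M[OF HT])
 have X_T: "X t = H T" if "t \<in> grid_times T" "\<not> t < T" for t
  using that grid_times_le[of t T] by (auto simp: X_def fun_eq_iff)
 have X_less: "X t = J t" if "t < T" for t using that by (auto simp: X_def fun_eq_iff)
 have end_le: "ei A (H T) \<le> ei A (J T)" for A
  using le by (intro nn_integral_mono_AE) (auto elim!: eventually_mono intro!: mult_right_mono ennreal_leI)
 have "supermart (grid_times T) X" unfolding supermart_def
 proof (intro conjI ballI impI)
  fix t assume t: "t \<in> grid_times T"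
  then have tT: "\<not> t < T ==> t = T" using grid_times_le[of t T] by auto
  show "X t \<in> borel_measurable (F t)"
   using X_T[OF t] X_less[of t] tT HT supermartD(1)[OF J_facts(2) t] by (cases "t < T") auto
  show "0 \<le> X t x" if "x \<in> space M" for x using H_nonneg[of T x] J_facts(7)[of t x] that by (auto simp: X_def)
  show "integrable M (X t)" using X_T[OF t] X_less[of t] HT_int supermartD(4)[OF J_facts(2) t] by (cases "t < T") auto
 next
  fix s t A assume s: "s \<in> grid_times T" and t: "t \<in> grid_times T" and st: "s \<le> t" and A: "A \<in> sets (F s)"
  have tT: "\<not> t < T ==> t = T" and sT: "\<not> s < T ==> s = T" using grid_times_le t s by force+
  note le_J = supermart_le[OF J_facts(2) s t st A]
  show "ei A (X t) \<le> ei A (X s)"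
  proof (cases "t < T")
   case True
   then show ?thesis using le_J st X_less[of t] X_less[of s] by auto
  next
   case False
   then show ?thesis
    using order_trans[OF end_le[of A] le_J[unfolded tT[OF False]]] X_less[of s] X_T[OF t] X_T[OF s] by (cases "s < T") auto
  qed
 qed
 moreover have "AE x in M. H q x \<le> X q x" if q: "q \<in> grid_times T" for q using J_facts(5)
 proof eventually_elim
  case (elim x)
  then show ?case using grid_times_le[OF q] by (cases "q < T") (auto simp: X_def not_less)
 qed
 ultimately have "dominates X H" by (auto simp: dominates_def)
 from snell_envelope_minimal[OF snell this end_in_grid_times] le show ?thesis by eventually_elim (auto simp: X_def)
qed

section \<open>Stopping when H exceeds a fraction of its envelope\<close>

definition gap :: "real => 'a process" where
 "gap \<theta> t x = H t x - \<theta> * J t x"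

lemma gap_adapted: "adapted F T (gap \<theta>)"
 using H_adapted J_facts(8) unfolding adapted_def gap_def[abs_def] by (auto intro!: borel_measurable_diff borel_measurable_times)

lemma gap_rc: "x \<in> space M ==> right_continuous_path T (\<lambda>t. gap \<theta> t x)"
 unfolding gap_def by (intro right_continuous_diff right_continuous_mult right_continuous_const H_rc J_facts(3))

lemma hitting_gap: "stopping \<rho> ==> stopping (hitting \<rho> (gap \<theta>))"
 by (rule stopping_hitting[OF _ gap_adapted gap_rc])

text \<open>The convex combination \<open>\<theta> J + (1 - \<theta>) U\<close>, where \<open>U\<close> is the value of stopping \<open>J\<close> when
 \<open>H\<close> first exceeds \<open>\<theta> J\<close>, dominates \<open>H\<close>; so minimality of \<open>J\<close> gives \<open>J \<le> U\<close>.\<close>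

lemma snell_le_hitting_const:
 assumes \<theta>: "0 < \<theta>" "\<theta> < 1" and q: "q \<in> grid_times T" and A: "A \<in> sets (F q)"
 shows "ei A (J q) \<le> ei A (\<lambda>x. J (hitting (\<lambda>_. q) (gap \<theta>) x) x)"
proof -
 define \<tau> where "\<tau> q = hitting (\<lambda>_. q) (gap \<theta>)" for q
 have \<tau>: "stopping (\<tau> q)" if "q \<in> grid_times T" for q
  unfolding \<tau>_def using that by (intro hitting_gap stopping_const grid_times_le)
 define U where "U q = closed_martingale (\<lambda>x. max 0 (J (\<tau> q x) x)) q" for q
 have U_int: "ei A (U q) = ev A (\<tau> q) J" if "q \<in> grid_times T" "A \<in> sets (F q)" for q A unfolding U_def
  by (rule nn_conditional_version[OF snell_stopped_measurable(2)[OF \<tau>[OF that(1)]] snell_finite[OF \<tau>[OF that(1)]] that(2)])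
 have U_meas: "U q \<in> borel_measurable (F q)" for q unfolding U_def by (rule closed_martingale_measurable)
 have U_nonneg: "0 \<le> U q x" for q x unfolding U_def closed_martingale_def by simp
 have U: "supermart (grid_times T) U" unfolding supermart_def
 proof (intro conjI ballI impI U_meas U_nonneg)
  fix t assume t: "t \<in> grid_times T"
  have "(\<integral>\<^sup>+ x. ennreal (U t x) \<partial>M) = ei (space M) (U t)" by (intro nn_integral_cong) auto
  also have "\<dots> = ev (space M) (\<tau> t) J" using sets.top[of "F t"] by (intro U_int[OF t]) (simp add: space_F)
  also have "\<dots> = (\<integral>\<^sup>+ x. ennreal (J (\<tau> t x) x) \<partial>M)" by (intro nn_integral_cong) auto
  also have "\<dots> < \<infinity>" by (rule snell_finite[OF \<tau>[OF t]])
  finally show "integrable M (U t)" using F_measurable_M[OF U_meas] by (intro integrableI_nonneg) (auto simp: U_nonneg)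
 next
  fix s t A assume s: "s \<in> grid_times T" and t: "t \<in> grid_times T" and st: "s \<le> t" and A: "A \<in> sets (F s)"
  have At: "A \<in> sets (F t)" by (rule F_mono[OF A st])
  have "A \<in> sets (pre_sigma (\<tau> s))"
   using grid_times_le[OF s] by (intro pre_sigma_mono[OF stopping_const \<tau>[OF s] _ pre_sigma_const[OF _ A]])
    (auto simp: \<tau>_def intro: hitting_ge)
  then have "ev A (\<tau> t) J \<le> ev A (\<tau> s) J"
   using st by (intro snell_sampling \<tau> s t) (auto simp: \<tau>_def intro!: hitting_mono)
  then show "ei A (U t) \<le> ei A (U s)" using U_int[OF t At] U_int[OF s A] by simp
 qed
 define W where "W t x = \<theta> * J t x + (1 - \<theta>) * U t x" for t x
 have "supermart (grid_times T) W" unfolding W_def using \<theta> by (intro supermart_add_scaled J_facts U) auto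
 moreover have "AE x in M. H t x \<le> W t x" if t: "t \<in> grid_times T" for t
 proof -
  have tT: "t \<le> T" by (rule grid_times_le[OF t])
  note [measurable] = supermartD(1)[OF J_facts(2) t] U_meas[of t]
  have gap_m [measurable]: "gap \<theta> t \<in> borel_measurable (F t)" using gap_adapted tT by (auto simp: adapted_def)
  \<comment> \<open>On \<open>B\<close> the entry time is \<open>t\<close> itself, so
    \<open>U\<close> reaches \<open>J\<close> there; off \<open>B\<close> already
    \<open>\<theta> * J\<close> dominates \<open>H\<close>, and \<open>U\<close> is
    nonnegative.\<close>
  define B where "B = {x \<in> space (F t). 0 < gap \<theta> t x}"
  have B: "B \<in> sets (F t)" unfolding B_def by measurable
  have B': "B \<in> sets M" by (rule F_le_M[OF B])
  have "AE x in M. J t x * indicator B x \<le> U t x"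
  proof (rule AE_le_of_F_integrals[where t = t])
   show "(\<lambda>x. J t x * indicator B x) \<in> borel_measurable (F t)" using B by measurable
   show "integrable M (\<lambda>x. J t x * indicator B x)"
    using supermartD(4)[OF J_facts(2) t] B' by (rule integrable_real_mult_indicator[rotated])
   fix A assume A: "A \<in> sets (F t)"
   have "ei A (\<lambda>x. J t x * indicator B x) = ei (A \<inter> B) (J t)"
    by (intro nn_integral_cong) (auto simp: indicator_def)
   also have "\<dots> = ev (A \<inter> B) (\<tau> t) J"
   proof (intro nn_integral_cong)
    fix x assume "x \<in> space M"
    show "ennreal (J t x) * indicator (A \<inter> B) x = ennreal (J (\<tau> t x) x) * indicator (A \<inter> B) x"
    proof (cases "x \<in> A \<inter> B")
     case True
     then have "\<tau> t x \<le> t" unfolding \<tau>_def using tT by (intro hitting_le_hit) (auto simp: B_def)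
     moreover have "t \<le> \<tau> t x" unfolding \<tau>_def using tT by (intro hitting_ge)
     ultimately have "\<tau> t x = t" by simp
     then show ?thesis by simp
    qed auto
   qed
   also have "\<dots> = ei (A \<inter> B) (U t)" using A B by (intro U_int[OF t, symmetric]) auto
   also have "\<dots> \<le> ei A (U t)" by (intro nn_integral_mono mult_left_mono) (auto simp: indicator_def)
   finally show "ei A (\<lambda>x. J t x * indicator B x) \<le> ei A (U t)" .
  qed (auto simp: U_meas U_nonneg)
  with J_facts(5) AE_space show ?thesis
  proof eventually_elim
   case (elim x)
   have HJ: "H t x \<le> J t x" using elim(1) tT by auto
   show ?case
   proof (cases "x \<in> B")
    case True
    then have "J t x \<le> U t x" using elim(3) by simp
    then have "(1 - \<theta>) * J t x \<le> (1 - \<theta>) * U t x" using \<theta> by (intro mult_left_mono) auto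
    then show ?thesis using HJ by (simp add: W_def algebra_simps)
   next
    case False
    then have "H t x \<le> \<theta> * J t x" using elim(2) by (auto simp: B_def gap_def space_F)
    moreover have "0 \<le> (1 - \<theta>) * U t x" using \<theta> U_nonneg by simp
    ultimately show ?thesis by (simp add: W_def)
   qed
  qed
 qed
 ultimately have "dominates W H" by (auto simp: dominates_def)
 from snell_envelope_minimal[OF snell this q] have "AE x in M. J q x \<le> U q x"
 proof eventually_elim
  case (elim x)
  then have "(1 - \<theta>) * J q x \<le> (1 - \<theta>) * U q x" by (simp add: W_def algebra_simps)
  then show ?case using \<theta> by simp
 qed
 then have "ei A (J q) \<le> ei A (U q)"
  by (intro nn_integral_mono_AE) (auto elim!: eventually_mono intro!: mult_right_mono ennreal_leI)
 then show ?thesis using U_int[OF q A] by (simp add: \<tau>_def)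
qed

text \<open>The values of the rounded \<open>S\<close> reduce this to constant starting times. Entry
  after the rounded time is not earlier than entry after \<open>S\<close>, so sampling leads back to
  the latter; right-continuity removes the rounding on the left.\<close>

lemma snell_le_hitting:
 assumes \<theta>: "0 < \<theta>" "\<theta> < 1" and S: "stopping S" and A: "A \<in> sets (pre_sigma S)"
 shows "ev A S J \<le> ei A (\<lambda>x. J (hitting S (gap \<theta>) x) x)"
proof (rule right_closure_le[OF J_facts(2,6) S pre_sigma_le_M[OF S A]])
 fix m
 define S' where "S' x = round_up T m (S x)" for x
 have S': "stopping S'" unfolding S'_def by (rule stopping_round_up[OF S])
 have SS': "S x \<le> S' x" if "x \<in> space M" for x
  unfolding S'_def using stoppingD(2)[OF S that] by (rule round_up_ge)
 have S'_in: "S' x \<in> grid T m" for x by (simp add: S'_def round_up_in_grid)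
 have A': "A \<in> sets (pre_sigma S')" by (rule pre_sigma_mono[OF S S' SS' A])
 have A_sub: "A \<subseteq> space M" using sets.sets_into_space[OF A] by (simp add: space_pre_sigma)
 define \<tau>' where "\<tau>' = hitting S' (gap \<theta>)"
 have \<tau>': "stopping \<tau>'" unfolding \<tau>'_def by (rule hitting_gap[OF S'])
 note [measurable] = snell_stopped_measurable(2)[OF S'] snell_stopped_measurable(2)[OF \<tau>']
 have eq: "{x \<in> A. S' x = s} \<in> sets (F s)" for s by (rule pre_sigma_eq_sets[OF S' A'])
 have "ev A S' J = (\<Sum>s\<in>grid T m. \<integral>\<^sup>+ x\<in>{x \<in> A. S' x = s}. ennreal (J (S' x) x) \<partial>M)"
  by (intro nn_integral_split_values F_le_M[OF eq]) (auto simp: S'_in)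
 also have "\<dots> = (\<Sum>s\<in>grid T m. \<integral>\<^sup>+ x\<in>{x \<in> A. S' x = s}. ennreal (J s x) \<partial>M)"
  by (intro sum.cong nn_integral_cong) (auto simp: indicator_def)
 also have "\<dots> \<le> (\<Sum>s\<in>grid T m. \<integral>\<^sup>+ x\<in>{x \<in> A. S' x = s}. ennreal (J (hitting (\<lambda>_. s) (gap \<theta>) x) x) \<partial>M)"
  by (intro sum_mono snell_le_hitting_const[OF \<theta>] eq subsetD[OF grid_subset_times])
 also have "\<dots> = (\<Sum>s\<in>grid T m. \<integral>\<^sup>+ x\<in>{x \<in> A. S' x = s}. ennreal (J (\<tau>' x) x) \<partial>M)"
  by (intro sum.cong nn_integral_cong) (auto simp: indicator_def \<tau>'_def hitting_def)
 also have "\<dots> = ev A \<tau>' J" by (intro nn_integral_split_values[symmetric] F_le_M[OF eq]) (auto simp: S'_in)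
 also have "\<dots> \<le> ei A (\<lambda>x. J (hitting S (gap \<theta>) x) x)"
 proof (rule snell_sampling[OF hitting_gap[OF S] \<tau>'])
  show "hitting S (gap \<theta>) x \<le> \<tau>' x" if "x \<in> space M" for x
   unfolding \<tau>'_def using SS'[OF that] by (intro hitting_mono) auto
  show "A \<in> sets (pre_sigma (hitting S (gap \<theta>)))"
   using stoppingD(2)[OF S] by (intro pre_sigma_mono[OF S hitting_gap[OF S] _ A] hitting_ge)
 qed
 finally show "ei A (\<lambda>x. J (round_up T m (S x)) x) \<le> ei A (\<lambda>x. J (hitting S (gap \<theta>) x) x)"
  by (simp add: S'_def)
qed

text \<open>The fractions start at 1/2 and increase to 1. Entry at fraction 1 itself would carry no
  information, since almost surely \<open>H\<close> never exceeds \<open>J\<close>.\<close>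

definition contact_time :: "('a => ennreal) => 'a => ennreal" where
 "contact_time S x = (SUP n. hitting S (gap (1 - 1 / real (n + 2))) x)"

lemma stopping_contact_time: assumes S: "stopping S" shows "stopping (contact_time S)"
 unfolding contact_time_def[abs_def] by (rule stopping_SUP[OF hitting_gap[OF S]])

lemma contact_time_ge: "stopping S ==> x \<in> space M ==> S x \<le> contact_time S x" unfolding contact_time_def
 by (rule order_trans[OF hitting_ge SUP_upper[of 0]]) (auto dest: stoppingD)

lemma before_contact_time: assumes "S x \<le> t" "t < contact_time S x"
 shows "\<exists>\<theta>. 0 < \<theta> \<and> \<theta> < 1 \<and> H t x \<le> \<theta> * J t x"
proof -
 obtain n where "t < hitting S (gap (1 - 1 / real (n + 2))) x"
  using assms(2) by (auto simp: contact_time_def less_SUP_iff)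
 from before_hitting[OF assms(1) this] show ?thesis
  by (intro exI[of _ "1 - 1 / real (n + 2)"]) (auto simp: gap_def field_simps)
qed

text \<open>Stopping at fraction \<theta> secures at least \<theta> times the mean of the envelope.
  By \<open>usc\<close> the mean of \<open>H\<close> does not drop in the limit of increasing times,
  so the loss vanishes as \<theta> tends to 1.\<close>

theorem snell_contact_time:
 assumes usc: "\<And>\<tau> A c. (\<And>n. stopping (\<tau> n)) ==> (\<And>n x. x \<in> space M ==> \<tau> n x \<le> \<tau> (Suc n) x) ==>
   A \<in> sets (pre_sigma (\<tau> 0)) ==> (\<And>n::nat. c \<le> ev A (\<tau> n) H) ==>
   c \<le> ei A (\<lambda>x. H (SUP n. \<tau> n x) x)"
  and S: "stopping S" shows "A \<in> sets (pre_sigma S) ==>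
   ev A S J = ev A (contact_time S) H"
  and "AE x in M. J (contact_time S x) x = H (contact_time S x) x"
proof -
 define \<theta> where "\<theta> n = 1 - 1 / real (n + 2)" for n
 have \<theta>: "0 < \<theta> n" "\<theta> n < 1" for n by (auto simp: \<theta>_def field_simps)
 have \<theta>_mono: "\<theta> n \<le> \<theta> m" if "n \<le> m" for n m
  unfolding \<theta>_def using that by (intro diff_left_mono divide_left_mono) auto
 define \<tau> where "\<tau> n = hitting S (gap (\<theta> n))" for n
 have \<tau>: "stopping (\<tau> n)" for n unfolding \<tau>_def by (rule hitting_gap[OF S])
 have \<tau>_mono: "\<tau> n x \<le> \<tau> m x" if "x \<in> space M" "n \<le> m" for n m x
  unfolding \<tau>_def hitting_def
 proof (rule Inf_superset_mono, safe)
  fix s assume s: "s \<le> T" "0 < gap (\<theta> m) s x"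
  have "\<theta> n * J s x \<le> \<theta> m * J s x"
   using \<theta>_mono[OF that(2)] J_facts(7)[OF s(1) that(1)] by (intro mult_right_mono)
  then show "0 < gap (\<theta> n) s x" using s(2) by (simp add: gap_def)
 qed
 have ct: "contact_time S x = (SUP n. \<tau> n x)" for x by (simp add: contact_time_def \<tau>_def \<theta>_def)
 have ct_shift: "contact_time S x = (SUP n. \<tau> (n + j) x)" if "x \<in> space M" for x j unfolding ct
 proof (rule antisym)
  show "(SUP n. \<tau> n x) \<le> (SUP n. \<tau> (n + j) x)"
   using \<tau>_mono[OF that] by (intro SUP_mono) (auto intro!: exI le_add1)
  show "(SUP n. \<tau> (n + j) x) \<le> (SUP n. \<tau> n x)" by (intro SUP_mono) auto
 qed
 have A_sets: "A \<in> sets (pre_sigma (\<tau> n))" if "A \<in> sets (pre_sigma S)" for A n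
  using stoppingD(2)[OF S] unfolding \<tau>_def by (intro pre_sigma_mono[OF S hitting_gap[OF S] _ that] hitting_ge)
 have HJ_hit: "AE x in M. \<theta> n * J (\<tau> n x) x \<le> H (\<tau> n x) x" for n using snell_end AE_space
 proof eventually_elim
  case (elim x)
  show ?case
  proof (cases "\<tau> n x < T")
   case True
   then show ?thesis
    using hitting_value[where Z = "gap (\<theta> n)" and \<rho> = S, OF gap_rc[OF elim(2)] _ stoppingD(2)[OF S elim(2)]]
    by (simp add: \<tau>_def gap_def)
  next
   case False
   then have "\<tau> n x = T" using hitting_le[of S "gap (\<theta> n)" x] by (simp add: \<tau>_def)
   moreover have "\<theta> n * J T x \<le> 1 * J T x"
    using \<theta>[of n] J_facts(7)[of T x] elim(2) by (intro mult_right_mono) auto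
   ultimately show ?thesis using elim(1) by simp
  qed
 qed
 have le: "ev A S J \<le> ev A (contact_time S) H" if A: "A \<in> sets (pre_sigma S)" for A
 proof -
  have [measurable]: "A \<in> sets M" by (rule pre_sigma_le_M[OF S A])
  note [measurable] = snell_stopped_measurable(2)[OF S]
  let ?c = "\<integral>\<^sup>+ x\<in>A. ennreal (J (S x) x) \<partial>M"
  have 1: "ennreal (\<theta> n) * ?c \<le> ev A (\<tau> n) H" for n
  proof -
   note [measurable] = snell_stopped_measurable(2)[OF \<tau>[of n]]
   have "ennreal (\<theta> n) * ?c \<le> ennreal (\<theta> n) * ev A (\<tau> n) J"
    unfolding \<tau>_def by (intro mult_left_mono snell_le_hitting \<theta> S A) auto
   also have "\<dots> = (\<integral>\<^sup>+ x. ennreal (\<theta> n) * (ennreal (J (\<tau> n x) x) * indicator A x) \<partial>M)"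
    by (rule nn_integral_cmult[symmetric]) measurable
   also have "\<dots> \<le> ev A (\<tau> n) H"
   proof (rule nn_integral_mono_AE)
    show "AE x in M. ennreal (\<theta> n) * (ennreal (J (\<tau> n x) x) * indicator A x) \<le> ennreal (H (\<tau> n x) x) * indicator A x"
     using HJ_hit[of n] AE_space
    proof eventually_elim
     case (elim x)
     have "0 \<le> J (\<tau> n x) x" by (rule J_facts(7)[OF stoppingD(2)[OF \<tau> elim(2)] elim(2)])
     then have "ennreal (\<theta> n) * ennreal (J (\<tau> n x) x) \<le> ennreal (H (\<tau> n x) x)"
      using elim(1) \<theta>[of n] by (simp add: ennreal_mult[symmetric] ennreal_leI)
     then show ?case by (simp add: mult.assoc[symmetric] mult_right_mono)
    qed
   qed
   finally show ?thesis .
  qed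
  \<comment> \<open>\<open>usc\<close> asks for a bound independent of \<open>n\<close>: the
    fraction is frozen at index \<open>j\<close> and the sequence of times shifted by
    \<open>j\<close>.\<close>
  have 2: "ennreal (\<theta> j) * ?c \<le> ev A (contact_time S) H" for j
  proof -
   have "ennreal (\<theta> j) * ?c \<le> ei A (\<lambda>x. H (SUP n. \<tau> (n + j) x) x)"
   proof (rule usc[of "\<lambda>n. \<tau> (n + j)"])
    fix n
    have "ennreal (\<theta> j) * ?c \<le> ennreal (\<theta> (n + j)) * ?c"
     by (intro mult_right_mono ennreal_leI \<theta>_mono) auto
    also note 1[of "n + j"]
    finally show "ennreal (\<theta> j) * ?c \<le> ei A (\<lambda>x. H (\<tau> (n + j) x) x)" .
   qed (use \<tau> \<tau>_mono A_sets[OF A] in auto)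
   also have "\<dots> = ev A (contact_time S) H" by (intro nn_integral_cong) (simp add: ct_shift[of _ j])
   finally show ?thesis .
  qed
  have "\<theta> \<longlonglongrightarrow> 1 - 0"
   unfolding \<theta>_def using LIMSEQ_ignore_initial_segment[OF lim_const_over_n[of 1], of 2]
   by (intro tendsto_diff tendsto_const) simp
  then have "(\<lambda>j. ennreal (\<theta> j) * ?c) \<longlonglongrightarrow> ennreal 1 * ?c"
   by (intro tendsto_mult_ennreal tendsto_ennrealI tendsto_const) auto
  then show ?thesis using 2 by (intro LIMSEQ_le_const2[of "\<lambda>j. ennreal (\<theta> j) * ?c"]) auto
 qed
 note ctb = stopping_contact_time[OF S]
 have HJ: "AE x in M. H (contact_time S x) x \<le> J (contact_time S x) x"
  using J_facts(5) AE_space by eventually_elim (auto intro!: stoppingD(2)[OF ctb])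
 have HJ_int: "ev A (contact_time S) H \<le> ev A (contact_time S) J" for A
  using HJ by (intro nn_integral_mono_AE) (auto elim!: eventually_mono intro!: mult_right_mono ennreal_leI)
 have JJ: "ev A (contact_time S) J \<le> ev A S J" if "A \<in> sets (pre_sigma S)" for A
  by (rule snell_sampling[OF S ctb contact_time_ge[OF S] that])
 show "ev A S J = ev A (contact_time S) H" if "A \<in> sets (pre_sigma S)"
  using le[OF that] HJ_int[of A] JJ[OF that] by simp
 show "AE x in M. J (contact_time S x) x = H (contact_time S x) x"
 proof -
  note [measurable] = snell_stopped_measurable(2,4)[OF ctb]
  have *: "(\<integral>\<^sup>+ x. ennreal (J (contact_time S x) x) \<partial>M) \<le> (\<integral>\<^sup>+ x. ennreal (H (contact_time S x) x) \<partial>M)"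
  proof -
   have sp: "(\<integral>\<^sup>+ x. f x \<partial>M) = (\<integral>\<^sup>+ x\<in>space M. f x \<partial>M)" for f
    by (intro nn_integral_cong) auto
   show ?thesis using order_trans[OF JJ[OF space_in_pre_sigma] le[OF space_in_pre_sigma]] by (simp only: sp[symmetric])
  qed
  have fin: "(\<integral>\<^sup>+ x. ennreal (H (contact_time S x) x) \<partial>M) \<noteq> \<infinity>"
  proof -
   have "(\<integral>\<^sup>+ x. ennreal (H (contact_time S x) x) \<partial>M) \<le> (\<integral>\<^sup>+ x. ennreal (J (contact_time S x) x) \<partial>M)"
    using HJ by (intro nn_integral_mono_AE) (auto elim!: eventually_mono intro!: ennreal_leI)
   then show ?thesis using snell_finite[OF ctb] by (auto simp: top_unique)
  qed
  have "(\<integral>\<^sup>+ x. ennreal (J (contact_time S x) x) - ennreal (H (contact_time S x) x) \<partial>M) =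
   (\<integral>\<^sup>+ x. ennreal (J (contact_time S x) x) \<partial>M) - (\<integral>\<^sup>+ x. ennreal (H (contact_time S x) x) \<partial>M)"
   using HJ fin by (intro nn_integral_diff) (auto elim!: eventually_mono intro!: ennreal_leI)
  also have "\<dots> = 0" using snell_finite[OF ctb] * by (intro diff_eq_0_ennreal) auto
  finally have "AE x in M. ennreal (J (contact_time S x) x) - ennreal (H (contact_time S x) x) = 0"
   by (subst (asm) nn_integral_0_iff_AE) auto
  with HJ AE_space show ?thesis
  proof eventually_elim
   case (elim x)
   have "0 \<le> H (contact_time S x) x" by (rule H_nonneg[OF stoppingD(2)[OF ctb elim(2)] elim(2)])
   then show ?case using elim by (simp add: ennreal_minus ennreal_eq_0_iff)
  qed
 qed
qed

end

end

section \<open>Marginal utilities\<close>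

locale utility =
 fixes u :: "real => real => real" assumes nonneg: "\<And>x c. 0 \<le> x ==> 0 \<le> c ==> 0 \<le> u x c"
  and concave: "strictly_concave_nonneg u" and C1: "C1_pos u"
  and ux_0: "\<And>c. 0 < c ==> filterlim (\<lambda>x. partial_x u x c) at_top (at_right 0)"
  and ux_inf: "\<And>c. 0 < c ==> ((\<lambda>x. partial_x u x c) \<longlongrightarrow> 0) at_top"
begin

lemma partial_derivatives: assumes "0 < x" "0 < c"
 shows "((\<lambda>y. u y c) has_real_derivative partial_x u x c) (at x)"
  "((\<lambda>d. u x d) has_real_derivative partial_c u x c) (at c)"
 using C1 assms unfolding C1_pos_def partial_x_def partial_c_def by (auto simp: DERIV_deriv_iff_real_differentiable)

lemma utility_has_derivative: assumes "0 < x" "0 < c"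
 shows "((\<lambda>(y, d). u y d) has_derivative (\<lambda>(a, b). a * partial_x u x c + b * partial_c u x c)) (at (x, c))"
proof -
 have S: "open ({0<..} \<times> {0<..} :: (real \<times> real) set)" by (intro open_Times) auto
 have "((\<lambda>(y, d). u y d) has_derivative (\<lambda>(a, b). a * partial_x u x c + blinfun_scaleR_left (partial_c u x c) b))
  (at (x, c) within {0<..} \<times> {0<..})"
 proof (rule has_derivative_partialsI[where f = u and fx = "\<lambda>a. a * partial_x u x c" and x = x and y = c
    and X = "{0<..}" and Y = "{0<..}" and fy = "\<lambda>y d. blinfun_scaleR_left (partial_c u y d)"])
  show "((\<lambda>y. u y c) has_derivative (\<lambda>a. a * partial_x u x c)) (at x within {0<..})"
   by (rule has_derivative_at_withinI,
     rule has_derivative_eq_rhs[OF partial_derivatives(1)[OF assms, unfolded has_field_derivative_def]])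
    (simp add: fun_eq_iff)
  show "((\<lambda>d. u y d) has_derivative blinfun_apply (blinfun_scaleR_left (partial_c u y d))) (at d within {0<..})"
   if "y \<in> {0<..}" "d \<in> {0<..}" for y d by (rule has_derivative_at_withinI,
     rule has_derivative_eq_rhs[OF partial_derivatives(2)[of y d, unfolded has_field_derivative_def]])
    (use that in \<open>simp_all add: fun_eq_iff\<close>)
  have "continuous_on ({0<..} \<times> {0<..}) (\<lambda>(y, d). partial_c u y d)" using C1 by (simp add: C1_pos_def)
  then have "((\<lambda>z. partial_c u (fst z) (snd z)) \<longlongrightarrow> partial_c u x c) (at (x, c) within {0<..} \<times> {0<..})"
   using assms unfolding continuous_on_def case_prod_beta by (drule_tac bspec[where x = "(x, c)"]) simp_all
  from bounded_linear.tendsto[OF bounded_linear_blinfun_scaleR_left this]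
  show "continuous (at (x, c) within {0<..} \<times> {0<..}) (\<lambda>(y, d). blinfun_scaleR_left (partial_c u y d))"
   unfolding continuous_within case_prod_beta by simp
 qed (use assms in auto)
 then show ?thesis using assms by (simp add: at_within_open[OF _ S] case_prod_beta)
qed

lemma utility_concave: assumes "0 \<le> x" "0 \<le> c" "0 \<le> x'" "0 \<le> c'" "0 \<le> s" "s \<le> 1"
 shows "(1 - s) * u x c + s * u x' c' \<le> u ((1 - s) * x + s * x') ((1 - s) * c + s * c')"
proof (cases "(x, c) = (x', c') \<or> s = 0 \<or> s = 1")
 case True
 then show ?thesis by (auto simp: algebra_simps)
next
 case False
 then show ?thesis using assms
  by (intro less_imp_le[OF concave[unfolded strictly_concave_nonneg_def, rule_format]]) auto
qed

text \<open>By concavity the difference quotients along the segment are at least the full increment;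
  total differentiability identifies their limit at 0 with the linear term.\<close>

lemma gradient_le: assumes p: "0 < x" "0 < c" and q: "0 \<le> x'" "0 \<le> c'"
 shows "u x' c' \<le> u x c + partial_x u x c * (x' - x) + partial_c u x c * (c' - c)"
proof -
 define \<phi> where "\<phi> s = u (x + s * (x' - x)) (c + s * (c' - c))" for s
 define D where "D = partial_x u x c * (x' - x) + partial_c u x c * (c' - c)"
 have "((\<lambda>s. (x + s * (x' - x), c + s * (c' - c))) has_derivative (\<lambda>s. (s * (x' - x), s * (c' - c)))) (at 0)"
  by (auto intro!: derivative_eq_intros)
 moreover have "((\<lambda>(y, d). u y d) has_derivative (\<lambda>(a, b). a * partial_x u x c + b * partial_c u x c))
   (at (x + 0 * (x' - x), c + 0 * (c' - c)))" using utility_has_derivative[OF p] by simp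
 ultimately have "((\<lambda>s. (\<lambda>(y, d). u y d) (x + s * (x' - x), c + s * (c' - c))) has_derivative
   (\<lambda>s. (\<lambda>(a, b). a * partial_x u x c + b * partial_c u x c) (s * (x' - x), s * (c' - c)))) (at 0)"
  by (rule has_derivative_compose)
 then have "(\<phi> has_derivative (\<lambda>s. D * s)) (at 0)" unfolding \<phi>_def D_def by (simp add: algebra_simps)
 then have "(\<phi> has_real_derivative D) (at 0)" by (simp add: has_field_derivative_def)
 then have lim: "((\<lambda>s. (\<phi> s - \<phi> 0) / s) \<longlongrightarrow> D) (at_right 0)"
  by (auto simp: DERIV_def intro: tendsto_within_subset[where S = UNIV])
 have "eventually (\<lambda>s. \<phi> 1 - \<phi> 0 \<le> (\<phi> s - \<phi> 0) / s) (at_right 0)"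
 proof -
  have "\<phi> 1 - \<phi> 0 \<le> (\<phi> s - \<phi> 0) / s" if s: "0 < s" "s < 1" for s
  proof -
   have "(1 - s) * u x c + s * u x' c' \<le> u ((1 - s) * x + s * x') ((1 - s) * c + s * c')"
    using p q s by (intro utility_concave) auto
   then have "(1 - s) * \<phi> 0 + s * \<phi> 1 \<le> \<phi> s" by (simp add: \<phi>_def algebra_simps)
   then show ?thesis using s by (simp add: field_simps)
  qed
  then show ?thesis by (auto simp: eventually_at_right[of 0 1] intro!: exI[of _ 1])
 qed
 with lim have "\<phi> 1 - \<phi> 0 \<le> D" by (intro tendsto_lowerbound) auto
 then show ?thesis by (simp add: \<phi>_def D_def)
qed

text \<open>Strict concavity at the midpoint, together with the tangent bound evaluated at that
  midpoint.\<close>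

lemma gradient_less: assumes p: "0 < x" "0 < c" and q: "0 \<le> x'" "0 \<le> c'" and ne: "(x, c) \<noteq> (x', c')"
 shows "u x' c' < u x c + partial_x u x c * (x' - x) + partial_c u x c * (c' - c)"
proof -
 have "(1 - 1/2) * u x c + 1/2 * u x' c' < u ((1 - 1/2) * x + 1/2 * x') ((1 - 1/2) * c + 1/2 * c')"
  using p q ne by (intro concave[unfolded strictly_concave_nonneg_def, rule_format]) auto
 moreover have "u ((x + x') / 2) ((c + c') / 2) \<le> u x c + partial_x u x c * ((x + x') / 2 - x) + partial_c u x c * ((c + c') / 2 - c)"
  using p q by (intro gradient_le) auto
 moreover have "(x + x') / 2 - x = (x' - x) / 2" "(c + c') / 2 - c = (c' - c) / 2" by (auto simp: field_simps)
 ultimately show ?thesis by (simp add: field_simps)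
qed

lemma partial_x_strict_antimono: assumes "0 < x" "x < x'" "0 < c" shows "partial_x u x' c < partial_x u x c"
proof -
 have "u x' c < u x c + partial_x u x c * (x' - x) + partial_c u x c * (c - c)"
  using assms by (intro gradient_less) auto
 moreover have "u x c < u x' c + partial_x u x' c * (x - x') + partial_c u x' c * (c - c)"
  using assms by (intro gradient_less) auto
 ultimately have "0 < (partial_x u x c - partial_x u x' c) * (x' - x)" by (simp add: algebra_simps)
 then show ?thesis using assms by (simp add: zero_less_mult_iff)
qed

lemma partial_x_less_iff:
 "0 < x ==> 0 < x' ==> 0 < c ==> partial_x u x' c < partial_x u x c \<longleftrightarrow> x < x'"
 using partial_x_strict_antimono[of x x' c] partial_x_strict_antimono[of x' x c] by (cases x x' rule: linorder_cases) auto

lemma partial_x_continuous: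
 "0 < c ==> continuous_on {0<..} (\<lambda>x. partial_x u x c)"
 "0 < x ==> continuous_on {0<..} (\<lambda>c. partial_x u x c)"
proof -
 have c: "continuous_on ({0<..} \<times> {0<..}) (\<lambda>z. partial_x u (fst z) (snd z))"
  using C1 by (simp add: C1_pos_def case_prod_beta)
 show "continuous_on {0<..} (\<lambda>x. partial_x u x c)" if "0 < c"
  using that by (intro continuous_on_compose2[OF c, of _ "\<lambda>x. (x, c)", simplified] continuous_intros) auto
 show "continuous_on {0<..} (\<lambda>c. partial_x u x c)" if "0 < x"
  using that by (intro continuous_on_compose2[OF c, of _ "\<lambda>c. (x, c)", simplified] continuous_intros) auto
qed

section \<open>The inverse marginal utility and the function h\<close>

lemma partial_x_surj: assumes "0 < c" "0 < \<psi>" shows "\<exists>x>0. partial_x u x c = \<psi>"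
proof -
 have "eventually (\<lambda>x. \<psi> < partial_x u x c) (at_right 0)"
  using ux_0[OF assms(1)] by (simp add: filterlim_at_top_dense)
 then obtain b where b: "0 < b" "\<And>y. 0 < y ==> y < b ==> \<psi> < partial_x u y c"
  by (auto simp: eventually_at_right[of 0 1])
 have "eventually (\<lambda>x. partial_x u x c < \<psi>) at_top"
  using ux_inf[OF assms(1)] assms(2) by (rule order_tendstoD)
 then obtain B where B: "\<And>y. B < y ==> partial_x u y c < \<psi>" by (auto simp: eventually_at_top_dense)
 define x1 where "x1 = b / 2"
 define x2 where "x2 = max (b) (B + 1)"
 have "x1 \<le> b" "b \<le> x2" using b by (auto simp: x1_def x2_def)
 then have "x1 \<le> x2" by simp
 moreover have "0 < x1" "\<psi> < partial_x u x1 c" using b by (auto simp: x1_def)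
 moreover have "partial_x u x2 c < \<psi>" using B[of x2] by (auto simp: x2_def)
 ultimately have x: "0 < x1" "x1 \<le> x2" "\<psi> < partial_x u x1 c" "partial_x u x2 c < \<psi>" by auto
 have "continuous_on {x1..x2} (\<lambda>x. partial_x u x c)"
  using x(1) by (intro continuous_on_subset[OF partial_x_continuous(1)[OF assms(1)]]) auto
 then obtain y where "x1 \<le> y" "y \<le> x2" "partial_x u y c = \<psi>"
  using IVT2'[of "\<lambda>x. partial_x u x c" x2 \<psi> x1] x by auto
 then show ?thesis using x by (intro exI[of _ y]) auto
qed

lemma g_inv: assumes "0 < c" "0 < \<psi>" shows "0 < g_inv u \<psi> c" "partial_x u (g_inv u \<psi> c) c = \<psi>"
proof -
 have inj: "inj_on (\<lambda>x. partial_x u x c) {0<..}"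
 proof (rule inj_onI)
  fix x y :: real assume "x \<in> {0<..}" "y \<in> {0<..}" "partial_x u x c = partial_x u y c"
  then show "x = y" using partial_x_less_iff[of x y c] partial_x_less_iff[of y x c] assms by auto
 qed
 obtain x where x: "0 < x" "partial_x u x c = \<psi>" using partial_x_surj[OF assms] by auto
 have "g_inv u \<psi> c = x" unfolding g_inv_def by (rule the_inv_into_f_eq[OF inj x(2)]) (use x in auto)
 then show "0 < g_inv u \<psi> c" "partial_x u (g_inv u \<psi> c) c = \<psi>" using x by auto
qed

lemma g_inv_less_iff: assumes "0 < c" "0 < \<psi>" "0 < a"
 shows "g_inv u \<psi> c < a \<longleftrightarrow> partial_x u a c < \<psi>" "a < g_inv u \<psi> c \<longleftrightarrow> \<psi> < partial_x u a c"
 using partial_x_less_iff[OF g_inv(1)[OF assms(1,2)] assms(3,1)] partial_x_less_iff[OF assms(3) g_inv(1)[OF assms(1,2)] assms(1)]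
 by (simp_all add: g_inv(2)[OF assms(1,2)])

text \<open>\<open>g_inv_less_iff\<close> translates a bound \<open>a\<close> on
  \<open>g_inv\<close> into a strict inequality between \<psi> and \<open>partial_x u a c\<close>
  with \<open>a\<close> fixed, which is an open condition on the pair.\<close>

lemma g_inv_continuous: "continuous_on ({0<..} \<times> {0<..}) (\<lambda>(\<psi>, c). g_inv u \<psi> c)"
 unfolding continuous_on_def
proof
 fix p :: "real \<times> real" assume p: "p \<in> {0<..} \<times> {0<..}"
 let ?G = "at p within {0<..} \<times> {0<..}"
 obtain \<psi> c where pc: "p = (\<psi>, c)" "0 < \<psi>" "0 < c" using p by auto
 have fst: "(fst \<longlongrightarrow> \<psi>) ?G" and snd: "(snd \<longlongrightarrow> c) ?G"
  using pc by (auto intro!: tendsto_eq_intros)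
 have pos: "eventually (\<lambda>z. 0 < fst z \<and> 0 < snd z) ?G"
  by (auto simp: eventually_at_filter intro!: always_eventually)
 have ux: "((\<lambda>z. partial_x u a (snd z)) \<longlongrightarrow> partial_x u a c) ?G" if a: "0 < a" for a
 proof (rule continuous_on_tendsto_compose[OF partial_x_continuous(2)[OF a] snd])
  show "eventually (\<lambda>z. snd z \<in> {0<..}) ?G" using pos by eventually_elim auto
 qed (use pc in auto)
 show "((\<lambda>(\<psi>, c). g_inv u \<psi> c) \<longlongrightarrow> (\<lambda>(\<psi>, c). g_inv u \<psi> c) p) ?G"
  unfolding case_prod_beta
 proof (rule order_tendstoI)
  fix a assume a: "a < g_inv u (fst p) (snd p)"
  show "eventually (\<lambda>z. a < g_inv u (fst z) (snd z)) ?G"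
  proof (cases "0 < a")
   case True
   then have "\<psi> < partial_x u a c" using a g_inv_less_iff(2)[OF pc(3,2) True] pc by simp
   with tendsto_diff[OF ux[OF True] fst] have "eventually (\<lambda>z. 0 < partial_x u a (snd z) - fst z) ?G"
    by (intro order_tendstoD) auto
   with pos show ?thesis by eventually_elim (simp add: g_inv_less_iff(2)[OF _ _ True])
  next
   case False
   with pos show ?thesis by (auto elim!: eventually_mono intro: le_less_trans[OF _ g_inv(1)])
  qed
 next
  fix a assume a: "g_inv u (fst p) (snd p) < a"
  then have "0 < a" using g_inv(1)[OF pc(3,2)] pc by simp
  then have "partial_x u a c < \<psi>" using a g_inv_less_iff(1)[OF pc(3,2)] pc by simp
  with tendsto_diff[OF fst ux[OF \<open>0 < a\<close>]] have "eventually (\<lambda>z. 0 < fst z - partial_x u a (snd z)) ?G"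
   by (intro order_tendstoD) auto
  with pos show "eventually (\<lambda>z. g_inv u (fst z) (snd z) < a) ?G"
   by eventually_elim (simp add: g_inv_less_iff(1)[OF _ _ \<open>0 < a\<close>])
 qed
qed

lemma h_fun_continuous: "continuous_on ({0<..} \<times> {0<..}) (\<lambda>(\<psi>, c). h_fun u \<psi> c)"
proof -
 have c: "continuous_on ({0<..} \<times> {0<..}) (\<lambda>z. partial_c u (fst z) (snd z))"
  using C1 by (simp add: C1_pos_def case_prod_beta)
 have "continuous_on ({0<..} \<times> {0<..}) (\<lambda>z. partial_c u (fst (g_inv u (fst z) (snd z), snd z)) (snd (g_inv u (fst z) (snd z), snd z)))"
  by (intro continuous_on_compose2[OF c, where f = "\<lambda>z. (g_inv u (fst z) (snd z), snd z)"] continuous_intros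
    g_inv_continuous[unfolded case_prod_beta]) (auto intro: g_inv)
 then show ?thesis by (simp add: h_fun_def case_prod_beta)
qed

lemma h_fun_continuous_c: assumes "0 < \<psi>" shows "continuous_on {0<..} (h_fun u \<psi>)"
 using assms by (intro continuous_on_compose2[OF h_fun_continuous, of _ "\<lambda>c. (\<psi>, c)", simplified] continuous_intros) auto

text \<open>The strict tangent inequalities at the two maximisers are added: both points have
  x-derivative \<psi>, so the x-terms cancel and only the c-derivatives remain. No derivative of
  \<open>g_inv\<close> is involved.\<close>

lemma h_fun_strict_antimono: assumes "0 < \<psi>" "0 < c" "c < c'" shows "h_fun u \<psi> c' < h_fun u \<psi> c"
proof -
 let ?x = "g_inv u \<psi> c" and ?x' = "g_inv u \<psi> c'"
 have c': "0 < c'" using assms by simp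
 note g = g_inv[OF assms(2,1)] and g' = g_inv[OF c' assms(1)]
 have "u ?x' c' < u ?x c + partial_x u ?x c * (?x' - ?x) + partial_c u ?x c * (c' - c)"
  using g(1) g'(1) assms by (intro gradient_less) auto
 moreover have "u ?x c < u ?x' c' + partial_x u ?x' c' * (?x - ?x') + partial_c u ?x' c' * (c - c')"
  using g(1) g'(1) assms by (intro gradient_less) auto
 ultimately have "0 < (h_fun u \<psi> c - h_fun u \<psi> c') * (c' - c)"
  unfolding g(2) g'(2) h_fun_def by (simp add: algebra_simps)
 then show ?thesis using assms by (simp add: zero_less_mult_iff)
qed

text \<open>The tangent plane at the maximiser is evaluated with second coordinate 0, where utility
  is nonnegative; \<open>price_le_utility\<close> does the same with first coordinate 0.\<close>

lemma h_fun_le_utility: assumes "0 < \<psi>" "0 < c" shows "c * h_fun u \<psi> c \<le> u (g_inv u \<psi> c) c"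
proof -
 note g = g_inv[OF assms(2,1)]
 have "0 \<le> u (g_inv u \<psi> c) 0" using g by (intro nonneg) auto
 also have "\<dots> \<le> u (g_inv u \<psi> c) c + partial_x u (g_inv u \<psi> c) c * (g_inv u \<psi> c - g_inv u \<psi> c) + partial_c u (g_inv u \<psi> c) c * (0 - c)"
  using g assms by (intro gradient_le) auto
 finally show ?thesis by (simp add: h_fun_def mult.commute)
qed

lemma price_le_utility: assumes "0 < \<psi>" "0 < c" shows "\<psi> * g_inv u \<psi> c \<le> u (g_inv u \<psi> c) c"
proof -
 note g = g_inv[OF assms(2,1)]
 have "0 \<le> u 0 c" using assms by (intro nonneg) auto
 also have "\<dots> \<le> u (g_inv u \<psi> c) c + partial_x u (g_inv u \<psi> c) c * (0 - g_inv u \<psi> c) + partial_c u (g_inv u \<psi> c) c * (c - c)"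
  using g assms by (intro gradient_le) auto
 finally show ?thesis by (simp add: g(2))
qed

lemma utility_scale:
 assumes "0 \<le> \<theta>" "\<theta> \<le> 1" "0 \<le> x" "0 \<le> c" shows "\<theta> * u x c \<le> u (\<theta> * x) c"
proof -
 have "0 \<le> (1 - \<theta>) * u 0 c" using assms nonneg by simp
 moreover have "(1 - \<theta>) * u 0 c + \<theta> * u x c \<le> u ((1 - \<theta>) * 0 + \<theta> * x) ((1 - \<theta>) * c + \<theta> * c)"
  using assms by (intro utility_concave) auto
 ultimately show ?thesis by (simp add: algebra_simps)
qed

lemma h_fun_pos:
 assumes "0 < \<psi>" "0 < c" and inada: "((\<lambda>c. h_fun u \<psi> c) \<longlongrightarrow> 0) at_top"
 shows "0 < h_fun u \<psi> c"
proof -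
 have "0 \<le> h_fun u \<psi> (c + 1)"
 proof (rule tendsto_upperbound[OF inada])
  show "\<forall>\<^sub>F d in at_top. h_fun u \<psi> d \<le> h_fun u \<psi> (c + 1)" unfolding eventually_at_top_dense
   using assms h_fun_strict_antimono[of \<psi> "c + 1"] by (intro exI[of _ "c + 1"]) (auto intro: less_imp_le)
 qed simp
 then show ?thesis using h_fun_strict_antimono[of \<psi> c "c + 1"] assms by simp
qed

end

section \<open>Integration in time\<close>

lemma measurable_ennreal_time:
 "ennreal \<in> restrict_space lborel {s. 0 \<le> s \<and> ennreal s \<le> T} \<rightarrow>\<^sub>M restrict_space borel {..T}"
 by (rule measurable_restrict_space3) auto

lemma space_leb_time [simp]: "space (leb_time T) = {..T}"
 and sets_leb_time [measurable_cong, simp]: "sets (leb_time T) = sets (restrict_space borel {..T})"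
 by (simp_all add: leb_time_def space_restrict_space)

lemma nn_integral_leb_time: assumes "f \<in> borel_measurable (restrict_space borel {..T})"
 shows "(\<integral>\<^sup>+ t. f t \<partial>leb_time T) = (\<integral>\<^sup>+ s. f (ennreal s) * indicator {s. 0 \<le> s \<and> ennreal s \<le> T} s \<partial>lborel)"
proof -
 have "f \<in> borel_measurable (distr (restrict_space lborel {s. 0 \<le> s \<and> ennreal s \<le> T}) (restrict_space borel {..T}) ennreal)"
  using assms by simp
 moreover have "{s::real. 0 \<le> s \<and> ennreal s \<le> T} \<in> sets borel" by measurable
 ultimately show ?thesis
  unfolding leb_time_def by (subst nn_integral_distr[OF measurable_ennreal_time], simp, subst nn_integral_restrict_space) auto
qed

lemma emeasure_leb_time: assumes "A \<in> sets borel" "A \<subseteq> {..T}"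
 shows "emeasure (leb_time T) A = emeasure lborel {s. 0 \<le> s \<and> ennreal s \<in> A}"
proof -
 have A: "A \<in> sets (leb_time T)" using assms by (auto simp: sets_restrict_space_iff)
 have "emeasure (leb_time T) A = (\<integral>\<^sup>+ t. indicator A t \<partial>leb_time T)" using A by simp
 also have "\<dots> = (\<integral>\<^sup>+ s. indicator A (ennreal s) * indicator {s. 0 \<le> s \<and> ennreal s \<le> T} s \<partial>lborel)"
  using assms by (intro nn_integral_leb_time measurable_restrict_space1) auto
 also have "\<dots> = (\<integral>\<^sup>+ s. indicator {s. 0 \<le> s \<and> ennreal s \<in> A} s \<partial>lborel)"
  using assms by (intro nn_integral_cong) (auto simp: indicator_def)
 also have "\<dots> = emeasure lborel {s. 0 \<le> s \<and> ennreal s \<in> A}"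
 proof -
  have "{s::real. 0 \<le> s \<and> ennreal s \<in> A} = {s \<in> space borel. 0 \<le> s \<and> ennreal s \<in> A}" by simp
  also have "\<dots> \<in> sets borel" using assms by measurable
  finally show ?thesis by simp
 qed
 finally show ?thesis .
qed

lemma emeasure_leb_time_interval: assumes "0 \<le> a" "a \<le> b" "ennreal b \<le> T"
 shows "emeasure (leb_time T) {ennreal a<..ennreal b} = ennreal (b - a)"
proof -
 have "{s. 0 \<le> s \<and> ennreal s \<in> {ennreal a<..ennreal b}} = {a<..b}"
  using assms by (auto simp: ennreal_less_iff ennreal_le_iff)
 moreover have "{ennreal a<..ennreal b} \<subseteq> {..T}" using assms by (auto intro: order_trans)
 ultimately show ?thesis using assms by (subst emeasure_leb_time) auto
qed

lemma emeasure_leb_time_point [simp]: assumes "t \<le> T" shows "emeasure (leb_time T) {t} = 0"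
proof -
 have "{s. 0 \<le> s \<and> ennreal s \<in> {t}} \<subseteq> {enn2real t}" by auto
 then have "emeasure lborel {s. 0 \<le> s \<and> ennreal s \<in> {t}} \<le> emeasure lborel {enn2real t}"
  by (intro emeasure_mono) auto
 then show ?thesis using assms by (subst emeasure_leb_time) auto
qed

lemma AE_leb_time_neq: "AE s in leb_time T. s \<noteq> t"
proof (cases "t \<le> T")
 case True
 then have "{t} \<in> null_sets (leb_time T)" by (auto simp: null_sets_def sets_restrict_space_iff)
 from AE_not_in[OF this] show ?thesis by simp
next
 case False
 then show ?thesis by (intro AE_I2) auto
qed

lemma AE_leb_time_less: "AE s in leb_time T. s < T"
proof -
 have "AE s in leb_time T. s \<in> space (leb_time T)" by (rule AE_space)
 with AE_leb_time_neq[of T T] show ?thesis by eventually_elim auto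
qed

lemma emeasure_leb_time_atMost:
 assumes "ennreal b \<le> T" "0 \<le> b" shows "emeasure (leb_time T) {..ennreal b} = ennreal b"
proof -
 have "{s. 0 \<le> s \<and> ennreal s \<in> {..ennreal b}} = {0..b}" using assms by (auto simp: ennreal_le_iff)
 moreover have "{..ennreal b} \<subseteq> {..T}" using assms by auto
 ultimately show ?thesis using assms by (subst emeasure_leb_time) auto
qed

lemma emeasure_leb_time_atMost_le: "emeasure (leb_time T) ({..t} \<inter> {..T}) \<le> t"
proof (cases "min t T")
 case (real b)
 then have "{..t} \<inter> {..T} = {..ennreal b}" "ennreal b \<le> T" "ennreal b \<le> t" by (auto simp: min_def split: if_splits)
 then show ?thesis using emeasure_leb_time_atMost[of b T] real by simp
next
 case top
 then have "t = \<top>" by (auto simp: min_def top_unique split: if_splits)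
 then show ?thesis by simp
qed

lemma sigma_finite_leb_time: "sigma_finite_measure (leb_time T)"
proof
 \<comment> \<open>The set \<open>{T}\<close> covers the point \<infinity> in case \<open>T\<close>
   is infinite, which no bounded interval contains; it has measure 0.\<close>
 let ?A = "insert {T} ((\<lambda>n::nat. {..of_nat n} \<inter> {..T}) ` UNIV)"
 show "\<exists>A. countable A \<and> A \<subseteq> sets (leb_time T) \<and> \<Union> A = space (leb_time T) \<and> (\<forall>a\<in>A. emeasure (leb_time T) a \<noteq> \<infinity>)"
 proof (intro exI[of _ ?A] conjI ballI)
  show "countable ?A" by simp
  show "?A \<subseteq> sets (leb_time T)" by (auto simp: sets_restrict_space_iff)
  show "\<Union> ?A = space (leb_time T)"
  proof -
   have "t \<in> \<Union> ?A" if "t \<le> T" for t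
   proof (cases "t = \<top>")
    case True
    then show ?thesis using that by (auto simp: top_unique)
   next
    case False
    then have "t < \<top>" by (simp add: top.not_eq_extremum)
    then obtain n :: nat where "t \<le> of_nat n" using ennreal_Ex_less_of_nat[of t] by (auto intro: less_imp_le)
    then show ?thesis using that by auto
   qed
   then have "{..T} \<subseteq> \<Union> ?A" by blast
   moreover have "\<Union> ?A \<subseteq> {..T}" by auto
   ultimately show ?thesis unfolding space_leb_time by (rule equalityI[rotated])
  qed
  fix a assume "a \<in> ?A"
  then consider "a = {T}" | n where "a = {..of_nat n} \<inter> {..T}" by auto
  then show "emeasure (leb_time T) a \<noteq> \<infinity>"
  proof cases
   case (2 n)
   then show ?thesis using emeasure_leb_time_atMost_le[of T "of_nat n"] by (auto simp: top_unique)
  qed simp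
 qed
qed

lemma nn_integral_leb_time_subinterval:
 assumes f: "f \<in> borel_measurable (restrict_space borel {..T})" and t: "t \<le> T"
 shows "(\<integral>\<^sup>+ s. f s \<partial>leb_time t) = (\<integral>\<^sup>+ s\<in>{..t}. f s \<partial>leb_time T)"
proof -
 have "f \<in> borel_measurable (restrict_space borel {..t})" by (rule measurable_restrict_mono[OF f]) (use t in auto)
 moreover have "(\<lambda>s. f s * indicator {..t} s) \<in> borel_measurable (restrict_space borel {..T})"
  using f by (intro borel_measurable_times_ennreal measurable_restrict_space1[of "indicator {..t}"]) auto
 ultimately show ?thesis using t by (simp only: nn_integral_leb_time) (intro nn_integral_cong, auto simp: indicator_def)
qed

lemma time_integral_tendsto:
 fixes f :: "ennreal => ennreal"
 assumes f: "f \<in> borel_measurable (leb_time T)" and fin: "(\<integral>\<^sup>+ s. f s \<partial>leb_time T) < \<infinity>" and S: "S \<longlonglongrightarrow> t"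
 shows "(\<lambda>n. \<integral>\<^sup>+ s\<in>{..S n}. f s \<partial>leb_time T) \<longlonglongrightarrow> (\<integral>\<^sup>+ s\<in>{..t}. f s \<partial>leb_time T)"
proof (rule nn_integral_dominated_convergence[OF _ _ f _ fin])
 have m: "(indicator {..v} :: _ => ennreal) \<in> borel_measurable (leb_time T)" for v
  by (simp cong: measurable_cong_sets) (rule measurable_restrict_space1, simp)
 note [measurable] = m f
 show "(\<lambda>s. f s * indicator {..S n} s) \<in> borel_measurable (leb_time T)" "(\<lambda>s. f s * indicator {..t} s) \<in> borel_measurable (leb_time T)" for n
  by (intro borel_measurable_times_ennreal f m)+
 show "AE s in leb_time T. f s * indicator {..S n} s \<le> f s" for n by (intro AE_I2) (auto simp: indicator_def)
 show "AE s in leb_time T. (\<lambda>n. f s * indicator {..S n} s) \<longlonglongrightarrow> f s * indicator {..t} s"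
  using AE_leb_time_neq[of t T]
 proof eventually_elim
  case (elim s)
  have "eventually (\<lambda>n. f s * indicator {..S n} s = f s * indicator {..t} s) sequentially"
  proof (cases "s < t")
   case True
   with S have "eventually (\<lambda>n. s < S n) sequentially" by (rule order_tendstoD)
   then show ?thesis by eventually_elim (use True in \<open>auto simp: indicator_def\<close>)
  next
   case False
   then have "t < s" using elim by auto
   with S have "eventually (\<lambda>n. S n < s) sequentially" by (rule order_tendstoD)
   then show ?thesis by eventually_elim (use False elim in \<open>auto simp: indicator_def\<close>)
  qed
  then show ?case by (rule tendsto_eventually)
 qed
qed

text \<open>Every interval to the right of \<open>a\<close> has positive length, so a property of
  almost every time holds at times arbitrarily close to \<open>a\<close>.\<close>

lemma positive_time_dense:
 assumes ae: "AE s in leb_time T. a < s \<and> s < T \<longrightarrow> P s" and v: "a < v" "v \<le> T"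
 shows "\<exists>s. a < s \<and> s < v \<and> P s"
proof (rule ccontr)
 assume no: "\<not> ?thesis"
 obtain q1 where q1: "a < q1" "q1 < v" using dense[OF v(1)] by auto
 obtain q2 where q2: "q1 < q2" "q2 < v" using dense[OF q1(2)] by auto
 have "q1 < \<top>" "q2 < \<top>" using q1 q2 by (auto intro: less_le_trans)
 then obtain a' b' where ab: "q1 = ennreal a'" "0 \<le> a'" "q2 = ennreal b'" "0 \<le> b'" by (cases q1; cases q2) auto
 have "a' < b'" using q2 ab by (simp add: ennreal_less_iff)
 have I: "{q1<..q2} \<in> sets (leb_time T)" using q2 v by (auto simp: sets_restrict_space_iff intro: order_trans less_imp_le)
 have "AE s in leb_time T. s \<notin> {q1<..q2}"
  using ae by eventually_elim (use no q1 q2 v in \<open>auto intro: less_trans less_le_trans le_less_trans\<close>)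
 then have "emeasure (leb_time T) {q1<..q2} = 0"
  using sets.sets_into_space[OF I] by (subst (asm) AE_iff_measurable[OF I]) auto
 moreover have "emeasure (leb_time T) {q1<..q2} = ennreal (b' - a')"
  unfolding ab using ab q2 v \<open>a' < b'\<close> by (intro emeasure_leb_time_interval) (auto intro: less_imp_le order_trans)
 ultimately show False using \<open>a' < b'\<close> by (simp add: ennreal_eq_0_iff)
qed

section \<open>Optional processes\<close>

lemma antimono_cadlag:
 fixes f :: "ennreal => real"
 assumes anti: "\<And>s t. s \<le> t ==> t \<le> T ==> f t \<le> f s" and low: "\<And>t. t \<le> T ==> L \<le> f t"
  and rc: "right_continuous_path T f" shows "cadlag_path T f" unfolding cadlag_path_def
proof (intro conjI rc allI impI)
 fix t assume t: "0 < t \<and> t \<le> T"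
 let ?a = "INF s\<in>{..<t}. f s"
 have bdd: "bdd_below (f ` {..<t})" using low t by (intro bdd_belowI2[where m = L]) auto
 have ne: "{..<t} \<noteq> {}" using t by auto
 have "(f \<longlongrightarrow> ?a) (at_left t)"
 proof (rule order_tendstoI)
  fix b assume "b < ?a"
  then have "\<And>s. s < t ==> b < f s" using cINF_lower[OF bdd] by (auto intro: less_le_trans)
  then show "eventually (\<lambda>s. b < f s) (at_left t)" using t by (auto simp: eventually_at_left[of 0 t])
 next
  fix b assume "?a < b"
  then obtain s where s: "s < t" "f s < b" using cINF_less_iff[OF ne bdd] by auto
  have "f v < b" if "s < v" "v < t" for v using order_trans[OF less_imp_le[OF that(2)], of T] t
   by (intro le_less_trans[OF anti[OF less_imp_le[OF that(1)]] s(2)]) simp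
  then show "eventually (\<lambda>s. f s < b) (at_left t)"
   using t s by (auto simp: eventually_at_left[of 0 t] intro!: exI[of _ s])
 qed
 then show "\<exists>a. (f \<longlongrightarrow> a) (at_left t)" by auto
qed

context filtered_prob_space
begin

lemma space_optional_sigma [simp]: "space (optional_sigma M F T) = space M \<times> {..T}"
 unfolding optional_sigma_def by (rule space_measure_of) auto

lemma optional_cadlag: assumes "adapted F T X" "\<And>x. x \<in> space M ==> cadlag_path T (\<lambda>t. X t x)"
 shows "optional_process M F T X" unfolding optional_process_def
proof (rule measurableI)
 fix B :: "real set" assume B: "B \<in> sets borel"
 have "(\<lambda>(x, t). X t x) -` B \<inter> space (optional_sigma M F T) = {(x, t) \<in> space M \<times> {..T}. X t x \<in> B}"
  by auto
 also have "\<dots> \<in> sets (optional_sigma M F T)"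
  unfolding optional_sigma_def using assms B by (intro in_measure_of) auto
 finally show "(\<lambda>(x, t). X t x) -` B \<inter> space (optional_sigma M F T) \<in> sets (optional_sigma M F T)" .
qed auto

text \<open>Optional sets are progressive; phrased as measurability of the inclusion, this passes to
  all optional processes by composition.\<close>

lemma measurable_optional_id: assumes t: "t \<le> T"
 shows "(\<lambda>z. z) \<in> F t \<Otimes>\<^sub>M restrict_space borel {..t} \<rightarrow>\<^sub>M optional_sigma M F T"
 unfolding optional_sigma_def
proof (rule measurable_measure_of)
 let ?N = "F t \<Otimes>\<^sub>M restrict_space borel {..t}"
 have sp: "space ?N = space M \<times> {..t}" by (auto simp: space_pair_measure space_F space_restrict_space)
 show "(\<lambda>z. z) \<in> space ?N \<rightarrow> space M \<times> {..T}" using t by (auto simp: sp)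
 fix A assume "A \<in> {{(x, t) \<in> space M \<times> {..T}. X t x \<in> B} | X B.
    adapted F T X \<and> (\<forall>x\<in>space M. cadlag_path T (\<lambda>t. X t x)) \<and> B \<in> sets borel}"
 then obtain X and B :: "real set" where A: "A = {(x, t) \<in> space M \<times> {..T}. X t x \<in> B}" and X: "adapted F T X"
  "\<And>x. x \<in> space M ==> cadlag_path T (\<lambda>t. X t x)" and B: "B \<in> sets borel" by auto
 have "progressive X" by (rule right_continuous_progressive[OF X(1) cadlag_right_continuous[OF X(2)]])
 then have "(\<lambda>(x, s). X s x) \<in> borel_measurable ?N"
  using t by (auto simp: progressive_def measurable_process_def)
 then have "(\<lambda>(x, s). X s x) -` B \<inter> space ?N \<in> sets ?N" using B by (rule measurable_sets)
 also have "(\<lambda>(x, s). X s x) -` B \<inter> space ?N = (\<lambda>z. z) -` A \<inter> space ?N"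
  unfolding A sp using t by auto
 finally show "(\<lambda>z. z) -` A \<inter> space ?N \<in> sets ?N" .
qed auto

lemma optional_progressive: "optional_process M F T X ==> progressive X"
 unfolding progressive_def measurable_process_def optional_process_def
 using measurable_compose[OF measurable_optional_id] by auto

lemma measurable_F_times: "(\<lambda>z. z) \<in> M \<Otimes>\<^sub>M N \<rightarrow>\<^sub>M F t \<Otimes>\<^sub>M N"
proof -
 have [measurable]: "(\<lambda>x. x) \<in> M \<rightarrow>\<^sub>M F t" by (rule measurable_from_subalg[OF sub_F[of t]]) simp
 have "(\<lambda>z. (fst z, snd z)) \<in> M \<Otimes>\<^sub>M N \<rightarrow>\<^sub>M F t \<Otimes>\<^sub>M N"
  by (intro measurable_Pair measurable_compose[OF measurable_fst]) measurable
 then show ?thesis by simp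
qed

lemma progressive_measurable_process: assumes "progressive X" shows "measurable_process M T X"
 using assms measurable_compose[OF measurable_F_times[of "restrict_space borel {..T}" T]]
 unfolding progressive_def measurable_process_def by auto

lemma measurable_optional_id_M: "(\<lambda>z. z) \<in> M \<Otimes>\<^sub>M restrict_space borel {..T} \<rightarrow>\<^sub>M optional_sigma M F T"
 using measurable_compose[OF measurable_F_times measurable_optional_id[OF order_refl]] by simp

lemma measurable_process_path: assumes "measurable_process M T X" "x \<in> space M"
 shows "(\<lambda>t. X t x) \<in> borel_measurable (restrict_space borel {..T})"
 using measurable_compose[OF measurable_Pair1' assms(1)[unfolded measurable_process_def]] assms(2) by simp

lemma time_integral_measurable:
 fixes X :: "ennreal => 'a => ennreal"
 assumes "(\<lambda>(x, s). X s x) \<in> borel_measurable (N \<Otimes>\<^sub>M restrict_space borel {..t})"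
 shows "(\<lambda>x. \<integral>\<^sup>+ s. X s x \<partial>leb_time t) \<in> borel_measurable N"
proof -
 have "(\<lambda>(x, s). X s x) \<in> borel_measurable (N \<Otimes>\<^sub>M leb_time t)"
  using assms by (simp cong: measurable_cong_sets sets_pair_measure_cong)
 then show ?thesis by (rule sigma_finite_measure.borel_measurable_nn_integral[OF sigma_finite_leb_time])
qed

section \<open>Accumulated rates and discount factors\<close>

lemma cumulative_eq: assumes r: "bounded_positive_rate M T r" and "t \<le> T" "x \<in> space M"
 shows "cumulative r t x = (\<integral>\<^sup>+ s\<in>{..t}. ennreal (r s x) \<partial>leb_time T)"
proof -
 have "measurable_process M T r" using r by (auto simp: bounded_positive_rate_def)
 from measurable_process_path[OF this assms(3)] show ?thesis
  unfolding cumulative_def by (intro nn_integral_leb_time_subinterval assms(2)) simp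
qed

lemma cumulative_mono: assumes r: "bounded_positive_rate M T r" and "s \<le> t" "t \<le> T" "x \<in> space M"
 shows "cumulative r s x \<le> cumulative r t x"
 using assms by (simp only: cumulative_eq[OF r] order_trans[OF \<open>s \<le> t\<close> \<open>t \<le> T\<close>])
  (intro nn_integral_mono mult_left_mono, auto simp: indicator_def)

lemma cumulative_finite: assumes r: "bounded_positive_rate M T r" and t: "t \<le> T" "t < \<infinity>" "x \<in> space M"
 shows "cumulative r t x < \<infinity>"
proof -
 obtain K where K: "\<forall>t\<le>T. \<forall>x\<in>space M. 0 < r t x \<and> r t x \<le> K"
  using r by (auto simp: bounded_positive_rate_def)
 have "cumulative r t x \<le> (\<integral>\<^sup>+ s. ennreal K * indicator ({..t} \<inter> {..T}) s \<partial>leb_time T)"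
  unfolding cumulative_eq[OF r t(1,3)] using K t by (intro nn_integral_mono) (auto simp: indicator_def intro!: ennreal_leI)
 also have "\<dots> = ennreal K * emeasure (leb_time T) ({..t} \<inter> {..T})"
  by (rule nn_integral_cmult_indicator) (auto simp: sets_restrict_space_iff)
 also have "\<dots> \<le> ennreal K * t" by (intro mult_left_mono emeasure_leb_time_atMost_le) simp
 also have "\<dots> < \<infinity>" using t by (simp add: ennreal_mult_less_top)
 finally show ?thesis .
qed

lemma discount_finite: assumes "bounded_positive_rate M T r" "t \<le> T" "t < \<infinity>" "x \<in> space M"
 shows "discount r t x = exp (- enn2real (cumulative r t x))"
 using cumulative_finite[OF assms] by (simp add: discount_def)

lemma discount_bounds: "0 \<le> discount r t x" "discount r t x \<le> 1" by (auto simp: discount_def)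

lemma discount_antimono: assumes r: "bounded_positive_rate M T r" and st: "s \<le> t" "t \<le> T" "x \<in> space M"
 shows "discount r t x \<le> discount r s x"
 using cumulative_mono[OF assms] by (auto simp: discount_def top_unique top.not_eq_extremum enn2real_mono)

lemma cumulative_right_tendsto: assumes r: "bounded_positive_rate M T r" and t: "t < T" and x: "x \<in> space M"
 shows "((\<lambda>s. cumulative r s x) \<longlongrightarrow> cumulative r t x) (at_right t)"
proof -
 \<comment> \<open>The total rate may be infinite when \<open>T\<close> is; up to a time
   \<open>v < T\<close>, necessarily finite, it is not.\<close>
 obtain v where v: "t < v" "v < T" using dense[OF t] by auto
 have fin: "cumulative r v x < \<infinity>"
  using v(2) by (intro cumulative_finite[OF r _ _ x]) (auto intro: less_le_trans)
 have m: "(\<lambda>t. ennreal (r t x)) \<in> borel_measurable (restrict_space borel {..T})"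
  using measurable_process_path[OF _ x, of r] r by (simp add: bounded_positive_rate_def)
 have "{..v} \<in> sets (restrict_space borel {..T})" using v(2) by (auto simp: sets_restrict_space_iff)
 with m have m': "(\<lambda>s. ennreal (r s x) * indicator {..v} s) \<in> borel_measurable (leb_time T)"
  by (simp cong: measurable_cong_sets)
 have eq: "cumulative r s x = (\<integral>\<^sup>+ u\<in>{..s}. (ennreal (r u x) * indicator {..v} u) \<partial>leb_time T)" if "s \<le> v" for s
  using that v(2) by (subst cumulative_eq[OF r _ x]) (auto intro!: nn_integral_cong simp: indicator_def)
 show ?thesis
 proof (rule tendsto_at_right_sequentially[OF v(1)])
  fix S assume S: "\<And>n. t < S n" "\<And>n. S n < v" "decseq S" "S \<longlonglongrightarrow> t"
  have "(\<integral>\<^sup>+ s. ennreal (r s x) * indicator {..v} s \<partial>leb_time T) < \<infinity>"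
   using fin v(2) by (simp add: cumulative_eq[OF r _ x])
  from time_integral_tendsto[OF m' this S(4)]
  show "(\<lambda>n. cumulative r (S n) x) \<longlonglongrightarrow> cumulative r t x"
   using S(2) v(1) by (simp add: eq less_imp_le)
 qed
qed

lemma cadlag_discount: assumes r: "bounded_positive_rate M T r" and x: "x \<in> space M"
 shows "cadlag_path T (\<lambda>t. discount r t x)"
proof (rule antimono_cadlag[where L = 0])
 show "right_continuous_path T (\<lambda>t. discount r t x)" unfolding right_continuous_path_def continuous_within
 proof (intro allI impI)
  fix t assume t: "t < T"
  have fin: "cumulative r s x \<noteq> \<infinity>" if "s < T" for s
   using cumulative_finite[OF r less_imp_le[OF that] _ x] less_le_trans[OF that, of \<top>] by auto
  have "((\<lambda>s. enn2real (cumulative r s x)) \<longlongrightarrow> enn2real (cumulative r t x)) (at_right t)"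
   using cumulative_right_tendsto[OF r t x] fin[OF t] by (simp add: tendsto_enn2real top.not_eq_extremum)
  then have "((\<lambda>s. exp (- enn2real (cumulative r s x))) \<longlongrightarrow> exp (- enn2real (cumulative r t x))) (at_right t)"
   by (intro tendsto_exp tendsto_minus)
  moreover have "eventually (\<lambda>s. discount r s x = exp (- enn2real (cumulative r s x))) (at_right t)"
   unfolding eventually_at_right[OF t] using fin t by (intro exI[of _ T]) (auto simp: discount_def)
  ultimately show "((\<lambda>s. discount r s x) \<longlongrightarrow> discount r t x) (at_right t)"
   using fin[OF t] by (simp add: discount_def[of r t] filterlim_cong)
 qed
qed (use discount_antimono[OF r _ _ x] discount_bounds in auto)

lemma cumulative_adapted: assumes "progressive r" "t \<le> T" shows "cumulative r t \<in> borel_measurable (F t)"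
proof -
 have "(\<lambda>(x, s). r s x) \<in> borel_measurable (F t \<Otimes>\<^sub>M restrict_space borel {..t})"
  using assms by (auto simp: progressive_def measurable_process_def)
 then have "(\<lambda>(x, s). ennreal (r s x)) \<in> borel_measurable (F t \<Otimes>\<^sub>M restrict_space borel {..t})"
  unfolding case_prod_beta by measurable
 from time_integral_measurable[OF this] show ?thesis unfolding cumulative_def[abs_def] .
qed

lemma discount_adapted: assumes "progressive r" shows "adapted F T (discount r)" unfolding adapted_def
proof (intro allI impI)
 fix t assume "t \<le> T"
 note [measurable] = cumulative_adapted[OF assms this]
 show "discount r t \<in> borel_measurable (F t)" unfolding discount_def[abs_def] by measurable
qed

lemma optional_discount: assumes "optional_process M F T r" "bounded_positive_rate M T r"
 shows "optional_process M F T (discount r)"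
 using discount_adapted[OF optional_progressive[OF assms(1)]] cadlag_discount[OF assms(2)] by (rule optional_cadlag)

end

section \<open>Price processes\<close>

lemma nn_integral_tendsto_0_of_min:
 fixes g :: "'b => real" assumes g: "integrable N g" and k: "\<And>n. k n \<in> borel_measurable N"
  and lim: "\<And>z. z \<in> space N ==> (\<lambda>n. k n z) \<longlonglongrightarrow> 0"
 shows "(\<lambda>n. \<integral>\<^sup>+ z. ennreal (min (k n z) (g z)) \<partial>N) \<longlonglongrightarrow> 0"
proof -
 have [measurable]: "g \<in> borel_measurable N" using g by simp
 note [measurable] = k
 have "(\<lambda>n. \<integral>\<^sup>+ z. ennreal (min (k n z) (g z)) \<partial>N) \<longlonglongrightarrow> (\<integral>\<^sup>+ z. 0 \<partial>N)"
 proof (rule nn_integral_dominated_convergence[where w = "\<lambda>z. ennreal (g z)"])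
  show "(\<integral>\<^sup>+ z. ennreal (g z) \<partial>N) < \<infinity>"
   using g by (auto simp: real_integrable_def top.not_eq_extremum)
  show "AE z in N. ennreal (min (k n z) (g z)) \<le> ennreal (g z)" for n by (intro AE_I2 ennreal_leI) auto
  show "AE z in N. (\<lambda>n. ennreal (min (k n z) (g z))) \<longlonglongrightarrow> 0"
  proof (intro AE_I2)
   fix z assume z: "z \<in> space N"
   have "(\<lambda>n. ennreal (k n z)) \<longlonglongrightarrow> ennreal 0" by (intro tendsto_ennrealI lim[OF z])
   then have lim': "(\<lambda>n. ennreal (k n z)) \<longlonglongrightarrow> 0" by simp
   show "(\<lambda>n. ennreal (min (k n z) (g z))) \<longlonglongrightarrow> 0"
    by (rule tendsto_sandwich[OF _ _ tendsto_const lim']) (auto intro!: always_eventually ennreal_leI)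
  qed
 qed measurable
 then show ?thesis by simp
qed

text \<open>Uniform integrability of utilities rules out an infinite expenditure: scaling a plan of expenditure
 \<open>I\<close> by \<open>w / I\<close> keeps its utility above \<open>\<mu> w\<close>, although the scaled plans tend to \<open>0\<close> pointwise.\<close>

lemma uniformly_integrable_imp_finite:
 fixes b f :: "'b => real" and \<Phi> :: "real => nat => 'b => real"
 assumes bm: "b \<in> borel_measurable N" and fm: "f \<in> borel_measurable N"
  and b0: "\<And>z. z \<in> space N ==> 0 \<le> b z" and bf: "\<And>z. z \<in> space N ==> \<mu> * b z \<le> f z"
  and \<mu>: "0 < \<mu>" and w: "0 < w"
  and B: "\<And>k. B k \<in> sets N" "incseq B" "AE z in N. z \<in> (\<Union>k. B k)"
  and fin: "\<And>k. (\<integral>\<^sup>+ z\<in>B k. ennreal (b z) \<partial>N) < \<infinity>"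
  and K: "\<And>\<theta> k. 0 < \<theta> ==> \<theta> \<le> 1 ==> ennreal \<theta> * (\<integral>\<^sup>+ z\<in>B k. ennreal (b z) \<partial>N) \<le> ennreal w ==> \<Phi> \<theta> k \<in> K"
  and \<Phi>: "\<And>\<theta> k z. 0 < \<theta> ==> \<theta> \<le> 1 ==> z \<in> B k ==> \<theta> * f z \<le> \<Phi> \<theta> k z"
  and ui: "uniformly_integrable N K" shows "(\<integral>\<^sup>+ z. ennreal (f z) \<partial>N) < \<infinity>"
proof -
 note [measurable] = bm fm B(1)
 have f0: "0 \<le> f z" if "z \<in> space N" for z
  using bf[OF that] b0[OF that] \<mu> by (meson mult_nonneg_nonneg less_imp_le order_trans)
 define I where "I k = (\<integral>\<^sup>+ z\<in>B k. ennreal (b z) \<partial>N)" for k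
 have BN: "z \<in> space N" if "z \<in> B k" for z k using sets.sets_into_space[OF B(1)] that by auto
 \<comment> \<open>Where the absolute value of \<phi> exceeds \<open>g\<close> the integral is at
   most \<epsilon>; elsewhere \<open>h\<close> is below \<open>g\<close>.\<close>
 have split: "(\<integral>\<^sup>+ z. ennreal (h z) \<partial>N) \<le> \<epsilon> + (\<integral>\<^sup>+ z. ennreal (min (h z) (g z)) \<partial>N)"
  if h: "h \<in> borel_measurable N" "\<And>z. z \<in> space N ==> h z \<le> \<bar>\<phi> z\<bar>" and \<phi>: "\<phi> \<in> borel_measurable N"
   and g: "g \<in> borel_measurable N"
   and le: "(\<integral>\<^sup>+ z\<in>{z. g z < \<bar>\<phi> z\<bar>}. ennreal \<bar>\<phi> z\<bar> \<partial>N) \<le> \<epsilon>" for h \<phi> g \<epsilon>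
 proof -
  note [measurable] = h(1) \<phi> g
  have "(\<integral>\<^sup>+ z. ennreal (h z) \<partial>N) \<le> (\<integral>\<^sup>+ z. ennreal \<bar>\<phi> z\<bar> * indicator {z. g z < \<bar>\<phi> z\<bar>} z + ennreal (min (h z) (g z)) \<partial>N)"
  proof (rule nn_integral_mono)
   fix z assume z: "z \<in> space N"
   show "ennreal (h z) \<le> ennreal \<bar>\<phi> z\<bar> * indicator {z. g z < \<bar>\<phi> z\<bar>} z + ennreal (min (h z) (g z))"
   proof (cases "g z < \<bar>\<phi> z\<bar>")
    case True
    then show ?thesis using h(2)[OF z] by (simp add: add_increasing2 ennreal_leI)
   next
    case False
    then have "h z \<le> g z" using h(2)[OF z] by simp
    then show ?thesis using False by simp
   qed
  qed
  also have "\<dots> = (\<integral>\<^sup>+ z\<in>{z. g z < \<bar>\<phi> z\<bar>}. ennreal \<bar>\<phi> z\<bar> \<partial>N) + (\<integral>\<^sup>+ z. ennreal (min (h z) (g z)) \<partial>N)"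
   by (rule nn_integral_add) measurable
  also have "\<dots> \<le> \<epsilon> + (\<integral>\<^sup>+ z. ennreal (min (h z) (g z)) \<partial>N)" using le by (rule add_right_mono)
  finally show ?thesis .
 qed
 have KM: "\<phi> \<in> borel_measurable N" if "\<phi> \<in> K" for \<phi> using ui that by (auto simp: uniformly_integrable_def)
 have I_fin: "(SUP k. I k) \<noteq> \<infinity>"
 proof
  \<comment> \<open>Scaling by \<open>w / J k\<close> spends exactly \<open>w\<close>, so
    \<open>h k\<close> has integral \<open>\<mu> * w\<close> for all \<open>k\<close> although it
    tends to 0 pointwise. Uniform integrability with tolerance \<open>\<mu> * w / 2\<close> then
    bounds \<open>\<mu> * w\<close> by its half in the limit.\<close>
  assume top: "(SUP k. I k) = \<infinity>"
  obtain g where g: "integrable N g" "\<And>z. z \<in> space N ==> 0 \<le> g z"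
   and gK: "\<And>\<phi>. \<phi> \<in> K ==> (\<integral>\<^sup>+ z\<in>{z. g z < \<bar>\<phi> z\<bar>}. ennreal \<bar>\<phi> z\<bar> \<partial>N) \<le> ennreal (\<mu> * w / 2)"
   using ui \<mu> w unfolding uniformly_integrable_def by (metis half_gt_zero mult_pos_pos)
  have Imono: "incseq I"
   unfolding I_def using B(2) by (intro incseq_SucI nn_integral_mono mult_left_mono) (auto simp: indicator_def incseq_def, meson lessI less_imp_le subsetD)
  have I_lim: "I \<longlonglongrightarrow> \<infinity>" using LIMSEQ_SUP[OF Imono] top by simp
  then have "eventually (\<lambda>k. ennreal w < I k) sequentially" by (intro order_tendstoD) auto
  then obtain k0 where k0: "\<And>k. k0 \<le> k ==> ennreal w < I k" by (auto simp: eventually_sequentially)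
  define J where "J k = enn2real (I (k + k0))" for k
  have IJ: "I (k + k0) = ennreal (J k)" for k using fin[of "k + k0"] by (simp add: J_def I_def)
  have wJ: "w < J k" for k using k0[of "k + k0"] IJ[of k] w by (simp add: ennreal_less_iff)
  have J_lim: "filterlim J at_top sequentially" unfolding filterlim_at_top
  proof
   fix Z :: real
   have "eventually (\<lambda>k. ennreal (max 0 Z) < I k) sequentially" using I_lim by (intro order_tendstoD) auto
   then have "eventually (\<lambda>k. ennreal (max 0 Z) < I (k + k0)) sequentially" by (rule eventually_sequentially_seg[THEN iffD2])
   then show "eventually (\<lambda>k. Z \<le> J k) sequentially"
   proof eventually_elim
    case (elim k)
    then have "max 0 Z < J k" by (simp only: IJ ennreal_less_iff[OF max.cobounded1])
    then show ?case by simp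
   qed
  qed
  define h where "h k z = w / J k * (\<mu> * (b z * indicator (B (k + k0)) z))" for k z
  have h_int: "(\<integral>\<^sup>+ z. ennreal (h k z) \<partial>N) = ennreal (\<mu> * w)" for k
  proof -
   have "(\<integral>\<^sup>+ z. ennreal (h k z) \<partial>N) = (\<integral>\<^sup>+ z. ennreal (w / J k * \<mu>) * (ennreal (b z) * indicator (B (k + k0)) z) \<partial>N)"
    using wJ[of k] w \<mu> b0 by (intro nn_integral_cong) (auto simp: h_def ennreal_mult[symmetric] indicator_def)
   also have "\<dots> = ennreal (w / J k * \<mu>) * I (k + k0)" unfolding I_def by (rule nn_integral_cmult) measurable
   also have "\<dots> = ennreal (\<mu> * w)"
    using wJ[of k] w \<mu> unfolding IJ by (subst ennreal_mult[symmetric]) (auto simp: mult.commute)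
   finally show ?thesis .
  qed
  have "(\<lambda>k. \<integral>\<^sup>+ z. ennreal (min (h k z) (g z)) \<partial>N) \<longlonglongrightarrow> 0"
  proof (rule nn_integral_tendsto_0_of_min[OF g(1)])
   show "h k \<in> borel_measurable N" for k unfolding h_def[abs_def] by measurable
   fix z assume z: "z \<in> space N"
   have lim: "(\<lambda>k. w / J k * (\<mu> * b z)) \<longlonglongrightarrow> 0 * (\<mu> * b z)"
    by (intro tendsto_mult tendsto_const real_tendsto_divide_at_top[OF tendsto_const J_lim])
   show "(\<lambda>k. h k z) \<longlonglongrightarrow> 0"
   proof (rule tendsto_sandwich[OF _ _ tendsto_const])
    show "(\<lambda>k. w / J k * (\<mu> * b z)) \<longlonglongrightarrow> 0" using lim by simp
    show "eventually (\<lambda>k. 0 \<le> h k z) sequentially" "eventually (\<lambda>k. h k z \<le> w / J k * (\<mu> * b z)) sequentially"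
     using wJ w \<mu> b0[OF z] by (auto simp: h_def indicator_def intro!: always_eventually mult_nonneg_nonneg divide_nonneg_nonneg less_imp_le[OF less_trans[OF w wJ]])
   qed
  qed
  then have "(\<lambda>k. ennreal (\<mu> * w / 2) + (\<integral>\<^sup>+ z. ennreal (min (h k z) (g z)) \<partial>N)) \<longlonglongrightarrow> ennreal (\<mu> * w / 2) + 0"
   by (intro tendsto_add tendsto_const)
  moreover have "ennreal (\<mu> * w) \<le> ennreal (\<mu> * w / 2) + (\<integral>\<^sup>+ z. ennreal (min (h k z) (g z)) \<partial>N)" for k
  proof -
   have \<theta>: "0 < w / J k" "w / J k \<le> 1" using wJ[of k] w by auto
   have "ennreal (w / J k) * I (k + k0) = ennreal w"
    using wJ[of k] w unfolding IJ by (subst ennreal_mult[symmetric]) auto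
   then have \<Phi>K: "\<Phi> (w / J k) (k + k0) \<in> K" using K[OF \<theta>, of "k + k0"] by (simp add: I_def)
   have "h k z \<le> \<bar>\<Phi> (w / J k) (k + k0) z\<bar>" if z: "z \<in> space N" for z
   proof (cases "z \<in> B (k + k0)")
    case True
    have "h k z = w / J k * (\<mu> * b z)" using True by (simp add: h_def)
    also have "\<dots> \<le> w / J k * f z" using bf[OF z] \<theta> by (intro mult_left_mono) auto
    also have "\<dots> \<le> \<Phi> (w / J k) (k + k0) z" by (rule \<Phi>[OF \<theta> True])
    finally show ?thesis by simp
   qed (simp add: h_def)
   from split[OF _ this KM[OF \<Phi>K] _ gK[OF \<Phi>K]] show ?thesis
    using g(1) unfolding h_int by (simp add: h_def[abs_def])
  qed
  ultimately have "ennreal (\<mu> * w) \<le> ennreal (\<mu> * w / 2)"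
   by (intro LIMSEQ_le_const[where X = "\<lambda>k. ennreal (\<mu> * w / 2) + (\<integral>\<^sup>+ z. ennreal (min (h k z) (g z)) \<partial>N)"]) auto
  then show False using \<mu> w by (simp add: ennreal_le_iff)
 qed
 define S where "S = enn2real (SUP k. I k)"
 have S: "I k \<le> ennreal S" for k
 proof -
  have "ennreal S = (SUP k. I k)" unfolding S_def using I_fin
   by (metis ennreal_enn2real infinity_ennreal_def top.not_eq_extremum)
  then show ?thesis using SUP_upper[of k UNIV I] by simp
 qed
 have S0: "0 \<le> S" by (simp add: S_def)
 \<comment> \<open>All expenditures are now at most \<open>S\<close>, so one scaling makes every
   truncated plan affordable; \<open>S + 1\<close> avoids division by 0.\<close>
 define \<theta> where "\<theta> = min 1 (w / (S + 1))"
 have \<theta>: "0 < \<theta>" "\<theta> \<le> 1" using w S0 by (auto simp: \<theta>_def)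
 have \<theta>I: "ennreal \<theta> * I k \<le> ennreal w" for k
 proof -
  have "ennreal \<theta> * I k \<le> ennreal \<theta> * ennreal S" by (intro mult_left_mono S) auto
  also have "\<dots> = ennreal (\<theta> * S)" using \<theta> S0 by (simp add: ennreal_mult)
  also have "\<theta> * S \<le> w / (S + 1) * (S + 1)" using S0 w by (intro mult_mono) (auto simp: \<theta>_def)
  finally show ?thesis using S0 by (simp add: ennreal_leI)
 qed
 obtain g where g: "integrable N g" "\<And>z. z \<in> space N ==> 0 \<le> g z"
  and gK: "\<And>\<phi>. \<phi> \<in> K ==> (\<integral>\<^sup>+ z\<in>{z. g z < \<bar>\<phi> z\<bar>}. ennreal \<bar>\<phi> z\<bar> \<partial>N) \<le> ennreal 1"
  using ui unfolding uniformly_integrable_def by (metis zero_less_one)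
 have "(\<integral>\<^sup>+ z. ennreal (\<theta> * (f z * indicator (B k) z)) \<partial>N) \<le> ennreal 1 + (\<integral>\<^sup>+ z. ennreal (g z) \<partial>N)" for k
 proof -
  have \<Phi>K: "\<Phi> \<theta> k \<in> K" using K[OF \<theta>] \<theta>I[of k] by (simp add: I_def)
  have "\<theta> * (f z * indicator (B k) z) \<le> \<bar>\<Phi> \<theta> k z\<bar>" if "z \<in> space N" for z
   using order_trans[OF \<Phi>[OF \<theta>, of z k] abs_ge_self] by (cases "z \<in> B k") simp_all
  from split[OF _ this KM[OF \<Phi>K] _ gK[OF \<Phi>K]]
  have "(\<integral>\<^sup>+ z. ennreal (\<theta> * (f z * indicator (B k) z)) \<partial>N) \<le>
   ennreal 1 + (\<integral>\<^sup>+ z. ennreal (min (\<theta> * (f z * indicator (B k) z)) (g z)) \<partial>N)"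
   using g(1) by simp
  also have "\<dots> \<le> ennreal 1 + (\<integral>\<^sup>+ z. ennreal (g z) \<partial>N)"
   by (intro add_left_mono nn_integral_mono ennreal_leI) auto
  finally show ?thesis .
 qed
 then have "(\<integral>\<^sup>+ z. ennreal (\<theta> * f z) \<partial>N) \<le> ennreal 1 + (\<integral>\<^sup>+ z. ennreal (g z) \<partial>N)"
 proof (intro nn_integral_le_of_tendsto[where f = "\<lambda>k z. ennreal (\<theta> * (f z * indicator (B k) z))"])
  show "AE z in N. (\<lambda>k. ennreal (\<theta> * (f z * indicator (B k) z))) \<longlonglongrightarrow> ennreal (\<theta> * f z)"
   using B(3)
  proof eventually_elim
   case (elim z)
   then obtain k where k: "z \<in> B k" by auto
   have "eventually (\<lambda>k. ennreal (\<theta> * (f z * indicator (B k) z)) = ennreal (\<theta> * f z)) sequentially"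
    unfolding eventually_sequentially using k incseqD[OF B(2), of k] by (intro exI[of _ k]) (auto simp: indicator_def)
   then show ?case by (rule tendsto_eventually)
  qed
 qed (auto intro: always_eventually)
 also have "\<dots> < \<infinity>" using g(1) by (auto simp: real_integrable_def top.not_eq_extremum)
 also have "(\<integral>\<^sup>+ z. ennreal (\<theta> * f z) \<partial>N) = ennreal \<theta> * (\<integral>\<^sup>+ z. ennreal (f z) \<partial>N)"
  using \<theta> f0 by (subst nn_integral_cmult[symmetric]) (auto intro!: nn_integral_cong simp: ennreal_mult)
 finally show ?thesis using \<theta> by (auto simp: ennreal_mult_less_top ennreal_eq_0_iff)
qed

context filtered_prob_space
begin

section \<open>Prices as supermartingales\<close>

lemma martingale_set_integral:
 assumes E: "martingale_on M F T E" and pos: "\<And>t x. t \<le> T ==> x \<in> space M ==> 0 \<le> E t x"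
  and st: "s \<le> t" "t \<le> T" and A: "A \<in> sets (F s)" shows "ei A (E t) = ei A (E s)"
proof -
 interpret sigma_finite_subalgebra M "F s" by (rule sigma_finite_sub_F)
 have I: "integrable M (E v)" if "v \<le> T" for v using E that by (auto simp: martingale_on_def)
 have AM: "A \<in> sets M" by (rule F_le_M[OF A])
 have eq: "ei A (E v) = ennreal (\<integral>x\<in>A. E v x \<partial>M)" if "v \<le> T" for v
 proof -
  have "ei A (E v) = (\<integral>\<^sup>+ x. ennreal (indicator A x * E v x) \<partial>M)"
   by (intro nn_integral_cong) (auto simp: indicator_def)
  also have "\<dots> = ennreal (\<integral>x\<in>A. E v x \<partial>M)"
   unfolding set_lebesgue_integral_def using I[OF that] AM pos[OF that]
   by (subst nn_integral_eq_integral) (auto intro!: integrable_real_mult_indicator AE_I2 simp: mult.commute[of "indicator A _"])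
  finally show ?thesis .
 qed
 have "(\<integral>x\<in>A. E t x \<partial>M) = (\<integral>x\<in>A. real_cond_exp M (F s) (E t) x \<partial>M)"
  by (rule real_cond_exp_intA[OF I[OF st(2)] A])
 also have "\<dots> = (\<integral>x\<in>A. E s x \<partial>M)"
 proof -
  have Es: "E s \<in> borel_measurable M" using I[of s] st by auto
  have "AE x in M. real_cond_exp M (F s) (E t) x = E s x" using E st by (auto simp: martingale_on_def)
  then show ?thesis
   unfolding set_lebesgue_integral_def using AM Es by (intro integral_cong_AE) (auto elim: eventually_mono)
 qed
 finally show ?thesis using eq st by simp
qed

text \<open>The value 0 at \<open>T\<close> absorbs the indicator on the right-hand side of the
  equation. Being a downward jump, it preserves the supermartingale property, and right-continuity
  is a condition before \<open>T\<close> only.\<close>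

definition stopped_price :: "'a process => 'a process" where
 "stopped_price \<psi> t x = (if t < T then \<psi> t x else 0)"

lemma stopped_price_nonneg:
 "price_process M F T \<psi> ==> x \<in> space M ==> 0 \<le> stopped_price \<psi> t x"
 by (auto simp: stopped_price_def price_process_def intro!: less_imp_le) (meson infinity_ennreal_def less_imp_le less_le_trans top_greatest)

lemma stopped_price_pos:
 "price_process M F T \<psi> ==> x \<in> space M ==> t < T ==> 0 < \<psi> t x"
 by (auto simp: price_process_def) (meson infinity_ennreal_def less_imp_le less_le_trans top_greatest)

lemma stopped_price_adapted: assumes "price_process M F T \<psi>" shows "adapted F T (stopped_price \<psi>)"
 using assms unfolding adapted_def stopped_price_def[abs_def] price_process_def by auto

lemma stopped_price_rc: assumes "price_process M F T \<psi>" "x \<in> space M"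
 shows "right_continuous_path T (\<lambda>t. stopped_price \<psi> t x)"
 unfolding right_continuous_path_def continuous_within
proof (intro allI impI)
 fix t assume t: "t < T"
 have "((\<lambda>t. \<psi> t x) \<longlongrightarrow> \<psi> t x) (at_right t)"
  using assms t by (auto simp: price_process_def right_continuous_path_def continuous_within)
 moreover have "eventually (\<lambda>s. stopped_price \<psi> s x = \<psi> s x) (at_right t)"
  unfolding eventually_at_right[OF t] by (intro exI[of _ T]) (auto simp: stopped_price_def t)
 ultimately show "((\<lambda>t. stopped_price \<psi> t x) \<longlongrightarrow> stopped_price \<psi> t x) (at_right t)"
  using t by (simp add: stopped_price_def[of \<psi> t] filterlim_cong)
qed

text \<open>The last clause encodes that the discount factor decreases. The representation of the
  price holds for each time separately, so the exceptional set depends on the pair of times.\<close>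

lemma price_decomposition: assumes "price_process M F T \<psi>"
 obtains E where "martingale_on M F T E" "\<And>t x. t \<le> T ==> x \<in> space M ==> 0 < E t x"
  "\<And>t. t \<le> T ==> (\<integral>\<^sup>+ x. ennreal (E t x) \<partial>M) = 1"
  "\<And>t. t < T ==> AE x in M. \<psi> t x \<le> E t x"
  "\<And>s t. s \<le> t ==> t < T ==> AE x in M. \<psi> t x \<le> \<psi> s x / E s x * E t x"
proof -
 obtain \<rho> E where \<rho>: "bounded_positive_rate M T \<rho>" and E: "exponential_martingale M F T E"
  and \<psi>: "\<And>t. t \<le> T ==> AE x in M. \<psi> t x = discount \<rho> t x * E t x"
  using assms by (auto simp: price_process_def)
 have mart: "martingale_on M F T E" and pos: "\<And>t x. t \<le> T ==> x \<in> space M ==> 0 < E t x"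
  and one: "\<And>t. t \<le> T ==> (\<integral>x. E t x \<partial>M) = 1"
  using E by (auto simp: exponential_martingale_def)
 show thesis
 proof (rule that[OF mart pos])
  show "(\<integral>\<^sup>+ x. ennreal (E t x) \<partial>M) = 1" if "t \<le> T" for t
   using mart that one pos[OF that] by (subst nn_integral_eq_integral) (auto simp: martingale_on_def intro!: AE_I2 less_imp_le)
  show "AE x in M. \<psi> t x \<le> E t x" if "t < T" for t using \<psi>[OF less_imp_le[OF that]] AE_space
  proof eventually_elim
   case (elim x)
   have "discount \<rho> t x * E t x \<le> 1 * E t x"
    using discount_bounds pos[of t x] elim(2) that by (intro mult_right_mono) (auto intro: less_imp_le)
   then show ?case using elim(1) by simp
  qed
  show "AE x in M. \<psi> t x \<le> \<psi> s x / E s x * E t x" if st: "s \<le> t" "t < T" for s t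
   using \<psi>[OF less_imp_le[OF st(2)]] \<psi>[OF order_trans[OF st(1) less_imp_le[OF st(2)]]] AE_space
  proof eventually_elim
   case (elim x)
   have "discount \<rho> t x * E t x \<le> discount \<rho> s x * E t x"
    using discount_antimono[OF \<rho> st(1) _ elim(3)] pos[of t x] elim(3) st
    by (intro mult_right_mono) (auto intro: less_imp_le)
   moreover have "E s x > 0" using pos[of s x] elim(3) st by auto
   ultimately show ?case using elim(1,2) by simp
  qed
 qed
qed

text \<open>Given \<open>F s\<close>, the ratio \<open>\<psi> s / E s\<close> is known and only
  \<open>E t\<close> is averaged. The second claim, with \<open>E T\<close> as witness, later
  supplies \<open>end_bound\<close>; the third bounds the cost of constant plans.\<close>

lemma stopped_price_supermart: assumes P: "price_process M F T \<psi>" shows "supermart {..T} (stopped_price \<psi>)"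
  and "\<exists>Z. integrable M Z \<and> (\<forall>t\<le>T. \<forall>A\<in>sets (F t).
   ei A (stopped_price \<psi> t) \<le> ei A Z)"
  and "(\<integral>\<^sup>+ x. ennreal (\<psi> 0 x) \<partial>M) \<le> 1"
proof -
 obtain E where E: "martingale_on M F T E" "\<And>t x. t \<le> T ==> x \<in> space M ==> 0 < E t x"
  and one: "\<And>t. t \<le> T ==> (\<integral>\<^sup>+ x. ennreal (E t x) \<partial>M) = 1"
  and le: "\<And>t. t < T ==> AE x in M. \<psi> t x \<le> E t x"
  and dec: "\<And>s t. s \<le> t ==> t < T ==> AE x in M. \<psi> t x \<le> \<psi> s x / E s x * E t x"
  by (rule price_decomposition[OF P]) blast
 have ad: "stopped_price \<psi> t \<in> borel_measurable (F t)" if "t \<le> T" for t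
  using stopped_price_adapted[OF P] that by (auto simp: adapted_def)
 have Em: "E t \<in> borel_measurable (F t)" and EI: "integrable M (E t)" if "t \<le> T" for t
  using E(1) that by (auto simp: martingale_on_def adapted_def)
 have le': "AE x in M. stopped_price \<psi> t x \<le> E t x" if "t \<le> T" for t
 proof (cases "t < T")
  case True
  then show ?thesis using le by (simp add: stopped_price_def)
 next
  case False
  then show ?thesis using E(2)[OF that] by (auto simp: stopped_price_def intro!: AE_I2 less_imp_le)
 qed
 have int: "integrable M (stopped_price \<psi> t)" if t: "t \<le> T" for t
 proof (rule Bochner_Integration.integrable_bound[OF EI[OF t]])
  show "stopped_price \<psi> t \<in> borel_measurable M" by (rule F_measurable_M[OF ad[OF t]])
  show "AE x in M. norm (stopped_price \<psi> t x) \<le> norm (E t x)" using le'[OF t] AE_space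
  proof eventually_elim
   case (elim x)
   then show ?case using stopped_price_nonneg[OF P elim(2), of t] by simp
  qed
 qed
 have E_const: "ei A (E t) = ei A (E s)" if "s \<le> t" "t \<le> T" "A \<in> sets (F s)" for s t A
  using martingale_set_integral[OF E(1) less_imp_le[OF E(2)] that] .
 show "supermart {..T} (stopped_price \<psi>)" unfolding supermart_def
 proof (intro conjI ballI impI)
  fix t assume t: "t \<in> {..T}"
  then show "stopped_price \<psi> t \<in> borel_measurable (F t)" "integrable M (stopped_price \<psi> t)"
   using ad int by auto
  show "0 \<le> stopped_price \<psi> t x" if "x \<in> space M" for x by (rule stopped_price_nonneg[OF P that])
 next
  fix s t A assume "s \<in> {..T}" "t \<in> {..T}" and st: "s \<le> t" and A: "A \<in> sets (F s)"
  show "ei A (stopped_price \<psi> t) \<le> ei A (stopped_price \<psi> s)"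
  proof (cases "t < T")
   case False
   then show ?thesis by (simp add: stopped_price_def)
  next
   case True
   then have tT: "t \<le> T" and sT: "s < T" "s \<le> T" using st by auto
   interpret sigma_finite_subalgebra M "F s" by (rule sigma_finite_sub_F)
   note [measurable] = Em[OF sT(2)] F_measurable_M[OF Em[OF tT]] F_measurable_M[OF Em[OF sT(2)]]
   have \<psi>m [measurable]: "\<psi> s \<in> borel_measurable (F s)" using P sT by (auto simp: price_process_def adapted_def)
   have [measurable]: "\<psi> s \<in> borel_measurable M" by (rule F_measurable_M[OF \<psi>m])
   have Am [measurable]: "A \<in> sets (F s)" by (rule A)
   have [measurable]: "A \<in> sets M" by (rule F_le_M[OF A])
   have cond: "AE x in M. ennreal (E s x) = nn_cond_exp M (F s) (\<lambda>x. ennreal (E t x)) x"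
    by (rule nn_cond_exp_charact) (auto simp: E_const[OF st tT])
   let ?d = "\<lambda>x. ennreal (\<psi> s x / E s x) * indicator A x"
   have "ei A (stopped_price \<psi> t) \<le> (\<integral>\<^sup>+ x. ?d x * ennreal (E t x) \<partial>M)"
   proof (rule nn_integral_mono_AE)
    show "AE x in M. ennreal (stopped_price \<psi> t x) * indicator A x \<le> ?d x * ennreal (E t x)"
     using dec[OF st True] AE_space
    proof eventually_elim
     case (elim x)
     have "0 \<le> \<psi> s x / E s x" "0 \<le> E t x"
      using E(2)[OF sT(2) elim(2)] E(2)[OF tT elim(2)] stopped_price_pos[OF P elim(2) sT(1)] by auto
     then show ?case
      using elim(1) True by (auto simp: stopped_price_def indicator_def ennreal_mult[symmetric] intro!: ennreal_leI)
    qed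
   qed
   also have "\<dots> = (\<integral>\<^sup>+ x. ?d x * nn_cond_exp M (F s) (\<lambda>x. ennreal (E t x)) x \<partial>M)"
    by (rule nn_cond_exp_intg[symmetric]) measurable
   also have "\<dots> = (\<integral>\<^sup>+ x. ?d x * ennreal (E s x) \<partial>M)"
    using cond by (intro nn_integral_cong_AE) (auto elim!: eventually_mono)
   also have "\<dots> = ei A (stopped_price \<psi> s)"
   proof (rule nn_integral_cong)
    fix x assume x: "x \<in> space M"
    show "?d x * ennreal (E s x) = ennreal (stopped_price \<psi> s x) * indicator A x"
     using E(2)[OF sT(2) x] stopped_price_pos[OF P x sT(1)] sT
     by (auto simp: stopped_price_def indicator_def ennreal_mult[symmetric])
   qed
   finally show ?thesis .
  qed
 qed
 show "\<exists>Z. integrable M Z \<and> (\<forall>t\<le>T. \<forall>A\<in>sets (F t).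
   ei A (stopped_price \<psi> t) \<le> ei A Z)"
 proof (intro exI[of _ "E T"] conjI allI impI ballI EI)
  fix t A assume t: "t \<le> T" and A: "A \<in> sets (F t)"
  have "ei A (stopped_price \<psi> t) \<le> ei A (E t)"
   using le'[OF t] by (intro nn_integral_mono_AE) (auto elim!: eventually_mono intro!: mult_right_mono ennreal_leI)
  then show "ei A (stopped_price \<psi> t) \<le> ei A (E T)" using E_const[OF t order_refl A] by simp
 qed auto
 show "(\<integral>\<^sup>+ x. ennreal (\<psi> 0 x) \<partial>M) \<le> 1"
 proof -
  have "(\<integral>\<^sup>+ x. ennreal (\<psi> 0 x) \<partial>M) \<le> (\<integral>\<^sup>+ x. ennreal (E 0 x) \<partial>M)"
   using le[OF T_pos] by (intro nn_integral_mono_AE) (auto elim!: eventually_mono intro!: ennreal_leI)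
  then show ?thesis using one[of 0] by simp
 qed
qed

end

section \<open>The marginal value process\<close>

lemma nn_integral_stieltjes_const:
 assumes "0 \<le> c" shows "(\<integral>\<^sup>+ t. f t \<partial>stieltjes T (\<lambda>_. c)) = f 0 * ennreal c"
proof -
 have sub: "(\<lambda>t. {..t}) ` {..T} \<subseteq> Pow {..T}" by auto
 have sp: "space (stieltjes T (\<lambda>_. c)) = {..T}" unfolding stieltjes_def by (rule space_extend_measure[OF sub])
 have meas: "{..t} \<in> sets (stieltjes T (\<lambda>_. c))" if "t \<le> T" for t
  using that unfolding stieltjes_def sets_extend_measure[OF sub] by auto
 have em: "emeasure (stieltjes T (\<lambda>_. c)) {..t} = ennreal c" if "t \<le> T" for t
  using assms that by (intro emeasure_stieltjes) (auto simp: right_continuous_path_def mono_on_def)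
 have "emeasure (stieltjes T (\<lambda>_. c)) ({..T} - {..0}) = ennreal c - ennreal c"
  using em meas by (subst emeasure_Diff) auto
 then have "{..T} - {..0} \<in> null_sets (stieltjes T (\<lambda>_. c))" using meas by (auto simp: null_sets_def)
 from AE_not_in[OF this] have "AE t in stieltjes T (\<lambda>_. c). f t = f 0"
  using AE_space by eventually_elim (auto simp: sp)
 then have "(\<integral>\<^sup>+ t. f t \<partial>stieltjes T (\<lambda>_. c)) = (\<integral>\<^sup>+ t. f 0 \<partial>stieltjes T (\<lambda>_. c))"
  by (rule nn_integral_cong_AE)
 then show ?thesis using em[of T] by (simp add: sp)
qed

locale backward_setting = filtered_prob_space M F T
 for M :: "'a measure" and F :: "ennreal => 'a measure" and T :: ennreal +
 fixes n :: nat and u :: "nat => real => real => real" and w \<gamma> :: "nat => real" and lam :: real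
  and r \<psi>x \<psi>c :: "'a process" assumes n: "1 \<le> n" and wealth: "\<And>i. i \<in> {1..n} ==> 0 < w i"
  and u_nonneg: "\<And>i x c. i \<in> {1..n} ==> 0 \<le> x ==> 0 \<le> c ==> 0 \<le> u i x c"
  and U: "assumption_U M F T n u w r \<psi>x \<psi>c" and P: "assumption_P M F T r \<psi>x \<psi>c"
  and Inada_0: "\<And>i \<psi>. i \<in> {1..n} ==> 0 < \<psi> ==> filterlim (\<lambda>c. h_fun (u i) \<psi> c) at_top (at_right 0)"
  and Inada_inf: "\<And>i \<psi>. i \<in> {1..n} ==> 0 < \<psi> ==> ((\<lambda>c. h_fun (u i) \<psi> c) \<longlongrightarrow> 0) at_top"
  and weights_pos: "\<And>i. i \<in> {1..n} ==> 0 < \<gamma> i" and lam_pos: "0 < lam"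
begin

lemma utility_agent: assumes "i \<in> {1..n}" shows "utility (u i)"
 using U assms u_nonneg[OF assms] unfolding assumption_U_def C2_pos_def by unfold_locales auto

lemma price_x: "price_process M F T \<psi>x" and price_c: "price_process M F T \<psi>c"
 and rate: "bounded_positive_rate M T r" and rate_optional: "optional_process M F T r"
 using P by (auto simp: assumption_P_def)

lemma discount_pos: "t < T ==> x \<in> space M ==> 0 < discount r t x"
 by (subst discount_finite[OF rate]) (auto intro: less_le_trans)

lemma exp_cumulative: assumes "t < T" "x \<in> space M" shows "exp (enn2real (cumulative r t x)) = 1 / discount r t x"
 using assms less_le_trans[OF assms(1), of \<top>]
 by (subst discount_finite[OF rate]) (auto simp: exp_minus field_simps)

lemma optional_measurable:
 "optional_process M F T X ==> (\<lambda>z. X (snd z) (fst z)) \<in> borel_measurable (optional_sigma M F T)"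
 unfolding optional_process_def case_prod_beta .

text \<open>The events \<open>snd z < c\<close> come from the deterministic step process that drops
  from 1 to 0 at \<open>c\<close>, which is adapted and cadlag.\<close>

lemma measurable_snd_optional: "snd \<in> borel_measurable (optional_sigma M F T)"
proof (rule borel_measurableI_less)
 fix c :: ennreal
 define X :: "'a process" where "X t x = (if t < c then 1 else 0)" for t x
 have rc: "right_continuous_path T (\<lambda>t. X t x)" for x unfolding right_continuous_path_def continuous_within
 proof (intro allI impI)
  fix t assume t: "t < T"
  have "eventually (\<lambda>s. X s x = X t x) (at_right t)"
  proof (cases "t < c")
   case True
   then show ?thesis by (auto simp: eventually_at_right[OF True] X_def intro!: exI[of _ c])
  next
   case False
   then show ?thesis using t by (auto simp: eventually_at_right[OF t] X_def not_less intro!: exI[of _ T])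
  qed
  then show "((\<lambda>t. X t x) \<longlongrightarrow> X t x) (at_right t)" by (rule tendsto_eventually)
 qed
 have "optional_process M F T X"
 proof (rule optional_cadlag)
  show "adapted F T X" by (auto simp: adapted_def X_def[abs_def])
  show "cadlag_path T (\<lambda>t. X t x)" for x by (rule antimono_cadlag[where L = 0, OF _ _ rc]) (auto simp: X_def)
 qed
 note [measurable] = optional_measurable[OF this]
 have "{z \<in> space (optional_sigma M F T). snd z < c} = {z \<in> space (optional_sigma M F T). X (snd z) (fst z) = 1}"
  by (auto simp: X_def)
 also have "\<dots> \<in> sets (optional_sigma M F T)" by measurable
 finally show "{z \<in> space (optional_sigma M F T). snd z < c} \<in> sets (optional_sigma M F T)" .
qed

lemma optional_measurable_product:
 assumes "f \<in> borel_measurable (optional_sigma M F T)" shows "f \<in> borel_measurable (M \<Otimes>\<^sub>M leb_time T)"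
proof -
 have "f \<in> borel_measurable (M \<Otimes>\<^sub>M restrict_space borel {..T})"
  using measurable_compose[OF measurable_optional_id_M assms] by simp
 then show ?thesis by (simp cong: measurable_cong_sets sets_pair_measure_cong)
qed

section \<open>Affordable plans and integrability of the marginal value\<close>

lemma optional_const: "optional_process M F T (\<lambda>t x. c)" by (auto simp: optional_process_def)

text \<open>A constant \<open>C\<close> is a single purchase at time 0, and the mean of
  \<open>\<psi>c 0\<close> is at most 1, so it costs at most \<open>c\<close>.\<close>

lemma budget_set_const_plan:
 assumes x: "optional_process M F T x" "\<And>t y. t \<le> T ==> y \<in> space M ==> 0 \<le> x t y" and c: "0 \<le> c"
  and A: "A \<in> borel_measurable M" "AE y in M. (\<integral>\<^sup>+ t. ennreal (\<psi>x t y * x t y) \<partial>leb_time T) = A y"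
  and cost: "(\<integral>\<^sup>+ y. A y \<partial>M) + ennreal c \<le> ennreal v"
 shows "(x, \<lambda>t y. c) \<in> budget_set M F T \<psi>x \<psi>c v"
proof -
 have "\<psi>c 0 \<in> borel_measurable (F 0)" using price_c by (auto simp: price_process_def adapted_def)
 then have [measurable]: "\<psi>c 0 \<in> borel_measurable M" by (rule F_measurable_M)
 note [measurable] = A(1)
 have "total_price M T \<psi>x \<psi>c x (\<lambda>t y. c) = (\<integral>\<^sup>+ y. A y + ennreal (\<psi>c 0 y) * ennreal c \<partial>M)"
  unfolding total_price_def nn_integral_stieltjes_const[OF c]
  using A(2) by (intro nn_integral_cong_AE) (auto elim!: eventually_mono)
 also have "\<dots> = (\<integral>\<^sup>+ y. A y \<partial>M) + (\<integral>\<^sup>+ y. ennreal (\<psi>c 0 y) \<partial>M) * ennreal c"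
  by (subst nn_integral_add, measurable) (simp add: nn_integral_multc)
 also have "\<dots> \<le> (\<integral>\<^sup>+ y. A y \<partial>M) + 1 * ennreal c"
  by (intro add_left_mono mult_right_mono stopped_price_supermart(3)[OF price_c]) auto
 also have "\<dots> \<le> ennreal v" using cost by simp
 finally show ?thesis
  using x c unfolding budget_set_def by (auto simp: optional_const right_continuous_path_def mono_on_def)
qed

lemma emeasure_product_time:
 assumes "B \<in> sets (leb_time T)" shows "emeasure (M \<Otimes>\<^sub>M leb_time T) (space M \<times> B) = emeasure (leb_time T) B"
proof -
 interpret L: sigma_finite_measure "leb_time T" by (rule sigma_finite_leb_time)
 show ?thesis using assms by (simp add: L.emeasure_pair_measure_Times emeasure_space_1)
qed

lemma AE_product_time_less: "AE z in M \<Otimes>\<^sub>M leb_time T. snd z < T"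
proof -
 have T: "{T} \<in> sets (leb_time T)" by (auto simp: sets_restrict_space_iff)
 then have "space M \<times> {T} \<in> null_sets (M \<Otimes>\<^sub>M leb_time T)"
  using emeasure_product_time[OF T] by (auto intro!: null_setsI)
 from AE_not_in[OF this] AE_space show ?thesis by eventually_elim (auto simp: space_pair_measure)
qed

text \<open>The optional sigma-algebra is generated by cadlag processes while \<open>\<psi>x\<close>
  is only right-continuous. Plans are built from this version, which almost surely agrees with
  \<open>\<psi>x\<close> before \<open>T\<close>.\<close>

definition price_version :: "'a process" where
 "price_version = regularised (stopped_price \<psi>x)"

lemma price_version_super: "supermart (grid_times T) (stopped_price \<psi>x)"
 by (rule supermart_subset[OF stopped_price_supermart(1)[OF price_x]]) (auto dest: grid_times_le)

lemma price_version_optional: "optional_process M F T price_version" unfolding price_version_def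
proof (rule optional_cadlag[OF _ cadlag_regularised])
 show "adapted F T (regularised (stopped_price \<psi>x))"
  using supermartD(1)[OF supermart_regularised[OF price_version_super]] by (auto simp: adapted_def)
qed

lemma price_version_nonneg: "t \<le> T ==> x \<in> space M ==> 0 \<le> price_version t x"
 unfolding price_version_def by (rule regularised_nonneg[OF price_version_super])

lemma price_version_eq: "AE y in M. \<forall>t<T. price_version t y = \<psi>x t y"
proof -
 have "AE y in M. \<forall>t\<le>T. regularised (stopped_price \<psi>x) t y = stopped_price \<psi>x t y"
  by (rule AE_regularised_eq[OF price_version_super]) (rule stopped_price_rc[OF price_x])
 then show ?thesis by eventually_elim (auto simp: price_version_def stopped_price_def)
qed

text \<open>By \<open>h_fun_le_utility\<close> the utility of consuming \<open>g_inv\<close> bounds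
  \<open>c\<close> times the integrand, and \<open>uniformly_integrable_imp_finite\<close> reduces
  its integrability to affordable plans: agent \<open>i\<close> spends at most
  \<open>w i / 2\<close> on scaled, truncated consumption, and agent 1 buys the constant
  \<open>c\<close> for at most \<open>w 1 / 2\<close>. The halves allow
  \<open>i = 1\<close>.\<close>

lemma utility_integrable_small: assumes i: "i \<in> {1..n}" and \<mu>: "0 < \<mu>" and c: "0 < c" "c \<le> w 1 / 2"
 shows "(\<integral>\<^sup>+ y. \<integral>\<^sup>+ t. ennreal (discount r t y * h_fun (u i) (\<mu> / discount r t y * price_version t y) c *
  indicator {t. t < T \<and> 0 < price_version t y} t) \<partial>leb_time T \<partial>M) < \<infinity>"
proof -
 interpret ut: utility "u i" by (rule utility_agent[OF i])
 interpret L: sigma_finite_measure "leb_time T" by (rule sigma_finite_leb_time)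
 let ?O = "optional_sigma M F T" and ?N = "M \<Otimes>\<^sub>M leb_time T"
 have spN: "space ?N = space M \<times> {..T}" by (simp add: space_pair_measure)
 define p where "p z = price_version (snd z) (fst z)" for z
 define d where "d z = discount r (snd z) (fst z)" for z
 note [measurable] = measurable_snd_optional
 have [measurable]: "p \<in> borel_measurable ?O" "d \<in> borel_measurable ?O" unfolding p_def d_def
  by (rule optional_measurable[OF price_version_optional], rule optional_measurable[OF optional_discount[OF rate_optional rate]])
 have d_pos: "0 < d z" if "z \<in> space M \<times> {..T}" "snd z < T" for z
  using discount_pos[of "snd z" "fst z"] that by (auto simp: d_def)
 have d_nonneg: "0 \<le> d z" for z by (simp add: d_def discount_bounds)
 have p_nonneg: "0 \<le> p z" if "z \<in> space M \<times> {..T}" for z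
  using that by (auto simp: p_def intro!: price_version_nonneg)
 define G where "G \<psi> = (if \<psi> \<in> {0<..} then g_inv (u i) \<psi> c else 0)" for \<psi>
 define V where "V x = (if x \<in> {0<..} then u i x c else u i 0 c)" for x
 have "continuous_on {0<..} (\<lambda>\<psi>. g_inv (u i) \<psi> c)"
  using c(1) by (intro continuous_on_compose2[OF ut.g_inv_continuous, of _ "\<lambda>\<psi>. (\<psi>, c)", simplified] continuous_intros) auto
 then have [measurable]: "G \<in> borel_measurable borel"
  unfolding G_def[abs_def] by (intro borel_measurable_continuous_on_if) auto
 have "continuous_on {0<..} (\<lambda>x. u i x c)" using ut.partial_derivatives(1)[OF _ c(1)]
  by (intro continuous_at_imp_continuous_on ballI) (auto intro: DERIV_isCont)
 then have [measurable]: "V \<in> borel_measurable borel"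
  unfolding V_def[abs_def] by (intro borel_measurable_continuous_on_if) auto
 have V: "V x = u i x c" if "0 \<le> x" for x using that by (auto simp: V_def)
 define xs where "xs z = (if snd z < T then G (\<mu> / d z * p z) else 0)" for z
 have [measurable]: "xs \<in> borel_measurable ?O" unfolding xs_def[abs_def] by measurable
 have G_nonneg: "0 \<le> G \<psi>" for \<psi> using ut.g_inv(1)[OF c(1), of \<psi>] by (auto simp: G_def)
 then have xs_nonneg: "0 \<le> xs z" for z by (auto simp: xs_def)
 define b where "b z = p z * xs z" for z
 define f where "f z = d z * V (xs z)" for z
 have bO [measurable]: "b \<in> borel_measurable ?O" and fO [measurable]: "f \<in> borel_measurable ?O"
  unfolding b_def[abs_def] f_def[abs_def] by measurable
 \<comment> \<open>Bounded time and bounded spending keep the expenditure on each \<open>B k\<close>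
   finite even for infinite \<open>T\<close>.\<close>
 define B where "B k = {z \<in> space ?O. snd z \<le> of_nat k \<and> b z \<le> real k}" for k
 have BO [measurable]: "B k \<in> sets ?O" for k unfolding B_def by measurable
 have BN [measurable]: "B k \<in> sets ?N" for k
 proof -
  have "(indicator (B k) :: _ => real) \<in> borel_measurable ?N" by (rule optional_measurable_product) measurable
  then have "{z \<in> space ?N. indicator (B k) z = (1::real)} \<in> sets ?N" by measurable
  also have "{z \<in> space ?N. indicator (B k) z = (1::real)} = B k" by (auto simp: B_def spN indicator_def)
  finally show ?thesis .
 qed
 define \<Phi> where "\<Phi> \<theta> k = (\<lambda>(y, t). discount r t y * u i (\<theta> * xs (y, t) * indicator (B k) (y, t)) c)" for \<theta> k
 define K where "K = {(\<lambda>(y, t). discount r t y * u i (x i t y) (\<Sum>j=1..n. C j t y)) | x C.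
     \<forall>j\<in>{1..n}. (x j, C j) \<in> budget_set M F T \<psi>x \<psi>c (w j)}"
 have ui: "uniformly_integrable ?N K" using U i unfolding assumption_U_def K_def by blast
 have "(\<integral>\<^sup>+ z. ennreal (f z) \<partial>?N) < \<infinity>"
 proof (rule uniformly_integrable_imp_finite[where b = b and \<mu> = \<mu> and B = B and w = "w i / 2" and \<Phi> = \<Phi> and K = K])
  show "b \<in> borel_measurable ?N" "f \<in> borel_measurable ?N"
   by (rule optional_measurable_product[OF bO], rule optional_measurable_product[OF fO])
  show "0 < w i / 2" using wealth[OF i] by simp
  show "0 \<le> b z" if "z \<in> space ?N" for z using p_nonneg xs_nonneg that by (auto simp: b_def spN)
  show "\<mu> * b z \<le> f z" if z: "z \<in> space ?N" for z
  proof (cases "snd z < T \<and> 0 < p z")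
   case True
   have dz: "0 < d z" using d_pos True z by (auto simp: spN)
   have q: "0 < \<mu> / d z * p z" using True dz \<mu> by simp
   have xz: "xs z = g_inv (u i) (\<mu> / d z * p z) c" using True q by (simp add: xs_def G_def)
   have "(\<mu> / d z * p z) * xs z \<le> u i (xs z) c" unfolding xz by (rule ut.price_le_utility[OF q c(1)])
   then have "d z * ((\<mu> / d z * p z) * xs z) \<le> d z * V (xs z)"
    unfolding V[OF xs_nonneg] using dz by (intro mult_left_mono) auto
   moreover have "d z * ((\<mu> / d z * p z) * xs z) = \<mu> * b z" using dz by (simp add: b_def)
   ultimately show ?thesis by (simp add: f_def)
  next
   case False
   then have "b z = 0" using p_nonneg[of z] z by (auto simp: b_def xs_def spN)
   then show ?thesis using d_nonneg u_nonneg[OF i xs_nonneg[of z]] c by (simp add: f_def V xs_nonneg)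
  qed
  show "incseq B" by (intro incseq_SucI) (auto simp: B_def intro: order_trans add_increasing2)
  show "AE z in ?N. z \<in> (\<Union>k. B k)" using AE_product_time_less AE_space
  proof eventually_elim
   case (elim z)
   have "snd z < \<top>" using elim(1) by (auto intro: less_le_trans)
   then obtain k1 :: nat where k1: "snd z < of_nat k1" using ennreal_Ex_less_of_nat by auto
   obtain k2 :: nat where k2: "b z \<le> real k2" using real_arch_simple by blast
   have "z \<in> B (max k1 k2)" using elim(2) k1 k2 by (auto simp: B_def spN max_def intro: order_trans less_imp_le)
   then show ?case by auto
  qed
  show "(\<integral>\<^sup>+ z\<in>B k. ennreal (b z) \<partial>?N) < \<infinity>" for k
  proof -
   have T: "{..of_nat k} \<inter> {..T} \<in> sets (leb_time T)" by (auto simp: sets_restrict_space_iff)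
   have "(\<integral>\<^sup>+ z\<in>B k. ennreal (b z) \<partial>?N) \<le> (\<integral>\<^sup>+ z. ennreal (real k) * indicator (space M \<times> ({..of_nat k} \<inter> {..T})) z \<partial>?N)"
    by (intro nn_integral_mono) (auto simp: B_def indicator_def spN intro!: ennreal_leI)
   also have "\<dots> = ennreal (real k) * emeasure (leb_time T) ({..of_nat k} \<inter> {..T})"
    using T by (subst nn_integral_cmult_indicator) (auto simp: emeasure_product_time)
   also have "\<dots> \<le> ennreal (real k) * of_nat k" by (intro mult_left_mono emeasure_leb_time_atMost_le) simp
   also have "\<dots> < \<infinity>" by (simp add: ennreal_mult_less_top of_nat_less_top)
   finally show ?thesis .
  qed
  show "\<theta> * f z \<le> \<Phi> \<theta> k z" if \<theta>: "0 < \<theta>" "\<theta> \<le> 1" and z: "z \<in> B k" for \<theta> k z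
  proof -
   have "\<theta> * u i (xs z) c \<le> u i (\<theta> * xs z) c"
    using \<theta> xs_nonneg c by (intro ut.utility_scale) auto
   then have "d z * (\<theta> * u i (xs z) c) \<le> d z * u i (\<theta> * xs z) c" by (rule mult_left_mono[OF _ d_nonneg])
   then show ?thesis using z by (cases z) (simp add: f_def \<Phi>_def V xs_nonneg d_def mult.left_commute)
  qed
  show "\<Phi> \<theta> k \<in> K" if \<theta>: "0 < \<theta>" "\<theta> \<le> 1" and cost: "ennreal \<theta> * (\<integral>\<^sup>+ z\<in>B k. ennreal (b z) \<partial>?N) \<le> ennreal (w i / 2)" for \<theta> k
  proof -
   \<comment> \<open>Only agent \<open>i\<close> consumes and only agent 1 holds \<open>C\<close>,
     so the aggregate of the \<open>C j\<close> is the constant \<open>c\<close>.\<close>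
   define x where "x j t y = (if j = i then \<theta> * xs (y, t) * indicator (B k) (y, t) else 0)" for j :: nat and t y
   define C where "C j = (\<lambda>(t::ennreal) (y::'a). if j = 1 then c else (0::real))" for j :: nat
   have sumC: "(\<Sum>j=1..n. C j t y) = c" for t y using n by (simp add: C_def)
   have \<Phi>_eq: "\<Phi> \<theta> k = (\<lambda>(y, t). discount r t y * u i (x i t y) (\<Sum>j=1..n. C j t y))"
    unfolding sumC by (simp add: \<Phi>_def x_def)
   define e where "e z = ennreal (\<theta> * b z * indicator (B k) z)" for z
   have eN [measurable]: "e \<in> borel_measurable ?N"
    unfolding e_def[abs_def] by (rule optional_measurable_product) measurable
   define A where "A y = (\<integral>\<^sup>+ t. e (y, t) \<partial>leb_time T)" for y
   have Am [measurable]: "A \<in> borel_measurable M" unfolding A_def[abs_def] by measurable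
   have A_int: "(\<integral>\<^sup>+ y. A y \<partial>M) \<le> ennreal (w i / 2)"
   proof -
    have "(\<integral>\<^sup>+ y. A y \<partial>M) = (\<integral>\<^sup>+ z. e z \<partial>?N)" unfolding A_def by (rule L.nn_integral_fst[OF eN])
    also have "\<dots> = (\<integral>\<^sup>+ z. ennreal \<theta> * (ennreal (b z) * indicator (B k) z) \<partial>?N)"
     using \<theta> p_nonneg xs_nonneg by (intro nn_integral_cong) (auto simp: e_def b_def spN ennreal_mult[symmetric] indicator_def)
    also have "\<dots> = ennreal \<theta> * (\<integral>\<^sup>+ z\<in>B k. ennreal (b z) \<partial>?N)"
     by (rule nn_integral_cmult, rule optional_measurable_product) measurable
    finally show ?thesis using cost by simp
   qed
   have "(x j, C j) \<in> budget_set M F T \<psi>x \<psi>c (w j)" if j: "j \<in> {1..n}" for j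
   proof -
    have "(x j, \<lambda>t y. if j = 1 then c else 0) \<in> budget_set M F T \<psi>x \<psi>c (w j)"
    proof (rule budget_set_const_plan[where A = "\<lambda>y. if j = i then A y else 0"])
     show "optional_process M F T (x j)"
     proof -
      have "(\<lambda>z. \<theta> * xs z * indicator (B k) z) \<in> borel_measurable ?O" by measurable
      then show ?thesis unfolding optional_process_def x_def case_prod_beta by (cases "j = i") simp_all
     qed
     show "0 \<le> x j t y" for t y using \<theta> xs_nonneg by (auto simp: x_def)
     show "0 \<le> (if j = 1 then c else 0)" using c by simp
     show "(\<lambda>y. if j = i then A y else 0) \<in> borel_measurable M" by measurable
     show "AE y in M. (\<integral>\<^sup>+ t. ennreal (\<psi>x t y * x j t y) \<partial>leb_time T) = (if j = i then A y else 0)"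
     proof (cases "j = i")
      case True
      show ?thesis using price_version_eq
      proof eventually_elim
       case (elim y)
       have "(\<integral>\<^sup>+ t. ennreal (\<psi>x t y * x j t y) \<partial>leb_time T) = A y" unfolding A_def
       proof (rule nn_integral_cong_AE)
        show "AE t in leb_time T. ennreal (\<psi>x t y * x j t y) = e (y, t)" using AE_leb_time_less[of T]
         by eventually_elim (use elim True in \<open>auto simp: e_def x_def b_def p_def mult_ac\<close>)
       qed
       then show ?case using True by simp
      qed
     qed (simp add: x_def)
     have w1: "c \<le> w j / 2" if "j = 1" using c that by simp
     show "(\<integral>\<^sup>+ y. (if j = i then A y else 0) \<partial>M) + ennreal (if j = 1 then c else 0) \<le> ennreal (w j)"
     proof -
      have "(\<integral>\<^sup>+ y. (if j = i then A y else 0) \<partial>M) \<le> ennreal (w j / 2)"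
       using A_int by (cases "j = i") auto
      moreover have "ennreal (if j = 1 then c else 0) \<le> ennreal (w j / 2)"
       using w1 wealth[OF j] by (intro ennreal_leI) auto
      ultimately have "(\<integral>\<^sup>+ y. (if j = i then A y else 0) \<partial>M) + ennreal (if j = 1 then c else 0) \<le> ennreal (w j / 2) + ennreal (w j / 2)"
       by (rule add_mono)
      also have "\<dots> = ennreal (w j)" using wealth[OF j] by (simp flip: ennreal_plus)
      finally show ?thesis .
     qed
    qed
    then show ?thesis by (simp add: C_def)
   qed
   then show ?thesis unfolding K_def \<Phi>_eq by blast
  qed
 qed (use \<mu> ui BN in auto)
 then have "ennreal (1 / c) * (\<integral>\<^sup>+ z. ennreal (f z) \<partial>?N) < \<infinity>" by (simp add: ennreal_mult_less_top)
 moreover have "(\<integral>\<^sup>+ y. \<integral>\<^sup>+ t. ennreal (discount r t y * h_fun (u i) (\<mu> / discount r t y * price_version t y) c *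
   indicator {t. t < T \<and> 0 < price_version t y} t) \<partial>leb_time T \<partial>M) \<le>
  (\<integral>\<^sup>+ y. \<integral>\<^sup>+ t. ennreal (1 / c) * ennreal (f (y, t)) \<partial>leb_time T \<partial>M)"
 proof (intro nn_integral_mono)
  fix y t assume y: "y \<in> space M" and t: "t \<in> space (leb_time T)"
  show "ennreal (discount r t y * h_fun (u i) (\<mu> / discount r t y * price_version t y) c *
   indicator {t. t < T \<and> 0 < price_version t y} t) \<le> ennreal (1 / c) * ennreal (f (y, t))"
  proof (cases "t < T \<and> 0 < price_version t y")
   case True
   have dz: "0 < discount r t y" using discount_pos True y by auto
   have q: "0 < \<mu> / discount r t y * price_version t y" using True dz \<mu> by simp
   have xz: "xs (y, t) = g_inv (u i) (\<mu> / discount r t y * price_version t y) c"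
    using True q by (simp add: xs_def G_def d_def p_def)
   have "c * h_fun (u i) (\<mu> / discount r t y * price_version t y) c \<le> u i (xs (y, t)) c"
    unfolding xz by (rule ut.h_fun_le_utility[OF q c(1)])
   then have "discount r t y * (c * h_fun (u i) (\<mu> / discount r t y * price_version t y) c) \<le> f (y, t)"
    unfolding f_def V[OF xs_nonneg] d_def fst_conv snd_conv using dz by (intro mult_left_mono) auto
   then have "discount r t y * h_fun (u i) (\<mu> / discount r t y * price_version t y) c \<le> 1 / c * f (y, t)"
    using c by (simp add: field_simps)
   then show ?thesis using True c by (simp add: ennreal_mult'[symmetric] ennreal_leI)
  qed simp
 qed
 moreover have "(\<integral>\<^sup>+ y. \<integral>\<^sup>+ t. ennreal (1 / c) * ennreal (f (y, t)) \<partial>leb_time T \<partial>M) =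
   ennreal (1 / c) * (\<integral>\<^sup>+ z. ennreal (f z) \<partial>?N)"
 proof -
  have "(\<integral>\<^sup>+ y. \<integral>\<^sup>+ t. ennreal (1 / c) * ennreal (f (y, t)) \<partial>leb_time T \<partial>M) = (\<integral>\<^sup>+ z. ennreal (1 / c) * ennreal (f z) \<partial>?N)"
   by (rule L.nn_integral_fst, rule optional_measurable_product) measurable
  also have "\<dots> = ennreal (1 / c) * (\<integral>\<^sup>+ z. ennreal (f z) \<partial>?N)"
   by (rule nn_integral_cmult, rule optional_measurable_product) measurable
  finally show ?thesis .
 qed
 ultimately show ?thesis by simp
qed

end

context backward_setting
begin

text \<open>The integrand of the equation with the running supremum frozen at \<open>l\<close>.
  Before \<open>T\<close>, dividing by \<open>discount\<close> is multiplying by the exponential of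
  the accumulated rate; the value 0 at \<open>T\<close> avoids a vanishing discount factor.\<close>

definition marginal :: "real => 'a process" where
 "marginal l t y = (if t < T then discount r t y *
  (\<Sum>i=1..n. \<gamma> i * h_fun (u i) (lam / \<gamma> i / discount r t y * \<psi>x t y) l) else 0)"

lemma price_arg_pos: assumes "t < T" "y \<in> space M" "i \<in> {1..n}"
 shows "0 < lam / \<gamma> i / discount r t y * \<psi>x t y"
 using discount_pos[OF assms(1,2)] stopped_price_pos[OF price_x assms(2,1)] lam_pos weights_pos[OF assms(3)] by simp

lemma agent_term_pos: assumes "t < T" "y \<in> space M" "i \<in> {1..n}" "0 < l"
 shows "0 < h_fun (u i) (lam / \<gamma> i / discount r t y * \<psi>x t y) l"
proof -
 interpret utility "u i" by (rule utility_agent[OF assms(3)])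
 show ?thesis by (rule h_fun_pos[OF price_arg_pos[OF assms(1-3)] assms(4) Inada_inf[OF assms(3) price_arg_pos[OF assms(1-3)]]])
qed

lemma marginal_pos: assumes "t < T" "x \<in> space M" "0 < l" shows "0 < marginal l t x"
 using n agent_term_pos[OF assms(1,2) _ assms(3)] weights_pos discount_pos[OF assms(1,2)] assms(1)
 by (auto simp: marginal_def intro!: mult_pos_pos sum_pos)

lemma marginal_nonneg: "x \<in> space M ==> 0 < l ==> 0 \<le> marginal l t x"
 using marginal_pos[of t x l] by (cases "t < T") (auto simp: marginal_def less_imp_le)

lemma marginal_strict_antimono:
 assumes "t < T" "y \<in> space M" "0 < l" "l < l'" shows "marginal l' t y < marginal l t y"
proof -
 have "h_fun (u i) (lam / \<gamma> i / discount r t y * \<psi>x t y) l' < h_fun (u i) (lam / \<gamma> i / discount r t y * \<psi>x t y) l"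
  if i: "i \<in> {1..n}" for i
  by (rule utility.h_fun_strict_antimono[OF utility_agent[OF i] price_arg_pos[OF assms(1,2) i] assms(3,4)])
 then have "(\<Sum>i=1..n. \<gamma> i * h_fun (u i) (lam / \<gamma> i / discount r t y * \<psi>x t y) l') <
  (\<Sum>i=1..n. \<gamma> i * h_fun (u i) (lam / \<gamma> i / discount r t y * \<psi>x t y) l)"
  using n weights_pos by (intro sum_strict_mono) auto
 then show ?thesis using discount_pos[OF assms(1,2)] assms(1) by (simp add: marginal_def)
qed

lemma marginal_antimono: assumes "x \<in> space M" "0 < l" "l \<le> l'" shows "marginal l' t x \<le> marginal l t x"
 using marginal_strict_antimono[of t x l l'] assms
 by (cases "t < T"; cases "l = l'") (auto simp: marginal_def less_imp_le)

lemma marginal_continuous: assumes "y \<in> space M" shows "continuous_on {0<..} (\<lambda>l. marginal l t y)"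
proof (cases "t < T")
 case True
 have "continuous_on {0<..} (h_fun (u i) (lam / \<gamma> i / discount r t y * \<psi>x t y))" if i: "i \<in> {1..n}" for i
  by (rule utility.h_fun_continuous_c[OF utility_agent[OF i] price_arg_pos[OF True assms i]])
 then show ?thesis using True by (auto simp: marginal_def intro!: continuous_intros)
qed (simp add: marginal_def)

lemma marginal_at_0:
 assumes t: "t < T" and y: "y \<in> space M" shows "filterlim (\<lambda>l. marginal l t y) at_top (at_right 0)"
proof -
 have 1: "1 \<in> {1..n}" using n by simp
 let ?p = "\<lambda>i. lam / \<gamma> i / discount r t y * \<psi>x t y"
 have "filterlim (\<lambda>l. discount r t y * \<gamma> 1 * h_fun (u 1) (?p 1) l) at_top (at_right 0)"
  using discount_pos[OF t y] weights_pos[OF 1]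
  by (intro filterlim_tendsto_pos_mult_at_top[OF tendsto_const] Inada_0[OF 1 price_arg_pos[OF t y 1]]) auto
 moreover have "eventually (\<lambda>l. discount r t y * \<gamma> 1 * h_fun (u 1) (?p 1) l \<le> marginal l t y) (at_right 0)"
  unfolding eventually_at_right[OF zero_less_one]
 proof (intro exI[of _ 1] conjI allI impI)
  fix l :: real assume l: "0 < l"
  have "\<gamma> 1 * h_fun (u 1) (?p 1) l \<le> (\<Sum>i=1..n. \<gamma> i * h_fun (u i) (?p i) l)"
   using agent_term_pos[OF t y _ l] weights_pos 1
   by (intro member_le_sum[where f = "\<lambda>i. \<gamma> i * h_fun (u i) (?p i) l"]) (auto intro: less_imp_le)
  then show "discount r t y * \<gamma> 1 * h_fun (u 1) (?p 1) l \<le> marginal l t y"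
   using discount_pos[OF t y] t by (simp add: marginal_def mult.assoc)
 qed simp
 ultimately show ?thesis by (rule filterlim_at_top_mono)
qed

lemma marginal_at_top:
 assumes y: "y \<in> space M" shows "((\<lambda>l. marginal l t y) \<longlongrightarrow> 0) at_top"
proof (cases "t < T")
 case True
 let ?p = "\<lambda>i. lam / \<gamma> i / discount r t y * \<psi>x t y"
 have "((\<lambda>l. discount r t y * (\<Sum>i=1..n. \<gamma> i * h_fun (u i) (?p i) l)) \<longlongrightarrow>
   discount r t y * (\<Sum>i=1..n. \<gamma> i * 0)) at_top"
  by (intro tendsto_mult tendsto_const tendsto_sum Inada_inf price_arg_pos[OF True y])
 then show ?thesis using True by (simp add: marginal_def)
qed (simp add: marginal_def)

text \<open>\<open>h_fun\<close> is continuous on positive arguments only and is therefore extended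
  by 0 off that open set before composing.\<close>

lemma agent_term_measurable:
 assumes i: "i \<in> {1..n}" and \<mu>: "0 < \<mu>" and [measurable]: "d \<in> borel_measurable N" "p \<in> borel_measurable N" "S \<in> borel_measurable N"
 shows "(\<lambda>z. if 0 < d z \<and> 0 < p z \<and> 0 < S z then h_fun (u i) (\<mu> / d z * p z) (S z) else (0::real)) \<in> borel_measurable N"
proof -
 define A where "A = ({0<..} \<times> {0<..} :: (real \<times> real) set)"
 have A: "A \<in> sets borel" unfolding A_def by (intro borel_open open_Times) auto
 define k where "k z = (if z \<in> A then h_fun (u i) (fst z) (snd z) else 0)" for z
 have [measurable]: "k \<in> borel_measurable borel" unfolding k_def[abs_def]
 proof (rule borel_measurable_continuous_on_if[OF A])
  show "continuous_on A (\<lambda>z. h_fun (u i) (fst z) (snd z))"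
   using utility.h_fun_continuous[OF utility_agent[OF i]] by (simp add: A_def case_prod_beta)
 qed simp
 have "(\<lambda>z. if 0 < d z \<and> 0 < p z then k (\<mu> / d z * p z, S z) else 0) \<in> borel_measurable N"
  by measurable
 moreover have "(if 0 < d z \<and> 0 < p z then k (\<mu> / d z * p z, S z) else 0) =
   (if 0 < d z \<and> 0 < p z \<and> 0 < S z then h_fun (u i) (\<mu> / d z * p z) (S z) else 0)" for z
  using \<mu> by (auto simp: k_def A_def)
 ultimately show ?thesis by simp
qed

text \<open>The space \<open>N\<close> is left free: progressive measurability, the product with
  time and single paths are all instances.\<close>

lemma marginal_measurable: assumes a: "\<And>z. z \<in> space N ==> a z \<in> space M"
  and [measurable]: "(\<lambda>z. discount r (\<tau> z) (a z)) \<in> borel_measurable N"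
   "(\<lambda>z. stopped_price \<psi>x (\<tau> z) (a z)) \<in> borel_measurable N" "S \<in> borel_measurable N"
 shows "(\<lambda>z. if 0 < S z then marginal (S z) (\<tau> z) (a z) else 0) \<in> borel_measurable N"
proof -
 let ?d = "\<lambda>z. discount r (\<tau> z) (a z)" and ?p = "\<lambda>z. stopped_price \<psi>x (\<tau> z) (a z)"
 let ?t = "\<lambda>i z. if 0 < ?d z \<and> 0 < ?p z \<and> 0 < S z then h_fun (u i) (lam / \<gamma> i / ?d z * ?p z) (S z) else 0"
 have [measurable]: "?t i \<in> borel_measurable N" if "i \<in> {1..n}" for i
  by (rule agent_term_measurable[OF that]) (use lam_pos weights_pos[OF that] in auto)
 have "(\<lambda>z. ?d z * (\<Sum>i=1..n. \<gamma> i * ?t i z)) \<in> borel_measurable N"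
  by (intro borel_measurable_times borel_measurable_sum) simp_all
 then show ?thesis
 proof (rule measurable_cong[THEN iffD1, rotated])
  fix z assume "z \<in> space N"
  then have az: "a z \<in> space M" by (rule a)
  show "?d z * (\<Sum>i=1..n. \<gamma> i * ?t i z) = (if 0 < S z then marginal (S z) (\<tau> z) (a z) else 0)"
   using discount_pos[OF _ az, of "\<tau> z"] stopped_price_pos[OF price_x az, of "\<tau> z"]
   by (auto simp: marginal_def stopped_price_def)
 qed
qed

lemma discount_progressive: "progressive (discount r)"
 by (rule optional_progressive[OF optional_discount[OF rate_optional rate]])

lemma stopped_price_progressive:
 "price_process M F T \<psi> ==> progressive (stopped_price \<psi>)"
 by (rule right_continuous_progressive[OF stopped_price_adapted stopped_price_rc])

lemma progressiveD: "progressive X ==> t \<le> T ==>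
  (\<lambda>z. X (snd z) (fst z)) \<in> borel_measurable (F t \<Otimes>\<^sub>M restrict_space borel {..t})"
 unfolding progressive_def measurable_process_def case_prod_beta by simp

lemma progressive_product: "progressive X ==> (\<lambda>z. X (snd z) (fst z)) \<in> borel_measurable (M \<Otimes>\<^sub>M leb_time T)"
 using progressive_measurable_process[of X]
 unfolding measurable_process_def case_prod_beta by (simp cong: measurable_cong_sets sets_pair_measure_cong)

lemma marginal_progressive: assumes "0 < l" shows "progressive (marginal l)"
 unfolding progressive_def measurable_process_def case_prod_beta
proof (intro allI impI)
 fix t assume t: "t \<le> T"
 have "(\<lambda>z. if 0 < l then marginal l (snd z) (fst z) else 0) \<in> borel_measurable (F t \<Otimes>\<^sub>M restrict_space borel {..t})"
  by (rule marginal_measurable[where S = "\<lambda>_. l"])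
   (auto simp: space_pair_measure space_F intro!: progressiveD[OF discount_progressive t] progressiveD[OF stopped_price_progressive[OF price_x] t])
 then show "(\<lambda>z. marginal l (snd z) (fst z)) \<in> borel_measurable (F t \<Otimes>\<^sub>M restrict_space borel {..t})"
  using assms by simp
qed

lemma marginal_product: assumes "S \<in> borel_measurable (M \<Otimes>\<^sub>M leb_time T)"
 shows "(\<lambda>z. if 0 < S z then marginal (S z) (snd z) (fst z) else 0) \<in> borel_measurable (M \<Otimes>\<^sub>M leb_time T)"
 by (rule marginal_measurable[OF _ progressive_product[OF discount_progressive]
    progressive_product[OF stopped_price_progressive[OF price_x]] assms]) (auto simp: space_pair_measure)

lemma marginal_path_measurable:
 "0 < l ==> x \<in> space M ==> (\<lambda>t. marginal l t x) \<in> borel_measurable (restrict_space borel {..T})"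
 by (rule measurable_process_path[OF progressive_measurable_process[OF marginal_progressive]])

text \<open>Levels up to \<open>w 1 / 2\<close> are covered by
  \<open>utility_integrable_small\<close>; higher ones follow because the marginal value decreases
  in the level.\<close>

lemma marginal_integrable: assumes l: "0 < l"
 shows "(\<integral>\<^sup>+ y. \<integral>\<^sup>+ t. ennreal (marginal l t y) \<partial>leb_time T \<partial>M) < \<infinity>"
proof -
 interpret L: sigma_finite_measure "leb_time T" by (rule sigma_finite_leb_time)
 let ?N = "M \<Otimes>\<^sub>M leb_time T"
 have w1: "0 < w 1" using wealth n by simp
 define c where "c = min l (w 1 / 2)"
 have c: "0 < c" "c \<le> w 1 / 2" "c \<le> l" using l w1 by (auto simp: c_def)
 define k where "k i y t = discount r t y * h_fun (u i) (lam / \<gamma> i / discount r t y * price_version t y) c *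
  indicator {t. t < T \<and> 0 < price_version t y} t" for i y t
 have [measurable]: "(\<lambda>z. k i (fst z) (snd z)) \<in> borel_measurable ?N" if i: "i \<in> {1..n}" for i
 proof -
  have m [measurable]: "(\<lambda>z. discount r (snd z) (fst z)) \<in> borel_measurable ?N"
   "(\<lambda>z. price_version (snd z) (fst z)) \<in> borel_measurable ?N"
   by (rule progressive_product[OF discount_progressive],
     rule progressive_product[OF optional_progressive[OF price_version_optional]])
  have s [measurable]: "snd \<in> borel_measurable ?N" by (rule optional_measurable_product[OF measurable_snd_optional])
  have "0 < lam / \<gamma> i" using lam_pos weights_pos[OF i] by simp
  note [measurable] = agent_term_measurable[OF i this m, of "\<lambda>_. c"]
  have "(\<lambda>z. if snd z < T then discount r (snd z) (fst z) * (if 0 < discount r (snd z) (fst z) \<and> 0 < price_version (snd z) (fst z) \<and> 0 < c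
   then h_fun (u i) (lam / \<gamma> i / discount r (snd z) (fst z) * price_version (snd z) (fst z)) c else 0) else 0) \<in> borel_measurable ?N"
   by measurable
  then show ?thesis
  proof (rule measurable_cong[THEN iffD1, rotated])
   fix z assume "z \<in> space ?N"
   then show "(if snd z < T then discount r (snd z) (fst z) * (if 0 < discount r (snd z) (fst z) \<and> 0 < price_version (snd z) (fst z) \<and> 0 < c
    then h_fun (u i) (lam / \<gamma> i / discount r (snd z) (fst z) * price_version (snd z) (fst z)) c else 0) else 0) = k i (fst z) (snd z)"
    using discount_pos[of "snd z" "fst z"] c by (auto simp: k_def space_pair_measure)
  qed
 qed
 have k0: "0 \<le> k i y t" if i: "i \<in> {1..n}" and y: "y \<in> space M" for i y t
 proof (cases "t < T \<and> 0 < price_version t y")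
  case True
  interpret utility "u i" by (rule utility_agent[OF i])
  have q: "0 < lam / \<gamma> i / discount r t y * price_version t y"
   using True discount_pos[of t y] y lam_pos weights_pos[OF i] by simp
  show ?thesis using h_fun_pos[OF q c(1) Inada_inf[OF i q]] discount_bounds[of r t y] by (simp add: k_def)
 qed (simp add: k_def)
 have fin: "(\<integral>\<^sup>+ y. \<integral>\<^sup>+ t. ennreal (k i y t) \<partial>leb_time T \<partial>M) < \<infinity>" if i: "i \<in> {1..n}" for i
  unfolding k_def by (rule utility_integrable_small[OF i _ c(1,2)]) (use lam_pos weights_pos[OF i] in simp)
 have km: "(\<lambda>t. ennreal (k i y t)) \<in> borel_measurable (leb_time T)" if "i \<in> {1..n}" "y \<in> space M" for i y
 proof -
  have "(\<lambda>t. ennreal (k i (fst (y, t)) (snd (y, t)))) \<in> borel_measurable (leb_time T)"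
   using that by measurable
  then show ?thesis by simp
 qed
 have Km: "(\<lambda>y. \<integral>\<^sup>+ t. ennreal (k i y t) \<partial>leb_time T) \<in> borel_measurable M" if "i \<in> {1..n}" for i
 proof -
  have "(\<lambda>y. \<integral>\<^sup>+ t. ennreal (k i (fst (y, t)) (snd (y, t))) \<partial>leb_time T) \<in> borel_measurable M"
   by (rule L.borel_measurable_nn_integral_fst) (use that in measurable)
  then show ?thesis by simp
 qed
 have "(\<integral>\<^sup>+ y. \<integral>\<^sup>+ t. ennreal (marginal l t y) \<partial>leb_time T \<partial>M) \<le>
  (\<integral>\<^sup>+ y. (\<Sum>i=1..n. ennreal (\<gamma> i) * (\<integral>\<^sup>+ t. ennreal (k i y t) \<partial>leb_time T)) \<partial>M)"
 proof (rule nn_integral_mono_AE)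
  show "AE y in M. (\<integral>\<^sup>+ t. ennreal (marginal l t y) \<partial>leb_time T) \<le>
   (\<Sum>i=1..n. ennreal (\<gamma> i) * (\<integral>\<^sup>+ t. ennreal (k i y t) \<partial>leb_time T))"
   using price_version_eq AE_space
  proof eventually_elim
   case (elim y)
   have "(\<integral>\<^sup>+ t. ennreal (marginal l t y) \<partial>leb_time T) \<le> (\<integral>\<^sup>+ t. (\<Sum>i=1..n. ennreal (\<gamma> i) * ennreal (k i y t)) \<partial>leb_time T)"
   proof (rule nn_integral_mono_AE)
    show "AE t in leb_time T. ennreal (marginal l t y) \<le> (\<Sum>i=1..n. ennreal (\<gamma> i) * ennreal (k i y t))"
     using AE_leb_time_less[of T]
    proof eventually_elim
     case (elim t)
     have pv: "price_version t y = \<psi>x t y" using \<open>\<forall>t<T. price_version t y = \<psi>x t y\<close> elim by simp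
     have pos: "0 < \<psi>x t y" by (rule stopped_price_pos[OF price_x \<open>y \<in> space M\<close> elim])
     have "marginal c t y = (\<Sum>i=1..n. \<gamma> i * k i y t)"
      using elim pos by (simp add: marginal_def k_def pv sum_distrib_left mult_ac)
     then have "ennreal (marginal l t y) \<le> ennreal (\<Sum>i=1..n. \<gamma> i * k i y t)"
      using marginal_antimono[OF \<open>y \<in> space M\<close> c(1,3), of t] by (simp add: ennreal_leI)
     also have "\<dots> = (\<Sum>i=1..n. ennreal (\<gamma> i * k i y t))"
      by (intro sum_ennreal[symmetric] mult_nonneg_nonneg k0[OF _ \<open>y \<in> space M\<close>] less_imp_le[OF weights_pos])
     also have "\<dots> = (\<Sum>i=1..n. ennreal (\<gamma> i) * ennreal (k i y t))"
      using k0 weights_pos \<open>y \<in> space M\<close> by (intro sum.cong ennreal_mult) (auto intro: less_imp_le)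
     finally show ?case .
    qed
   qed
   also have "\<dots> = (\<Sum>i=1..n. ennreal (\<gamma> i) * (\<integral>\<^sup>+ t. ennreal (k i y t) \<partial>leb_time T))"
    using km elim by (subst nn_integral_sum) (auto intro!: sum.cong nn_integral_cmult borel_measurable_times_ennreal)
   finally show ?case .
  qed
 qed
 also have "\<dots> = (\<Sum>i=1..n. ennreal (\<gamma> i) * (\<integral>\<^sup>+ y. \<integral>\<^sup>+ t. ennreal (k i y t) \<partial>leb_time T \<partial>M))"
  using Km by (subst nn_integral_sum) (auto intro!: sum.cong nn_integral_cmult borel_measurable_times_ennreal)
 also have "\<dots> < \<infinity>" using fin by (auto simp: ennreal_mult_less_top)
 finally show ?thesis .
qed

text \<open>Setting the process to 0 on the null event of an infinite total makes every path finite,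
  nondecreasing and continuous in time.\<close>

definition marg_integral :: "real => 'a process" where
 "marg_integral l t x = (if (\<integral>\<^sup>+ s. ennreal (marginal l s x) \<partial>leb_time T) < \<infinity>
  then enn2real (\<integral>\<^sup>+ s\<in>{..t}. ennreal (marginal l s x) \<partial>leb_time T) else 0)"

lemma marginal_leb_measurable:
 "0 < l ==> x \<in> space M ==> (\<lambda>t. ennreal (marginal l t x)) \<in> borel_measurable (leb_time T)"
 using marginal_path_measurable[of l x] by (simp cong: measurable_cong_sets)

lemma AE_marginal_finite:
 assumes "0 < l" shows "AE x in M. (\<integral>\<^sup>+ s. ennreal (marginal l s x) \<partial>leb_time T) < \<infinity>"
proof -
 have "(\<lambda>x. \<integral>\<^sup>+ s. ennreal (marginal l s x) \<partial>leb_time T) \<in> borel_measurable M"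
  using progressive_measurable_process[OF marginal_progressive[OF assms]]
  by (intro time_integral_measurable) (simp add: measurable_process_def case_prod_beta)
 then have "AE x in M. (\<integral>\<^sup>+ s. ennreal (marginal l s x) \<partial>leb_time T) \<noteq> \<infinity>"
  using marginal_integrable[OF assms] by (intro nn_integral_PInf_AE) auto
 then show ?thesis by (simp add: top.not_eq_extremum)
qed

lemma marginal_sub_finite:
 "(\<integral>\<^sup>+ s. ennreal (marginal l s x) \<partial>leb_time T) < \<infinity> ==> (\<integral>\<^sup>+ s\<in>A. ennreal (marginal l s x) \<partial>leb_time T) < \<infinity>"
 by (rule le_less_trans[OF nn_integral_mono]) (auto simp: indicator_def)

lemma marg_integral_eq:
 "(\<integral>\<^sup>+ s. ennreal (marginal l s x) \<partial>leb_time T) < \<infinity> ==>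
  ennreal (marg_integral l t x) = (\<integral>\<^sup>+ s\<in>{..t}. ennreal (marginal l s x) \<partial>leb_time T)"
 using marginal_sub_finite[of l x "{..t}"] by (simp add: marg_integral_def)

lemma marg_integral_nonneg: "0 \<le> marg_integral l t x" by (simp add: marg_integral_def)

lemma marg_integral_mono: "s \<le> t ==> marg_integral l s x \<le> marg_integral l t x"
 using marginal_sub_finite[of l x "{..t}"]
 by (auto simp: marg_integral_def intro!: enn2real_mono nn_integral_mono mult_left_mono)

lemma marg_integral_tendsto: assumes "0 < l" "x \<in> space M" "S \<longlonglongrightarrow> t"
 shows "(\<lambda>n. marg_integral l (S n) x) \<longlonglongrightarrow> marg_integral l t x"
proof (cases "(\<integral>\<^sup>+ s. ennreal (marginal l s x) \<partial>leb_time T) < \<infinity>")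
 case True
 have "(\<lambda>n. \<integral>\<^sup>+ s\<in>{..S n}. ennreal (marginal l s x) \<partial>leb_time T) \<longlonglongrightarrow> ennreal (marg_integral l t x)"
  unfolding marg_integral_eq[OF True]
  by (rule time_integral_tendsto[OF marginal_leb_measurable[OF assms(1,2)] True assms(3)])
 from tendsto_enn2real[OF this marg_integral_nonneg] show ?thesis using True by (simp add: marg_integral_def)
qed (simp add: marg_integral_def)

lemma marg_integral_rc:
 assumes "0 < l" "x \<in> space M" shows "right_continuous_path T (\<lambda>t. marg_integral l t x)"
 unfolding right_continuous_path_def continuous_within
proof (intro allI impI)
 fix t assume "t < T"
 then show "((\<lambda>t. marg_integral l t x) \<longlongrightarrow> marg_integral l t x) (at_right t)"
  by (rule tendsto_at_right_sequentially) (rule marg_integral_tendsto[OF assms])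
qed

lemma marg_integral_adapted: assumes l: "0 < l" shows "adapted F T (marg_integral l)" unfolding adapted_def
proof (intro allI impI)
 fix t assume t: "t \<le> T"
 have "(\<lambda>z. ennreal (marginal l (snd z) (fst z))) \<in> borel_measurable (F t \<Otimes>\<^sub>M restrict_space borel {..t})"
  using progressiveD[OF marginal_progressive[OF l] t] by measurable
 then have "(\<lambda>x. \<integral>\<^sup>+ s. ennreal (marginal l s x) \<partial>leb_time t) \<in> borel_measurable (F t)"
  by (intro time_integral_measurable) (simp add: case_prod_beta)
 then have "(\<lambda>x. enn2real (\<integral>\<^sup>+ s. ennreal (marginal l s x) \<partial>leb_time t)) \<in> borel_measurable (F t)"
  by measurable
 then show "marg_integral l t \<in> borel_measurable (F t)"
 proof (rule F_measurable_AE)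
  show "AE x in M. enn2real (\<integral>\<^sup>+ s. ennreal (marginal l s x) \<partial>leb_time t) = marg_integral l t x"
   using AE_marginal_finite[OF l] AE_space
  proof eventually_elim
   case (elim x)
   then show ?case
    using nn_integral_leb_time_subinterval[OF measurable_compose[OF marginal_path_measurable[OF l elim(2)] measurable_ennreal] t]
    by (simp add: marg_integral_def)
  qed
 qed
qed

lemma marg_integral_integrable: assumes l: "0 < l" and "t \<le> T" shows "integrable M (marg_integral l t)"
proof (rule integrableI_nonneg)
 show "marg_integral l t \<in> borel_measurable M"
  using marg_integral_adapted[OF l] assms(2) F_measurable_M by (auto simp: adapted_def)
 show "AE x in M. 0 \<le> marg_integral l t x" by (simp add: marg_integral_nonneg)
 have "(\<integral>\<^sup>+ x. ennreal (marg_integral l t x) \<partial>M) \<le> (\<integral>\<^sup>+ x. \<integral>\<^sup>+ s. ennreal (marginal l s x) \<partial>leb_time T \<partial>M)"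
 proof (rule nn_integral_mono_AE)
  show "AE x in M. ennreal (marg_integral l t x) \<le> (\<integral>\<^sup>+ s. ennreal (marginal l s x) \<partial>leb_time T)"
   using AE_marginal_finite[OF l]
   by eventually_elim (auto simp: marg_integral_eq indicator_def intro!: nn_integral_mono)
 qed
 then show "(\<integral>\<^sup>+ x. ennreal (marg_integral l t x) \<partial>M) < \<infinity>"
  using marginal_integrable[OF l] by (rule le_less_trans)
qed

end

section \<open>The family of stopping problems\<close>

context backward_setting
begin

definition end_cost :: "'a process" where
 "end_cost t x = lam * stopped_price \<psi>c t x"

lemma end_cost_nonneg: "x \<in> space M ==> 0 \<le> end_cost t x"
 using stopped_price_nonneg[OF price_c] lam_pos by (simp add: end_cost_def)

lemma end_cost_rc: "x \<in> space M ==> right_continuous_path T (\<lambda>t. end_cost t x)"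
 unfolding end_cost_def by (intro right_continuous_mult right_continuous_const stopped_price_rc price_c)

lemma supermart_end_cost: "supermart {..T} end_cost"
proof -
 have "supermart {..T} (\<lambda>t x. lam * stopped_price \<psi>c t x + 0 * stopped_price \<psi>c t x)"
  using lam_pos by (intro supermart_add_scaled stopped_price_supermart price_c) auto
 then show ?thesis by (simp add: end_cost_def[abs_def])
qed

lemma supermart_end_cost_grid: "supermart (grid_times T) end_cost"
 by (rule supermart_subset[OF supermart_end_cost]) (auto dest: grid_times_le)

lemma end_cost_sampling:
 "stopping S ==> stopping \<tau> ==> (\<And>x. x \<in> space M ==> S x \<le> \<tau> x) ==> A \<in> sets (pre_sigma S) ==>
 ev A \<tau> end_cost \<le> ev A S end_cost"
 by (rule optional_sampling[OF supermart_end_cost_grid right_closure_self]) (rule end_cost_rc)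

lemma progressive_end_cost: "progressive end_cost"
 using right_continuous_progressive[OF _ end_cost_rc] supermartD(1)[OF supermart_end_cost] by (auto simp: adapted_def)

text \<open>Its conditional expectations bound the price term at every time; such a variable comes
  from the terminal value of the martingale factor of \<open>\<psi>c\<close>.\<close>

definition end_bound :: "'a => real" where
 "end_bound = (SOME Z. integrable M Z \<and> (\<forall>x\<in>space M. 0 \<le> Z x) \<and> (\<forall>t\<le>T. \<forall>A\<in>sets (F t).
   ei A (end_cost t) \<le> ei A Z))"

lemma end_bound: "integrable M end_bound" "x \<in> space M ==> 0 \<le> end_bound x"
 "t \<le> T ==> A \<in> sets (F t) ==>
   ei A (end_cost t) \<le> ei A end_bound"
proof -
 obtain Z where Z: "integrable M Z" and le: "\<And>t A. t \<le> T ==> A \<in> sets (F t) ==>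
   ei A (stopped_price \<psi>c t) \<le> ei A Z" using stopped_price_supermart(2)[OF price_c] by blast
 have I: "integrable M (\<lambda>x. lam * max 0 (Z x))" using Z by auto
 have "ei A (end_cost t) \<le> ei A (\<lambda>x. lam * max 0 (Z x))"
  if t: "t \<le> T" and A: "A \<in> sets (F t)" for t A
 proof -
  have [measurable]: "A \<in> sets M" "Z \<in> borel_measurable M" "stopped_price \<psi>c t \<in> borel_measurable M"
   using F_le_M[OF A] Z stopped_price_adapted[OF price_c] t F_measurable_M by (auto simp: adapted_def)
  have "ei A (end_cost t) = (\<integral>\<^sup>+ x. ennreal lam * (ennreal (stopped_price \<psi>c t x) * indicator A x) \<partial>M)"
   using lam_pos by (intro nn_integral_cong) (auto simp: end_cost_def ennreal_mult' mult.assoc)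
  also have "\<dots> = ennreal lam * ei A (stopped_price \<psi>c t)" by (rule nn_integral_cmult) measurable
  also have "\<dots> \<le> ennreal lam * ei A Z" by (intro mult_left_mono le t A) simp
  also have "\<dots> = (\<integral>\<^sup>+ x. ennreal lam * (ennreal (Z x) * indicator A x) \<partial>M)"
   by (rule nn_integral_cmult[symmetric]) measurable
  also have "\<dots> = ei A (\<lambda>x. lam * max 0 (Z x))"
   using lam_pos by (intro nn_integral_cong) (auto simp: ennreal_mult' mult.assoc max_def ennreal_neg)
  finally show ?thesis .
 qed
 then have "\<exists>Z. integrable M Z \<and> (\<forall>x\<in>space M. 0 \<le> Z x) \<and> (\<forall>t\<le>T. \<forall>A\<in>sets (F t).
   ei A (end_cost t) \<le> ei A Z)" using I lam_pos by (intro exI[of _ "\<lambda>x. lam * max 0 (Z x)"]) auto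
 from someI_ex[OF this] show "integrable M end_bound" "x \<in> space M ==> 0 \<le> end_bound x"
  "t \<le> T ==> A \<in> sets (F t) ==>
   ei A (end_cost t) \<le> ei A end_bound" unfolding end_bound_def by blast+
qed

definition cost :: "real => 'a process" where
 "cost l t x = end_cost t x + marg_integral l t x"

text \<open>Minimising the expected cost amounts to maximising the expected reward
 \<open>E[cost_bound | F\<^sub>t] - cost\<close>, which exceeds \<open>1\<close> and hence fits Snell envelopes of nonnegative processes.\<close>

definition cost_bound :: "real => 'a => real" where
 "cost_bound l x = end_bound x + marg_integral l T x + 1"

definition bound_martingale :: "real => 'a process" where
 "bound_martingale l = regularised (closed_martingale (cost_bound l))"

text \<open>Almost surely the maximum is inactive (\<open>reward_eq\<close>). A reward of at least 1
  makes the envelope positive, so that a bound by a fraction of the envelope is a strict one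
  (\<open>before_level_time\<close>).\<close>

definition reward :: "real => 'a process" where
 "reward l t x = max 1 (bound_martingale l t x - cost l t x)"

lemma cost_nonneg: "x \<in> space M ==> 0 \<le> cost l t x" by (simp add: cost_def end_cost_nonneg marg_integral_nonneg)

lemma reward_ge_1: "1 \<le> reward l t x" by (simp add: reward_def)

lemma reward_nonneg: "0 \<le> reward l t x" by (rule order_trans[OF _ reward_ge_1]) simp

context
 fixes l :: real assumes l: "0 < l"
begin

lemma cost_rc: "x \<in> space M ==> right_continuous_path T (\<lambda>t. cost l t x)"
 unfolding cost_def by (intro right_continuous_add end_cost_rc marg_integral_rc l)

lemma cost_adapted: "adapted F T (cost l)" using marg_integral_adapted[OF l] supermartD(1)[OF supermart_end_cost]
 by (auto simp: adapted_def cost_def[abs_def])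

lemma progressive_cost: "progressive (cost l)" by (rule right_continuous_progressive[OF cost_adapted cost_rc])

lemma progressive_marg_integral: "progressive (marg_integral l)"
 by (rule right_continuous_progressive[OF marg_integral_adapted[OF l] marg_integral_rc[OF l]])

lemma cost_bound_integrable: "integrable M (cost_bound l)"
 unfolding cost_bound_def[abs_def] using end_bound(1) marg_integral_integrable[OF l order_refl] by auto

lemma cost_bound_nonneg: "x \<in> space M ==> 1 \<le> cost_bound l x"
 using end_bound(2) marg_integral_nonneg[of l T x] by (auto simp: cost_bound_def)

lemmas bound_martingale_super =
 supermart_regularised[OF supermart_closed_martingale[OF cost_bound_integrable], folded bound_martingale_def]

lemmas bound_martingale_sampling =
 regularised_martingale_sampling[OF cost_bound_integrable, folded bound_martingale_def]

lemma bound_martingale_rc: "right_continuous_path T (\<lambda>t. bound_martingale l t x)"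
 unfolding bound_martingale_def by (rule right_continuous_regularised)

text \<open>At a grid time both parts of the cost are compared on events with their bounds, the
  accrual up to \<open>q\<close> with that up to \<open>T\<close>; right-continuity extends the
  inequality to all times.\<close>

lemma bound_martingale_ge: "AE x in M. \<forall>t\<le>T. cost l t x + 1 \<le> bound_martingale l t x"
proof -
 have "AE x in M. cost l q x + 1 \<le> bound_martingale l q x" if q: "q \<in> grid_times T" for q
 proof -
  have qT: "q \<le> T" by (rule grid_times_le[OF q])
  have cm: "cost l q \<in> borel_measurable (F q)" using cost_adapted qT by (auto simp: adapted_def)
  have em: "end_cost q \<in> borel_measurable M" using supermartD(2)[OF supermart_end_cost] qT by simp
  have bm: "end_bound \<in> borel_measurable M" using end_bound(1) by auto
  have fm: "marg_integral l t \<in> borel_measurable M" if "t \<le> T" for t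
   using marg_integral_integrable[OF l that] by auto
  note [measurable] = em bm fm[OF qT] fm[OF order_refl]
  show ?thesis
  proof (rule AE_le_of_F_integrals[where t = q])
   show "(\<lambda>x. cost l q x + 1) \<in> borel_measurable (F q)" using cm by measurable
   show "bound_martingale l q \<in> borel_measurable (F q)"
    using supermartD(1)[OF bound_martingale_super, of q] qT by auto
   show "0 \<le> bound_martingale l q x" if "x \<in> space M" for x
    using supermartD(3)[OF bound_martingale_super, of q] qT that by auto
   show "integrable M (\<lambda>x. cost l q x + 1)"
    unfolding cost_def using supermartD(4)[OF supermart_end_cost, of q] qT marg_integral_integrable[OF l qT] by auto
   fix A assume A: "A \<in> sets (F q)"
   then have [measurable]: "A \<in> sets M" by (rule F_le_M)
   have "ei A (\<lambda>x. cost l q x + 1) = (\<integral>\<^sup>+ x. ennreal (end_cost q x) * indicator A x + ennreal (marg_integral l q x + 1) * indicator A x \<partial>M)"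
    using end_cost_nonneg by (intro nn_integral_cong)
     (auto simp: cost_def marg_integral_nonneg ennreal_plus[symmetric] indicator_def add.assoc simp del: ennreal_plus)
   also have "\<dots> = ei A (end_cost q) + ei A (\<lambda>x. marg_integral l q x + 1)"
    by (rule nn_integral_add) measurable
   also have "\<dots> \<le> ei A end_bound + ei A (\<lambda>x. marg_integral l T x + 1)"
    by (intro add_mono end_bound(3) qT A nn_integral_mono mult_right_mono ennreal_leI marg_integral_mono) auto
   also have "\<dots> = (\<integral>\<^sup>+ x. ennreal (end_bound x) * indicator A x + ennreal (marg_integral l T x + 1) * indicator A x \<partial>M)"
    by (rule nn_integral_add[symmetric]) measurable
   also have "\<dots> = ei A (cost_bound l)" using end_bound(2) by (intro nn_integral_cong)
     (auto simp: cost_bound_def marg_integral_nonneg ennreal_plus[symmetric] indicator_def add.assoc simp del: ennreal_plus)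
   also have "\<dots> = ei A (bound_martingale l q)"
    by (rule bound_martingale_sampling[OF stopping_const[OF qT] pre_sigma_const[OF qT A], symmetric])
   finally show "ei A (\<lambda>x. cost l q x + 1) \<le> ei A (bound_martingale l q)" .
  qed
 qed
 then have "AE x in M. \<forall>q\<in>grid_times T. cost l q x + 1 \<le> bound_martingale l q x"
  by (simp add: AE_ball_countable[OF countable_grid_times])
 with AE_space show ?thesis
 proof eventually_elim
  case (elim x)
  have "right_continuous_path T (\<lambda>t. cost l t x + 1)"
   by (rule right_continuous_add[OF cost_rc[OF elim(1)] right_continuous_const])
  from right_continuous_le[OF this bound_martingale_rc] show ?case using elim by auto
 qed
qed

lemma reward_eq: "AE x in M. \<forall>t\<le>T. reward l t x = bound_martingale l t x - cost l t x"
 using bound_martingale_ge by eventually_elim (force simp: reward_def)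

lemma right_continuous_max:
 "right_continuous_path T f ==> right_continuous_path T (\<lambda>t. max (c::real) (f t))"
 unfolding right_continuous_path_def by (auto intro!: continuous_max)

lemma reward_rc: "x \<in> space M ==> right_continuous_path T (\<lambda>t. reward l t x)"
 unfolding reward_def by (intro right_continuous_max right_continuous_diff bound_martingale_rc cost_rc)

lemma reward_adapted: "adapted F T (reward l)" using cost_adapted supermartD(1)[OF bound_martingale_super]
 by (auto simp: adapted_def reward_def[abs_def] intro!: borel_measurable_max)

text \<open>Reward plus cost is almost surely a closed martingale, whose mean does not depend on the
  stopping time.\<close>

lemma reward_sampling: assumes \<tau>: "stopping \<tau>" and A: "A \<in> sets (pre_sigma \<tau>)"
 shows "ev A \<tau> (reward l) + ev A \<tau> (cost l) =
  ei A (cost_bound l)"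
proof -
 have [measurable]: "A \<in> sets M" by (rule pre_sigma_le_M[OF \<tau> A])
 note [measurable] = progressive_stopped_measurable[OF progressive_cost \<tau>]
  progressive_stopped_measurable[OF right_continuous_progressive[OF reward_adapted reward_rc] \<tau>]
 have "ev A \<tau> (reward l) + ev A \<tau> (cost l) =
  (\<integral>\<^sup>+ x. ennreal (reward l (\<tau> x) x) * indicator A x + ennreal (cost l (\<tau> x) x) * indicator A x \<partial>M)"
  by (rule nn_integral_add[symmetric]) measurable
 also have "\<dots> = ev A \<tau> (bound_martingale l)"
 proof (rule nn_integral_cong_AE)
  show "AE x in M. ennreal (reward l (\<tau> x) x) * indicator A x + ennreal (cost l (\<tau> x) x) * indicator A x =
   ennreal (bound_martingale l (\<tau> x) x) * indicator A x" using reward_eq AE_space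
  proof eventually_elim
   case (elim x)
   then have "bound_martingale l (\<tau> x) x = reward l (\<tau> x) x + cost l (\<tau> x) x"
    using stoppingD(2)[OF \<tau>] by auto
   then show ?case using reward_ge_1[of l "\<tau> x" x] cost_nonneg[OF elim(2), of l "\<tau> x"]
    by (simp add: ennreal_plus distrib_right)
  qed
 qed
 also have "\<dots> = ei A (cost_bound l)" by (rule bound_martingale_sampling[OF \<tau> A])
 finally show ?thesis .
qed

lemma cost_bound_finite: "ei A (cost_bound l) < \<infinity>"
proof (rule le_less_trans[OF nn_integral_mono])
 show "ennreal (cost_bound l x) * indicator A x \<le> ennreal (norm (cost_bound l x))" for x
  by (auto simp: indicator_def intro: ennreal_leI)
 show "(\<integral>\<^sup>+ x. ennreal (norm (cost_bound l x)) \<partial>M) < \<infinity>"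
  using cost_bound_integrable by (simp add: integrable_iff_bounded)
qed

lemma dominates_reward: "dominates (bound_martingale l) (reward l)" unfolding dominates_def
proof
 show "supermart (grid_times T) (bound_martingale l)"
  by (rule supermart_subset[OF bound_martingale_super]) (auto dest: grid_times_le)
 show "\<forall>q\<in>grid_times T. AE x in M. reward l q x \<le> bound_martingale l q x"
 proof
  fix q assume "q \<in> grid_times T"
  then have qT: "q \<le> T" by (rule grid_times_le)
  show "AE x in M. reward l q x \<le> bound_martingale l q x"
   using reward_eq AE_space by eventually_elim (use cost_nonneg qT in auto)
 qed
qed

definition envelope :: "'a process" where
 "envelope = (SOME J. snell_envelope (reward l) J)"

lemma snell_envelope_reward: "snell_envelope (reward l) envelope"
 unfolding envelope_def by (rule someI_ex[OF snell_envelope_exists[OF dominates_reward reward_rc]])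

text \<open>The price may lack left limits, but by sampling its mean only falls along increasing
  times, and the accrued value converges by continuity. Hence the mean cost does not jump up in the
  limit, and \<open>reward_sampling\<close> translates this.\<close>

lemma reward_left_usc:
 assumes \<tau>: "\<And>n. stopping (\<tau> n)" and mono: "\<And>n x. x \<in> space M ==> \<tau> n x \<le> \<tau> (Suc n) x"
  and A: "A \<in> sets (pre_sigma (\<tau> 0))" and c: "\<And>n::nat. c \<le> ev A (\<tau> n) (reward l)"
 shows "c \<le> ei A (\<lambda>x. reward l (SUP n. \<tau> n x) x)"
proof -
 define \<rho> where "\<rho> x = (SUP n. \<tau> n x)" for x
 have \<rho>: "stopping \<rho>" unfolding \<rho>_def by (rule stopping_SUP[OF \<tau>])
 have \<tau>_mono: "\<tau> i x \<le> \<tau> j x" if "i \<le> j" "x \<in> space M" for i j x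
  by (rule lift_Suc_mono_le[of "\<lambda>n. \<tau> n x", OF mono[OF that(2)] that(1)])
 have \<tau>\<rho>: "\<tau> i x \<le> \<rho> x" for i x unfolding \<rho>_def by (rule SUP_upper) simp
 have A_\<tau>: "A \<in> sets (pre_sigma (\<tau> i))" for i by (rule pre_sigma_mono[OF \<tau> \<tau> \<tau>_mono A]) auto
 have A_\<rho>: "A \<in> sets (pre_sigma \<rho>)" by (rule pre_sigma_mono[OF \<tau> \<rho> \<tau>\<rho> A])
 have [measurable]: "A \<in> sets M" by (rule pre_sigma_le_M[OF \<rho> A_\<rho>])
 let ?I = "\<lambda>Y \<tau>. \<integral>\<^sup>+ x\<in>A. ennreal (Y (\<tau> x) x) \<partial>M"
 have split: "?I (cost l) S = ?I end_cost S + ?I (marg_integral l) S" if S: "stopping S" for S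
 proof -
  note [measurable] = progressive_stopped_measurable[OF progressive_end_cost S] progressive_stopped_measurable[OF progressive_marg_integral S]
  have "?I (cost l) S = (\<integral>\<^sup>+ x. ennreal (end_cost (S x) x) * indicator A x + ennreal (marg_integral l (S x) x) * indicator A x \<partial>M)"
   using end_cost_nonneg by (intro nn_integral_cong) (auto simp: cost_def marg_integral_nonneg distrib_right)
  also have "\<dots> = ?I end_cost S + ?I (marg_integral l) S" by (rule nn_integral_add) measurable
  finally show ?thesis .
 qed
 have fin: "?I end_cost S < \<infinity>" if S: "stopping S" and A': "A \<in> sets (pre_sigma S)" for S
  using cost_bound_finite[of A] unfolding reward_sampling[OF S A', symmetric] split[OF S]
  by (auto simp: less_top[symmetric] ennreal_add_eq_top)
 have fin': "?I (marg_integral l) \<rho> < \<infinity>"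
  using cost_bound_finite[of A] unfolding reward_sampling[OF \<rho> A_\<rho>, symmetric] split[OF \<rho>]
  by (auto simp: less_top[symmetric] ennreal_add_eq_top)
 have le: "c + ?I (marg_integral l) (\<tau> i) \<le> ?I (reward l) \<rho> + ?I (marg_integral l) \<rho>" for i
 proof -
  have "?I end_cost (\<tau> i) + (?I (reward l) (\<tau> i) + ?I (marg_integral l) (\<tau> i)) = ?I (reward l) (\<tau> i) + ?I (cost l) (\<tau> i)"
   unfolding split[OF \<tau>] by (simp only: ac_simps)
  also have "\<dots> = ?I (reward l) \<rho> + ?I (cost l) \<rho>"
   by (simp add: reward_sampling[OF \<tau> A_\<tau>] reward_sampling[OF \<rho> A_\<rho>])
  also have "\<dots> \<le> ?I end_cost (\<tau> i) + (?I (reward l) \<rho> + ?I (marg_integral l) \<rho>)"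
   unfolding split[OF \<rho>]
   using add_right_mono[OF end_cost_sampling[OF \<tau> \<rho> \<tau>\<rho> A_\<tau>, of i], of "?I (reward l) \<rho> + ?I (marg_integral l) \<rho>"]
   by (simp only: ac_simps)
  finally have "?I (reward l) (\<tau> i) + ?I (marg_integral l) (\<tau> i) \<le> ?I (reward l) \<rho> + ?I (marg_integral l) \<rho>"
   using fin[OF \<tau> A_\<tau>, of i] by (auto simp: ennreal_add_left_cancel_le)
  then show ?thesis using c[of i] by (meson add_right_mono order_trans)
 qed
 have "(\<lambda>i. ?I (marg_integral l) (\<tau> i)) \<longlonglongrightarrow> ?I (marg_integral l) \<rho>"
 proof (rule nn_integral_dominated_convergence[where w = "\<lambda>x. ennreal (marg_integral l (\<rho> x) x) * indicator A x"])
  note [measurable] = progressive_stopped_measurable[OF progressive_marg_integral \<tau>] progressive_stopped_measurable[OF progressive_marg_integral \<rho>]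
  show "(\<lambda>x. ennreal (marg_integral l (\<tau> j x) x) * indicator A x) \<in> borel_measurable M"
   "(\<lambda>x. ennreal (marg_integral l (\<rho> x) x) * indicator A x) \<in> borel_measurable M"
   "(\<lambda>x. ennreal (marg_integral l (\<rho> x) x) * indicator A x) \<in> borel_measurable M" for j by measurable
  show "AE x in M. ennreal (marg_integral l (\<tau> j x) x) * indicator A x \<le> ennreal (marg_integral l (\<rho> x) x) * indicator A x" for j
   by (intro AE_I2 mult_right_mono ennreal_leI marg_integral_mono \<tau>\<rho>) auto
  show "?I (marg_integral l) \<rho> < \<infinity>" by (rule fin')
  show "AE x in M. (\<lambda>i. ennreal (marg_integral l (\<tau> i x) x) * indicator A x) \<longlonglongrightarrow> ennreal (marg_integral l (\<rho> x) x) * indicator A x"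
  proof (rule AE_I2)
   fix x assume x: "x \<in> space M"
   have "(\<lambda>i. \<tau> i x) \<longlonglongrightarrow> \<rho> x"
    unfolding \<rho>_def by (intro LIMSEQ_SUP incseq_SucI mono x)
   from tendsto_ennrealI[OF marg_integral_tendsto[OF l x this]]
   show "(\<lambda>i. ennreal (marg_integral l (\<tau> i x) x) * indicator A x) \<longlonglongrightarrow> ennreal (marg_integral l (\<rho> x) x) * indicator A x"
    by (cases "x \<in> A") auto
  qed
 qed
 then have "(\<lambda>i. c + ?I (marg_integral l) (\<tau> i)) \<longlonglongrightarrow> c + ?I (marg_integral l) \<rho>"
  by (intro tendsto_add tendsto_const)
 then have "c + ?I (marg_integral l) \<rho> \<le> ?I (reward l) \<rho> + ?I (marg_integral l) \<rho>"
  by (rule LIMSEQ_le_const2) (use le in auto)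
 then have "?I (marg_integral l) \<rho> + c \<le> ?I (marg_integral l) \<rho> + ?I (reward l) \<rho>" by (simp add: add.commute)
 then have "c \<le> ?I (reward l) \<rho>" using fin' by (auto simp: ennreal_add_left_cancel_le)
 then show ?thesis by (simp add: \<rho>_def)
qed

definition level_time :: "('a => ennreal) => 'a => ennreal" where
 "level_time = contact_time (reward l) envelope"

lemma stopping_level_time: "stopping S ==> stopping (level_time S)" unfolding level_time_def
 by (rule stopping_contact_time[OF snell_envelope_reward reward_adapted reward_rc])
  (auto intro: order_trans[OF _ reward_ge_1])

lemma level_time_ge: "stopping S ==> x \<in> space M ==> S x \<le> level_time S x" unfolding level_time_def
 by (rule contact_time_ge[OF snell_envelope_reward reward_adapted reward_rc])
  (auto intro: order_trans[OF _ reward_ge_1])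

lemma before_level_time: assumes "S x \<le> t" "t < level_time S x" shows "reward l t x < envelope t x"
proof -
 obtain \<theta> where \<theta>: "0 < \<theta>" "\<theta> < 1" "reward l t x \<le> \<theta> * envelope t x"
  using before_contact_time[OF snell_envelope_reward reward_adapted reward_rc reward_nonneg assms[unfolded level_time_def]]
  by blast
 then have "0 < envelope t x" using reward_ge_1[of l t x] zero_less_mult_pos[of \<theta> "envelope t x"] by linarith
 then have "\<theta> * envelope t x < envelope t x" using \<theta> by simp
 then show ?thesis using \<theta> by simp
qed

lemma level_time_contact: assumes "stopping S"
 shows "AE x in M. envelope (level_time S x) x = reward l (level_time S x) x" unfolding level_time_def
 by (rule snell_contact_time(2)[OF snell_envelope_reward reward_adapted reward_rc _ reward_left_usc assms])
  (auto intro: order_trans[OF _ reward_ge_1])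

lemma envelope_level_time: assumes "stopping S" "A \<in> sets (pre_sigma S)"
 shows "ev A S envelope = ev A (level_time S) (reward l)" unfolding level_time_def
 by (rule snell_contact_time(1)[OF snell_envelope_reward reward_adapted reward_rc _ reward_left_usc assms])
  (auto intro: order_trans[OF _ reward_ge_1])

theorem level_time_optimal:
 assumes S: "stopping S" and \<tau>: "stopping \<tau>" and le: "\<And>x. x \<in> space M ==> S x \<le> \<tau> x"
  and A: "A \<in> sets (pre_sigma S)" shows "ev A (level_time S) (cost l) \<le> ev A \<tau> (cost l)"
proof -
 let ?I = "\<lambda>Y \<tau>. \<integral>\<^sup>+ x\<in>A. ennreal (Y (\<tau> x) x) \<partial>M"
 note lt = stopping_level_time[OF S]
 have A_\<tau>: "A \<in> sets (pre_sigma \<tau>)" by (rule pre_sigma_mono[OF S \<tau> le A])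
 have A_l: "A \<in> sets (pre_sigma (level_time S))" by (rule pre_sigma_mono[OF S lt level_time_ge[OF S] A])
 have "?I (reward l) \<tau> \<le> ?I envelope \<tau>" using snell_envelopeD(5)[OF snell_envelope_reward] AE_space
  by (intro nn_integral_mono_AE, eventually_elim)
   (use stoppingD(2)[OF \<tau>] in \<open>auto intro!: mult_right_mono ennreal_leI\<close>)
 also have "\<dots> \<le> ?I envelope S"
  by (rule snell_sampling[OF snell_envelope_reward reward_adapted reward_rc _ S \<tau> le A])
   (auto intro: order_trans[OF _ reward_ge_1])
 also have "\<dots> = ?I (reward l) (level_time S)" by (rule envelope_level_time[OF S A])
 finally have le: "?I (reward l) \<tau> \<le> ?I (reward l) (level_time S)" .
 have "?I (reward l) (level_time S) + ?I (cost l) (level_time S) = ?I (reward l) \<tau> + ?I (cost l) \<tau>"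
  by (simp add: reward_sampling[OF \<tau> A_\<tau>] reward_sampling[OF lt A_l])
 also have "\<dots> \<le> ?I (reward l) (level_time S) + ?I (cost l) \<tau>" using le by (rule add_right_mono)
 finally show ?thesis using cost_bound_finite[of A] unfolding reward_sampling[OF lt A_l, symmetric]
  by (auto simp: ennreal_add_left_cancel_le less_top[symmetric] ennreal_add_eq_top)
qed

text \<open>Converse to \<open>level_time_contact\<close>, localised to \<open>B\<close>: if waiting
  for the level time saves nothing on any event inside \<open>B\<close>, the envelope integrates to
  no more than the reward there and hence equals it.\<close>

theorem contact_if_optimal: assumes S: "stopping S" and B: "B \<in> sets (pre_sigma S)"
  and opt: "\<And>A. A \<in> sets (pre_sigma S) ==> A \<subseteq> B ==>
   ev A S (cost l) \<le> ev A (level_time S) (cost l)"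
 shows "AE x in M. x \<in> B \<longrightarrow> envelope (S x) x = reward l (S x) x"
proof -
 let ?I = "\<lambda>A Y \<tau>. \<integral>\<^sup>+ x\<in>A. ennreal (Y (\<tau> x) x) \<partial>M"
 note lt = stopping_level_time[OF S]
 note meas = snell_stopped_measurable(1,3)[OF snell_envelope_reward reward_adapted reward_rc _ S]
 have le: "?I A envelope S \<le> ?I A (reward l) S" if A: "A \<in> sets (pre_sigma S)" "A \<subseteq> B" for A
 proof -
  have A_l: "A \<in> sets (pre_sigma (level_time S))" by (rule pre_sigma_mono[OF S lt level_time_ge[OF S] A(1)])
  have "?I A (cost l) S + ?I A (reward l) (level_time S) \<le> ?I A (reward l) (level_time S) + ?I A (cost l) (level_time S)"
   using opt[OF A] by (simp add: add.commute add_left_mono)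
  also have "\<dots> = ?I A (cost l) S + ?I A (reward l) S" by (subst add.commute[of "?I A (cost l) S"])
    (rule trans[OF reward_sampling[OF lt A_l] reward_sampling[OF S A(1), symmetric]])
  finally have "?I A (reward l) (level_time S) \<le> ?I A (reward l) S"
   using cost_bound_finite[of A] unfolding reward_sampling[OF S A(1), symmetric]
   by (auto simp: ennreal_add_left_cancel_le less_top[symmetric] ennreal_add_eq_top)
  then show ?thesis by (simp add: envelope_level_time[OF S A(1)])
 qed
 have "AE x in M. ennreal (envelope (S x) x) * indicator B x \<le> ennreal (reward l (S x) x) * indicator B x"
 proof (rule AE_le_of_set_integrals[OF sub_pre_sigma[OF S]])
  have m: "(\<lambda>x. envelope (S x) x) \<in> borel_measurable (pre_sigma S)" "(\<lambda>x. reward l (S x) x) \<in> borel_measurable (pre_sigma S)"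
   by (rule meas, auto intro: order_trans[OF _ reward_ge_1])+
  note [measurable] = m B
  show "(\<lambda>x. ennreal (envelope (S x) x) * indicator B x) \<in> borel_measurable (pre_sigma S)"
   "(\<lambda>x. ennreal (reward l (S x) x) * indicator B x) \<in> borel_measurable (pre_sigma S)" by measurable
  have "?I B envelope S \<le> (\<integral>\<^sup>+ x. ennreal (envelope (S x) x) \<partial>M)"
   by (intro nn_integral_mono) (auto simp: indicator_def)
  also have "\<dots> < \<infinity>"
   by (rule snell_finite[OF snell_envelope_reward reward_adapted reward_rc _ S]) (auto intro: order_trans[OF _ reward_ge_1])
  finally show "?I B envelope S < \<infinity>" .
  fix A assume A: "A \<in> sets (pre_sigma S)"
  have "?I (A \<inter> B) envelope S \<le> ?I (A \<inter> B) (reward l) S" using A B by (intro le) auto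
  moreover have "?I (A \<inter> B) Y S = (\<integral>\<^sup>+ x\<in>A. (ennreal (Y (S x) x) * indicator B x) \<partial>M)" for Y :: "'a process"
   by (intro nn_integral_cong) (auto simp: indicator_def)
  ultimately show "(\<integral>\<^sup>+ x\<in>A. (ennreal (envelope (S x) x) * indicator B x) \<partial>M) \<le>
    (\<integral>\<^sup>+ x\<in>A. (ennreal (reward l (S x) x) * indicator B x) \<partial>M)" by simp
 qed
 with snell_envelopeD(5)[OF snell_envelope_reward] AE_space show ?thesis
 proof eventually_elim
  case (elim x)
  then have "reward l (S x) x \<le> envelope (S x) x" using stoppingD(2)[OF S] by auto
  with elim reward_ge_1[of l "S x" x] show ?case by (auto simp: indicator_def ennreal_le_iff)
 qed
qed

end

section \<open>Comparison of levels\<close>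

lemma marg_integral_increment:
 assumes l: "0 < l" and x: "x \<in> space M" and fin: "(\<integral>\<^sup>+ s. ennreal (marginal l s x) \<partial>leb_time T) < \<infinity>" and st: "s \<le> t"
 shows "ennreal (marg_integral l t x - marg_integral l s x) = (\<integral>\<^sup>+ v\<in>{s..t}. ennreal (marginal l v x) \<partial>leb_time T)"
proof -
 have m: "(indicator {..v} :: _ => ennreal) \<in> borel_measurable (leb_time T)" "(indicator {s<..v} :: _ => ennreal) \<in> borel_measurable (leb_time T)" for v
  by (simp_all cong: measurable_cong_sets) (rule measurable_restrict_space1, simp)+
 note [measurable] = m marginal_leb_measurable[OF l x]
 have "ennreal (marg_integral l t x) = (\<integral>\<^sup>+ v. ennreal (marginal l v x) * indicator {..s} v + ennreal (marginal l v x) * indicator {s<..t} v \<partial>leb_time T)"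
  unfolding marg_integral_eq[OF fin] using st by (intro nn_integral_cong) (auto simp: indicator_def)
 also have "\<dots> = ennreal (marg_integral l s x) + (\<integral>\<^sup>+ v\<in>{s<..t}. ennreal (marginal l v x) \<partial>leb_time T)"
  unfolding marg_integral_eq[OF fin] by (rule nn_integral_add) measurable
 also have "(\<integral>\<^sup>+ v\<in>{s<..t}. ennreal (marginal l v x) \<partial>leb_time T) = (\<integral>\<^sup>+ v\<in>{s..t}. ennreal (marginal l v x) \<partial>leb_time T)"
  using AE_leb_time_neq[of s T] by (intro nn_integral_cong_AE) (auto simp: indicator_def elim!: eventually_mono)
 finally show ?thesis by (subst ennreal_minus[OF marg_integral_nonneg, symmetric]) simp
qed

lemma marg_integral_diff_mono:
 assumes l: "0 < l" "l \<le> l'" and x: "x \<in> space M" and fin: "(\<integral>\<^sup>+ s. ennreal (marginal l s x) \<partial>leb_time T) < \<infinity>" and st: "s \<le> t"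
 shows "marg_integral l' t x - marg_integral l' s x \<le> marg_integral l t x - marg_integral l s x"
proof -
 have le: "ennreal (marginal l' v x) \<le> ennreal (marginal l v x)" for v
  by (rule ennreal_leI[OF marginal_antimono[OF x l]])
 have fin': "(\<integral>\<^sup>+ s. ennreal (marginal l' s x) \<partial>leb_time T) < \<infinity>"
  by (rule le_less_trans[OF nn_integral_mono fin]) (rule le)
 have l': "0 < l'" using l by simp
 have "ennreal (marg_integral l' t x - marg_integral l' s x) \<le> ennreal (marg_integral l t x - marg_integral l s x)"
  unfolding marg_integral_increment[OF l(1) x fin st] marg_integral_increment[OF l' x fin' st]
  by (intro nn_integral_mono mult_right_mono le) simp
 then show ?thesis using marg_integral_mono[OF st] by (simp add: ennreal_le_iff)
qed

lemma reward_integrable: assumes l: "0 < l" and t: "t \<le> T" shows "integrable M (reward l t)"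
proof (rule integrableI_nonneg)
 show "reward l t \<in> borel_measurable M" using reward_adapted[OF l] t F_measurable_M by (auto simp: adapted_def)
 have "ei (space M) (reward l t) \<le> ei (space M) (cost_bound l)"
  using reward_sampling[OF l stopping_const[OF t] space_in_pre_sigma, symmetric] by simp
 also have "\<dots> < \<infinity>" by (rule cost_bound_finite[OF l])
 also have "ei (space M) (reward l t) = (\<integral>\<^sup>+ x. ennreal (reward l t x) \<partial>M)"
  by (intro nn_integral_cong) simp
 finally show "(\<integral>\<^sup>+ x. ennreal (reward l t x) \<partial>M) < \<infinity>" .
qed (simp add: reward_nonneg)

text \<open>The difference of the rewards of two levels is the supermartingale generated by the
 decreasing process of the remaining difference of marginal values.\<close>

theorem envelope_gap_mono: assumes l: "0 < l" "l \<le> l'"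
 shows "AE x in M. \<forall>t\<le>T. envelope l t x - reward l t x \<le> envelope l' t x - reward l' t x"
proof -
 have l': "0 < l'" using l by simp
 let ?\<Phi> = "\<lambda>l t x. marg_integral l T x - marg_integral l t x"
 \<comment> \<open>The excess of the accrual after \<open>t\<close> at the lower level over that at
   the higher one; the maximum with 0 acts on a null event only.\<close>
 define D where "D t x = max 0 (?\<Phi> l t x - ?\<Phi> l' t x)" for t x
 note \<Phi>I = marg_integral_integrable[OF l(1)] marg_integral_integrable[OF l']
 have D_int: "integrable M (D t)" if "t \<le> T" for t unfolding D_def[abs_def] using \<Phi>I that by auto
 have D0: "0 \<le> D t x" for t x by (simp add: D_def)
 have D_AE: "AE x in M. D t x \<le> D s x \<and> D s x = ?\<Phi> l s x - ?\<Phi> l' s x" if st: "s \<le> t" "t \<le> T" for s t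
  using AE_marginal_finite[OF l(1)] AE_space
 proof eventually_elim
  case (elim x)
  have "s \<le> T" using st by simp
  then show ?case
   using marg_integral_diff_mono[OF l elim(2,1) st(1)] marg_integral_diff_mono[OF l elim(2,1) \<open>s \<le> T\<close>]
   by (auto simp: D_def)
 qed
 define R where "R t = closed_martingale (D t) t" for t
 have R_int: "ei A (R t) = ei A (D t)" if "t \<le> T" "A \<in> sets (F t)" for t A
  unfolding R_def by (rule closed_martingale_set_integral[OF D_int[OF that(1)] that(2)])
 have R_super: "supermart (grid_times T) R" unfolding supermart_def
 proof (intro conjI ballI impI)
  fix t assume "t \<in> grid_times T"
  then have t: "t \<le> T" by (rule grid_times_le)
  note S = supermartD[OF supermart_closed_martingale[OF D_int[OF t]], of t "{t}", folded R_def]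
  show "R t \<in> borel_measurable (F t)" "integrable M (R t)" using S by auto
  show "0 \<le> R t x" if "x \<in> space M" for x using S(3)[OF _ that] by simp
 next
  fix s t A assume s: "s \<in> grid_times T" and t: "t \<in> grid_times T" and st: "s \<le> t" and A: "A \<in> sets (F s)"
  have sT: "s \<le> T" "t \<le> T" using grid_times_le s t by auto
  show "ei A (R t) \<le> ei A (R s)" unfolding R_int[OF sT(1) A] R_int[OF sT(2) F_mono[OF A st]]
   using D_AE[OF st sT(2)] by (intro nn_integral_mono_AE) (auto elim!: eventually_mono intro!: mult_right_mono ennreal_leI)
 qed
 \<comment> \<open>Both rewards contain the same price terms, so only the accruals differ. The costs
   are added to both sides and cancelled at the end, since they are finite.\<close>
 have R_eq: "AE x in M. reward l q x = R q x + reward l' q x" if q: "q \<in> grid_times T" for q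
 proof -
  have qT: "q \<le> T" by (rule grid_times_le[OF q])
  note rI = reward_integrable[OF l(1) qT] reward_integrable[OF l' qT]
  have rm: "reward l q \<in> borel_measurable (F q)" "reward l' q \<in> borel_measurable (F q)"
   using reward_adapted[OF l(1)] reward_adapted[OF l'] qT by (auto simp: adapted_def)
  note Rm = supermartD(1)[OF R_super q] and RI = supermartD(4)[OF R_super q] and R0 = supermartD(3)[OF R_super q]
  have eq: "ei A (reward l q) = ei A (\<lambda>x. R q x + reward l' q x)" if A: "A \<in> sets (F q)" for A
  proof -
   let ?I = "\<lambda>Y. \<integral>\<^sup>+ x\<in>A. ennreal (Y x) \<partial>M"
   have [measurable]: "A \<in> sets M" by (rule F_le_M[OF A])
   have add: "?I (\<lambda>x. Y x + Z x) = ?I Y + ?I Z"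
    if [measurable]: "Y \<in> borel_measurable M" "Z \<in> borel_measurable M"
     and nn: "\<And>x. x \<in> space M ==> 0 \<le> Y x" "\<And>x. x \<in> space M ==> 0 \<le> Z x" for Y Z
   proof -
    have "?I (\<lambda>x. Y x + Z x) = (\<integral>\<^sup>+ x. ennreal (Y x) * indicator A x + ennreal (Z x) * indicator A x \<partial>M)"
     using nn by (intro nn_integral_cong) (auto simp: distrib_right)
    also have "\<dots> = ?I Y + ?I Z" by (rule nn_integral_add) measurable
    finally show ?thesis .
   qed
   note pA = pre_sigma_const[OF qT A] and qs = stopping_const[OF qT]
   have c: "cost k q \<in> borel_measurable M" if "0 < k" for k
    using cost_adapted[OF that] qT F_measurable_M by (auto simp: adapted_def)
   have b: "cost_bound k \<in> borel_measurable M" if "0 < k" for k using cost_bound_integrable[OF that] by auto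
   have b0: "0 \<le> cost_bound k x" if "0 < k" "x \<in> space M" for k x using cost_bound_nonneg[OF that] by simp
   have d: "D q \<in> borel_measurable M" using D_int[OF qT] by auto
   have "?I (reward l q) + ?I (cost l q) + ?I (cost l' q) = ?I (\<lambda>x. cost_bound l x + cost l' q x)"
    using reward_sampling[OF l(1) qs pA] add[OF b[OF l(1)] c[OF l'] b0[OF l(1)] cost_nonneg] by simp
   also have "\<dots> = ?I (\<lambda>x. D q x + (cost_bound l' x + cost l q x))"
   proof (rule nn_integral_cong_AE)
    show "AE x in M. ennreal (cost_bound l x + cost l' q x) * indicator A x =
      ennreal (D q x + (cost_bound l' x + cost l q x)) * indicator A x" using D_AE[OF order_refl qT]
    proof eventually_elim
     case (elim x)
     then have "cost_bound l x + cost l' q x = D q x + (cost_bound l' x + cost l q x)"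
      by (simp add: cost_bound_def cost_def)
     then show ?case by simp
    qed
   qed
   also have "\<dots> = ?I (D q) + (?I (cost_bound l') + ?I (cost l q))"
    using add[OF d borel_measurable_add[OF b[OF l'] c[OF l(1)]] D0 add_nonneg_nonneg[OF b0[OF l'] cost_nonneg]]
     add[OF b[OF l'] c[OF l(1)] b0[OF l'] cost_nonneg] by simp
   also have "?I (cost_bound l') = ?I (reward l' q) + ?I (cost l' q)" by (rule reward_sampling[OF l' qs pA, symmetric])
   finally have "(?I (cost l q) + ?I (cost l' q)) + ?I (reward l q) = (?I (cost l q) + ?I (cost l' q)) + (?I (D q) + ?I (reward l' q))"
    by (simp only: ac_simps)
   moreover have "?I (cost l q) + ?I (cost l' q) < \<infinity>"
    using cost_bound_finite[OF l(1), of A] cost_bound_finite[OF l', of A]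
    unfolding reward_sampling[OF l(1) qs pA, symmetric] reward_sampling[OF l' qs pA, symmetric]
    by (auto simp: less_top[symmetric] ennreal_add_eq_top)
   ultimately have "?I (reward l q) = ?I (D q) + ?I (reward l' q)" by (auto simp: ennreal_add_left_cancel)
   also have "\<dots> = ?I (\<lambda>x. R q x + reward l' q x)" unfolding R_int[OF qT A, symmetric]
    by (rule add[symmetric]) (use F_measurable_M[OF Rm] rI(2) R0 reward_nonneg in auto)
   finally show ?thesis .
  qed
  have "AE x in M. reward l q x \<le> R q x + reward l' q x"
   by (rule AE_le_of_F_integrals[where t = q]) (use rm Rm rI RI R0 reward_nonneg eq in \<open>auto intro: add_nonneg_nonneg\<close>)
  moreover have "AE x in M. R q x + reward l' q x \<le> reward l q x"
   by (rule AE_le_of_F_integrals[where t = q]) (use rm Rm rI RI R0 reward_nonneg eq in auto)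
  ultimately show ?thesis by eventually_elim simp
 qed
 note E' = snell_envelopeD[OF snell_envelope_reward[OF l']] and E = snell_envelopeD[OF snell_envelope_reward[OF l(1)]]
 \<comment> \<open>This process dominates the reward at level \<open>l\<close>; minimality of the
   envelope and \<open>R_eq\<close> then give the claim.\<close>
 have "supermart (grid_times T) (\<lambda>t x. 1 * envelope l' t x + 1 * R t x)"
  by (rule supermart_add_scaled[OF E'(2) R_super]) auto
 then have dom: "dominates (\<lambda>t x. envelope l' t x + R t x) (reward l)" unfolding dominates_def
 proof (intro conjI ballI)
  fix q assume q: "q \<in> grid_times T"
  then have "q \<le> T" by (rule grid_times_le)
  then show "AE x in M. reward l q x \<le> envelope l' q x + R q x"
   using R_eq[OF q] E'(5) by (auto elim: eventually_elim2)
 qed simp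
 have "AE x in M. envelope l q x - reward l q x \<le> envelope l' q x - reward l' q x" if q: "q \<in> grid_times T" for q
  using snell_envelope_minimal[OF snell_envelope_reward[OF l(1)] dom q] R_eq[OF q] by eventually_elim simp
 then have "AE x in M. \<forall>q\<in>grid_times T. envelope l q x - reward l q x \<le> envelope l' q x - reward l' q x"
  by (simp add: AE_ball_countable[OF countable_grid_times])
 with AE_space show ?thesis
 proof eventually_elim
  case (elim x)
  show ?case
   using right_continuous_le[OF right_continuous_diff[OF E(3) reward_rc[OF l(1)]] right_continuous_diff[OF E'(3) reward_rc[OF l']],
    OF elim(1) elim(1) elim(1) elim(1)] elim(2) by auto
 qed
qed

end

section \<open>The backward equation for the running level\<close>

definition pos_rats :: "real set" where "pos_rats = {q \<in> \<rat>. 0 < q}"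

lemma countable_pos_rats: "countable pos_rats"
 unfolding pos_rats_def by (rule countable_subset[OF _ countable_rat]) auto

lemma pos_rats_pos: "q \<in> pos_rats ==> 0 < q" by (simp add: pos_rats_def)

lemma pos_rats_of_nat: "1 / real (Suc k) \<in> pos_rats" "real (Suc k) \<in> pos_rats" by (auto simp: pos_rats_def)

lemma pos_rats_add_frac: "a \<in> pos_rats ==> a + real j / real k \<in> pos_rats"
 by (auto simp: pos_rats_def intro!: add_pos_nonneg)

lemma pos_rats_between: assumes "0 \<le> (x::real)" "x < y" shows "\<exists>q\<in>pos_rats. x < q \<and> q < y"
 using Rats_dense_in_real[OF assms(2)] assms(1) by (force simp: pos_rats_def)

text \<open>The value is the junk \<open>real_of_ereal \<infinity> = 0\<close> if \<open>P\<close> holds at unbounded levels.\<close>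

definition level_of :: "(real => bool) => real" where
 "level_of P = real_of_ereal (SUP q\<in>pos_rats. if P q then ereal q else 0)"

lemma level_of: assumes mono: "\<And>q q'. q \<in> pos_rats ==> q' \<in> pos_rats ==> q \<le> q' ==> P q' ==> P q"
  and q0: "q0 \<in> pos_rats" "\<not> P q0" shows "0 \<le> level_of P" "q \<in> pos_rats ==> P q ==> q \<le> level_of P"
  "q \<in> pos_rats ==> \<not> P q ==> level_of P \<le> q"
proof -
 let ?E = "SUP q\<in>pos_rats. if P q then ereal q else 0"
 have up: "?E \<le> ereal q" if q: "q \<in> pos_rats" "\<not> P q" for q
 proof (rule SUP_least)
  fix q' assume q': "q' \<in> pos_rats"
  show "(if P q' then ereal q' else 0) \<le> ereal q"
   using mono[OF q(1) q'] q(2) pos_rats_pos[OF q(1)] by (cases "q \<le> q'") auto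
 qed
 have low: "ereal q \<le> ?E" if "q \<in> pos_rats" "P q" for q using that by (intro SUP_upper2[of q]) auto
 have "0 \<le> ?E" using pos_rats_of_nat(2)[of 0] by (intro SUP_upper2[of "real (Suc 0)"]) auto
 with up[OF q0] obtain s where s: "?E = ereal s" "0 \<le> s" by (cases ?E) auto
 then have "level_of P = s" by (simp add: level_of_def)
 with s up low show "0 \<le> level_of P" "q \<in> pos_rats ==> P q ==> q \<le> level_of P"
  "q \<in> pos_rats ==> \<not> P q ==> level_of P \<le> q" by auto
qed

lemma level_unique:
 assumes "0 \<le> s" "0 \<le> s'" "\<And>q. q \<in> pos_rats ==> P q ==> q \<le> s" "\<And>q. q \<in> pos_rats ==> \<not> P q ==> s \<le> q"
  "\<And>q. q \<in> pos_rats ==> P q ==> q \<le> s'" "\<And>q. q \<in> pos_rats ==> \<not> P q ==> s' \<le> q"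
 shows "s = s'"
proof (rule linorder_cases[of s s'])
 assume "s < s'"
 then obtain q where "q \<in> pos_rats" "s < q" "q < s'" using pos_rats_between[OF assms(1)] by blast
 then show ?thesis using assms(3,6) by force
next
 assume "s' < s"
 then obtain q where "q \<in> pos_rats" "s' < q" "q < s" using pos_rats_between[OF assms(2)] by blast
 then show ?thesis using assms(4,5) by force
qed

lemma level_of_measurable: assumes [measurable]: "\<And>q. q \<in> pos_rats ==> Measurable.pred N (\<lambda>z. P z q)"
 shows "(\<lambda>z. level_of (P z)) \<in> borel_measurable N"
proof -
 have "(\<lambda>z. SUP q\<in>pos_rats. if P z q then ereal q else 0) \<in> borel_measurable N"
  by (intro borel_measurable_SUP countable_pos_rats) measurable
 then show ?thesis unfolding level_of_def by measurable
qed

context backward_setting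
begin

section \<open>Integrals over stochastic intervals\<close>

abbreviation PT :: "('a \<times> ennreal) measure" where "PT \<equiv> M \<Otimes>\<^sub>M leb_time T"

text \<open>Half-open intervals make adjacent slices disjoint, so that they add up exactly.\<close>

definition between :: "'a set => ('a => ennreal) => ('a => ennreal) => ('a \<times> ennreal) set" where
 "between A S \<tau> = {z. fst z \<in> A \<and> S (fst z) \<le> snd z \<and> snd z < \<tau> (fst z)}"

definition slice :: "'a set => ('a => ennreal) => ('a => ennreal) => 'a process => ennreal" where
 "slice A S \<tau> Y = (\<integral>\<^sup>+ z\<in>between A S \<tau>. ennreal (Y (snd z) (fst z)) \<partial>PT)"

lemma measurable_snd_PT [measurable]: "snd \<in> borel_measurable PT"
 by (rule optional_measurable_product[OF measurable_snd_optional])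

lemma between_indicator_measurable:
 assumes [measurable]: "A \<in> sets M" "S \<in> borel_measurable M" "\<tau> \<in> borel_measurable M"
 shows "(indicator (between A S \<tau>) :: _ => ennreal) \<in> borel_measurable PT"
proof -
 have "(\<lambda>z. if fst z \<in> A \<and> S (fst z) \<le> snd z \<and> snd z < \<tau> (fst z) then 1 else 0 :: ennreal) \<in> borel_measurable PT"
  by measurable
 then show ?thesis by (rule measurable_cong[THEN iffD1, rotated]) (auto simp: between_def indicator_def)
qed

lemma AE_PT: assumes "AE x in M. P x" shows "AE z in PT. P (fst z)"
proof -
 interpret L: sigma_finite_measure "leb_time T" by (rule sigma_finite_leb_time)
 obtain N where N: "{x \<in> space M. \<not> P x} \<subseteq> N" "N \<in> null_sets M"
  using assms by (auto elim!: AE_E simp: null_sets_def)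
 have "N \<times> {..T} \<in> null_sets PT"
  using N(2) L.emeasure_pair_measure_Times[of N M "{..T}"] sets.top[of "leb_time T"] by (auto simp: null_sets_def)
 from AE_not_in[OF this] AE_space show ?thesis
  by eventually_elim (use N(1) in \<open>auto simp: space_pair_measure\<close>)
qed

lemma slice_mono:
 assumes "AE x in M. x \<in> A \<longrightarrow> (\<forall>t. S x \<le> t \<and> t < \<tau> x \<longrightarrow> Y t x \<le> Z t x)"
 shows "slice A S \<tau> Y \<le> slice A S \<tau> Z" unfolding slice_def using AE_PT[OF assms]
 by (intro nn_integral_mono_AE) (auto elim!: eventually_mono simp: between_def indicator_def intro!: ennreal_leI)

lemma slice_region_mono:
 assumes "\<And>x t. x \<in> space M ==> (x, t) \<in> between A S \<tau> ==> (x, t) \<in> between A' S' \<tau>'"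
 shows "slice A S \<tau> Y \<le> slice A' S' \<tau>' Y"
 unfolding slice_def using assms by (intro nn_integral_mono) (auto simp: space_pair_measure indicator_def)

abbreviation PTm :: "'a process => bool" where
 "PTm Y \<equiv> (\<lambda>z. Y (snd z) (fst z)) \<in> borel_measurable PT"

lemma slice_add: assumes Y: "PTm Y" and A: "A \<in> sets M" and st: "stopping S" "stopping \<tau>" "stopping \<rho>"
  and le: "AE x in M. S x \<le> \<tau> x \<and> \<tau> x \<le> \<rho> x"
 shows "slice A S \<rho> Y = slice A S \<tau> Y + slice A \<tau> \<rho> Y"
proof -
 note [measurable] = Y between_indicator_measurable[OF A, of S \<tau>] between_indicator_measurable[OF A, of \<tau> \<rho>] st
 have "slice A S \<rho> Y = (\<integral>\<^sup>+ z. ennreal (Y (snd z) (fst z)) * indicator (between A S \<tau>) z + ennreal (Y (snd z) (fst z)) * indicator (between A \<tau> \<rho>) z \<partial>PT)"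
  unfolding slice_def
  by (rule nn_integral_cong_AE, rule eventually_mono[OF AE_PT[OF le]]) (auto simp: between_def indicator_def)
 also have "\<dots> = slice A S \<tau> Y + slice A \<tau> \<rho> Y"
  unfolding slice_def by (rule nn_integral_add) measurable
 finally show ?thesis .
qed

lemma slice_iterated: assumes Y: "PTm Y" and A: "A \<in> sets M" and st: "stopping S" "stopping \<tau>"
 shows "slice A S \<tau> Y = (\<integral>\<^sup>+ x\<in>A. (\<integral>\<^sup>+ t\<in>{S x..\<tau> x}. ennreal (Y t x) \<partial>leb_time T) \<partial>M)"
proof -
 interpret L: sigma_finite_measure "leb_time T" by (rule sigma_finite_leb_time)
 note [measurable] = Y between_indicator_measurable[OF A, of S \<tau>] st
 have "slice A S \<tau> Y = (\<integral>\<^sup>+ x. \<integral>\<^sup>+ t. ennreal (Y t x) * indicator (between A S \<tau>) (x, t) \<partial>leb_time T \<partial>M)"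
  unfolding slice_def by (subst L.nn_integral_fst[symmetric]) simp_all
 also have "\<dots> = (\<integral>\<^sup>+ x\<in>A. (\<integral>\<^sup>+ t\<in>{S x..\<tau> x}. ennreal (Y t x) \<partial>leb_time T) \<partial>M)"
 proof (rule nn_integral_cong)
  fix x
  have "(\<integral>\<^sup>+ t. ennreal (Y t x) * indicator (between {x} S \<tau>) (x, t) \<partial>leb_time T) = (\<integral>\<^sup>+ t\<in>{S x..\<tau> x}. ennreal (Y t x) \<partial>leb_time T)"
   using AE_leb_time_neq[of "\<tau> x" T]
   by (intro nn_integral_cong_AE) (auto elim!: eventually_mono simp: between_def indicator_def)
  then show "(\<integral>\<^sup>+ t. ennreal (Y t x) * indicator (between A S \<tau>) (x, t) \<partial>leb_time T) =
    (\<integral>\<^sup>+ t\<in>{S x..\<tau> x}. ennreal (Y t x) \<partial>leb_time T) * indicator A x"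
   by (cases "x \<in> A") (simp_all add: between_def indicator_def)
 qed
 finally show ?thesis .
qed

lemma marginal_PT: "0 < l ==> PTm (marginal l)" by (rule progressive_product[OF marginal_progressive])

lemma slice_marginal_finite: assumes l: "0 < l" and A: "A \<in> sets M" and st: "stopping S" "stopping \<tau>"
 shows "slice A S \<tau> (marginal l) < \<infinity>" unfolding slice_iterated[OF marginal_PT[OF l] A st]
 by (rule le_less_trans[OF _ marginal_integrable[OF l]], intro nn_integral_mono)
  (auto simp: indicator_def intro!: nn_integral_mono)

lemma marg_integral_slice:
 assumes l: "0 < l" and A: "A \<in> sets M" and st: "stopping S" "stopping \<tau>" and le: "AE x in M. S x \<le> \<tau> x"
 shows "ev A \<tau> (marg_integral l) = ev A S (marg_integral l) + slice A S \<tau> (marginal l)"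
proof -
 note m [measurable] = A progressive_stopped_measurable[OF progressive_marg_integral[OF l] st(1)]
  progressive_stopped_measurable[OF progressive_marg_integral[OF l] st(2)]
 have inc: "AE x in M. ennreal (marg_integral l (\<tau> x) x - marg_integral l (S x) x) =
   (\<integral>\<^sup>+ t\<in>{S x..\<tau> x}. ennreal (marginal l t x) \<partial>leb_time T)"
  using le AE_marginal_finite[OF l] AE_space by eventually_elim (rule marg_integral_increment[OF l])
 have "ev A \<tau> (marg_integral l) = (\<integral>\<^sup>+ x. ennreal (marg_integral l (S x) x) * indicator A x +
   ennreal (marg_integral l (\<tau> x) x - marg_integral l (S x) x) * indicator A x \<partial>M)"
  by (rule nn_integral_cong_AE, rule eventually_mono[OF le])
   (auto simp: indicator_def marg_integral_nonneg marg_integral_mono ennreal_plus[symmetric] simp del: ennreal_plus)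
 also have "\<dots> = ev A S (marg_integral l) + ei A (\<lambda>x. marg_integral l (\<tau> x) x - marg_integral l (S x) x)"
  by (rule nn_integral_add) measurable
 also have "ei A (\<lambda>x. marg_integral l (\<tau> x) x - marg_integral l (S x) x) = slice A S \<tau> (marginal l)"
  unfolding slice_iterated[OF marginal_PT[OF l] A st] by (rule nn_integral_cong_AE, rule eventually_mono[OF inc]) simp
 finally show ?thesis .
qed

lemma ev_cost: assumes l: "0 < l" and A: "A \<in> sets M" and st: "stopping \<tau>"
 shows "ev A \<tau> (cost l) = ev A \<tau> end_cost + ev A \<tau> (marg_integral l)"
proof -
 note [measurable] = A progressive_stopped_measurable[OF progressive_marg_integral[OF l] st]
  progressive_stopped_measurable[OF progressive_end_cost st]
 have "ev A \<tau> (cost l) = (\<integral>\<^sup>+ x. ennreal (end_cost (\<tau> x) x) * indicator A x + ennreal (marg_integral l (\<tau> x) x) * indicator A x \<partial>M)"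
  using end_cost_nonneg by (intro nn_integral_cong) (auto simp: cost_def marg_integral_nonneg distrib_right)
 also have "\<dots> = ev A \<tau> end_cost + ev A \<tau> (marg_integral l)" by (rule nn_integral_add) measurable
 finally show ?thesis .
qed

lemma ev_marg_integral_finite:
 assumes l: "0 < l" and st: "stopping \<tau>" shows "ev A \<tau> (marg_integral l) < \<infinity>"
proof -
 have "ev A \<tau> (marg_integral l) \<le> (\<integral>\<^sup>+ x. ennreal (norm (marg_integral l T x)) \<partial>M)"
  using marg_integral_mono[OF stoppingD(2)[OF st]]
  by (intro nn_integral_mono) (auto simp: indicator_def marg_integral_nonneg intro!: ennreal_leI)
 also have "\<dots> < \<infinity>" using marg_integral_integrable[OF l order_refl] by (simp add: integrable_iff_bounded)
 finally show ?thesis .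
qed

lemma ev_end_cost_finite: assumes st: "stopping \<tau>" shows "ev A \<tau> end_cost < \<infinity>"
proof -
 have "ev A \<tau> end_cost \<le> ev (space M) \<tau> end_cost" by (intro nn_integral_mono) (auto simp: indicator_def)
 also have "\<dots> \<le> ev (space M) (\<lambda>_. 0) end_cost" by (rule end_cost_sampling[OF stopping_const st]) auto
 also have "\<dots> < \<infinity>"
 proof (rule le_less_trans[OF nn_integral_mono])
  show "ennreal (end_cost 0 x) * indicator (space M) x \<le> ennreal (norm (end_cost 0 x))" for x
   by (auto simp: indicator_def intro: ennreal_leI)
  show "(\<integral>\<^sup>+ x. ennreal (norm (end_cost 0 x)) \<partial>M) < \<infinity>"
   using supermartD(4)[OF supermart_end_cost, of 0] by (simp add: integrable_iff_bounded)
 qed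
 finally show ?thesis .
qed

context
 fixes S :: "'a => ennreal" and A :: "'a set" assumes S: "stopping S" and A: "A \<in> sets (pre_sigma S)"
begin

lemma A_M: "A \<in> sets M" by (rule pre_sigma_le_M[OF S A])

text \<open>Optimality of the level time with the common accrual cancelled. This and
  \<open>level_time_earlier\<close> squeeze every level step from the two sides.\<close>

lemma level_time_later:
 assumes l: "0 < l" and \<tau>: "stopping \<tau>" "\<And>x. x \<in> space M ==> S x \<le> \<tau> x" and le: "AE x in M. level_time l S x \<le> \<tau> x"
 shows "ev A (level_time l S) end_cost \<le> ev A \<tau> end_cost + slice A (level_time l S) \<tau> (marginal l)"
proof -
 note lt = stopping_level_time[OF l S]
 have "ev A (level_time l S) (marg_integral l) + ev A (level_time l S) end_cost \<le>
   ev A (level_time l S) (marg_integral l) + (ev A \<tau> end_cost + slice A (level_time l S) \<tau> (marginal l))"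
  using level_time_optimal[OF l S \<tau> A]
  unfolding ev_cost[OF l A_M lt] ev_cost[OF l A_M \<tau>(1)] marg_integral_slice[OF l A_M lt \<tau>(1) le]
  by (simp only: ac_simps)
 then show ?thesis using ev_marg_integral_finite[OF l lt, of A] by (auto simp: ennreal_add_left_cancel_le)
qed

lemma level_time_earlier:
 assumes l: "0 < l" and \<tau>: "stopping \<tau>" "\<And>x. x \<in> space M ==> S x \<le> \<tau> x" and le: "AE x in M. \<tau> x \<le> level_time l S x"
 shows "ev A (level_time l S) end_cost + slice A \<tau> (level_time l S) (marginal l) \<le> ev A \<tau> end_cost"
proof -
 note lt = stopping_level_time[OF l S]
 have "ev A \<tau> (marg_integral l) + (ev A (level_time l S) end_cost + slice A \<tau> (level_time l S) (marginal l)) \<le>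
   ev A \<tau> (marg_integral l) + ev A \<tau> end_cost" using level_time_optimal[OF l S \<tau> A]
  unfolding ev_cost[OF l A_M lt] ev_cost[OF l A_M \<tau>(1)] marg_integral_slice[OF l A_M \<tau>(1) lt le]
  by (simp only: ac_simps)
 then show ?thesis using ev_marg_integral_finite[OF l \<tau>(1), of A] by (auto simp: ennreal_add_left_cancel_le)
qed

end

text \<open>The envelope dominates the reward almost surely, so the inequality expresses equality;
  in this form it passes directly through \<open>envelope_gap_mono\<close>.\<close>

definition contact :: "real => ennreal => 'a => bool" where
 "contact q t x \<longleftrightarrow> envelope q t x \<le> reward q t x"

lemma AE_contact_mono:
 "AE x in M. \<forall>q\<in>pos_rats. \<forall>q'\<in>pos_rats. q \<le> q' \<longrightarrow> (\<forall>t\<le>T. contact q' t x \<longrightarrow> contact q t x)"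
proof -
 have "AE x in M. q \<le> q' \<longrightarrow> (\<forall>t\<le>T. contact q' t x \<longrightarrow> contact q t x)" if "q \<in> pos_rats" for q q'
 proof (cases "q \<le> q'")
  case True
  from envelope_gap_mono[OF pos_rats_pos[OF that] this] show ?thesis by eventually_elim (force simp: contact_def)
 qed simp
 then show ?thesis by (simp add: AE_ball_countable[OF countable_pos_rats])
qed

text \<open>A running supremum expressed by level times alone; \<open>AE_running_opt_level\<close>
  identifies it with that of \<open>opt_level\<close>.\<close>

definition running_level :: "('a => ennreal) => 'a process" where
 "running_level S t x = level_of (\<lambda>q. level_time q S x \<le> t)"

context
 fixes S :: "'a => ennreal" assumes S: "stopping S"
begin

abbreviation "lt q \<equiv> level_time q S"

lemma lt_bounded: "q \<in> pos_rats ==> stopping (lt q)" by (rule stopping_level_time[OF pos_rats_pos S])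

lemma lt_ge: "q \<in> pos_rats ==> x \<in> space M ==> S x \<le> lt q x" by (rule level_time_ge[OF pos_rats_pos S])

text \<open>Monotonicity in the level: contact at a higher level implies contact at a lower one,
  which cannot happen before the lower level time.\<close>

lemma AE_level_times: "AE x in M. \<forall>q\<in>pos_rats. contact q (lt q x) x \<and>
  (\<forall>t. S x \<le> t \<and> t < lt q x \<longrightarrow> \<not> contact q t x) \<and> (\<forall>q'\<in>pos_rats. q \<le> q' \<longrightarrow> lt q x \<le> lt q' x)"
proof -
 have "AE x in M. \<forall>q\<in>pos_rats. envelope q (lt q x) x = reward q (lt q x) x"
  using level_time_contact[OF pos_rats_pos S] by (simp add: AE_ball_countable[OF countable_pos_rats])
 with AE_contact_mono AE_space show ?thesis
 proof eventually_elim
  case (elim x)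
  have 1: "contact q (lt q x) x" if "q \<in> pos_rats" for q using elim that by (simp add: contact_def)
  have 2: "\<not> contact q t x" if "q \<in> pos_rats" "S x \<le> t" "t < lt q x" for q t
   using before_level_time[OF pos_rats_pos[OF that(1)] that(2,3)] by (simp add: contact_def)
  have 3: "lt q x \<le> lt q' x" if q: "q \<in> pos_rats" "q' \<in> pos_rats" "q \<le> q'" for q q'
  proof (rule ccontr)
   assume "\<not> lt q x \<le> lt q' x"
   then have "\<not> contact q (lt q' x) x" using lt_ge[OF q(2) elim(2)] by (intro 2 q) auto
   then show False using elim(1) 1[OF q(2)] q stoppingD(2)[OF lt_bounded[OF q(2)] elim(2)] by blast
  qed
  from 1 2 3 show ?case by blast
 qed
qed

lemma lt_mono: "q \<in> pos_rats ==> q' \<in> pos_rats ==> q \<le> q' ==> AE x in M. lt q x \<le> lt q' x"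
 using AE_level_times by (auto elim!: eventually_mono)

lemma marginal_vanishes: "(\<lambda>k. slice (space M) S (\<lambda>_. T) (marginal (real (Suc k)))) \<longlonglongrightarrow> 0"
proof -
 note T = stopping_const[OF order_refl]
 have [measurable]: "(\<lambda>z. ennreal (marginal (real (Suc k)) (snd z) (fst z))) \<in> borel_measurable PT" for k
  using marginal_PT[of "real (Suc k)"] by simp
 note [measurable] = between_indicator_measurable[OF sets.top, of S "\<lambda>_. T"] S
 let ?b = "between (space M) S (\<lambda>_. T)"
 have "(\<lambda>k. slice (space M) S (\<lambda>_. T) (marginal (real (Suc k)))) \<longlonglongrightarrow> (\<integral>\<^sup>+ z. 0 \<partial>PT)"
  unfolding slice_def
 proof (rule nn_integral_dominated_convergence[where w = "\<lambda>z. ennreal (marginal 1 (snd z) (fst z)) * indicator ?b z"])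
  show "(\<integral>\<^sup>+ z\<in>?b. ennreal (marginal 1 (snd z) (fst z)) \<partial>PT) < \<infinity>"
   using slice_marginal_finite[OF zero_less_one sets.top S T] by (simp add: slice_def)
  show "(\<lambda>z. ennreal (marginal 1 (snd z) (fst z)) * indicator ?b z) \<in> borel_measurable PT"
   using marginal_PT[of 1] by simp
  show "AE z in PT. ennreal (marginal (real (Suc k)) (snd z) (fst z)) * indicator ?b z \<le> ennreal (marginal 1 (snd z) (fst z)) * indicator ?b z" for k
   by (rule AE_I2) (auto simp: space_pair_measure intro!: mult_right_mono ennreal_leI marginal_antimono)
  show "AE z in PT. (\<lambda>k. ennreal (marginal (real (Suc k)) (snd z) (fst z)) * indicator ?b z) \<longlonglongrightarrow> 0"
  proof (rule AE_I2)
   fix z assume "z \<in> space PT"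
   then have "(\<lambda>k. marginal (real (Suc k)) (snd z) (fst z)) \<longlonglongrightarrow> 0"
    by (intro filterlim_compose[OF marginal_at_top] filterlim_compose[OF filterlim_real_sequentially filterlim_Suc])
     (auto simp: space_pair_measure)
   from tendsto_ennrealI[OF this] show "(\<lambda>k. ennreal (marginal (real (Suc k)) (snd z) (fst z)) * indicator ?b z) \<longlonglongrightarrow> 0"
    by (cases "z \<in> ?b") auto
  qed
 qed measurable
 then show ?thesis by simp
qed

text \<open>The comparison is with waiting until \<open>T\<close>, where the price term is
  0.\<close>

lemma ev_lt_le: assumes q: "q \<in> pos_rats" "l \<le> q" and l: "0 < l"
 shows "ev A (lt q) end_cost \<le> slice (space M) S (\<lambda>_. T) (marginal l)"
proof -
 note T = stopping_const[OF order_refl]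
 have T0: "ev (space M) (\<lambda>_. T) end_cost = 0" by (simp add: end_cost_def stopped_price_def)
 have lT: "AE x in M. lt q x \<le> T" using stoppingD(2)[OF lt_bounded[OF q(1)]] by auto
 have "ev A (lt q) end_cost \<le> ev (space M) (lt q) end_cost" by (intro nn_integral_mono) (auto simp: indicator_def)
 also have "\<dots> \<le> ev (space M) (\<lambda>_. T) end_cost + slice (space M) (lt q) (\<lambda>_. T) (marginal q)"
  by (rule level_time_later[OF S space_in_pre_sigma pos_rats_pos[OF q(1)] T stoppingD(2)[OF S] lT])
 also have "\<dots> \<le> slice (space M) S (\<lambda>_. T) (marginal q)"
  unfolding T0 add_0 by (rule slice_region_mono) (use order_trans[OF lt_ge[OF q(1)]] in \<open>auto simp: between_def\<close>)
 also have "\<dots> \<le> slice (space M) S (\<lambda>_. T) (marginal l)"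
  by (rule slice_mono) (use marginal_antimono[OF _ l q(2)] in auto)
 finally show ?thesis .
qed

text \<open>At the supremum of the level times the mean price is below the total marginal value at
  arbitrarily high levels, hence 0. Since the price is positive before \<open>T\<close>, this
  supremum is \<open>T\<close>.\<close>

lemma AE_upper_levels: "AE x in M. \<forall>t<T. \<exists>q\<in>pos_rats. t < lt q x"
proof -
 define \<rho> where "\<rho> x = (SUP k. lt (real (Suc k)) x)" for x
 note q = pos_rats_of_nat(2)
 have \<rho>: "stopping \<rho>" unfolding \<rho>_def by (rule stopping_SUP[OF lt_bounded[OF q]])
 have "ev (space M) \<rho> end_cost \<le> ev (space M) (lt (real (Suc k))) end_cost" for k
  by (rule end_cost_sampling[OF lt_bounded[OF q] \<rho>]) (auto simp: \<rho>_def intro: SUP_upper)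
 from order_trans[OF this ev_lt_le[OF q order_refl]]
 have "ev (space M) \<rho> end_cost \<le> 0" by (intro LIMSEQ_le_const[OF marginal_vanishes]) auto
 then have "AE x in M. ennreal (end_cost (\<rho> x) x) * indicator (space M) x = 0"
  using progressive_stopped_measurable[OF progressive_end_cost \<rho>] by (subst (asm) le_zero_eq, subst (asm) nn_integral_0_iff_AE) auto
 with AE_space show ?thesis
 proof eventually_elim
  case (elim x)
  then have "\<not> 0 < end_cost (\<rho> x) x" by (simp add: ennreal_eq_0_iff)
  then have "T \<le> \<rho> x"
   using stopped_price_pos[OF price_c elim(1), of "\<rho> x"] lam_pos by (intro leI) (auto simp: end_cost_def stopped_price_def)
  then show ?case using q by (auto simp: \<rho>_def le_SUP_iff)
 qed
qed

text \<open>Until the infimum \<kappa> of the level times the marginal value of every level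
  \<open>1 / Suc k\<close> accrues, yet its mean stays below the finite mean price at
  \<open>S\<close>. It blows up as the level tends to 0, so the interval from \<open>S\<close> to
  \<kappa> is null and therefore empty.\<close>

lemma AE_lower_levels: "AE x in M. \<forall>t>S x. \<exists>k. lt (1 / real (Suc k)) x < t"
proof -
 define \<kappa> where "\<kappa> x = (INF k. lt (1 / real (Suc k)) x)" for x
 note q = pos_rats_of_nat(1)
 have \<kappa>: "stopping \<kappa>" unfolding \<kappa>_def by (rule stopping_INF[OF lt_bounded[OF q]])
 note [measurable] = \<kappa> S between_indicator_measurable[OF sets.top, of S \<kappa>]
 have [measurable]: "(\<lambda>z. ennreal (marginal (1 / real (Suc k)) (snd z) (fst z))) \<in> borel_measurable PT" for k
  using marginal_PT[of "1 / real (Suc k)"] by simp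
 let ?b = "between (space M) S \<kappa>"
 let ?f = "\<lambda>k z. ennreal (marginal (1 / real (Suc k)) (snd z) (fst z)) * indicator ?b z"
 have le: "(\<integral>\<^sup>+ z. ?f k z \<partial>PT) \<le> ev (space M) S end_cost" for k
 proof -
  have "(\<integral>\<^sup>+ z. ?f k z \<partial>PT) \<le> slice (space M) S (lt (1 / real (Suc k))) (marginal (1 / real (Suc k)))"
   using slice_region_mono[of "space M" S \<kappa> "space M" S "lt (1 / real (Suc k))"] less_le_trans[OF _ INF_lower[of k UNIV]]
   by (auto simp: between_def \<kappa>_def slice_def)
  also have "\<dots> \<le> ev (space M) (lt (1 / real (Suc k))) end_cost + slice (space M) S (lt (1 / real (Suc k))) (marginal (1 / real (Suc k)))" by simp
  also have "\<dots> \<le> ev (space M) S end_cost"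
   by (rule level_time_earlier[OF S space_in_pre_sigma pos_rats_pos[OF q] S order_refl AE_I2[OF lt_ge[OF q]]])
  finally show ?thesis .
 qed
 have lim: "(\<lambda>k. ?f k z) \<longlonglongrightarrow> \<infinity> * indicator ?b z" if z: "z \<in> space PT" "snd z < T" for z
 proof -
  have "filterlim (\<lambda>k. 1 / real (Suc k)) (at_right 0) sequentially"
   by (intro tendsto_imp_filterlim_at_right LIMSEQ_Suc[OF lim_const_over_n]) auto
  then have "filterlim (\<lambda>k. marginal (1 / real (Suc k)) (snd z) (fst z)) at_top sequentially"
   using z by (intro filterlim_compose[OF marginal_at_0]) (auto simp: space_pair_measure)
  then have "(\<lambda>k. ennreal (marginal (1 / real (Suc k)) (snd z) (fst z))) \<longlonglongrightarrow> \<infinity>"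
   by (auto simp: tendsto_top_iff_ennreal filterlim_at_top_dense ennreal_less_iff)
  then show ?thesis by (cases "z \<in> ?b") auto
 qed
 have "(\<integral>\<^sup>+ z. \<infinity> * indicator ?b z \<partial>PT) \<le> ev (space M) S end_cost"
 proof (rule nn_integral_le_of_tendsto[where f = ?f])
  show "AE z in PT. (\<lambda>k. ?f k z) \<longlonglongrightarrow> \<infinity> * indicator ?b z"
   using AE_product_time_less AE_space by eventually_elim (rule lim)
  show "?f k \<in> borel_measurable PT" for k by measurable
 qed (use le in auto)
 also have "\<dots> < \<infinity>" by (rule ev_end_cost_finite[OF S])
 finally have "AE z in PT. \<infinity> * indicator ?b z \<noteq> (\<infinity>::ennreal)"
  by (intro nn_integral_noteq_infinite) auto
 then have "AE z in PT. z \<notin> ?b" by eventually_elim (auto simp: indicator_def split: if_splits)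
 then have "AE x in M. AE t in leb_time T. (x, t) \<notin> ?b"
  by (rule pair_sigma_finite.AE_pair[OF pair_sigma_finite.intro[OF sigma_finite_measure_axioms sigma_finite_leb_time]])
 with AE_space show ?thesis
 proof eventually_elim
  case (elim x)
  have "\<not> S x < \<kappa> x"
  proof
   assume "S x < \<kappa> x"
   then have "\<exists>s. S x < s \<and> s < \<kappa> x \<and> (x, s) \<notin> ?b"
    using elim stoppingD(2)[OF \<kappa>] by (intro positive_time_dense) (auto elim: eventually_mono)
   then show False using elim(1) by (auto simp: between_def)
  qed
  then show ?case by (auto simp: \<kappa>_def INF_less_iff not_less INF_le_iff)
 qed
qed

abbreviation "RL \<equiv> running_level S"

lemma running_level_measurable [measurable]: "PTm RL" unfolding running_level_def
proof (rule level_of_measurable)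
 fix q assume "q \<in> pos_rats"
 note [measurable] = stopping_measurable[OF lt_bounded[OF this]]
 show "Measurable.pred PT (\<lambda>z. lt q (fst z) \<le> snd z)" by measurable
qed

lemma AE_running_level: "AE x in M. \<forall>t<T. 0 \<le> RL t x \<and>
  (\<forall>q\<in>pos_rats. (lt q x \<le> t \<longrightarrow> q \<le> RL t x) \<and> (t < lt q x \<longrightarrow> RL t x \<le> q))"
 using AE_level_times AE_upper_levels
proof eventually_elim
 case (elim x)
 show ?case
 proof (intro allI impI)
  fix t assume "t < T"
  then obtain q0 where q0: "q0 \<in> pos_rats" "\<not> lt q0 x \<le> t" using elim(2) by (auto simp: not_le)
  have "lt q x \<le> t" if "q \<in> pos_rats" "q' \<in> pos_rats" "q \<le> q'" "lt q' x \<le> t" for q q'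
   using elim(1) that order_trans by blast
  from level_of[of "\<lambda>q. lt q x \<le> t", OF this q0]
  show "0 \<le> RL t x \<and> (\<forall>q\<in>pos_rats. (lt q x \<le> t \<longrightarrow> q \<le> RL t x) \<and> (t < lt q x \<longrightarrow> RL t x \<le> q))"
   by (auto simp: running_level_def not_le)
 qed
qed

section \<open>Summation over a partition of levels\<close>

definition level_value :: "'a process" where
 "level_value t x = (if 0 < RL t x then marginal (RL t x) t x else 0)"

lemma level_value_measurable [measurable]: "PTm level_value"
 unfolding level_value_def by (rule marginal_product) measurable

lemma marginal_of_level_measurable: assumes [measurable]: "g \<in> borel_measurable borel" and g: "\<And>s. 0 < g s"
 shows "PTm (\<lambda>t x. marginal (g (RL t x)) t x)"
 using marginal_product[of "\<lambda>z. g (RL (snd z) (fst z))"] g by simp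

context
 fixes A a assumes A: "A \<in> sets (pre_sigma S)" and a: "a \<in> pos_rats"
begin

lemmas AM = A_M[OF S A]

text \<open>The marginal value at the lowest level \<open>a\<close> is an integrable majorant, and
  on this slice the running level is at least \<open>a\<close>, where the marginal value is
  continuous in the level.\<close>

lemma slice_level_tendsto:
 assumes b: "b \<in> pos_rats" and g: "\<And>m. g m \<in> borel_measurable borel" "\<And>m s. a \<le> g m s"
  and lim: "\<And>s. a \<le> s ==> (\<lambda>m. g m s) \<longlonglongrightarrow> s"
 shows "(\<lambda>m. slice A (lt a) (lt b) (\<lambda>t x. marginal (g m (RL t x)) t x)) \<longlonglongrightarrow> slice A (lt a) (lt b) level_value"
 unfolding slice_def
proof (rule nn_integral_dominated_convergence[where w = "\<lambda>z. ennreal (marginal a (snd z) (fst z)) * indicator (between A (lt a) (lt b)) z"])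
 let ?b = "between A (lt a) (lt b)"
 have a0: "0 < a" by (rule pos_rats_pos[OF a])
 have g0: "0 < g m s" for m s using a0 g(2)[of m s] by linarith
 note [measurable] = between_indicator_measurable[OF AM stopping_measurable[OF lt_bounded[OF a]] stopping_measurable[OF lt_bounded[OF b]]]
  marginal_of_level_measurable[OF g(1) g0] marginal_PT[OF a0]
 show "(\<lambda>z. ennreal (marginal (g m (RL (snd z) (fst z))) (snd z) (fst z)) * indicator ?b z) \<in> borel_measurable PT"
  "(\<lambda>z. ennreal (marginal a (snd z) (fst z)) * indicator ?b z) \<in> borel_measurable PT"
  "(\<lambda>z. ennreal (level_value (snd z) (fst z)) * indicator ?b z) \<in> borel_measurable PT" for m by measurable
 show "AE z in PT. ennreal (marginal (g m (RL (snd z) (fst z))) (snd z) (fst z)) * indicator ?b z \<le> ennreal (marginal a (snd z) (fst z)) * indicator ?b z" for m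
  by (rule AE_I2) (auto simp: space_pair_measure intro!: mult_right_mono ennreal_leI marginal_antimono g a0)
 show "(\<integral>\<^sup>+ z\<in>?b. ennreal (marginal a (snd z) (fst z)) \<partial>PT) < \<infinity>"
  using slice_marginal_finite[OF a0 AM lt_bounded[OF a] lt_bounded[OF b]] by (simp add: slice_def)
 show "AE z in PT. (\<lambda>m. ennreal (marginal (g m (RL (snd z) (fst z))) (snd z) (fst z)) * indicator ?b z) \<longlonglongrightarrow> ennreal (level_value (snd z) (fst z)) * indicator ?b z"
  using AE_PT[OF AE_running_level] AE_product_time_less AE_space
 proof eventually_elim
  case (elim z)
  show ?case
  proof (cases "z \<in> ?b")
   case True
   then have s: "a \<le> RL (snd z) (fst z)" using elim a by (auto simp: between_def)
   have "isCont (\<lambda>l. marginal l (snd z) (fst z)) (RL (snd z) (fst z))"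
    using marginal_continuous[of "fst z" "snd z"] elim(3) s a0
    by (auto simp: space_pair_measure continuous_on_eq_continuous_at)
   from isCont_tendsto_compose[OF this lim[OF s]]
   show ?thesis using True s a0 by (auto simp: level_value_def intro!: tendsto_ennrealI)
  qed simp
 qed
qed

text \<open>Between the two level times the running level lies in \<open>[l, l']\<close>, so
  \<open>l\<close> and \<open>l'\<close> can be traded for the running level shifted by the step.
  The integrand then depends on the step size only, which lets steps be added; the cut at
  \<open>a\<close> keeps the level positive.\<close>

lemma level_step: assumes ll: "l \<in> pos_rats" "l' \<in> pos_rats" "a \<le> l" "l \<le> l'"
 shows "ev A (lt l) end_cost \<le> ev A (lt l') end_cost + slice A (lt l) (lt l') (\<lambda>t x. marginal (max a (RL t x - (l' - l))) t x)"
  and "ev A (lt l') end_cost + slice A (lt l) (lt l') (\<lambda>t x. marginal (max a (RL t x + (l' - l))) t x) \<le> ev A (lt l) end_cost"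
proof -
 note [simp] = pos_rats_pos[OF ll(1)] pos_rats_pos[OF ll(2)] pos_rats_pos[OF a]
 note B = lt_bounded[OF ll(1)] lt_bounded[OF ll(2)] and mono = lt_mono[OF ll(1,2,4)]
 have lT: "lt l' x \<le> T" if "x \<in> space M" for x by (rule stoppingD(2)[OF B(2) that])
 have "ev A (lt l) end_cost \<le> ev A (lt l') end_cost + slice A (lt l) (lt l') (marginal l)"
  by (rule level_time_later[OF S A _ B(2) lt_ge[OF ll(2)] mono]) simp
 also have "slice A (lt l) (lt l') (marginal l) \<le> slice A (lt l) (lt l') (\<lambda>t x. marginal (max a (RL t x - (l' - l))) t x)"
 proof (rule slice_mono)
  show "AE x in M. x \<in> A \<longrightarrow> (\<forall>t. lt l x \<le> t \<and> t < lt l' x \<longrightarrow> marginal l t x \<le> marginal (max a (RL t x - (l' - l))) t x)"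
   using AE_running_level AE_space
  proof eventually_elim
   case (elim x)
   show ?case
   proof (intro impI allI marginal_antimono elim)
    fix t assume t: "lt l x \<le> t \<and> t < lt l' x"
    then have "RL t x \<le> l'" using elim ll lT by (meson order_less_le_trans)
    then show "max a (RL t x - (l' - l)) \<le> l" using ll(3) by simp
   qed (simp add: less_max_iff_disj)
  qed
 qed
 finally show "ev A (lt l) end_cost \<le> ev A (lt l') end_cost + slice A (lt l) (lt l') (\<lambda>t x. marginal (max a (RL t x - (l' - l))) t x)"
  by (simp add: add_left_mono)
 have "slice A (lt l) (lt l') (\<lambda>t x. marginal (max a (RL t x + (l' - l))) t x) \<le> slice A (lt l) (lt l') (marginal l')"
 proof (rule slice_mono)
  show "AE x in M. x \<in> A \<longrightarrow> (\<forall>t. lt l x \<le> t \<and> t < lt l' x \<longrightarrow> marginal (max a (RL t x + (l' - l))) t x \<le> marginal l' t x)"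
   using AE_running_level AE_space
  proof eventually_elim
   case (elim x)
   show ?case
   proof (intro impI allI marginal_antimono elim)
    fix t assume t: "lt l x \<le> t \<and> t < lt l' x"
    then have "l \<le> RL t x" using elim ll lT by (meson order_less_le_trans)
    then show "l' \<le> max a (RL t x + (l' - l))" by simp
   qed simp
  qed
 qed
 then have "ev A (lt l') end_cost + slice A (lt l) (lt l') (\<lambda>t x. marginal (max a (RL t x + (l' - l))) t x) \<le> ev A (lt l') end_cost + slice A (lt l) (lt l') (marginal l')"
  by (rule add_left_mono)
 also have "\<dots> \<le> ev A (lt l) end_cost" by (rule level_time_earlier[OF S A _ B(1) lt_ge[OF ll(1)] mono]) simp
 finally show "ev A (lt l') end_cost + slice A (lt l) (lt l') (\<lambda>t x. marginal (max a (RL t x + (l' - l))) t x) \<le> ev A (lt l) end_cost" .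
qed

lemma level_chain:
 defines "l \<equiv> \<lambda>m k. a + real k / real (Suc m)"
 shows "ev A (lt a) end_cost \<le> ev A (lt (l m k)) end_cost + slice A (lt a) (lt (l m k)) (\<lambda>t x. marginal (max a (RL t x - 1 / real (Suc m))) t x) \<and>
  ev A (lt (l m k)) end_cost + slice A (lt a) (lt (l m k)) (\<lambda>t x. marginal (max a (RL t x + 1 / real (Suc m))) t x) \<le> ev A (lt a) end_cost"
  (is "_ \<le> _ + slice A _ _ ?U \<and> _ + slice A _ _ ?V \<le> _")
proof (induction k)
 case 0
 have "between A (lt a) (lt a) = {}" by (auto simp: between_def)
 then show ?case by (simp add: l_def slice_def)
next
 case (Suc k)
 have lk: "l m k \<in> pos_rats" "l m (Suc k) \<in> pos_rats" using pos_rats_add_frac[OF a] by (simp_all add: l_def del: of_nat_Suc)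
 have le: "a \<le> l m k" "l m k \<le> l m (Suc k)" and d: "l m (Suc k) - l m k = 1 / real (Suc m)"
  by (auto simp: l_def field_simps)
 have pm: "PTm ?U" "PTm ?V"
  using pos_rats_pos[OF a] marginal_of_level_measurable[of "\<lambda>s. max a (s - 1 / real (Suc m))"]
   marginal_of_level_measurable[of "\<lambda>s. max a (s + 1 / real (Suc m))"] by (simp_all add: less_max_iff_disj)
 have "AE x in M. lt a x \<le> lt (l m k) x \<and> lt (l m k) x \<le> lt (l m (Suc k)) x"
  using lt_mono[OF a lk(1) le(1)] lt_mono[OF lk le(2)] by eventually_elim simp
 note add = slice_add[OF _ AM lt_bounded[OF a] lt_bounded[OF lk(1)] lt_bounded[OF lk(2)] this]
 note step = level_step[OF lk le, unfolded d]
 show ?case using order_trans[OF conjunct1[OF Suc] add_right_mono[OF step(1)]]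
   order_trans[OF add_right_mono[OF step(2)] conjunct2[OF Suc]]
  unfolding add[OF pm(1)] add[OF pm(2)] by (simp only: ac_simps)
qed

lemma level_equation:
 "ev A (lt a) end_cost = ev A (lt (a + real K)) end_cost + slice A (lt a) (lt (a + real K)) level_value"
proof (rule antisym)
 let ?b = "a + real K"
 have b: "?b \<in> pos_rats" using pos_rats_add_frac[OF a, of K 1] by simp
 \<comment> \<open>An integer distance \<open>K\<close> is reached exactly by
   \<open>K * Suc m\<close> steps of size \<open>1 / Suc m\<close>, for every mesh.\<close>
 have b_eq: "a + real (K * Suc m) / real (Suc m) = ?b" for m by (simp del: of_nat_Suc mult_Suc_right)
 have n: "(\<lambda>m. 1 / real (Suc m)) \<longlonglongrightarrow> 0" by (rule LIMSEQ_Suc[OF lim_const_over_n])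
 have "(\<lambda>m. slice A (lt a) (lt ?b) (\<lambda>t x. marginal (max a (RL t x - 1 / real (Suc m))) t x)) \<longlonglongrightarrow> slice A (lt a) (lt ?b) level_value"
 proof (rule slice_level_tendsto[OF b])
  show "(\<lambda>m. max a (s - 1 / real (Suc m))) \<longlonglongrightarrow> s" if "a \<le> s" for s
   using tendsto_max[OF tendsto_const[of a] tendsto_diff[OF tendsto_const[of s] n]] that by (simp add: max_absorb2)
 qed simp_all
 from tendsto_add[OF tendsto_const this]
 show "ev A (lt a) end_cost \<le> ev A (lt ?b) end_cost + slice A (lt a) (lt ?b) level_value"
 proof (rule LIMSEQ_le_const, intro exI allI impI)
  fix m show "ev A (lt a) end_cost \<le> ev A (lt ?b) end_cost + slice A (lt a) (lt ?b) (\<lambda>t x. marginal (max a (RL t x - 1 / real (Suc m))) t x)"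
   using conjunct1[OF level_chain[of "K * Suc m" m]] unfolding b_eq .
 qed
 have "(\<lambda>m. slice A (lt a) (lt ?b) (\<lambda>t x. marginal (max a (RL t x + 1 / real (Suc m))) t x)) \<longlonglongrightarrow> slice A (lt a) (lt ?b) level_value"
 proof (rule slice_level_tendsto[OF b])
  show "(\<lambda>m. max a (s + 1 / real (Suc m))) \<longlonglongrightarrow> s" if "a \<le> s" for s
   using tendsto_max[OF tendsto_const[of a] tendsto_add[OF tendsto_const[of s] n]] that by (simp add: max_absorb2)
 qed simp_all
 from tendsto_add[OF tendsto_const this]
 show "ev A (lt ?b) end_cost + slice A (lt a) (lt ?b) level_value \<le> ev A (lt a) end_cost"
 proof (rule LIMSEQ_le_const2, intro exI allI impI)
  fix m show "ev A (lt ?b) end_cost + slice A (lt a) (lt ?b) (\<lambda>t x. marginal (max a (RL t x + 1 / real (Suc m))) t x) \<le> ev A (lt a) end_cost"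
   using conjunct2[OF level_chain[of "K * Suc m" m]] unfolding b_eq .
 qed
qed

end

section \<open>From bounded ranges of levels to all levels\<close>

lemma AE_PT_neq: "AE z in PT. snd z \<noteq> S (fst z)"
proof (rule pair_sigma_finite.AE_pair_measure[OF pair_sigma_finite.intro[OF sigma_finite_measure_axioms sigma_finite_leb_time]])
 note [measurable] = stopping_measurable[OF S]
 show "{z \<in> space PT. snd z \<noteq> S (fst z)} \<in> sets PT" by measurable
 show "AE x in M. AE t in leb_time T. snd (x, t) \<noteq> S (fst (x, t))" by (simp add: AE_leb_time_neq)
qed

text \<open>The approximating times may equal \<open>t\<close>, which the filter
  \<open>at_right t\<close> excludes.\<close>

lemma right_continuous_sequence: assumes rc: "right_continuous_path T f" and t: "t < T"
  and s: "\<And>n. t \<le> s n" "\<And>b. t < b ==> eventually (\<lambda>n. s n < b) sequentially"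
 shows "(\<lambda>n. f (s n)) \<longlonglongrightarrow> f t"
proof (rule topological_tendstoI)
 fix U assume U: "open U" "f t \<in> U"
 have "(f \<longlongrightarrow> f t) (at_right t)" using rc t by (simp add: right_continuous_path_def continuous_within)
 then have "eventually (\<lambda>v. f v \<in> U) (at_right t)" using U by (rule topological_tendstoD)
 then obtain b where b: "t < b" "\<And>v. t < v ==> v < b ==> f v \<in> U" by (auto simp: eventually_at_right[OF t])
 from s(2)[OF b(1)] show "eventually (\<lambda>n. f (s n) \<in> U) sequentially"
  by eventually_elim (use b(2) s(1) U(2) in \<open>metis order_le_less\<close>)
qed

lemma AE_levels_exhaust: "AE x in M. (\<forall>t>S x. eventually (\<lambda>n. lt (1 / real (Suc n)) x < t) sequentially) \<and>
 (\<forall>t<T. eventually (\<lambda>n. t < lt (1 / real (Suc n) + real n) x) sequentially)"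
 using AE_level_times AE_upper_levels AE_lower_levels
proof eventually_elim
 case (elim x)
 have q: "1 / real (Suc n) \<in> pos_rats" "1 / real (Suc n) + real n \<in> pos_rats" for n
  using pos_rats_of_nat(1)[of n] pos_rats_add_frac[OF pos_rats_of_nat(1), of n n 1] by auto
 have mono: "lt q x \<le> lt q' x" if "q \<in> pos_rats" "q' \<in> pos_rats" "q \<le> q'" for q q'
  using elim(1) that by blast
 show ?case
 proof (intro conjI allI impI)
  fix t assume "S x < t"
  then obtain k where k: "lt (1 / real (Suc k)) x < t" using elim(3) by blast
  show "eventually (\<lambda>n. lt (1 / real (Suc n)) x < t) sequentially" using eventually_ge_at_top[of k]
  proof eventually_elim
   case (elim n)
   then have "1 / real (Suc n) \<le> 1 / real (Suc k)" by (simp add: frac_le)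
   from mono[OF q(1) q(1) this] k show ?case by simp
  qed
 next
  fix t assume "t < T"
  then obtain p where p: "p \<in> pos_rats" "t < lt p x" using elim(2) by blast
  obtain k where "p \<le> real k" using real_arch_simple by blast
  show "eventually (\<lambda>n. t < lt (1 / real (Suc n) + real n) x) sequentially" using eventually_ge_at_top[of k]
  proof eventually_elim
   case (elim n)
   then have "p \<le> 1 / real (Suc n) + real n" using \<open>p \<le> real k\<close> by (simp add: add_increasing order_trans[of p "real k" "real n"])
   from mono[OF p(1) q(2) this] p(2) show ?case by simp
  qed
 qed
qed

text \<open>In \<open>level_equation\<close> from \<open>1 / Suc n\<close> to
  \<open>1 / Suc n + K\<close> the price at the upper level time disappears by
  \<open>ev_lt_le\<close>, and the lower level times tend to \<open>S\<close>. Right-continuity of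
  the price and Fatou's lemma give one inequality, the supermartingale property of the price and
  Fatou's lemma for the slices the other.\<close>

theorem running_level_equation: assumes A: "A \<in> sets (pre_sigma S)"
 shows "ev A S end_cost = slice A S (\<lambda>_. T) level_value"
proof (rule antisym)
 define a where "a n = 1 / real (Suc n)" for n
 have a: "a n \<in> pos_rats" "a n + real k \<in> pos_rats" for n k
  using pos_rats_of_nat(1)[of n] pos_rats_add_frac[OF pos_rats_of_nat(1), of n k 1] by (auto simp: a_def)
 note eq = level_equation[OF A a(1)] and exh = AE_levels_exhaust[folded a_def]
 note T = stopping_const[OF order_refl]
 note [measurable] = A_M[OF S A] stopping_measurable[OF lt_bounded[OF a(1)]] stopping_measurable[OF lt_bounded[OF a(2)]] S
  progressive_stopped_measurable[OF progressive_end_cost lt_bounded[OF a(1)]]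
 have lT: "lt q x \<le> T" if "q \<in> pos_rats" "x \<in> space M" for q x
  by (rule stoppingD(2)[OF lt_bounded[OF that(1)] that(2)])
 show "ev A S end_cost \<le> slice A S (\<lambda>_. T) level_value"
 proof (rule nn_integral_le_of_tendsto[where f = "\<lambda>n x. ennreal (end_cost (lt (a n) x) x) * indicator A x"])
  show "AE x in M. (\<lambda>n. ennreal (end_cost (lt (a n) x) x) * indicator A x) \<longlonglongrightarrow> ennreal (end_cost (S x) x) * indicator A x"
   using exh AE_space
  proof eventually_elim
   case (elim x)
   have "(\<lambda>n. end_cost (lt (a n) x) x) \<longlonglongrightarrow> end_cost (S x) x"
   proof (cases "S x < T")
    case True
    then show ?thesis
     using elim(1) by (intro right_continuous_sequence[OF end_cost_rc[OF elim(2)]] lt_ge[OF a(1) elim(2)]) auto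
   next
    case False
    then have "lt (a n) x = S x" for n using lt_ge[OF a(1) elim(2), of n] lT[OF a(1) elim(2), of n] by auto
    then show ?thesis by simp
   qed
   then show ?case by (cases "x \<in> A") (auto intro: tendsto_ennrealI)
  qed
  have "ev A (lt (a n)) end_cost \<le> slice A S (\<lambda>_. T) level_value" for n
  proof -
   have "ev A (lt (a n)) end_cost \<le> slice (space M) S (\<lambda>_. T) (marginal (real (Suc k))) + slice A S (\<lambda>_. T) level_value" for k
    unfolding eq[of n "Suc k"]
   proof (intro add_mono ev_lt_le a(2) slice_region_mono)
    show "real (Suc k) \<le> a n + real (Suc k)" by (simp add: a_def)
    show "(x, t) \<in> between A S (\<lambda>_. T)" if "x \<in> space M" "(x, t) \<in> between A (lt (a n)) (lt (a n + real (Suc k)))" for x t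
     using that lt_ge[OF a(1) that(1), of n] lT[OF a(2) that(1), of n "Suc k"] by (auto simp: between_def)
   qed simp
   then have "ev A (lt (a n)) end_cost \<le> 0 + slice A S (\<lambda>_. T) level_value"
    by (intro LIMSEQ_le_const[OF tendsto_add[OF marginal_vanishes tendsto_const]]) blast
   then show ?thesis by simp
  qed
  then show "eventually (\<lambda>n. ev A (lt (a n)) end_cost \<le> slice A S (\<lambda>_. T) level_value) sequentially" by simp
 qed measurable
 show "slice A S (\<lambda>_. T) level_value \<le> ev A S end_cost" unfolding slice_def
 proof (rule nn_integral_le_of_tendsto[where f = "\<lambda>n z. ennreal (level_value (snd z) (fst z)) * indicator (between A (lt (a n)) (lt (a n + real n))) z"])
  {
  fix n
  note [measurable] = between_indicator_measurable[of A "lt (a n)" "lt (a n + real n)"]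
  show "(\<lambda>z. ennreal (level_value (snd z) (fst z)) * indicator (between A (lt (a n)) (lt (a n + real n))) z) \<in> borel_measurable PT"
   by measurable
  have "slice A (lt (a n)) (lt (a n + real n)) level_value \<le> ev A (lt (a n)) end_cost" by (simp add: eq[of n n])
  also have "\<dots> \<le> ev A S end_cost" by (rule end_cost_sampling[OF S lt_bounded[OF a(1)] lt_ge[OF a(1)] A])
  finally have "slice A (lt (a n)) (lt (a n + real n)) level_value \<le> ev A S end_cost" .
  } note le = this
  show "eventually (\<lambda>n. (\<integral>\<^sup>+ z\<in>between A (lt (a n)) (lt (a n + real n)). ennreal (level_value (snd z) (fst z)) \<partial>PT) \<le> ev A S end_cost) sequentially"
   using le by (simp add: slice_def)
  show "AE z in PT. (\<lambda>n. ennreal (level_value (snd z) (fst z)) * indicator (between A (lt (a n)) (lt (a n + real n))) z) \<longlonglongrightarrow>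
    ennreal (level_value (snd z) (fst z)) * indicator (between A S (\<lambda>_. T)) z"
   using AE_PT[OF exh] AE_PT_neq AE_product_time_less AE_space
  proof eventually_elim
   case (elim z)
   have x: "fst z \<in> space M" using elim(4) by (auto simp: space_pair_measure)
   have "eventually (\<lambda>n. z \<in> between A (lt (a n)) (lt (a n + real n)) \<longleftrightarrow> z \<in> between A S (\<lambda>_. T)) sequentially"
   proof (cases "S (fst z) < snd z")
    case True
    then have "eventually (\<lambda>n. lt (a n) (fst z) < snd z) sequentially" "eventually (\<lambda>n. snd z < lt (a n + real n) (fst z)) sequentially"
     using elim by auto
    then show ?thesis by eventually_elim (use True elim(3) in \<open>auto simp: between_def\<close>)
   next
    case False
    then have "\<not> lt (a n) (fst z) \<le> snd z" for n using lt_ge[OF a(1) x, of n] elim(2) by auto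
    then show ?thesis using False elim(2) by (simp add: between_def)
   qed
   then show ?case by (rule tendsto_eventually[OF eventually_mono]) (simp add: indicator_def)
  qed
 qed
qed

end

end

section \<open>Existence of the solution\<close>

context backward_setting
begin

text \<open>\<open>end_cost\<close> need not have left limits; optionality is seen on its regularisation.\<close>

definition contact_version :: "real => ennreal => 'a => bool" where
 "contact_version q t x \<longleftrightarrow>
  envelope q t x \<le> max 1 (bound_martingale q t x - (regularised end_cost t x + marg_integral q t x))"

definition opt_level :: "'a process" where
 "opt_level t x = (if t < T then level_of (\<lambda>q. contact_version q t x) else 0)"

lemma AE_contact_version: "AE x in M. \<forall>t\<le>T. \<forall>q. contact_version q t x = contact q t x"
proof -
 have "AE x in M. \<forall>t\<le>T. regularised end_cost t x = end_cost t x"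
  by (rule AE_regularised_eq[OF supermart_end_cost_grid]) (rule end_cost_rc)
 then show ?thesis by eventually_elim (simp add: contact_version_def contact_def reward_def cost_def)
qed

lemma marg_integral_optional: assumes l: "0 < l" shows "optional_process M F T (marg_integral l)"
proof (rule optional_cadlag[OF marg_integral_adapted[OF l]])
 fix x assume x: "x \<in> space M"
 show "cadlag_path T (\<lambda>t. marg_integral l t x)" unfolding cadlag_path_def
 proof (intro conjI allI impI marg_integral_rc[OF l x])
  fix t :: ennreal assume "0 < t \<and> t \<le> T"
  then have "((\<lambda>t. marg_integral l t x) \<longlongrightarrow> marg_integral l t x) (at_left t)"
   by (intro tendsto_at_left_sequentially[of 0]) (auto intro: marg_integral_tendsto[OF l x])
  then show "\<exists>a. ((\<lambda>t. marg_integral l t x) \<longlongrightarrow> a) (at_left t)" ..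
 qed
qed

lemma optional_regularised: assumes "supermart (grid_times T) X" shows "optional_process M F T (regularised X)"
 using supermartD(1)[OF supermart_regularised[OF assms]]
 by (intro optional_cadlag cadlag_regularised) (auto simp: adapted_def)

lemma opt_level_optional: "optional_process M F T opt_level"
proof -
 let ?O = "optional_sigma M F T"
 note [measurable] = measurable_snd_optional optional_measurable[OF optional_regularised[OF supermart_end_cost_grid]]
 have "Measurable.pred ?O (\<lambda>z. contact_version q (snd z) (fst z))" if "q \<in> pos_rats" for q
 proof -
  have q: "0 < q" by (rule pos_rats_pos[OF that])
  note E = snell_envelopeD[OF snell_envelope_reward[OF q]]
  note [measurable] = optional_measurable[OF optional_cadlag[OF E(8,4)]] optional_measurable[OF marg_integral_optional[OF q]]
   optional_measurable[OF optional_regularised[OF supermart_closed_martingale[OF cost_bound_integrable[OF q]], folded bound_martingale_def]]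
  show ?thesis unfolding contact_version_def by measurable
 qed
 from level_of_measurable[OF this] have "(\<lambda>z. if snd z < T then level_of (\<lambda>q. contact_version q (snd z) (fst z)) else 0) \<in> borel_measurable ?O"
  by measurable
 then show ?thesis by (simp add: optional_process_def opt_level_def case_prod_beta)
qed

text \<open>Contact levels at \<open>t\<close> are bounded because some level time started at 0
  exceeds \<open>t\<close>, and before it there is no contact.\<close>

lemma AE_opt_level: "AE x in M. \<forall>t<T. 0 \<le> opt_level t x \<and>
  (\<forall>q\<in>pos_rats. (contact q t x \<longrightarrow> q \<le> opt_level t x) \<and> (\<not> contact q t x \<longrightarrow> opt_level t x \<le> q))"
 using AE_contact_version AE_contact_mono AE_upper_levels[OF stopping_const[OF zero_le]] AE_level_times[OF stopping_const[OF zero_le]]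
proof eventually_elim
 case (elim x)
 show ?case
 proof (intro allI impI)
  fix t assume t: "t < T"
  then obtain q0 where q0: "q0 \<in> pos_rats" "t < level_time q0 (\<lambda>_. 0) x" using elim(3) by auto
  then have "\<not> contact q0 t x" using elim(4) by auto
  moreover have "contact q t x" if "q \<in> pos_rats" "q' \<in> pos_rats" "q \<le> q'" "contact q' t x" for q q'
   using elim(2) that t less_imp_le by blast
  ultimately have "0 \<le> level_of (\<lambda>q. contact q t x) \<and> (\<forall>q\<in>pos_rats. (contact q t x \<longrightarrow> q \<le> level_of (\<lambda>q. contact q t x)) \<and>
    (\<not> contact q t x \<longrightarrow> level_of (\<lambda>q. contact q t x) \<le> q))"
   using level_of[of "\<lambda>q. contact q t x" q0] q0(1) by blast
  then show "0 \<le> opt_level t x \<and> (\<forall>q\<in>pos_rats. (contact q t x \<longrightarrow> q \<le> opt_level t x) \<and> (\<not> contact q t x \<longrightarrow> opt_level t x \<le> q))"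
   using t elim(1) by (simp add: opt_level_def less_imp_le)
 qed
qed

text \<open>A rational \<open>q\<close> slightly above the value at \<open>t\<close> is not in
  contact. The right-continuous gap between envelope and reward stays positive for a moment and caps
  the supremum by \<open>q\<close>. The lower bound is immediate, as \<open>v = t\<close> belongs to
  the range.\<close>

lemma opt_level_upper_right_continuous: "AE x in M. upper_right_continuous T (\<lambda>t. opt_level t x)"
 using AE_opt_level AE_space
proof eventually_elim
 case (elim x)
 show ?case unfolding upper_right_continuous_def
 proof (intro allI impI order_tendstoI)
  fix t y assume t: "t < T" and y: "y < ereal (opt_level t x)"
  show "eventually (\<lambda>s. y < (SUP v\<in>{t..<s}. ereal (opt_level v x))) (at_right t)"
   unfolding eventually_at_right[OF t] by (intro exI[of _ T] conjI t) (auto intro!: less_le_trans[OF y] SUP_upper)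
 next
  fix t y assume t: "t < T" and y: "ereal (opt_level t x) < y"
  obtain y' where y': "opt_level t x < y'" "ereal y' < y" using ereal_dense2[OF y] by auto
  have "0 \<le> opt_level t x" using elim(1) t by blast
  from pos_rats_between[OF this y'(1)] obtain q where q: "q \<in> pos_rats" "opt_level t x < q" "q < y'" by blast
  have q0: "0 < q" by (rule pos_rats_pos[OF q(1)])
  have "\<not> contact q t x" using elim(1) t q by force
  then have gap: "0 < envelope q t x - reward q t x" by (simp add: contact_def)
  have "right_continuous_path T (\<lambda>t. envelope q t x - reward q t x)"
   by (rule right_continuous_diff[OF snell_envelopeD(3)[OF snell_envelope_reward[OF q0] elim(2)] reward_rc[OF q0 elim(2)]])
  then have "((\<lambda>t. envelope q t x - reward q t x) \<longlongrightarrow> envelope q t x - reward q t x) (at_right t)"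
   using t by (simp add: right_continuous_path_def continuous_within)
  from order_tendstoD(1)[OF this gap] obtain b where b: "t < b" "\<And>v. t < v ==> v < b ==> 0 < envelope q v x - reward q v x"
   by (auto simp: eventually_at_right[OF t])
  have le: "opt_level v x \<le> q" if "t \<le> v" "v < min b T" for v
   using b(2)[of v] that q(1,2) elim(1) by (cases "v = t") (force simp: contact_def)+
  show "eventually (\<lambda>s. (SUP v\<in>{t..<s}. ereal (opt_level v x)) < y) (at_right t)"
   unfolding eventually_at_right[OF t]
  proof (intro exI[of _ "min b T"] conjI allI impI)
   fix s assume "t < s" and sb: "s < min b T"
   then have "(SUP v\<in>{t..<s}. ereal (opt_level v x)) \<le> ereal q" using le less_trans[OF _ sb] by (intro SUP_least) simp
   also have "\<dots> < y" using q(3) y'(2) by (metis ereal_less_eq(3) less_imp_le order_le_less_trans)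
   finally show "(SUP v\<in>{t..<s}. ereal (opt_level v x)) < y" .
  qed (use b(1) t in auto)
 qed
qed

section \<open>The running supremum of the constructed process and the equation\<close>

context
 fixes R :: "'a => ennreal" assumes R: "stopping R"
begin

text \<open>A level time up to \<open>t\<close> is itself a contact point, pushing the supremum to
  at least \<open>q\<close>; if it lies after \<open>t\<close>, no contact at \<open>q\<close> has
  occurred. Positivity comes from \<open>AE_lower_levels\<close>.\<close>

lemma AE_running_opt_level: "AE x in M. \<forall>t. R x < t \<and> t < T \<longrightarrow>
  bdd_above ((\<lambda>v. opt_level v x) ` {R x..t}) \<and> (SUP v\<in>{R x..t}. opt_level v x) = running_level R t x \<and> 0 < running_level R t x"
 using AE_opt_level AE_running_level[OF R] AE_level_times[OF R] AE_upper_levels[OF R] AE_lower_levels[OF R] AE_space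
proof eventually_elim
 case (elim x)
 show ?case
 proof (intro allI impI)
  fix t assume t: "R x < t \<and> t < T"
  let ?S = "SUP v\<in>{R x..t}. opt_level v x" and ?lt = "\<lambda>q. level_time q R x"
  have up: "opt_level v x \<le> q" if q: "q \<in> pos_rats" "\<not> ?lt q \<le> t" and v: "v \<in> {R x..t}" for q v
  proof -
   have "\<not> contact q v x" using elim(3) q v by (auto simp: not_le)
   moreover have "v < T" using v t by auto
   ultimately show ?thesis using elim(1) q(1) by blast
  qed
  obtain q0 where "q0 \<in> pos_rats" "\<not> ?lt q0 \<le> t" using elim(4) t by (auto simp: not_le)
  from up[OF this] have bdd: "bdd_above ((\<lambda>v. opt_level v x) ` {R x..t})" by (intro bdd_aboveI2)
  have low: "q \<le> ?S" if q: "q \<in> pos_rats" "?lt q \<le> t" for q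
  proof -
   have "q \<le> opt_level (?lt q) x" using elim(1,3) q t by (meson order_le_less_trans)
   also have "\<dots> \<le> ?S" using lt_ge[OF R q(1) elim(6)] q(2) by (intro cSUP_upper bdd) simp
   finally show ?thesis .
  qed
  obtain k where k: "?lt (1 / real (Suc k)) < t" using elim(5) t by blast
  have r: "0 \<le> running_level R t x" "\<And>q. q \<in> pos_rats ==> ?lt q \<le> t ==> q \<le> running_level R t x"
   "\<And>q. q \<in> pos_rats ==> \<not> ?lt q \<le> t ==> running_level R t x \<le> q" using elim(2) t by (auto simp: not_le)
  have S0: "0 \<le> ?S" using low[OF pos_rats_of_nat(1) less_imp_le[OF k]] by (rule order_trans[rotated]) simp
  have "?S = running_level R t x"
  proof (rule level_unique[where P = "\<lambda>q. ?lt q \<le> t", OF S0 r(1) low _ r(2,3)])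
   fix q assume "q \<in> pos_rats" "\<not> ?lt q \<le> t"
   from up[OF this] show "?S \<le> q" using t by (intro cSUP_least) auto
  qed
  moreover have "0 < running_level R t x"
   using r(2)[OF pos_rats_of_nat(1) less_imp_le[OF k]] by (rule less_le_trans[rotated]) simp
  ultimately show "bdd_above ((\<lambda>v. opt_level v x) ` {R x..t}) \<and> ?S = running_level R t x \<and> 0 < running_level R t x"
   using bdd by blast
 qed
qed

end

text \<open>Spelled as in the equation, so that the equation can be folded with it.\<close>

definition integrand :: "'a process => ('a => ennreal) => 'a process" where
 "integrand l \<tau> t y = discount r t y * (\<Sum>i=1..n. \<gamma> i * h_fun (u i)
  (lam / \<gamma> i * exp (enn2real (cumulative r t y)) * \<psi>x t y) (SUP v\<in>{\<tau> y..t}. l v y))"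

lemma integrand_eq: "t < T ==> x \<in> space M ==> integrand l \<tau> t x = marginal (SUP v\<in>{\<tau> x..t}. l v x) t x"
 by (simp add: integrand_def marginal_def exp_cumulative)

lemma integrand_integral: assumes S: "stopping S"
  and eq: "AE x in M. \<forall>t. S x < t \<and> t < T \<longrightarrow> integrand l S t x = Y t x"
 shows "AE x in M. (\<integral>\<^sup>+ t\<in>{S x..T}. ennreal (integrand l S t x) \<partial>leb_time T) = (\<integral>\<^sup>+ t\<in>{S x..T}. ennreal (Y t x) \<partial>leb_time T)"
 using eq
proof eventually_elim
 case (elim x)
 show ?case
 proof (rule nn_integral_cong_AE)
  show "AE t in leb_time T. ennreal (integrand l S t x) * indicator {S x..T} t = ennreal (Y t x) * indicator {S x..T} t"
   using AE_leb_time_neq[of "S x" T] AE_leb_time_less[of T]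
   by eventually_elim (use elim in \<open>auto simp: indicator_def\<close>)
 qed
qed

lemma time_integral_PT: assumes Y: "PTm Y" and S: "stopping S"
 shows "(\<lambda>x. \<integral>\<^sup>+ t\<in>{S x..T}. ennreal (Y t x) \<partial>leb_time T) \<in> borel_measurable M"
proof -
 interpret L: sigma_finite_measure "leb_time T" by (rule sigma_finite_leb_time)
 note [measurable] = stopping_measurable[OF S] Y
 have "(\<lambda>z. ennreal (Y (snd z) (fst z)) * indicator {z. S (fst z) \<le> snd z \<and> snd z \<le> T} z) \<in> borel_measurable PT"
  by measurable
 from L.borel_measurable_nn_integral_fst[OF this] show ?thesis by (simp add: indicator_def)
qed

lemma end_cost_eq: "end_cost (\<tau> x) x = lam * \<psi>c (\<tau> x) x * indicator {x. \<tau> x < T} x"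
 by (simp add: end_cost_def stopped_price_def indicator_def)

lemma opt_level_solves: "solves_backward_equation M F T n u \<gamma> lam r \<psi>x \<psi>c opt_level"
 unfolding solves_backward_equation_def integrand_def[symmetric] end_cost_eq[symmetric]
proof (intro allI impI conjI)
 fix \<tau> assume "stopping_time F \<tau> \<and> (\<forall>y\<in>space M. \<tau> y \<le> T)"
 then have \<tau>: "stopping \<tau>" by (simp add: stopping_def)
 note run = AE_running_opt_level[OF \<tau>] and lv = level_value_measurable[OF \<tau>]
 interpret sigma_finite_subalgebra M "pre_sigma \<tau>" by (rule sigma_finite_pre_sigma[OF \<tau>])
 show "AE y in M. \<forall>t. \<tau> y < t \<and> t < T \<longrightarrow>
   bdd_above ((\<lambda>v. opt_level v y) ` {\<tau> y..t}) \<and> 0 < (SUP v\<in>{\<tau> y..t}. opt_level v y)"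
  using run by eventually_elim auto
 let ?Y = "\<lambda>y. \<integral>\<^sup>+ t\<in>{\<tau> y..T}. ennreal (integrand opt_level \<tau> t y) \<partial>leb_time T"
 let ?Y' = "\<lambda>y. \<integral>\<^sup>+ t\<in>{\<tau> y..T}. ennreal (level_value \<tau> t y) \<partial>leb_time T"
 have "AE y in M. \<forall>t. \<tau> y < t \<and> t < T \<longrightarrow> integrand opt_level \<tau> t y = level_value \<tau> t y"
  using run AE_space by eventually_elim (auto simp: integrand_eq level_value_def[OF \<tau>])
 from integrand_integral[OF \<tau> this] have YY: "AE y in M. ?Y y = ?Y' y" .
 have "AE y in M. ennreal (end_cost (\<tau> y) y) = nn_cond_exp M (pre_sigma \<tau>) ?Y y"
 proof (rule nn_cond_exp_charact)
  show "?Y \<in> borel_measurable M"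
   by (rule M_measurable_AE[OF time_integral_PT[OF lv \<tau>]]) (use YY in \<open>auto elim: eventually_mono\<close>)
  show "(\<lambda>y. ennreal (end_cost (\<tau> y) y)) \<in> borel_measurable (pre_sigma \<tau>)"
   using progressive_pre_sigma[OF progressive_end_cost \<tau>] by measurable
  fix A assume A: "A \<in> sets (pre_sigma \<tau>)"
  have "(\<integral>\<^sup>+ y\<in>A. ?Y y \<partial>M) = (\<integral>\<^sup>+ y\<in>A. ?Y' y \<partial>M)"
   by (rule nn_integral_cong_AE, rule eventually_mono[OF YY]) simp
  also have "\<dots> = ev A \<tau> end_cost" unfolding running_level_equation[OF \<tau> A]
   by (rule slice_iterated[OF lv pre_sigma_le_M[OF \<tau> A] \<tau> stopping_const[OF order_refl], symmetric])
  finally show "(\<integral>\<^sup>+ y\<in>A. ?Y y \<partial>M) = ev A \<tau> end_cost" .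
 qed
 then show "AE y in M. nn_cond_exp M (pre_sigma \<tau>) ?Y y = ennreal (end_cost (\<tau> y) y)" by eventually_elim simp
qed

end

section \<open>Measurable and optional selections\<close>

definition box :: "'a set \<times> ennreal \<times> ennreal => ('a \<times> ennreal) set" where
 "box R = fst R \<times> {fst (snd R)..snd (snd R)}"

definition souslin_scheme :: "'a measure => (nat => (nat => nat) => 'a set \<times> ennreal \<times> ennreal) => bool" where
 "souslin_scheme M K \<longleftrightarrow> (\<forall>m S. fst (K m S) \<in> sets M) \<and>
  (\<forall>m S S'. (\<forall>i<m. S i = S' i) \<longrightarrow> K m S = K m S')"

text \<open>The Souslin operation applied to measurable sets times closed time intervals; closedness
  is what lets a limit of times remain in every box of a branch.\<close>

definition souslin :: "'a measure => ('a \<times> ennreal) set => bool" where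
 "souslin M B \<longleftrightarrow> (\<exists>K. souslin_scheme M K \<and> B = {z. \<exists>S. \<forall>m. z \<in> box (K m S)})"

lemma souslin_box: "A \<in> sets M ==> souslin M (A \<times> {a..b})" unfolding souslin_def souslin_scheme_def
 by (intro exI[of _ "\<lambda>_ _. (A, a, b)"]) (auto simp: box_def)

lemma souslin_choice: assumes "\<And>j::nat. souslin M (B j)"
 shows "\<exists>K. \<forall>j. souslin_scheme M (K j) \<and> B j = {z. \<exists>S. \<forall>m. z \<in> box (K j m S)}"
 using assms unfolding souslin_def by (intro choice) simp

text \<open>The first index selects the set and the others run its scheme; stage 0, which may not
  read any index, is the whole space.\<close>

lemma souslin_UN: assumes "\<And>j::nat. souslin M (B j)" shows "souslin M (\<Union>j. B j)"
proof -
 obtain K where K: "\<And>j. souslin_scheme M (K j)" "\<And>j. B j = {z. \<exists>S. \<forall>m. z \<in> box (K j m S)}"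
  using souslin_choice[of M B, OF assms] by blast
 define K' where "K' m S = (case m of 0 => (space M, 0, \<top>) | Suc m => K (S 0) m (\<lambda>i. S (Suc i)))" for m and S :: "nat => nat"
 have sub: "fst (K j m S) \<subseteq> space M" for j m S
  using K(1)[of j] sets.sets_into_space by (auto simp: souslin_scheme_def)
 have "z \<in> (\<Union>j. B j) \<longleftrightarrow> (\<exists>S. \<forall>m. z \<in> box (K' m S))" for z
 proof
  assume "z \<in> (\<Union>j. B j)"
  then obtain j S where "\<forall>m. z \<in> box (K j m S)" by (auto simp: K(2))
  then show "\<exists>S. \<forall>m. z \<in> box (K' m S)"
   using sub[of j 0 S] by (intro exI[of _ "\<lambda>i. case i of 0 => j | Suc i => S i"]) (auto simp: K'_def box_def split: nat.split)
 next
  assume "\<exists>S. \<forall>m. z \<in> box (K' m S)"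
  then obtain S where S: "z \<in> box (K' m S)" for m by blast
  from S[of "Suc _"] show "z \<in> (\<Union>j. B j)" by (auto simp: K'_def K(2))
 qed
 moreover have "souslin_scheme M K'" unfolding souslin_scheme_def
 proof (intro conjI allI impI)
  show "fst (K' m S) \<in> sets M" for m S using K(1) by (auto simp: K'_def souslin_scheme_def split: nat.split)
  fix m and S S' :: "nat => nat" assume eq: "\<forall>i<m. S i = S' i"
  show "K' m S = K' m S'"
  proof (cases m)
   case (Suc m')
   have "\<forall>i<m'. S (Suc i) = S' (Suc i)" "S 0 = S' 0" using eq Suc by auto
   then show ?thesis using K(1)[of "S 0"] by (simp add: K'_def Suc souslin_scheme_def)
  qed (simp add: K'_def)
 qed
 ultimately show ?thesis unfolding souslin_def by blast
qed

lemma prod_encode_less: "i < n ==> prod_encode (j, i) < prod_encode (j, n)"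
proof (induction n)
 case (Suc n)
 have "prod_encode (j, n) < prod_encode (j, Suc n)" by (simp add: prod_encode_def)
 then show ?case using Suc by (cases "i = n") auto
qed simp

text \<open>All schemes run in parallel on an index sequence split by \<open>prod_encode\<close>; by
  \<open>prod_encode_less\<close>, stage \<open>p\<close> reads only indices below
  \<open>p\<close>.\<close>

lemma souslin_INT: assumes "\<And>j::nat. souslin M (B j)" shows "souslin M (\<Inter>j. B j)"
proof -
 obtain K where K: "\<And>j. souslin_scheme M (K j)" "\<And>j. B j = {z. \<exists>S. \<forall>m. z \<in> box (K j m S)}"
  using souslin_choice[of M B, OF assms] by blast
 define K' where "K' p S = (case prod_decode p of (j, m) => K j m (\<lambda>i. S (prod_encode (j, i))))" for p and S :: "nat => nat"
 have "z \<in> (\<Inter>j. B j) \<longleftrightarrow> (\<exists>S. \<forall>m. z \<in> box (K' m S))" for z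
 proof
  assume "z \<in> (\<Inter>j. B j)"
  then have "\<forall>j. \<exists>S. \<forall>m. z \<in> box (K j m S)" by (auto simp: K(2))
  then obtain S where "z \<in> box (K j m (S j))" for j m by metis
  then show "\<exists>S. \<forall>m. z \<in> box (K' m S)"
   by (intro exI[of _ "\<lambda>p. case prod_decode p of (j, i) => S j i"]) (auto simp: K'_def split: prod.split)
 next
  assume "\<exists>S. \<forall>m. z \<in> box (K' m S)"
  then obtain S where S: "z \<in> box (K' m S)" for m by blast
  from S[of "prod_encode (_, _)"] show "z \<in> (\<Inter>j. B j)" by (auto simp: K'_def K(2))
 qed
 moreover have "souslin_scheme M K'" unfolding souslin_scheme_def
 proof (intro conjI allI impI)
  show "fst (K' m S) \<in> sets M" for m S using K(1) by (auto simp: K'_def souslin_scheme_def split: prod.split)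
  fix p and S S' :: "nat => nat" assume eq: "\<forall>i<p. S i = S' i"
  obtain j m where p: "prod_decode p = (j, m)" by (cases "prod_decode p")
  then have "prod_encode (j, m) = p" by (metis prod_decode_inverse)
  then have "\<forall>i<m. S (prod_encode (j, i)) = S' (prod_encode (j, i))" using eq prod_encode_less by blast
  then show "K' p S = K' p S'" using K(1)[of j] by (simp add: K'_def p souslin_scheme_def)
 qed
 ultimately show ?thesis unfolding souslin_def by blast
qed

text \<open>Asking for the complement as well gives a class closed under complements and countable
  unions, so it contains the product sigma-algebra.\<close>

definition bisouslin :: "'a measure => ('a \<times> ennreal) set => bool" where
 "bisouslin M B \<longleftrightarrow> B \<subseteq> space M \<times> UNIV \<and> souslin M B \<and> souslin M (space M \<times> UNIV - B)"

lemma bisouslin_compl: "bisouslin M B ==> bisouslin M (space M \<times> UNIV - B)"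
 by (auto simp: bisouslin_def double_diff)

lemma bisouslin_UN: assumes B: "\<And>j::nat. bisouslin M (B j)" shows "bisouslin M (\<Union>j. B j)"
proof -
 have eq: "space M \<times> UNIV - (\<Union>j. B j) = (\<Inter>j. space M \<times> UNIV - B j)" by blast
 show ?thesis
  unfolding bisouslin_def eq using B unfolding bisouslin_def by (intro conjI UN_least souslin_UN souslin_INT) auto
qed

lemma bisouslin_Int: assumes "bisouslin M A" "bisouslin M B" shows "bisouslin M (A \<inter> B)"
proof -
 have "bisouslin M (\<Union>j. (if j = (0::nat) then space M \<times> UNIV - A else space M \<times> UNIV - B))"
  using assms bisouslin_compl by (intro bisouslin_UN) auto
 also have "(\<Union>j. (if j = (0::nat) then space M \<times> UNIV - A else space M \<times> UNIV - B)) = space M \<times> UNIV - (A \<inter> B)" by auto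
 finally have "bisouslin M (space M \<times> UNIV - (space M \<times> UNIV - (A \<inter> B)))" by (rule bisouslin_compl)
 moreover have "space M \<times> UNIV - (space M \<times> UNIV - (A \<inter> B)) = A \<inter> B" using assms by (auto simp: bisouslin_def)
 ultimately show ?thesis by simp
qed

lemma UNIV_ennreal: "(UNIV::ennreal set) = {0..\<top>}" by auto

lemma bisouslin_times: assumes "A \<in> sets M" "B \<in> sets borel" shows "bisouslin M (A \<times> B)"
proof -
 have whole: "bisouslin M (C \<times> UNIV)" if C: "C \<in> sets M" for C
 proof -
  have "space M \<times> UNIV - C \<times> UNIV = (space M - C) \<times> (UNIV::ennreal set)" by auto
  then show ?thesis unfolding bisouslin_def UNIV_ennreal using C sets.sets_into_space[OF C] by (auto intro!: souslin_box)
 qed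
 have "sets (borel::ennreal measure) = sigma_sets UNIV (range greaterThan)" by (subst borel_Ioi) simp
 then have "B \<in> sigma_sets UNIV (range greaterThan)" using assms(2) by simp
 then have "bisouslin M (space M \<times> B)"
 proof induction
  case (Basic b)
  then obtain a where b: "b = {a<..}" by auto
  have "souslin M (space M \<times> {a<..})"
  proof (cases "a < \<top>")
   case True
   from approx_from_above_dense_linorder[OF this] obtain v where v: "\<And>n. a < v n" "v \<longlonglongrightarrow> a" by blast
   have "{a<..} = (\<Union>n. {v n..\<top>})"
   proof (intro equalityI subsetI)
    fix x assume "x \<in> {a<..}"
    then obtain n where "v n < x" using order_tendstoD(2)[OF v(2), of x] by (auto simp: eventually_sequentially)
    then show "x \<in> (\<Union>n. {v n..\<top>})" by (auto intro: less_imp_le)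
   qed (use v(1) in \<open>auto intro: less_le_trans\<close>)
   then have "space M \<times> {a<..} = (\<Union>n. space M \<times> {v n..\<top>})" by auto
   then show ?thesis by (simp only:) (intro souslin_UN souslin_box sets.top)
  next
   case False
   then have "\<not> a < x" for x using top_greatest[of x] by (metis order_less_le_trans)
   then have "{a<..} = {}" by auto
   then have "space M \<times> {a<..} = {} \<times> {0..\<top>}" by simp
   then show ?thesis by (simp only:) (intro souslin_box sets.empty_sets)
  qed
  moreover have "souslin M (space M \<times> {0..a})" by (intro souslin_box sets.top)
  moreover have "space M \<times> UNIV - space M \<times> b = space M \<times> {0..a}" using b by auto
  ultimately show ?case by (auto simp: bisouslin_def b)
 next
  case Empty
  then show ?case using whole[of "{}"] by simp
 next
  case (Compl b)
  have "space M \<times> (UNIV - b) = space M \<times> UNIV - space M \<times> b" by auto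
  then show ?case using bisouslin_compl[OF Compl.IH] by simp
 next
  case (Union b)
  have "space M \<times> (\<Union>i. b i) = (\<Union>i. space M \<times> b i)" by auto
  then show ?case using bisouslin_UN[OF Union.IH] by simp
 qed
 from bisouslin_Int[OF whole[OF assms(1)] this] show ?thesis
  using sets.sets_into_space[OF assms(1)] by (simp add: Times_Int_Times Int_absorb2)
qed

lemma bisouslin_product: assumes "B \<in> sets (M \<Otimes>\<^sub>M borel)" shows "bisouslin M B"
proof -
 have "B \<in> sigma_sets (space M \<times> UNIV) {a \<times> b | a b. a \<in> sets M \<and> b \<in> sets borel}"
  using assms by (simp add: sets_pair_measure)
 then show ?thesis
 proof induction
  case Empty
  then show ?case using bisouslin_times[of "{}" M "{}"] by simp
 qed (auto intro: bisouslin_times bisouslin_compl bisouslin_UN)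
qed

text \<open>Koenig's lemma: at each coordinate one of finitely many values recurs infinitely often
  among the sequences still considered.\<close>

lemma bounded_sequences_cluster:
 fixes s :: "nat => nat => nat" assumes bound: "\<And>k i. s k i \<le> b i"
 shows "\<exists>S. \<forall>k. infinite {j. \<forall>i<k. s j i = S i}"
proof -
 have "\<exists>f. \<forall>k. infinite {j. \<forall>i<k. s j i = f k i} \<and> (\<forall>i<k. f (Suc k) i = f k i)"
 proof (rule dependent_nat_choice)
  fix x k assume inf: "infinite {j. \<forall>i<k. s j i = x i}"
  have "(\<lambda>j. s j k) ` {j. \<forall>i<k. s j i = x i} \<subseteq> {..b k}" using bound by auto
  then have "finite ((\<lambda>j. s j k) ` {j. \<forall>i<k. s j i = x i})" by (rule finite_subset) simp
  from inf_img_fin_dom'[OF this inf] obtain y where "infinite ((\<lambda>j. s j k) -` {y} \<inter> {j. \<forall>i<k. s j i = x i})" by blast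
  moreover have "(\<lambda>j. s j k) -` {y} \<inter> {j. \<forall>i<k. s j i = x i} = {j. \<forall>i<Suc k. s j i = (x(k := y)) i}"
   by (auto simp: less_Suc_eq)
  ultimately show "\<exists>y. infinite {j. \<forall>i<Suc k. s j i = y i} \<and> (\<forall>i<k. y i = x i)"
   by (intro exI[of _ "x(k := y)"]) auto
 qed simp
 then obtain f where "\<forall>k. infinite {j. \<forall>i<k. s j i = f k i} \<and> (\<forall>i<k. f (Suc k) i = f k i)" ..
 then have f: "infinite {j. \<forall>i<k. s j i = f k i}" "i < k ==> f (Suc k) i = f k i" for k i by simp_all
 define S where "S i = f (Suc i) i" for i
 have "f k i = S i" if "i < k" for i k using that
 proof (induction k)
  case (Suc k)
  then show ?case using f(2)[of i k] by (cases "i = k") (auto simp: S_def)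
 qed simp
 then have "{j. \<forall>i<k. s j i = S i} = {j. \<forall>i<k. s j i = f k i}" for k by auto
 then show ?thesis using f(1) by (intro exI[of _ S]) simp
qed

text \<open>Truncating the first \<open>k\<close> indices of a Souslin scheme by \<open>b\<close> loses arbitrarily little outer measure, and
 leaves finitely many boxes at each stage, so that the earliest points are measurable.\<close>

theorem measurable_selection:
 assumes fin: "emeasure M (space M) \<noteq> \<infinity>" and B: "souslin M B" "B \<subseteq> space M \<times> UNIV"
  and pos: "0 < outer_measure_of M (fst ` B)"
 obtains W g where "W \<in> sets M" "0 < emeasure M W" "g \<in> borel_measurable M" "\<And>x. x \<in> W ==> (x, g x) \<in> B"
proof -
 obtain K where K: "souslin_scheme M K" and B_eq: "B = {z. \<exists>S. \<forall>m. z \<in> box (K m S)}"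
  using B(1) by (auto simp: souslin_def)
 have KA [measurable]: "fst (K m S) \<in> sets M" for m S using K by (simp add: souslin_scheme_def)
 have Kc: "K m S = K m S'" if "\<And>i. i < m ==> S i = S' i" for m S S' using K that by (simp add: souslin_scheme_def)
 obtain c where c: "0 < c" "c < outer_measure_of M (fst ` B)" using dense[OF pos] by blast
 \<comment> \<open>The projection of the part of \<open>B\<close> reached by index sequences bounded
   in their first \<open>k\<close> places. Raising the bound on the next place exhausts the current
   stage, and outer measure is continuous along increasing sets, so a bound staying above
   \<open>c\<close> can be fixed.\<close>
 define U where "U \<beta> k = {x. \<exists>t S. (\<forall>i<k. S i \<le> \<beta> i) \<and> (\<forall>m. (x, t) \<in> box (K m S))}" for \<beta> :: "nat => nat" and k
 have U_sub: "U \<beta> k \<subseteq> space M" for \<beta> k using B(2) by (auto simp: U_def B_eq)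
 have "\<exists>\<beta>. \<forall>k. c < outer_measure_of M (U (\<beta> k) k) \<and> (\<forall>i<k. \<beta> (Suc k) i = \<beta> k i)"
 proof (rule dependent_nat_choice)
  have "U (\<lambda>_. 0) 0 = fst ` B" by (force simp: U_def B_eq)
  then show "\<exists>\<beta>. c < outer_measure_of M (U \<beta> 0)" using c(2) by (intro exI[of _ "\<lambda>_. 0"]) simp
  fix \<beta> k assume less: "c < outer_measure_of M (U \<beta> k)"
  have U_Suc: "U (\<beta>(k := n)) (Suc k) = {x. \<exists>t S. ((\<forall>i<k. S i \<le> \<beta> i) \<and> S k \<le> n) \<and> (\<forall>m. (x, t) \<in> box (K m S))}" for n
  proof -
   have "(\<forall>i<Suc k. S i \<le> (\<beta>(k := n)) i) \<longleftrightarrow> (\<forall>i<k. S i \<le> \<beta> i) \<and> S k \<le> n" for S :: "nat => nat"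
    by (auto simp: less_Suc_eq)
   then show ?thesis unfolding U_def by simp
  qed
  have "U \<beta> k = (\<Union>n. U (\<beta>(k := n)) (Suc k))" unfolding U_Suc by (auto simp: U_def)
  moreover have "incseq (\<lambda>n. U (\<beta>(k := n)) (Suc k))"
  proof (rule incseq_SucI)
   show "U (\<beta>(k := n)) (Suc k) \<le> U (\<beta>(k := Suc n)) (Suc k)" for n
    unfolding U_Suc by (intro subsetI CollectI, elim CollectE exE conjE, intro exI conjI) (assumption | simp)+
  qed
  ultimately have "outer_measure_of M (U \<beta> k) = (SUP n. outer_measure_of M (U (\<beta>(k := n)) (Suc k)))"
   using U_sub by (simp add: SUP_outer_measure_of_incseq)
  with less obtain n where "c < outer_measure_of M (U (\<beta>(k := n)) (Suc k))"
   by (metis (no_types, lifting) less_SUP_iff)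
  then show "\<exists>\<beta>'. c < outer_measure_of M (U \<beta>' (Suc k)) \<and> (\<forall>i<k. \<beta>' i = \<beta> i)" by (intro exI[of _ "\<beta>(k := n)"]) auto
 qed
 then obtain \<beta> where "\<forall>k. c < outer_measure_of M (U (\<beta> k) k) \<and> (\<forall>i<k. \<beta> (Suc k) i = \<beta> k i)" ..
 then have \<beta>: "c < outer_measure_of M (U (\<beta> k) k)" "i < k ==> \<beta> (Suc k) i = \<beta> k i" for k i by simp_all
 define b where "b i = \<beta> (Suc i) i" for i
 have b: "\<beta> k i = b i" if "i < k" for i k using that
 proof (induction k)
  case (Suc k)
  then show ?case using \<beta>(2)[of i k] by (cases "i = k") (auto simp: b_def)
 qed simp
 \<comment> \<open>Places from \<open>k\<close> on are set to 0, since the stages up to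
   \<open>k\<close> do not read them; this leaves finitely many sequences.\<close>
 define \<Sigma> where "\<Sigma> k = {S. \<forall>i. S i \<le> (if i < k then b i else 0)}" for k
 have \<Sigma>_fin: "finite (\<Sigma> k)" for k
 proof (rule finite_subset)
  show "\<Sigma> k \<subseteq> {f. \<forall>i. (i \<in> {..<k} \<longrightarrow> f i \<in> {..\<Sum>i<k. b i}) \<and> (i \<notin> {..<k} \<longrightarrow> f i = 0)}"
  proof (intro subsetI CollectI allI conjI impI)
   fix S i assume "S \<in> \<Sigma> k"
   then have le: "S i \<le> (if i < k then b i else 0)" by (simp add: \<Sigma>_def)
   show "S i \<in> {..\<Sum>i<k. b i}" if "i \<in> {..<k}" using le that member_le_sum[of i "{..<k}" b] by simp
   show "S i = 0" if "i \<notin> {..<k}" using le that by simp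
  qed
 qed (rule finite_set_of_finite_funs; simp)
 \<comment> \<open>The intersection of the boxes 0 to \<open>k\<close> consists of the points of
   \<open>R\<close> with times from \<open>lo\<close> to \<open>hi\<close>.\<close>
 define lo where "lo k S = Max ((\<lambda>m. fst (snd (K m S))) ` {..k})" for k S
 define hi where "hi k S = Min ((\<lambda>m. snd (snd (K m S))) ` {..k})" for k S
 define R where "R k S = (if lo k S \<le> hi k S then \<Inter>m\<le>k. fst (K m S) else {})" for k S
 have [measurable]: "R k S \<in> sets M" for k S unfolding R_def by auto
 \<comment> \<open>The earliest left end over the remaining branches, \<open>\<top>\<close> if none
   is left; it increases with \<open>k\<close>, and its supremum is the selected time.\<close>
 define t where "t k x = Min ((\<lambda>S. if x \<in> R k S then lo k S else \<top>) ` \<Sigma> k)" for k x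
 define g where "g x = (SUP k. t k x)" for x
 define W where "W = (\<Inter>k. \<Union>S\<in>\<Sigma> k. R k S)"
 have "(\<lambda>_. 0) \<in> \<Sigma> k" for k by (simp add: \<Sigma>_def)
 then have \<Sigma>_ne: "\<Sigma> k \<noteq> {}" for k by blast
 have W_sets [measurable]: "(\<Union>S\<in>\<Sigma> k. R k S) \<in> sets M" for k using \<Sigma>_fin by auto
 have t_eq: "t k x = (INF S\<in>\<Sigma> k. if x \<in> R k S then lo k S else \<top>)" for k x
  unfolding t_def by (rule Min_Inf) (use \<Sigma>_fin \<Sigma>_ne in auto)
 have g_meas: "g \<in> borel_measurable M"
  unfolding g_def t_eq using \<Sigma>_fin by (intro borel_measurable_SUP[OF countableI_type] borel_measurable_INF countable_finite) auto
 define cut where "cut k S i = (if i < k then S i else (0::nat))" for k and S :: "nat => nat" and i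
 have cutK: "K m (cut k S) = K m S" if "m \<le> k" for m k S using that by (intro Kc) (simp add: cut_def)
 have lo_cut: "lo k (cut k' S) = lo k S" "hi k (cut k' S) = hi k S" "R k (cut k' S) = R k S" if "k \<le> k'" for k k' S
  using that cutK[of _ k' S] by (auto simp: lo_def hi_def R_def intro!: arg_cong[of _ _ Max] arg_cong[of _ _ Min] image_cong)
 have lo_mono: "lo k S \<le> lo k' S" "hi k' S \<le> hi k S" if "k \<le> k'" for k k' S
  using that by (auto simp: lo_def hi_def intro!: Max_mono Min_antimono)
 have R_mono: "R k' S \<subseteq> R k S" if "k \<le> k'" for k k' S
  using lo_mono[OF that, of S] that by (auto simp: R_def intro: order_trans)
 have cut_\<Sigma>: "cut k S \<in> \<Sigma> k" if "\<And>i. i < k ==> S i \<le> b i" for k S using that by (auto simp: \<Sigma>_def cut_def)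
 have \<Sigma>_b: "S i \<le> b i" if "S \<in> \<Sigma> k" for S k i
 proof -
  have "S i \<le> (if i < k then b i else 0)" using that by (simp add: \<Sigma>_def)
  then show ?thesis by (auto split: if_splits)
 qed
 have t_mono: "t k x \<le> t k' x" if kk: "k \<le> k'" for k k' x unfolding t_eq[of k']
 proof (rule INF_greatest)
  fix S assume S: "S \<in> \<Sigma> k'"
  show "t k x \<le> (if x \<in> R k' S then lo k' S else \<top>)"
  proof (cases "x \<in> R k' S")
   case True
   have "t k x \<le> (if x \<in> R k (cut k S) then lo k (cut k S) else \<top>)"
    unfolding t_eq using \<Sigma>_b[OF S] by (intro INF_lower cut_\<Sigma>)
   then show ?thesis using True R_mono[OF kk, of S] lo_mono(1)[OF kk, of S] by (auto simp: lo_cut)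
  qed simp
 qed
 \<comment> \<open>The minimising branches of the stages cluster at one sequence \<open>S\<close>.
   Infinitely many stages share a given box with \<open>S\<close>, and since their times increase to
   \<open>g x\<close>, the closed box contains the limit.\<close>
 have in_B: "(x, g x) \<in> B" if x: "x \<in> W" for x
 proof -
  have "\<exists>S\<in>\<Sigma> k. x \<in> R k S \<and> t k x = lo k S" for k
  proof -
   have "t k x \<in> (\<lambda>S. if x \<in> R k S then lo k S else \<top>) ` \<Sigma> k"
    unfolding t_def by (rule Min_in) (use \<Sigma>_fin \<Sigma>_ne in auto)
   then obtain S where S: "t k x = (if x \<in> R k S then lo k S else \<top>)" "S \<in> \<Sigma> k" by (rule imageE)
   show ?thesis
   proof (cases "x \<in> R k S")
    case False
    then have top: "t k x = \<top>" using S by simp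
    obtain S' where S': "S' \<in> \<Sigma> k" "x \<in> R k S'" using x by (auto simp: W_def)
    then have "t k x \<le> lo k S'" unfolding t_eq by (intro INF_lower2[OF S'(1)]) simp
    then show ?thesis using top S' top_unique by metis
   qed (use S in auto)
  qed
  then obtain s where s: "\<And>k. s k \<in> \<Sigma> k" "\<And>k. x \<in> R k (s k)" "\<And>k. t k x = lo k (s k)" by metis
  obtain S where S: "\<And>k. infinite {j. \<forall>i<k. s j i = S i}"
   using bounded_sequences_cluster[of s b] \<Sigma>_b[OF s(1)] by blast
  have "(x, g x) \<in> box (K m S)" for m
  proof -
   have ex: "\<exists>j\<ge>n. m \<le> j \<and> K m (s j) = K m S" for n
   proof -
    obtain j where "max n m < j" "\<forall>i<m. s j i = S i" using infinite_nat_iff_unbounded[THEN iffD1, OF S[of m]] by blast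
    then show ?thesis by (intro exI[of _ j]) (auto intro: Kc)
   qed
   have j: "x \<in> fst (K m S)" "fst (snd (K m S)) \<le> t j x" "t j x \<le> snd (snd (K m S))" if "m \<le> j" "K m (s j) = K m S" for j
   proof -
    have R: "lo j (s j) \<le> hi j (s j)" "x \<in> fst (K m (s j))" using s(2)[of j] that(1) by (auto simp: R_def split: if_splits)
    have "fst (snd (K m (s j))) \<le> lo j (s j)" "hi j (s j) \<le> snd (snd (K m (s j)))"
     unfolding lo_def hi_def using that(1) by (auto intro!: Max_ge Min_le simp del: Max_ge_iff Min_le_iff)
    then show "x \<in> fst (K m S)" "fst (snd (K m S)) \<le> t j x" "t j x \<le> snd (snd (K m S))" using R that s(3)[of j] by auto
   qed
   have "g x \<le> snd (snd (K m S))" unfolding g_def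
   proof (rule SUP_least)
    fix n obtain j where "n \<le> j" "m \<le> j" "K m (s j) = K m S" using ex by blast
    then show "t n x \<le> snd (snd (K m S))" using t_mono[of n j x] j(3)[of j] by (auto intro: order_trans)
   qed
   moreover obtain j where "m \<le> j" "K m (s j) = K m S" using ex by blast
   then have "fst (snd (K m S)) \<le> g x" "x \<in> fst (K m S)"
    unfolding g_def using j[of j] by (auto intro: SUP_upper2)
   ultimately show ?thesis by (auto simp: box_def)
  qed
  then show ?thesis by (auto simp: B_eq)
 qed
 \<comment> \<open>Each stage contains \<open>U (\<beta> k) k\<close>, of outer measure above
   \<open>c\<close>; finiteness of \<open>M\<close> carries the bound to the decreasing intersection
   \<open>W\<close>.\<close>
 have le: "c \<le> emeasure M (\<Union>S\<in>\<Sigma> k. R k S)" for k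
 proof -
  have "U (\<beta> k) k \<subseteq> (\<Union>S\<in>\<Sigma> k. R k S)"
  proof
   fix x assume "x \<in> U (\<beta> k) k"
   then obtain v S where S: "\<And>i. i < k ==> S i \<le> b i" "\<And>m. (x, v) \<in> box (K m S)" by (auto simp: U_def b)
   then have "lo k S \<le> v" "v \<le> hi k S" by (auto simp: lo_def hi_def box_def)
   then have "x \<in> R k S" using S(2) by (auto simp: R_def box_def)
   then show "x \<in> (\<Union>S\<in>\<Sigma> k. R k S)" using cut_\<Sigma>[OF S(1)] lo_cut(3)[OF order_refl, of k S] by blast
  qed
  from outer_measure_of_mono[OF this, of M] show ?thesis using \<beta>(1)[of k] by simp
 qed
 have "decseq (\<lambda>k. \<Union>S\<in>\<Sigma> k. R k S)"
 proof (rule decseq_SucI, rule subsetI)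
  fix k x assume "x \<in> (\<Union>S\<in>\<Sigma> (Suc k). R (Suc k) S)"
  then obtain S where S: "S \<in> \<Sigma> (Suc k)" "x \<in> R (Suc k) S" by auto
  then have "x \<in> R k (cut k S)" using R_mono[of k "Suc k" S] by (auto simp: lo_cut)
  then show "x \<in> (\<Union>S\<in>\<Sigma> k. R k S)" using cut_\<Sigma>[of k S] \<Sigma>_b[OF S(1)] by blast
 qed
 moreover have "emeasure M (\<Union>S\<in>\<Sigma> k. R k S) \<noteq> \<infinity>" for k
  using fin emeasure_space[of M] by (metis infinity_ennreal_def neq_top_trans)
 ultimately have INF: "(INF k. emeasure M (\<Union>S\<in>\<Sigma> k. R k S)) = emeasure M W"
  unfolding W_def by (intro INF_emeasure_decseq) auto
 have "c \<le> emeasure M W" unfolding INF[symmetric] by (intro INF_greatest le)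
 then show ?thesis using c(1) g_meas in_B by (intro that[of W g]) (auto simp: W_def)
qed

text \<open>A bounded strictly decreasing function on \<open>[0, \<infinity>]\<close>: its mean
  separates ordered stopping times, infinite values included.\<close>

lemma inverse_one_plus_strict: assumes "s < (t::ennreal)" shows "inverse (1 + t) < inverse (1 + s)"
proof (cases s; cases t)
 fix a b assume *: "0 \<le> a" "s = ennreal a" "0 \<le> b" "t = ennreal b"
 then have "inverse (1 + s) = ennreal (inverse (1 + a))" "inverse (1 + t) = ennreal (inverse (1 + b))"
  by (simp_all add: inverse_ennreal flip: ennreal_1 ennreal_plus)
 with * assms show ?thesis by (simp add: ennreal_less_iff)
next
 fix a assume "0 \<le> a" "s = ennreal a" "t = \<top>"
 then show ?thesis by (simp add: ennreal_inverse_positive)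
qed (use assms in \<open>auto simp: top_unique\<close>)

lemma inverse_one_plus_antimono: "s \<le> (t::ennreal) ==> inverse (1 + t) \<le> inverse (1 + s)"
 using inverse_one_plus_strict[of s t] by (auto simp: order_le_less)

section \<open>Optional sets and the section theorem\<close>

context filtered_prob_space
begin

text \<open>An optional set becomes one Borel condition, in the product topology, on a sequence of
  right-continuous adapted processes; inner regularity can then be applied in sequence
  space.\<close>

definition observes :: "(nat => 'a process) => (nat => real) set => ('a \<times> ennreal) set => bool" where
 "observes X C B \<longleftrightarrow> (\<forall>n. adapted F T (X n) \<and> (\<forall>x\<in>space M. right_continuous_path T (\<lambda>t. X n t x))) \<and>
  C \<in> sets borel \<and> B = {z \<in> space M \<times> {..T}. (\<lambda>n. X n (snd z) (fst z)) \<in> C}"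

lemma optional_observed: assumes "B \<in> sets (optional_sigma M F T)" shows "\<exists>X C. observes X C B"
proof -
 have "B \<in> sigma_sets (space M \<times> {..T}) {{(x, t) \<in> space M \<times> {..T}. X t x \<in> B} | X B.
    adapted F T X \<and> (\<forall>x\<in>space M. cadlag_path T (\<lambda>t. X t x)) \<and> B \<in> sets borel}"
  using assms by (subst (asm) optional_sigma_def, subst (asm) sets_measure_of) auto
 then show ?thesis
 proof induction
  case (Basic b)
  then obtain X C where X: "adapted F T X" "\<forall>x\<in>space M. cadlag_path T (\<lambda>t. X t x)" and [measurable]: "C \<in> sets borel"
   and b: "b = {(x, t) \<in> space M \<times> {..T}. X t x \<in> C}" by auto
  have "{f::nat => real. f 0 \<in> C} \<in> sets borel" by measurable
  with X have "observes (\<lambda>_. X) {f. f 0 \<in> C} b" by (auto simp: observes_def b intro: cadlag_right_continuous)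
  then show ?case by blast
 next
  case Empty
  have "observes (\<lambda>_ _ _. 0) {} {}" by (auto simp: observes_def adapted_def right_continuous_const)
  then show ?case by blast
 next
  case (Compl b)
  then obtain X C where "observes X C b" by blast
  then have "observes X (- C) (space M \<times> {..T} - b)" by (auto simp: observes_def)
  then show ?case by blast
 next
  case (Union b)
  from choice[OF allI[OF Union.IH]] obtain X where "\<forall>i. \<exists>C. observes (X i) C (b i)" ..
  from choice[OF this] obtain C where X: "\<forall>i. observes (X i) (C i) (b i)" ..
  let ?C = "\<Union>i. {f. (\<lambda>n. f (prod_encode (i, n))) \<in> C i}"
  have [measurable]: "{f. (\<lambda>n. f (prod_encode (i, n))) \<in> C i} \<in> sets borel" for i
  proof -
   have "(\<lambda>f n. f (prod_encode (i, n))) \<in> borel_measurable (borel :: (nat => real) measure)"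
    by (rule measurable_coordinatewise_then_product) measurable
   from measurable_sets[OF this, of "C i"] X show ?thesis by (simp add: vimage_def observes_def)
  qed
  have "?C \<in> sets borel" by measurable
  with X have "observes (\<lambda>p. case prod_decode p of (i, n) => X i n) ?C (\<Union>i. b i)"
   by (auto simp: observes_def split: prod.split)
  then show ?case by blast
 qed
qed

lemma infdist_path:
 fixes X :: "nat => 'a process"
 assumes X: "\<And>n. adapted F T (X n)" "\<And>n x. x \<in> space M ==> right_continuous_path T (\<lambda>t. X n t x)"
 shows "adapted F T (\<lambda>t x. infdist (\<lambda>n. X n t x) K)"
  "x \<in> space M ==> right_continuous_path T (\<lambda>t. infdist (\<lambda>n. X n t x) K)"
proof -
 have "(\<lambda>x n. X n t x) \<in> borel_measurable (F t)" if "t \<le> T" for t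
  using X(1) that by (intro measurable_coordinatewise_then_product) (auto simp: adapted_def)
 from measurable_compose[OF this borel_measurable_continuous_onI[OF continuous_on_infdist[OF continuous_on_id]]]
 show "adapted F T (\<lambda>t x. infdist (\<lambda>n. X n t x) K)" by (simp add: adapted_def)
 assume x: "x \<in> space M"
 show "right_continuous_path T (\<lambda>t. infdist (\<lambda>n. X n t x) K)"
  unfolding right_continuous_path_def continuous_within
 proof (intro allI impI tendsto_infdist)
  fix t assume "t < T"
  then have "((\<lambda>s. X n s x) \<longlongrightarrow> X n t x) (at_right t)" for n
   using X(2)[OF x] by (simp add: right_continuous_path_def continuous_within)
  then have "limitin (product_topology (\<lambda>_. euclidean) UNIV) (\<lambda>s n. X n s x) (\<lambda>n. X n t x) (at_right t)"
   by (simp add: limitin_componentwise)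
  then show "((\<lambda>s n. X n s x) \<longlongrightarrow> (\<lambda>n. X n t x)) (at_right t)"
   unfolding euclidean_product_topology by simp
 qed
qed

text \<open>An essential supremum: a sequence of avoiding times that nearly minimises the mean of
  \<open>1 / (1 + S)\<close> is merged by its pointwise supremum, which still avoids the zeros. A
  later avoiding time has the same mean and hence coincides.\<close>

lemma latest_avoiding_time:
 fixes Z :: "'a process"
 defines "avoids \<equiv> \<lambda>S. stopping S \<and> (AE x in M. \<forall>t<S x. 0 < Z t x)"
 obtains S where "avoids S" "\<And>\<tau>. avoids \<tau> ==> (\<And>x. x \<in> space M ==> S x \<le> \<tau> x) ==> AE x in M. \<tau> x = S x"
proof -
 let ?v = "\<lambda>S. \<integral>\<^sup>+ x. inverse (1 + S x) \<partial>M"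
 have fin: "?v S < \<infinity>" for S
 proof -
  have "?v S \<le> (\<integral>\<^sup>+ x. 1 \<partial>M)" by (intro nn_integral_mono) (use inverse_one_plus_antimono[of 0] in simp)
  then show ?thesis by (auto simp: emeasure_space_1 intro: le_less_trans)
 qed
 have "avoids (\<lambda>_. 0)" by (simp add: avoids_def stopping_const)
 then have "?v ` {S. avoids S} \<noteq> {}" by auto
 from ennreal_Inf_countable_INF[OF this] obtain s :: "nat => ennreal" where s: "range s \<subseteq> ?v ` {S. avoids S}" "Inf (?v ` {S. avoids S}) = (INF i. s i)"
  by blast
 have "\<forall>i. \<exists>S. avoids S \<and> s i = ?v S" using s(1) by auto
 from choice[OF this] obtain S where S: "avoids (S i)" "s i = ?v (S i)" for i by blast
 define \<rho> where "\<rho> x = (SUP i. S i x)" for x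
 have "AE x in M. \<forall>i. \<forall>t<S i x. 0 < Z t x" unfolding AE_all_countable using S(1) by (simp add: avoids_def)
 then have "AE x in M. \<forall>t<\<rho> x. 0 < Z t x" by eventually_elim (auto simp: \<rho>_def less_SUP_iff)
 then have \<rho>: "avoids \<rho>" using S(1) stopping_SUP[of S] by (simp add: avoids_def \<rho>_def[abs_def])
 have min: "?v \<rho> \<le> ?v \<tau>" if "avoids \<tau>" for \<tau>
 proof -
  have "?v \<rho> \<le> (INF i. s i)"
   unfolding S(2) by (intro INF_greatest nn_integral_mono inverse_one_plus_antimono) (auto simp: \<rho>_def intro: SUP_upper)
  also have "\<dots> \<le> ?v \<tau>" unfolding s(2)[symmetric] using that by (intro Inf_lower) auto
  finally show ?thesis .
 qed
 show ?thesis
 proof (rule that[OF \<rho>])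
  fix \<tau> assume \<tau>: "avoids \<tau>" and le: "\<And>x. x \<in> space M ==> \<rho> x \<le> \<tau> x"
  have [measurable]: "\<rho> \<in> borel_measurable M" "\<tau> \<in> borel_measurable M"
   using \<rho> \<tau> by (auto simp: avoids_def intro: stopping_measurable)
  have inv_le: "inverse (1 + \<tau> x) \<le> inverse (1 + \<rho> x)" if "x \<in> space M" for x
   by (intro inverse_one_plus_antimono le that)
  have "(\<integral>\<^sup>+ x. inverse (1 + \<rho> x) - inverse (1 + \<tau> x) \<partial>M) = ?v \<rho> - ?v \<tau>"
   using fin[of \<tau>] inv_le by (intro nn_integral_diff) auto
  also have "\<dots> = 0" using min[OF \<tau>] fin[of \<rho>] by (simp add: diff_eq_0_ennreal)
  finally have "AE x in M. inverse (1 + \<rho> x) - inverse (1 + \<tau> x) = 0" by (subst (asm) nn_integral_0_iff_AE) auto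
  with AE_space show "AE x in M. \<tau> x = \<rho> x"
  proof eventually_elim
   case (elim x)
   have "inverse (1 + \<rho> x) \<le> inverse (1 + \<tau> x)" using elim(2) by (simp add: diff_eq_0_iff_ennreal)
   then show ?case using inverse_one_plus_strict[of "\<rho> x" "\<tau> x"] le[OF elim(1)] by (auto simp: order_le_less)
  qed
 qed
qed

text \<open>If the projection of \<open>B\<close> is not null, a measurable selection carries
  positive mass into \<open>C\<close>, and inner regularity yields a compact \<open>K\<close> inside
  \<open>C\<close>. The condition \<open>Z = 0\<close> for the distance \<open>Z\<close> to
  \<open>K\<close> replaces \<open>B\<close>: the latest time avoiding the zeros of \<open>Z\<close>
  has to meet one if it is before \<open>T\<close>, and then its graph meets
  \<open>B\<close>.\<close>

theorem optional_section:
 assumes B: "B \<in> sets (optional_sigma M F T)" and end_time: "\<And>x t. (x, t) \<in> B ==> t < T"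
  and avoid: "\<And>S. stopping S ==> AE x in M. (x, S x) \<notin> B" shows "AE x in M. \<forall>t. (x, t) \<notin> B"
proof (rule ccontr)
 assume neg: "\<not> ?thesis"
 have B_sub: "B \<subseteq> space M \<times> {..T}" using sets.sets_into_space[OF B] by simp
 have "0 < outer_measure_of M (fst ` B)"
 proof (rule ccontr)
  assume zero: "\<not> ?thesis"
  have "fst ` B \<subseteq> space M" using B_sub by auto
  from outer_measure_of_attain[OF this] obtain E where E: "E \<in> sets M" "fst ` B \<subseteq> E" "outer_measure_of M (fst ` B) = emeasure M E" by blast
  then have "E \<in> null_sets M" using zero by (auto simp: null_sets_def)
  from AE_not_in[OF this] have "AE x in M. \<forall>t. (x, t) \<notin> B" by eventually_elim (use E(2) in force)
  with neg show False by blast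
 qed
 moreover have "souslin M B"
 proof -
  have "B \<in> sets (M \<Otimes>\<^sub>M restrict_space borel {..T})"
   using measurable_sets[OF measurable_optional_id_M B] B_sub by (simp add: space_pair_measure Int_absorb2)
  moreover have "sets (M \<Otimes>\<^sub>M restrict_space borel {..T}) \<subseteq> sets (M \<Otimes>\<^sub>M borel)"
   unfolding sets_pair_measure[of M "restrict_space borel {..T}"]
   by (intro sets.sigma_sets_subset') (auto simp: sets_restrict_space_iff)
  ultimately have "B \<in> sets (M \<Otimes>\<^sub>M borel)" by blast
  then show ?thesis using bisouslin_product by (auto simp: bisouslin_def)
 qed
 moreover have "B \<subseteq> space M \<times> UNIV" "emeasure M (space M) \<noteq> \<infinity>" using B_sub by (auto simp: emeasure_space_1)
 ultimately obtain W g where W: "W \<in> sets M" "0 < emeasure M W" and g: "g \<in> borel_measurable M" "\<And>x. x \<in> W ==> (x, g x) \<in> B"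
  using measurable_selection[of M B] by metis
 obtain X C where X: "\<And>n. adapted F T (X n)" "\<And>n x. x \<in> space M ==> right_continuous_path T (\<lambda>t. X n t x)"
  and C: "C \<in> sets borel" and B_eq: "B = {z \<in> space M \<times> {..T}. (\<lambda>n::nat. X n (snd z) (fst z)) \<in> C}"
  using optional_observed[OF B] unfolding observes_def by blast
 have W_space: "x \<in> space M" if "x \<in> W" for x using that W(1) sets.sets_into_space by blast
 define N where "N = distr (restrict_space M W) borel (\<lambda>x n. X n (g x) x)"
 have Xg: "(\<lambda>x n. X n (g x) x) \<in> borel_measurable (restrict_space M W)"
 proof (rule measurable_coordinatewise_then_product)
  fix n
  have "(\<lambda>x. (x, g x)) \<in> restrict_space M W \<rightarrow>\<^sub>M M \<Otimes>\<^sub>M restrict_space borel {..T}"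
   using g(1) g(2)[THEN subsetD[OF B_sub]]
   by (intro measurable_Pair measurable_restrict_space2 measurable_restrict_space1) (auto simp: space_restrict_space)
  from measurable_compose[OF this progressive_measurable_process[OF right_continuous_progressive[OF X(1,2)], unfolded measurable_process_def]]
  show "(\<lambda>x. X n (g x) x) \<in> borel_measurable (restrict_space M W)" by simp
 qed
 have N: "emeasure N D = emeasure M {x \<in> W. (\<lambda>n. X n (g x) x) \<in> D}" if "D \<in> sets borel" for D
 proof -
  have "emeasure N D = emeasure (restrict_space M W) ((\<lambda>x n. X n (g x) x) -` D \<inter> space (restrict_space M W))"
   unfolding N_def by (rule emeasure_distr[OF Xg that])
  also have "\<dots> = emeasure M {x \<in> W. (\<lambda>n. X n (g x) x) \<in> D}"
   using W(1) W_space by (subst emeasure_restrict_space) (auto simp: space_restrict_space intro!: arg_cong[of _ _ "emeasure M"])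
  finally show ?thesis .
 qed
 have "{x \<in> W. (\<lambda>n. X n (g x) x) \<in> C} = W" using g(2) by (auto simp: B_eq)
 then have "0 < emeasure N C" using N[OF C] W(2) by simp
 also have "emeasure N C = (SUP K\<in>{K. K \<subseteq> C \<and> compact K}. emeasure N K)"
 proof (rule inner_regular)
  have "emeasure N UNIV \<le> 1" using N[of UNIV] by (simp add: emeasure_le_1 )
  then show "emeasure N (space N) \<noteq> \<infinity>" by (auto simp: N_def top_unique)
 qed (use C in \<open>auto simp: N_def\<close>)
 finally obtain K where K: "K \<subseteq> C" "compact K" "0 < emeasure N K" by (auto simp: less_SUP_iff)
 have Kc: "closed K" using K(2) by (rule compact_imp_closed)
 have K_ne: "K \<noteq> {}" using K(3) by auto
 define Z where "Z t x = infdist (\<lambda>n. X n t x) K" for t x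
 have Z_in: "Z t x = 0 \<longleftrightarrow> (\<lambda>n. X n t x) \<in> K" for t x
  using in_closed_iff_infdist_zero[OF Kc K_ne] by (simp add: Z_def)
 have Z_nonneg: "0 \<le> Z t x" for t x by (simp add: Z_def infdist_nonneg)
 have Z_B: "(x, t) \<in> B" if "Z t x = 0" "x \<in> space M" "t \<le> T" for t x
  using that K(1) by (auto simp: B_eq Z_in)
 have Z: "adapted F T Z" "x \<in> space M ==> right_continuous_path T (\<lambda>t. Z t x)" for x
  unfolding Z_def[abs_def] by (rule infdist_path[OF X]; assumption)+
 define Y where "Y k t x = 1 / real (Suc k) - Z t x" for k t x
 obtain S where S': "stopping S \<and> (AE x in M. \<forall>t<S x. 0 < Z t x)"
  and max: "\<And>\<tau>. stopping \<tau> \<and> (AE x in M. \<forall>t<\<tau> x. 0 < Z t x) ==> (\<And>x. x \<in> space M ==> S x \<le> \<tau> x) ==> AE x in M. \<tau> x = S x"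
  by (rule latest_avoiding_time[of Z]) iprover
 note S = conjunct1[OF S'] conjunct2[OF S']
 \<comment> \<open>The limit of the entry times of \<open>Z\<close> below \<open>1 / Suc k\<close>
   after \<open>S\<close> still avoids the zeros. By maximality it equals \<open>S\<close>, so
   \<open>Z\<close> vanishes at \<open>S\<close> whenever \<open>S < T\<close>.\<close>
 define h where "h x = (SUP k. hitting S (Y k) x)" for x
 have Y: "adapted F T (Y k)" "x \<in> space M ==> right_continuous_path T (\<lambda>t. Y k t x)" for k x
  using Z unfolding Y_def[abs_def] by (auto simp: adapted_def intro!: right_continuous_diff right_continuous_const)
 have hit: "stopping (hitting S (Y k))" for k by (rule stopping_hitting[OF S(1) Y])
 have h: "stopping h" unfolding h_def by (rule stopping_SUP[OF hit])
 have S_hit: "S x \<le> hitting S (Y k) x" if "x \<in> space M" for x k by (rule hitting_ge) (rule stoppingD(2)[OF S(1) that])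
 have "AE x in M. \<forall>t<h x. 0 < Z t x" using S(2)
 proof eventually_elim
  case (elim x)
  show ?case
  proof (intro allI impI)
   fix t assume "t < h x"
   then obtain k where k: "t < hitting S (Y k) x" by (auto simp: h_def less_SUP_iff)
   show "0 < Z t x"
   proof (cases "t < S x")
    case False
    then have "Y k t x \<le> 0" using before_hitting[OF _ k] by simp
    then show ?thesis unfolding Y_def by (smt (verit) of_nat_0_less_iff zero_less_Suc zero_less_divide_1_iff)
   qed (use elim in simp)
  qed
 qed
 moreover have "S x \<le> h x" if "x \<in> space M" for x
  unfolding h_def by (rule SUP_upper2[of 0]) (simp_all add: S_hit[OF that])
 ultimately have "AE x in M. h x = S x" using h by (intro max) auto
 with S(2) avoid[OF S(1)] AE_space have "AE x in M. \<forall>t<T. 0 < Z t x"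
 proof eventually_elim
  case (elim x)
  have "\<not> S x < T"
  proof
   assume less: "S x < T"
   have "hitting S (Y k) x \<le> h x" for k unfolding h_def by (rule SUP_upper) simp
   then have "hitting S (Y k) x = S x" for k using elim(4) S_hit[OF elim(3), of k] by (metis antisym)
   then have "0 \<le> Y k (S x) x" for k
    using hitting_value[of "Y k" x S] Y(2)[OF elim(3)] less by (simp add: less_imp_le)
   then have "Z (S x) x \<le> 1 / real (Suc k)" for k by (simp add: Y_def)
   then have "Z (S x) x \<le> 0" using LIMSEQ_le_const[OF LIMSEQ_Suc[OF lim_const_over_n[of "1::real"]]] by blast
   then have "Z (S x) x = 0" using Z_nonneg[of "S x" x] by simp
   then show False using Z_B[OF _ elim(3), of "S x"] elim(2) less less_imp_le by blast
  qed
  then show ?case using elim(1) by (auto simp: not_less)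
 qed
 then have "AE x in M. \<not> (x \<in> W \<and> (\<lambda>n. X n (g x) x) \<in> K)" using AE_space
 proof eventually_elim
  case (elim x)
  show ?case using elim(1) g(2)[of x] end_time[of x "g x"] Z_in[of "g x" x] by force
 qed
 from emeasure_eq_0_AE[OF this] have "emeasure M {x \<in> space M. x \<in> W \<and> (\<lambda>n. X n (g x) x) \<in> K} = 0" .
 also have "{x \<in> space M. x \<in> W \<and> (\<lambda>n. X n (g x) x) \<in> K} = {x \<in> W. (\<lambda>n. X n (g x) x) \<in> K}" using W_space by auto
 finally have "emeasure M {x \<in> W. (\<lambda>n. X n (g x) x) \<in> K} = 0" .
 then show False using K(3) N[of K] Kc by simp
qed

end

section \<open>Uniqueness\<close>

context backward_setting
begin

text \<open>Starts strictly after \<open>S\<close>, where a solution is known to have a finite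
  positive running supremum; the omitted instant has measure 0.\<close>

definition sup_value :: "'a process => ('a => ennreal) => 'a process" where
 "sup_value l S t x = (if S x < t \<and> t < T then marginal (SUP v\<in>{S x..t}. l v x) t x else 0)"

definition sup_integral :: "'a process => ('a => ennreal) => 'a => ennreal" where
 "sup_integral l S x = (\<integral>\<^sup>+ t. ennreal (sup_value l S t x) \<partial>leb_time T)"

definition sup_positive :: "'a process => ('a => ennreal) => 'a => bool" where
 "sup_positive l S x \<longleftrightarrow> (\<forall>t. S x < t \<and> t < T \<longrightarrow>
  bdd_above ((\<lambda>v. l v x) ` {S x..t}) \<and> 0 < (SUP v\<in>{S x..t}. l v x))"

text \<open>The running supremum increases with \<open>t\<close>, so its superlevel sets are
  intervals up to one end point, whatever the path of \<open>l\<close>.\<close>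

lemma sup_value_measurable: assumes x: "x \<in> space M" and pos: "sup_positive l J x"
 shows "(\<lambda>t. ennreal (sup_value l J t x)) \<in> borel_measurable (leb_time T)"
proof -
 let ?R = "restrict_space borel {..T}"
 let ?I = "\<lambda>t. J x < t \<and> t < T"
 define S where "S t = (SUP v\<in>{J x..t}. l v x)" for t
 define g where "g t = (if ?I t then S t else 0)" for t
 have S: "0 < S t" "bdd_above ((\<lambda>v. l v x) ` {J x..t})" if "?I t" for t
  using pos that by (auto simp: S_def sup_positive_def)
 have S_mono: "S s \<le> S t" if "?I s" "?I t" "s \<le> t" for s t
  unfolding S_def using that S(2)[of t] by (intro cSUP_subset_mono) auto
 have [measurable]: "g \<in> borel_measurable ?R"
 proof (rule borel_measurableI_greater)
  fix y
  define U where "U = {t. ?I t \<and> y < S t}"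
  have "U = {t. Inf U < t \<and> ?I t} \<or> U = insert (Inf U) {t. Inf U < t \<and> ?I t}"
  proof -
   have "t \<in> U" if t: "Inf U < t" "?I t" for t
   proof -
    obtain s where "s \<in> U" "s < t" using t(1) by (auto simp: Inf_less_iff)
    then show ?thesis using S_mono[of s t] t(2) by (auto simp: U_def less_imp_le intro: less_le_trans[of y "S s"])
   qed
   moreover have "Inf U \<le> t" if "t \<in> U" for t using that by (rule Inf_lower)
   ultimately show ?thesis by (cases "Inf U \<in> U") (auto simp: U_def order_le_less)
  qed
  moreover have "{t. Inf U < t \<and> ?I t} \<in> sets borel" by measurable
  ultimately have "U \<in> sets borel" by (metis sets.insert_in_sets borel_singleton)
  then have "U \<in> sets ?R" by (auto simp: sets_restrict_space_iff U_def)
  moreover have "{t \<in> space ?R. y < g t} = (if y < 0 then space ?R else U)"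
   using S(1) by (auto simp: g_def U_def space_restrict_space intro: less_trans)
  ultimately show "{t \<in> space ?R. y < g t} \<in> sets ?R" using sets.top[of ?R] by presburger
 qed
 have "(\<lambda>t. if 0 < g t then marginal (g t) t x else 0) \<in> borel_measurable ?R"
  by (rule marginal_measurable[where a = "\<lambda>_. x" and \<tau> = "\<lambda>t. t"])
   (use x in \<open>auto intro!: measurable_process_path progressive_measurable_process discount_progressive stopped_price_progressive price_x\<close>)
 moreover have "(if 0 < g t then marginal (g t) t x else 0) = sup_value l J t x" for t
  using S(1)[of t] by (auto simp: g_def sup_value_def S_def)
 ultimately show ?thesis by (simp cong: measurable_cong_sets)
qed

lemma sup_value_mono:
 assumes "x \<in> space M" "sup_positive l S x" "sup_positive l' S x" "\<And>v. v < T ==> l v x \<le> l' v x"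
 shows "sup_value l' S t x \<le> sup_value l S t x"
proof (cases "S x < t \<and> t < T")
 case True
 then have bdd: "bdd_above ((\<lambda>v. l' v x) ` {S x..t})" using assms(3) by (simp add: sup_positive_def)
 have "(SUP v\<in>{S x..t}. l v x) \<le> (SUP v\<in>{S x..t}. l' v x)"
 proof (rule cSUP_mono[OF _ bdd])
  show "\<exists>m\<in>{S x..t}. l v x \<le> l' m x" if "v \<in> {S x..t}" for v using that True assms(4)[of v] by (intro bexI[OF _ that]) auto
 qed (use True in auto)
 then show ?thesis using True assms(1,2) by (auto simp: sup_value_def sup_positive_def intro: marginal_antimono)
qed (auto simp: sup_value_def)

context
 fixes l :: "'a process" assumes optional: "optional_process M F T l"
  and solves: "solves_backward_equation M F T n u \<gamma> lam r \<psi>x \<psi>c l"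
begin

lemma AE_sup_positive: "stopping R ==> AE x in M. sup_positive l R x"
 using solves unfolding solves_backward_equation_def sup_positive_def stopping_def by blast

text \<open>The random variable under the conditional expectation is measurable: otherwise its conditional
 expectation would be \<open>0\<close> by convention.\<close>

lemma sup_integral_equation: assumes R: "stopping R" shows "sup_integral l R \<in> borel_measurable M"
  and "A \<in> sets (pre_sigma R) ==> (\<integral>\<^sup>+ x\<in>A. sup_integral l R x \<partial>M) = ev A R end_cost"
proof -
 interpret sigma_finite_subalgebra M "pre_sigma R" by (rule sigma_finite_pre_sigma[OF R])
 let ?Y = "\<lambda>x. \<integral>\<^sup>+ t\<in>{R x..T}. ennreal (integrand l R t x) \<partial>leb_time T"
 have eq: "AE x in M. nn_cond_exp M (pre_sigma R) ?Y x = ennreal (end_cost (R x) x)"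
  using solves R unfolding solves_backward_equation_def integrand_def[symmetric] end_cost_eq[symmetric] stopping_def by blast
 have Y: "AE x in M. ?Y x = sup_integral l R x" using AE_space
 proof eventually_elim
  case (elim x)
  show ?case unfolding sup_integral_def
  proof (rule nn_integral_cong_AE)
   show "AE t in leb_time T. ennreal (integrand l R t x) * indicator {R x..T} t = ennreal (sup_value l R t x)"
    using AE_leb_time_neq[of "R x" T] AE_leb_time_less[of T]
    by eventually_elim (use elim in \<open>auto simp: indicator_def sup_value_def integrand_eq\<close>)
  qed
 qed
 have Ym: "?Y \<in> borel_measurable M"
 proof (rule ccontr)
  assume n: "\<not> ?thesis"
  then have "AE x in M. ennreal (end_cost (R x) x) = 0" using eq by (auto simp: nn_cond_exp_def elim: eventually_mono)
  with AE_space Y have "AE x in M. 0 = ?Y x"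
  proof eventually_elim
   case (elim x)
   then have "\<not> 0 < end_cost (R x) x" by (simp add: ennreal_eq_0_iff)
   then have "T \<le> R x"
    using stopped_price_pos[OF price_c elim(1), of "R x"] lam_pos by (intro leI) (auto simp: end_cost_def stopped_price_def)
   then have "sup_value l R t x = 0" for t by (auto simp: sup_value_def)
   then show ?case using elim(2) by (simp add: sup_integral_def)
  qed
  from M_measurable_AE[OF _ this] show False using n by simp
 qed
 show m: "sup_integral l R \<in> borel_measurable M" by (rule M_measurable_AE[OF Ym Y])
 assume A: "A \<in> sets (pre_sigma R)"
 have "(\<integral>\<^sup>+ x\<in>A. sup_integral l R x \<partial>M) = (\<integral>\<^sup>+ x. indicator A x * ?Y x \<partial>M)"
  by (rule nn_integral_cong_AE, rule eventually_mono[OF Y]) (simp add: mult.commute)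
 also have "\<dots> = (\<integral>\<^sup>+ x. indicator A x * nn_cond_exp M (pre_sigma R) ?Y x \<partial>M)"
  using A Ym by (intro nn_cond_exp_intg[symmetric]) auto
 also have "\<dots> = ev A R end_cost"
  by (rule nn_integral_cong_AE, rule eventually_mono[OF eq]) (simp add: mult.commute)
 finally show "(\<integral>\<^sup>+ x\<in>A. sup_integral l R x \<partial>M) = ev A R end_cost" .
qed

text \<open>Up to \<tau> the running supremum from \<open>R\<close> is at least \<open>q\<close>,
  afterwards at least the one from \<tau>; marginal values decrease in the level, so each part is
  bounded accordingly.\<close>

lemma sup_integral_split:
 assumes x: "x \<in> space M" and pos: "sup_positive l R x" "sup_positive l \<tau> x" and le: "R x \<le> \<tau> x" "\<tau> x \<le> T"
  and q: "0 < q" "q \<le> l (R x) x" and fin: "(\<integral>\<^sup>+ s. ennreal (marginal q s x) \<partial>leb_time T) < \<infinity>"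
 shows "sup_integral l R x + ennreal (marg_integral q (R x) x) \<le> sup_integral l \<tau> x + ennreal (marg_integral q (\<tau> x) x)"
proof -
 let ?i = "indicator {R x..\<tau> x} :: _ => ennreal"
 have [measurable]: "?i \<in> borel_measurable (leb_time T)"
  by (simp cong: measurable_cong_sets) (rule measurable_restrict_space1, simp)
 note [measurable] = sup_value_measurable[OF x pos(2)] marginal_leb_measurable[OF q(1) x]
 have "sup_integral l R x \<le> (\<integral>\<^sup>+ t. ennreal (marginal q t x) * ?i t + ennreal (sup_value l \<tau> t x) \<partial>leb_time T)"
  unfolding sup_integral_def
 proof (rule nn_integral_mono_AE)
  show "AE t in leb_time T. ennreal (sup_value l R t x) \<le> ennreal (marginal q t x) * ?i t + ennreal (sup_value l \<tau> t x)"
   using AE_leb_time_less[of T]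
  proof eventually_elim
   case (elim t)
   show ?case
   proof (cases "R x < t")
    case True
    note S = pos(1)[unfolded sup_positive_def, rule_format, of t, OF conjI[OF True elim]]
    have S_value: "sup_value l R t x = marginal (SUP v\<in>{R x..t}. l v x) t x" using True elim by (simp add: sup_value_def)
    show ?thesis
    proof (cases "t \<le> \<tau> x")
     case t: True
     have "q \<le> (SUP v\<in>{R x..t}. l v x)" using S True q(2) by (intro order_trans[OF q(2)] cSUP_upper) auto
     then have "ennreal (sup_value l R t x) \<le> ennreal (marginal q t x)"
      unfolding S_value by (intro ennreal_leI marginal_antimono[OF x q(1)])
     then show ?thesis using t True by (auto intro: order_trans add_increasing2)
    next
     case False
     note S' = pos(2)[unfolded sup_positive_def, rule_format, of t]
     have "(SUP v\<in>{\<tau> x..t}. l v x) \<le> (SUP v\<in>{R x..t}. l v x)"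
      using S False le(1) by (intro cSUP_subset_mono) auto
     then have "ennreal (sup_value l R t x) \<le> ennreal (sup_value l \<tau> t x)"
      unfolding S_value using False elim S' by (auto simp: sup_value_def intro!: ennreal_leI marginal_antimono[OF x])
     then show ?thesis by (auto intro: order_trans add_increasing)
    qed
   qed (simp add: sup_value_def)
  qed
 qed
 also have "\<dots> = ennreal (marg_integral q (\<tau> x) x - marg_integral q (R x) x) + sup_integral l \<tau> x"
  unfolding sup_integral_def marg_integral_increment[OF q(1) x fin le(1)] by (rule nn_integral_add) measurable
 finally have "sup_integral l R x + ennreal (marg_integral q (R x) x) \<le>
   ennreal (marg_integral q (\<tau> x) x - marg_integral q (R x) x) + sup_integral l \<tau> x + ennreal (marg_integral q (R x) x)"
  by (rule add_right_mono)
 also have "\<dots> = sup_integral l \<tau> x + (ennreal (marg_integral q (\<tau> x) x - marg_integral q (R x) x) + ennreal (marg_integral q (R x) x))"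
  by (simp only: ac_simps)
 also have "\<dots> = sup_integral l \<tau> x + ennreal (marg_integral q (\<tau> x) x)"
  using marg_integral_mono[OF le(1)] by (simp add: marg_integral_nonneg flip: ennreal_plus)
 finally show ?thesis .
qed

text \<open>The equation turns the prices at \<open>R\<close> and at the level time into integrals
  of marginal values, and \<open>sup_integral_split\<close> compares these pathwise: where
  \<open>l\<close> has reached \<open>q\<close>, waiting does not lower the cost.\<close>

lemma solution_contact: assumes R: "stopping R" and q: "0 < q"
 shows "AE x in M. q \<le> l (R x) x \<longrightarrow> contact q (R x) x"
proof -
 define B where "B = {x \<in> space M. q \<le> l (R x) x}"
 define \<tau> where "\<tau> = level_time q R"
 have \<tau>: "stopping \<tau>" "\<And>x. x \<in> space M ==> R x \<le> \<tau> x"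
  unfolding \<tau>_def by (rule stopping_level_time[OF q R], rule level_time_ge[OF q R])
 have "(\<lambda>x. l (R x) x) \<in> borel_measurable (pre_sigma R)"
  by (rule progressive_pre_sigma[OF optional_progressive[OF optional] R])
 then have "{x \<in> space (pre_sigma R). q \<le> l (R x) x} \<in> sets (pre_sigma R)" by measurable
 then have B: "B \<in> sets (pre_sigma R)" by (simp add: B_def space_pre_sigma)
 have "AE x in M. x \<in> B \<longrightarrow> envelope q (R x) x = reward q (R x) x"
 proof (rule contact_if_optimal[OF q R B, folded \<tau>_def])
  fix A assume A: "A \<in> sets (pre_sigma R)" "A \<subseteq> B"
  have A\<tau>: "A \<in> sets (pre_sigma \<tau>)" by (rule pre_sigma_mono[OF R \<tau> A(1)])
  have AM [measurable]: "A \<in> sets M" by (rule pre_sigma_le_M[OF R A(1)])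
  have add: "ev A \<rho> (cost q) = (\<integral>\<^sup>+ x\<in>A. (sup_integral l \<rho> x + ennreal (marg_integral q (\<rho> x) x)) \<partial>M)"
   if \<rho>: "stopping \<rho>" "A \<in> sets (pre_sigma \<rho>)" for \<rho>
  proof -
   note [measurable] = sup_integral_equation(1)[OF \<rho>(1)] progressive_stopped_measurable[OF progressive_marg_integral[OF q] \<rho>(1)]
   show ?thesis unfolding ev_cost[OF q AM \<rho>(1)] sup_integral_equation(2)[OF \<rho>, symmetric]
    by (subst nn_integral_add[symmetric]) (auto simp: distrib_right)
  qed
  show "ev A R (cost q) \<le> ev A \<tau> (cost q)" unfolding add[OF R A(1)] add[OF \<tau>(1) A\<tau>]
  proof (rule nn_integral_mono_AE)
   show "AE x in M. (sup_integral l R x + ennreal (marg_integral q (R x) x)) * indicator A x \<le>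
     (sup_integral l \<tau> x + ennreal (marg_integral q (\<tau> x) x)) * indicator A x"
    using AE_sup_positive[OF R] AE_sup_positive[OF \<tau>(1)] AE_marginal_finite[OF q] AE_space
   proof eventually_elim
    case (elim x)
    show ?case
    proof (cases "x \<in> A")
     case True
     then have "q \<le> l (R x) x" using A(2) by (auto simp: B_def)
     from sup_integral_split[OF elim(4,1,2) \<tau>(2)[OF elim(4)] stoppingD(2)[OF \<tau>(1) elim(4)] q this elim(3)]
     show ?thesis using True by simp
    qed simp
   qed
  qed
 qed
 with AE_space show ?thesis by eventually_elim (auto simp: B_def contact_def)
qed

text \<open>At a stopping time a rational level between the two values would contradict
  \<open>solution_contact\<close>; the section theorem extends this to all times at once.\<close>

lemma solution_le_opt_level: "AE x in M. \<forall>t<T. l t x \<le> opt_level t x"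
proof -
 let ?O = "optional_sigma M F T"
 define B where "B = {z \<in> space ?O. snd z < T \<and> opt_level (snd z) (fst z) < l (snd z) (fst z)}"
 note [measurable] = measurable_snd_optional optional_measurable[OF optional] optional_measurable[OF opt_level_optional]
 have "AE x in M. \<forall>t. (x, t) \<notin> B"
 proof (rule optional_section)
  show "B \<in> sets ?O" unfolding B_def by measurable
  fix R assume R: "stopping R"
  have "AE x in M. \<forall>q\<in>pos_rats. q \<le> l (R x) x \<longrightarrow> contact q (R x) x"
   using solution_contact[OF R pos_rats_pos] by (simp add: AE_ball_countable[OF countable_pos_rats])
  with AE_opt_level show "AE x in M. (x, R x) \<notin> B"
  proof eventually_elim
   case (elim x)
   show ?case
   proof
    assume "(x, R x) \<in> B"
    then have *: "R x < T" "opt_level (R x) x < l (R x) x" by (auto simp: B_def)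
    then have "0 \<le> opt_level (R x) x" using elim(1) by blast
    from pos_rats_between[OF this *(2)] obtain q where "q \<in> pos_rats" "opt_level (R x) x < q" "q < l (R x) x" by blast
    then show False using elim *(1) by force
   qed
  qed
 qed (auto simp: B_def)
 with AE_space show ?thesis by eventually_elim (force simp: B_def)
qed

end

text \<open>By \<open>solution_le_opt_level\<close> the marginal values at the running suprema are
  ordered, and the equation gives their integrals equal finite means. They therefore coincide for
  almost every \<open>t\<close>; strict monotonicity equates the suprema at times arbitrarily close
  to \<open>R\<close>, and upper right-continuity of \<open>l\<close> yields the value at
  \<open>R\<close>.\<close>

theorem solution_unique: assumes optional: "optional_process M F T l"
  and solves: "solves_backward_equation M F T n u \<gamma> lam r \<psi>x \<psi>c l"
  and urc: "AE e in M. upper_right_continuous T (\<lambda>t. l t e)"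
 shows "AE e in M. \<forall>t<T. l t e = opt_level t e"
proof -
 let ?O = "optional_sigma M F T"
 note le = solution_le_opt_level[OF optional solves]
 define B where "B = {z \<in> space ?O. snd z < T \<and> l (snd z) (fst z) \<noteq> opt_level (snd z) (fst z)}"
 note [measurable] = measurable_snd_optional optional_measurable[OF optional] optional_measurable[OF opt_level_optional]
 have "AE e in M. \<forall>t. (e, t) \<notin> B"
 proof (rule optional_section)
  show "B \<in> sets ?O" unfolding B_def by measurable
  fix R assume R: "stopping R"
  note eq = sup_integral_equation[OF optional solves R] and eq' = sup_integral_equation[OF opt_level_optional opt_level_solves R]
  note pos = AE_sup_positive[OF optional solves R] and pos' = AE_sup_positive[OF opt_level_optional opt_level_solves R]
  have mono: "AE e in M. \<forall>t. sup_value opt_level R t e \<le> sup_value l R t e"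
   using le pos pos' AE_space by eventually_elim (auto intro: sup_value_mono)
  have "(\<integral>\<^sup>+ e. sup_integral l R e \<partial>M) = ev (space M) R end_cost" "(\<integral>\<^sup>+ e. sup_integral opt_level R e \<partial>M) = ev (space M) R end_cost"
   using eq(2)[of "space M"] eq'(2)[of "space M"] by (simp_all cong: nn_integral_cong)
  moreover have "ev (space M) R end_cost < \<infinity>" by (rule ev_end_cost_finite[OF R])
  ultimately have fin: "(\<integral>\<^sup>+ e. sup_integral l R e \<partial>M) < \<infinity>" "(\<integral>\<^sup>+ e. sup_integral l R e \<partial>M) = (\<integral>\<^sup>+ e. sup_integral opt_level R e \<partial>M)" by simp_all
  have le_int: "AE e in M. sup_integral opt_level R e \<le> sup_integral l R e"
   using mono unfolding sup_integral_def by eventually_elim (auto intro!: nn_integral_mono ennreal_leI)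
  \<comment> \<open>\<open>nn_integral_less\<close> in contrapositive form: ordered functions with
    the same finite integral cannot differ on a non-null set.\<close>
  have eq_int: "AE e in M. sup_integral l R e \<le> sup_integral opt_level R e"
   using nn_integral_less[OF eq'(1) eq(1) _ le_int] fin by fastforce
  have fin_AE: "AE e in M. sup_integral l R e \<noteq> \<infinity>"
   using fin(1) eq(1) by (intro nn_integral_PInf_AE) auto
  show "AE e in M. (e, R e) \<notin> B" using mono eq_int fin_AE pos pos' le urc AE_space le_int
  proof eventually_elim
   case (elim e)
   note m = sup_value_measurable[OF elim(8) elim(4)] sup_value_measurable[OF elim(8) elim(5)]
   have ae: "AE t in leb_time T. ennreal (sup_value l R t e) \<le> ennreal (sup_value opt_level R t e)"
    using nn_integral_less[OF m(2,1)] elim(1,2,3,9) unfolding sup_integral_def by (force simp: top_unique ennreal_leI)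
   have "\<not> l (R e) e < opt_level (R e) e" if T: "R e < T"
   proof
    assume "l (R e) e < opt_level (R e) e"
    then obtain y where y: "l (R e) e < y" "y < opt_level (R e) e" using dense by blast
    have "((\<lambda>s. SUP v\<in>{R e..<s}. ereal (l v e)) \<longlongrightarrow> ereal (l (R e) e)) (at_right (R e))"
     using elim(7) T by (simp add: upper_right_continuous_def)
    then have "eventually (\<lambda>s. (SUP v\<in>{R e..<s}. ereal (l v e)) < ereal y) (at_right (R e))"
     using y(1) by (intro order_tendstoD) auto
    then obtain b where b: "R e < b" "\<And>s. R e < s ==> s < b ==> (SUP v\<in>{R e..<s}. ereal (l v e)) < ereal y"
     by (auto simp: eventually_at_right[OF T])
    have "\<exists>t. R e < t \<and> t < min b T \<and> sup_value l R t e \<le> sup_value opt_level R t e"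
    proof (rule positive_time_dense)
     show "AE t in leb_time T. R e < t \<and> t < T \<longrightarrow> sup_value l R t e \<le> sup_value opt_level R t e"
      using ae by eventually_elim
       (use elim(5,8) in \<open>auto simp: ennreal_le_iff sup_value_def sup_positive_def marginal_nonneg\<close>)
    qed (use b(1) T in auto)
    then obtain t where t: "R e < t" "t < b" "t < T" "sup_value l R t e \<le> sup_value opt_level R t e" by auto
    let ?S = "\<lambda>l. SUP v\<in>{R e..t}. l v e"
    have S: "0 < ?S l" "bdd_above ((\<lambda>v. opt_level v e) ` {R e..t})"
     using elim(4,5) t(1,3) by (auto simp: sup_positive_def)
    have "\<not> ?S l < ?S opt_level"
     using marginal_strict_antimono[OF t(3) elim(8) S(1), of "?S opt_level"] t by (auto simp: sup_value_def)
    moreover have "opt_level (R e) e \<le> ?S opt_level" using S(2) t(1) by (intro cSUP_upper) auto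
    moreover have "?S l \<le> y"
    proof (rule cSUP_least)
     fix v assume v: "v \<in> {R e..t}"
     obtain s where s: "t < s" "s < b" using dense[OF t(2)] by blast
     have "ereal (l v e) \<le> (SUP v\<in>{R e..<s}. ereal (l v e))" using v s(1) by (intro SUP_upper) auto
     also have "\<dots> < ereal y" using b(2)[of s] s t(1) by simp
     finally show "l v e \<le> y" by simp
    qed (use t(1) in auto)
    ultimately show False using y(2) by simp
   qed
   then show ?case using elim(6) by (force simp: B_def)
  qed
 qed (auto simp: B_def)
 with AE_space show ?thesis by eventually_elim (force simp: B_def)
qed

end

theorem proposition3p4:
  fixes M :: "'a measure" and F :: "ennreal \<Rightarrow> 'a measure" and T :: ennreal
    and n :: nat and u :: "nat \<Rightarrow> real \<Rightarrow> real \<Rightarrow> real" and w \<gamma> :: "nat \<Rightarrow> real" and lam :: real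
    and r \<psi>x \<psi>c :: "ennreal \<Rightarrow> 'a \<Rightarrow> real"
  assumes space: "filtered_prob_space M F T"
    and n: "n \<ge> 1"
    and wealth: "\<And>i. i \<in> {1..n} \<Longrightarrow> w i > 0"
    and u_nonneg: "\<And>i x c. i \<in> {1..n} \<Longrightarrow> x \<ge> 0 \<Longrightarrow> c \<ge> 0 \<Longrightarrow> u i x c \<ge> 0"
    and U: "assumption_U M F T n u w r \<psi>x \<psi>c"
    and P: "assumption_P M F T r \<psi>x \<psi>c"
    and Inada_0: "\<And>i \<psi>. i \<in> {1..n} \<Longrightarrow> \<psi> > 0 \<Longrightarrow> filterlim (\<lambda>c. h_fun (u i) \<psi> c) at_top (at_right 0)"
    and Inada_inf: "\<And>i \<psi>. i \<in> {1..n} \<Longrightarrow> \<psi> > 0 \<Longrightarrow> ((\<lambda>c. h_fun (u i) \<psi> c) \<longlongrightarrow> 0) at_top"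
    and weights_pos: "\<And>i. i \<in> {1..n} \<Longrightarrow> \<gamma> i > 0"
    and weights_sum: "(\<Sum>i=1..n. \<gamma> i) = 1"
    and lam_pos: "lam > 0"
  defines "solution \<equiv> \<lambda>l. optional_process M F T l \<and>
      (AE \<omega> in M. upper_right_continuous T (\<lambda>t. l t \<omega>)) \<and>
      solves_backward_equation M F T n u \<gamma> lam r \<psi>x \<psi>c l \<and>
      (AE \<omega> in M. l T \<omega> = 0)"
  shows "\<exists>l. solution l \<and> (\<forall>l'. solution l' \<longrightarrow> (AE \<omega> in M. \<forall>t\<le>T. l' t \<omega> = l t \<omega>))"
proof -
  interpret backward_setting M F T n u w \<gamma> lam r \<psi>x \<psi>c
    using space n wealth u_nonneg U P Inada_0 Inada_inf weights_pos lam_pos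
    by (intro backward_setting.intro backward_setting_axioms.intro) auto
  have "AE \<omega> in M. \<forall>t\<le>T. l' t \<omega> = opt_level t \<omega>" if l': "solution l'" for l'
  proof -
    have "AE \<omega> in M. l' T \<omega> = 0" "AE \<omega> in M. \<forall>t<T. l' t \<omega> = opt_level t \<omega>"
      using l' solution_unique unfolding solution_def by blast+
    then show ?thesis by eventually_elim (auto simp: opt_level_def order_le_less)
  qed
  moreover have "solution opt_level" unfolding solution_def
    using opt_level_optional opt_level_upper_right_continuous opt_level_solves by (simp add: opt_level_def)
  ultimately show ?thesis by blast
qed

end
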